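(* Let $L$ be a quadratic $O_F$-lattice of rank $n$ and $\varepsilon\in\{\pm1\}$. Then for every integer $k\ge0$, $$\mathrm{Den}(H^\varepsilon_{n+1+2k},L)=\mathrm{Nor}^\varepsilon(q^{-k},L)\cdot P(q^{-k}),\qquad P(X)=\sum_{L\subseteq L'\subseteq L'^\vee}X^{2\ell(L'/L)}\,\mathfrak{m}\big(t(L'),\mathrm{sgn}_{n+1}(L');\varepsilon X\big),$$ where the sum runs over integral lattices $L'\subseteq L_F$ containing $L$, and $\ell(L'/L)=\mathrm{length}_{O_F}(L'/L)$. In other words, the local Siegel series $\mathrm{Den}^\varepsilon(X,L)$ equals $P(X)$.
   Context: $F$ is a non-archimedean local field of odd residue characteristic, with ring of integers $O_F$, uniformizer $\varpi$, residue field $\kappa$ of size $q$. Quadratic $O_F$-lattices are finite free with symmetric bilinear form non-degenerate over $F$; $L^\vee=\{x\in L_F:(x,L)\subseteq O_F\}$; integral means $L\subseteq L^\vee$; the type $t(L')$ of integral $L'$ is the number of nonzero $a_i$ in $L'^\vee/L'\simeq\oplus O_F/\varpi^{a_i}$. $H^\varepsilon_r$ is the self-dual lattice of rank $r$ whose discriminant $(-1)^{r(r-1)/2}\det$ has quadratic residue symbol $\varepsilon$. $\mathrm{Den}(M,L)=\lim_N\#\mathrm{Rep}_{M,L}(O_F/\varpi^N)/q^{N s(2r-s-1)/2}$ ($r,s$ the ranks of $M,L$), $\mathrm{Rep}_{M,L}(R)$ = isometric $R$-linear maps $L\otimes R\to M\otimes R$. For a possibly degenerate quadratic space $U$ over $\kappa$,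 write $U=U_0\perp U_1$ with $U_0$ non-degenerate and $U_1$ the radical; $\chi(U_0)\in\{\pm1\}$ is $+1$ iff $(-1)^{\dim U_0(\dim U_0-1)/2}\det U_0$ is a square ($\chi(0)=+1$); $\mathrm{sgn}_r(U)=\chi(U_0)$ if $\dim U_0\equiv r\pmod 2$ and $0$ otherwise; $\mathrm{sgn}_r(L'):=\mathrm{sgn}_r(L'\otimes\kappa)$. Set $\mathrm{sgn}(H^\varepsilon_{n+1})=\varepsilon$ if $n+1$ is even and $0$ otherwise. Define $\mathrm{Nor}^\varepsilon(X,L)=(1-\mathrm{sgn}(H^\varepsilon_{n+1})q^{-(n+1)/2}X)\prod_{1\le i<(n+1)/2}(1-q^{-2i}X^2)$ (so that $\mathrm{Nor}^\varepsilon(q^{-k},L)=\mathrm{Den}(H^\varepsilon_{n+1+2k},H^\varepsilon_n)$), and the local Siegel series $\mathrm{Den}^\varepsilon(X,L)$ as the polynomial with $\mathrm{Den}^\varepsilon(q^{-k},L)=\mathrm{Den}(H^\varepsilon_{n+1+2k},L)/\mathrm{Nor}^\varepsilon(q^{-k},L)$ for all $k\ge0$. Weight polynomials: $\mathfrak{m}(0,s;X)=1$ and for $t\ge1$, $\mathfrak{m}(t,s;X)=(1+s\,q^{(t-1)/2}X)\prod_{0\le i<(t-1)/2}(1-q^{2i}X^2)$. *)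

theory Defs
  imports Complex_Main "HOL-Library.FuncSet" "HOL-Computational_Algebra.Polynomial"
    "Jordan_Normal_Form.Determinant"
begin

section \<open>Local fields\<close>

text \<open>
  A field is given by its type, and its local structure by a normalised discrete valuation \<open>v\<close>.
  The value \<open>v 0\<close> (morally infinite) is left unspecified and never used.
  \<open>power_ideal v N\<close> is the ideal generated by the \<open>N\<close>-th power of a uniformizer;
  the ring of integers is \<open>power_ideal v 0\<close>.
\<close>

definition power_ideal :: "('a::field \<Rightarrow> int) \<Rightarrow> nat \<Rightarrow> 'a set" where
  "power_ideal v N = {x. x = 0 \<or> int N \<le> v x}"

definition integers :: "('a::field \<Rightarrow> int) \<Rightarrow> 'a set" where
  "integers v = {x. x = 0 \<or> 0 \<le> v x}"

definition max_ideal :: "('a::field \<Rightarrow> int) \<Rightarrow> 'a set" where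
  "max_ideal v = {x. x = 0 \<or> 0 < v x}"

definition residue_field :: "('a::field \<Rightarrow> int) \<Rightarrow> 'a set set" where
  "residue_field v =
     integers v // {(x, y). x \<in> integers v \<and> y \<in> integers v \<and> x - y \<in> max_ideal v}"

definition residue_size :: "('a::field \<Rightarrow> int) \<Rightarrow> nat" where
  "residue_size v = card (residue_field v)"

definition residue_char :: "('a::field \<Rightarrow> int) \<Rightarrow> nat" where
  "residue_char v = (LEAST p. 0 < p \<and> of_nat p \<in> max_ideal v)"

locale nonarch_local_field =
  fixes v :: "'a::field \<Rightarrow> int"
  assumes val_mult: "x \<noteq> 0 \<Longrightarrow> y \<noteq> 0 \<Longrightarrow> v (x * y) = v x + v y"
    and val_add: "x \<noteq> 0 \<Longrightarrow> y \<noteq> 0 \<Longrightarrow> x + y \<noteq> 0 \<Longrightarrow> min (v x) (v y) \<le> v (x + y)"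
    and uniformizer: "\<exists>x. x \<noteq> 0 \<and> v x = 1"
    and complete:
      "(\<forall>N. \<exists>m. \<forall>i\<ge>m. \<forall>j\<ge>m. s i - s j \<in> power_ideal v N) \<Longrightarrow>
         \<exists>l. \<forall>N. \<exists>m. \<forall>i\<ge>m. (s :: nat \<Rightarrow> 'a) i - l \<in> power_ideal v N"
    and finite_residue_field: "finite (residue_field v)"

text \<open>The quadratic residue symbol of (the reduction of) an integer.\<close>

definition residue_symbol :: "('a::field \<Rightarrow> int) \<Rightarrow> 'a \<Rightarrow> int" where
  "residue_symbol v x =
     (if x \<in> max_ideal v then 0
      else if \<exists>y\<in>integers v. x - y ^ 2 \<in> max_ideal v then 1
      else -1)"


section \<open>Quadratic lattices\<close>

text \<open>
  A lattice is a subset \<open>lat L\<close> of an ambient vector space (with scalar multiplication \<open>scl L\<close>)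
  carrying a symmetric bilinear form \<open>form L\<close>.
  The ambient space may be larger than the span \<open>lat_space L\<close> of the lattice, so that one type
  can accommodate lattices of all ranks; only the restriction of the form to the span matters.
\<close>

record ('a, 'b) qlattice =
  scl :: "'a \<Rightarrow> 'b \<Rightarrow> 'b"
  form :: "'b \<Rightarrow> 'b \<Rightarrow> 'a"
  lat :: "'b set"

definition lat_space :: "('a::field, 'b::ab_group_add) qlattice \<Rightarrow> 'b set" where
  "lat_space L = module.span (scl L) (lat L)"

definition lat_rank :: "('a::field, 'b::ab_group_add) qlattice \<Rightarrow> nat" where
  "lat_rank L = vector_space.dim (scl L) (lat L)"

definition lat_basis ::
  "('a::field \<Rightarrow> int) \<Rightarrow> ('a, 'b::ab_group_add) qlattice \<Rightarrow> nat \<Rightarrow> (nat \<Rightarrow> 'b) \<Rightarrow> bool" where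
  "lat_basis v L n e \<longleftrightarrow>
     lat L = {(\<Sum>i<n. scl L (c i) (e i)) | c. \<forall>i<n. c i \<in> integers v} \<and>
     (\<forall>c. (\<Sum>i<n. scl L (c i) (e i)) = 0 \<longrightarrow> (\<forall>i<n. c i = 0))"

definition quadratic_lattice ::
  "('a::field \<Rightarrow> int) \<Rightarrow> ('a, 'b::ab_group_add) qlattice \<Rightarrow> bool" where
  "quadratic_lattice v L \<longleftrightarrow>
     vector_space (scl L) \<and>
     (\<forall>x. Vector_Spaces.linear (scl L) (*) (form L x)) \<and>
     (\<forall>x y. form L x y = form L y x) \<and>
     (\<exists>n e. lat_basis v L n e) \<and>
     (\<forall>x\<in>lat_space L. (\<forall>y\<in>lat_space L. form L x y = 0) \<longrightarrow> x = 0)"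

definition dual :: "('a::field \<Rightarrow> int) \<Rightarrow> ('a, 'b::ab_group_add) qlattice \<Rightarrow> 'b set" where
  "dual v L = {x \<in> lat_space L. \<forall>y\<in>lat L. form L x y \<in> integers v}"

definition gram :: "('a::field, 'b) qlattice \<Rightarrow> nat \<Rightarrow> (nat \<Rightarrow> 'b) \<Rightarrow> 'a mat" where
  "gram L n e = mat n n (\<lambda>(i, j). form L (e i) (e j))"

definition disc :: "('a::field, 'b) qlattice \<Rightarrow> nat \<Rightarrow> (nat \<Rightarrow> 'b) \<Rightarrow> 'a" where
  "disc L n e = (-1) ^ (n * (n - 1) div 2) * det (gram L n e)"

text \<open>
  \<open>is_H v \<epsilon> r M\<close>: \<open>M\<close> is the (unique up to isometry) self-dual lattice of rank \<open>r\<close>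
  whose discriminant has residue symbol \<open>\<epsilon>\<close>.
  The symbol does not depend on the basis, since a change of basis multiplies the discriminant
  by the square of a unit.
\<close>

definition is_H ::
  "('a::field \<Rightarrow> int) \<Rightarrow> int \<Rightarrow> nat \<Rightarrow> ('a, 'b::ab_group_add) qlattice \<Rightarrow> bool" where
  "is_H v \<epsilon> r M \<longleftrightarrow>
     quadratic_lattice v M \<and> lat_rank M = r \<and> dual v M = lat M \<and>
     (\<exists>e. lat_basis v M r e \<and> residue_symbol v (disc M r e) = \<epsilon>)"

text \<open>
  The number of nonzero \<open>a i\<close> in an isomorphism from the direct sum of the cyclic modules
  \<open>integers v / power_ideal v (a i)\<close>, \<open>i < m\<close>, to \<open>dual v L / lat L\<close>.
  Such an isomorphism is given by the images \<open>g i\<close> of the generators: the second conjunct is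
  surjectivity, the third one says that it is well defined and injective.
\<close>

definition lat_type :: "('a::field \<Rightarrow> int) \<Rightarrow> ('a, 'b::ab_group_add) qlattice \<Rightarrow> nat" where
  "lat_type v L = (THE t. \<exists>(m::nat) (g::nat \<Rightarrow> 'b) (a::nat \<Rightarrow> nat).
     (\<forall>i<m. g i \<in> dual v L) \<and>
     (\<forall>x\<in>dual v L. \<exists>c. (\<forall>i<m. c i \<in> integers v) \<and> x - (\<Sum>i<m. scl L (c i) (g i)) \<in> lat L) \<and>
     (\<forall>c. (\<forall>i<m. c i \<in> integers v) \<longrightarrow>
        ((\<Sum>i<m. scl L (c i) (g i)) \<in> lat L \<longleftrightarrow> (\<forall>i<m. c i \<in> power_ideal v (a i)))) \<and>
     t = card {i. i < m \<and> a i \<noteq> 0})"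

text \<open>
  Let \<open>U\<close> be the reduction of an integral lattice modulo the maximal ideal.
  \<open>residue_radical\<close> is the preimage in \<open>lat L\<close> of the radical of \<open>U\<close>, and
  \<open>residue_split v L d e\<close> says that the classes of \<open>e 0, \<dots>, e (d - 1)\<close> form a basis of a
  non-degenerate subspace \<open>U\<^sub>0\<close> that together with the radical \<open>U\<^sub>1\<close> spans \<open>U\<close>.
  The unit Gram determinant makes the classes independent, makes \<open>U\<^sub>0\<close> non-degenerate and
  forces \<open>U\<^sub>0\<close> to meet the radical trivially.
\<close>

definition residue_radical :: "('a::field \<Rightarrow> int) \<Rightarrow> ('a, 'b::ab_group_add) qlattice \<Rightarrow> 'b set" where
  "residue_radical v L = {x \<in> lat L. \<forall>y\<in>lat L. form L x y \<in> max_ideal v}"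

definition residue_split ::
  "('a::field \<Rightarrow> int) \<Rightarrow> ('a, 'b::ab_group_add) qlattice \<Rightarrow> nat \<Rightarrow> (nat \<Rightarrow> 'b) \<Rightarrow> bool" where
  "residue_split v L d e \<longleftrightarrow>
     (\<forall>i<d. e i \<in> lat L) \<and>
     det (gram L d e) \<notin> max_ideal v \<and>
     (\<forall>x\<in>lat L. \<exists>c. (\<forall>i<d. c i \<in> integers v) \<and>
        x - (\<Sum>i<d. scl L (c i) (e i)) \<in> residue_radical v L)"

definition lat_sgn :: "('a::field \<Rightarrow> int) \<Rightarrow> nat \<Rightarrow> ('a, 'b::ab_group_add) qlattice \<Rightarrow> int" where
  "lat_sgn v r L = (THE s. \<exists>d e. residue_split v L d e \<and>
     s = (if even d = even r then residue_symbol v (disc L d e) else 0))"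

definition osubmodule ::
  "('a::field \<Rightarrow> int) \<Rightarrow> ('a \<Rightarrow> 'b \<Rightarrow> 'b) \<Rightarrow> ('b::ab_group_add) set \<Rightarrow> bool" where
  "osubmodule v s S \<longleftrightarrow>
     0 \<in> S \<and> (\<forall>x\<in>S. \<forall>y\<in>S. x + y \<in> S) \<and> (\<forall>c\<in>integers v. \<forall>x\<in>S. s c x \<in> S)"

text \<open>
  The length of the quotient module \<open>A / B\<close>, as the maximal length of a strict chain of
  submodules (its submodules correspond to the modules between \<open>B\<close> and \<open>A\<close>).
\<close>

definition quot_length ::
  "('a::field \<Rightarrow> int) \<Rightarrow> ('a \<Rightarrow> 'b \<Rightarrow> 'b) \<Rightarrow> ('b::ab_group_add) set \<Rightarrow> 'b set \<Rightarrow> nat" where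
  "quot_length v s A B = (GREATEST m. \<exists>C :: nat \<Rightarrow> 'b set.
     C 0 = B \<and> C m = A \<and> (\<forall>i\<le>m. osubmodule v s (C i)) \<and> (\<forall>i<m. C i \<subset> C (Suc i)))"


section \<open>Local densities\<close>

text \<open>
  The tensor product of \<open>L\<close> with the quotient of the ring of integers by its ideal
  \<open>power_ideal v N\<close> is the quotient of \<open>lat L\<close> by \<open>lat_multiple v N L\<close>,
  realised as a set of cosets.
\<close>

definition lat_multiple ::
  "('a::field \<Rightarrow> int) \<Rightarrow> nat \<Rightarrow> ('a, 'b::ab_group_add) qlattice \<Rightarrow> 'b set" where
  "lat_multiple v N L = {scl L c z | c z. c \<in> power_ideal v N \<and> z \<in> lat L}"

definition lat_class ::
  "('a::field \<Rightarrow> int) \<Rightarrow> nat \<Rightarrow> ('a, 'b::ab_group_add) qlattice \<Rightarrow> 'b \<Rightarrow> 'b set" where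
  "lat_class v N L x = (\<lambda>z. x + z) ` lat_multiple v N L"

definition lat_reduction ::
  "('a::field \<Rightarrow> int) \<Rightarrow> nat \<Rightarrow> ('a, 'b::ab_group_add) qlattice \<Rightarrow> 'b set set" where
  "lat_reduction v N L = lat_class v N L ` lat L"

text \<open>
  Equality of values of the forms modulo \<open>power_ideal v N\<close> is expressed by their difference
  in the field; in particular there are no representations if \<open>L\<close> is not integral.
\<close>

definition reps ::
  "('a::field \<Rightarrow> int) \<Rightarrow> ('a, 'c::ab_group_add) qlattice \<Rightarrow> ('a, 'b::ab_group_add) qlattice \<Rightarrow>
     nat \<Rightarrow> ('b set \<Rightarrow> 'c set) set" where
  "reps v M L N = {f \<in> lat_reduction v N L \<rightarrow>\<^sub>E lat_reduction v N M.
     (\<forall>x\<in>lat L. \<forall>y\<in>lat L. \<forall>u\<in>f (lat_class v N L x). \<forall>w\<in>f (lat_class v N L y).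
        u + w \<in> f (lat_class v N L (x + y)) \<and>
        form M u w - form L x y \<in> power_ideal v N) \<and>
     (\<forall>c\<in>integers v. \<forall>x\<in>lat L. \<forall>u\<in>f (lat_class v N L x).
        scl M c u \<in> f (lat_class v N L (scl L c x)))}"

definition den ::
  "('a::field \<Rightarrow> int) \<Rightarrow> ('a, 'c::ab_group_add) qlattice \<Rightarrow> ('a, 'b::ab_group_add) qlattice \<Rightarrow> real"
  where
  "den v M L = lim (\<lambda>N. real (card (reps v M L N)) /
     real (residue_size v) powr
       (real N * real (lat_rank L) * (2 * real (lat_rank M) - real (lat_rank L) - 1) / 2))"


section \<open>Siegel series\<close>

definition sgn_H :: "int \<Rightarrow> nat \<Rightarrow> int" where
  "sgn_H \<epsilon> r = (if even r then \<epsilon> else 0)"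

definition nor_poly :: "real \<Rightarrow> int \<Rightarrow> nat \<Rightarrow> real poly" where
  "nor_poly q \<epsilon> n =
     [:1, - of_int (sgn_H \<epsilon> (n + 1)) * q powr (- (real n + 1) / 2):] *
     (\<Prod>i | 1 \<le> i \<and> real i < (real n + 1) / 2. [:1, 0, - (q powr (- 2 * real i)):])"

definition weight_poly :: "real \<Rightarrow> nat \<Rightarrow> int \<Rightarrow> real poly" where
  "weight_poly q t s =
     (if t = 0 then 1
      else [:1, of_int s * q powr ((real t - 1) / 2):] *
        (\<Prod>i | real i < (real t - 1) / 2. [:1, 0, - (q ^ (2 * i)):]))"

text \<open>
  The local Siegel series of \<open>L\<close>, where \<open>H k\<close> is the self-dual lattice of rank
  \<open>lat_rank L + 1 + 2 * k\<close> and sign \<open>\<epsilon>\<close>. A polynomial is determined by its values at the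
  infinitely many points \<open>inverse q ^ k\<close>.
\<close>

definition siegel_series ::
  "('a::field \<Rightarrow> int) \<Rightarrow> int \<Rightarrow> (nat \<Rightarrow> ('a, 'c::ab_group_add) qlattice) \<Rightarrow>
     ('a, 'b::ab_group_add) qlattice \<Rightarrow> real poly" where
  "siegel_series v \<epsilon> H L = (THE D. \<forall>k. let X = inverse (real (residue_size v)) ^ k in
     poly D X = den v (H k) L / poly (nor_poly (real (residue_size v)) \<epsilon> (lat_rank L)) X)"

definition integral_overlattices ::
  "('a::field \<Rightarrow> int) \<Rightarrow> ('a, 'b::ab_group_add) qlattice \<Rightarrow> 'b set set" where
  "integral_overlattices v L =
     {L'. L' \<subseteq> lat_space L \<and> quadratic_lattice v (L\<lparr>lat := L'\<rparr>) \<and>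
          lat L \<subseteq> L' \<and> L' \<subseteq> dual v (L\<lparr>lat := L'\<rparr>)}"

definition cho_yamauchi_poly ::
  "('a::field \<Rightarrow> int) \<Rightarrow> int \<Rightarrow> ('a, 'b::ab_group_add) qlattice \<Rightarrow> real poly" where
  "cho_yamauchi_poly v \<epsilon> L =
     (\<Sum>L' \<in> integral_overlattices v L.
        monom 1 (2 * quot_length v (scl L) L' (lat L)) *
        pcompose
          (weight_poly (real (residue_size v)) (lat_type v (L\<lparr>lat := L'\<rparr>))
             (lat_sgn v (lat_rank L + 1) (L\<lparr>lat := L'\<rparr>)))
          [:0, of_int \<epsilon>:])"

end

theory Submission
  imports Defs "HOL-Library.Function_Algebras"
begin

text \<open>
  A representation of \<open>L\<close> by a self-dual lattice \<open>M\<close> modulo a high power of the uniformizer lifts to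
  a linear map \<open>f\<close> on the space of \<open>L\<close> that is isometric on \<open>L\<close> up to high precision. The vectors
  that \<open>f\<close> sends into \<open>M\<close> form an integral lattice \<open>L'\<close> containing \<open>L\<close>, and \<open>f\<close> is primitive on
  \<open>L'\<close>. Sorting the representations by \<open>L'\<close> gives the sum over integral lattices; passing from
  \<open>L\<close> to \<open>L'\<close> changes the number of approximate isometries by the factor \<open>X\<close> to the power
  \<open>2 * length (L' / L)\<close>, and Hensel's lemma reduces the primitive ones to the residue field.

  Over the residue field an orthogonal basis of \<open>L'\<close> is embedded vector by vector. A vector of unit
  length splits off its orthogonal complement. For each of the \<open>t(L')\<close> vectors of the radical one
  chooses an isotropic vector outside the span of the earlier ones. The resulting product telescopes
  to the normalizing factor times the weight polynomial. The numbers of solutions of \<open>Q = a\<close> in the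
  orthogonal complements are found without Witt's theorem: adding a non-isotropic line to a quadratic space acts on
  them, up to a constant, as convolution with the quadratic character, which is invertible on
  functions of known total sum.
\<close>

section \<open>Counting cosets\<close>

text \<open>The residue field, the quotients \<open>M / \<pi>^N M\<close> and the spaces of linear
  maps are sets, not types. No quotient occurs as an object: every count is a number of cosets met
  by a subset of an additive group, every equation is a congruence in the field, and formulas are
  proved by comparing two such counts along a map. Precision is not preserved when \<open>L\<close>
  is replaced by \<open>L'\<close>. If \<open>L'\<close> has basis vectors
  \<open>\<pi>^(- k i)\<close> times those of \<open>L\<close>, precision \<open>N\<close> on
  \<open>L\<close> becomes \<open>N - k i\<close> on the vectors and \<open>N - k i - k j\<close> on
  the Gram matrix. With \<open>l\<close> the length of \<open>L' / L\<close> and \<open>m\<close>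
  the rank of the target, the vectors give \<open>q^(- m l)\<close> and the Gram matrix
  \<open>q^((n + 1) l)\<close>. As \<open>m - (n + 1) = 2 k\<close>, the result is
  \<open>X^(2 l)\<close> for \<open>X = q^(- k)\<close>. If \<open>t(L') > 2 k + 2\<close>, there
  are no primitive representations, and the weight polynomial has a zero at
  \<open>\<epsilon> q^(- k)\<close>; this case is separated throughout, because dimensions of
  complements would become negative. The limit defining the density is attained: beyond twice a
  conductor of \<open>L\<close>, the normalized count is constant in \<open>N\<close>.\<close>

definition subgrp :: "'g::ab_group_add set \<Rightarrow> bool" where
  "subgrp K \<longleftrightarrow> 0 \<in> K \<and> (\<forall>x\<in>K. \<forall>y\<in>K. x - y \<in> K)"

definition cosets :: "'g::ab_group_add set \<Rightarrow> 'g set \<Rightarrow> 'g set set" where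
  "cosets A K = (\<lambda>x. (+) x ` K) ` A"

definition ncosets :: "'g::ab_group_add set \<Rightarrow> 'g set \<Rightarrow> nat" where
  "ncosets A K = card (cosets A K)"

lemma subgrp_zero: "subgrp K \<Longrightarrow> 0 \<in> K"
  and subgrp_diff: "subgrp K \<Longrightarrow> x \<in> K \<Longrightarrow> y \<in> K \<Longrightarrow> x - y \<in> K"
  by (auto simp: subgrp_def)

lemma subgrp_minus: "subgrp K \<Longrightarrow> x \<in> K \<Longrightarrow> - x \<in> K"
  using subgrp_diff[of K 0 x] by (simp add: subgrp_zero)

lemma subgrp_add: "subgrp K \<Longrightarrow> x \<in> K \<Longrightarrow> y \<in> K \<Longrightarrow> x + y \<in> K"
  using subgrp_diff[of K x "- y"] by (simp add: subgrp_minus)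

lemma subgrp_sum: "subgrp K \<Longrightarrow> (\<And>i. i \<in> I \<Longrightarrow> f i \<in> K) \<Longrightarrow> sum f I \<in> K"
  by (induction I rule: infinite_finite_induct) (auto simp: subgrp_zero subgrp_add)

lemma subgrp_diff_commute: "subgrp K \<Longrightarrow> x - y \<in> K \<longleftrightarrow> y - x \<in> K"
  using subgrp_minus[of K "x - y"] subgrp_minus[of K "y - x"] by auto

lemma coset_eq_iff:
  assumes "subgrp K" shows "(+) x ` K = (+) y ` K \<longleftrightarrow> x - y \<in> K"
proof
  assume "(+) x ` K = (+) y ` K"
  then have "x + 0 \<in> (+) y ` K" using subgrp_zero[OF assms] by blast
  then show "x - y \<in> K" by auto
next
  have *: "(+) x ` K \<subseteq> (+) y ` K" if "x - y \<in> K" for x y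
  proof
    fix z assume "z \<in> (+) x ` K"
    then obtain k where "k \<in> K" "z = x + k" by auto
    then have "z = y + ((x - y) + k)" "(x - y) + k \<in> K" using subgrp_add[OF assms that] by auto
    then show "z \<in> (+) y ` K" by blast
  qed
  assume "x - y \<in> K"
  then show "(+) x ` K = (+) y ` K" using * subgrp_diff_commute[OF assms] by blast
qed

lemma cosets_mono: "A \<subseteq> B \<Longrightarrow> cosets A K \<subseteq> cosets B K"
  by (auto simp: cosets_def)

lemma bij_betw_images:
  assumes "\<And>x y. x \<in> A \<Longrightarrow> y \<in> A \<Longrightarrow> F x = F y \<longleftrightarrow> G x = G y"
  shows "\<exists>h. bij_betw h (F ` A) (G ` A)"
proof -
  define h where "h c = G (SOME x. x \<in> A \<and> F x = c)" for c
  have h: "h (F x) = G x" if "x \<in> A" for x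
    unfolding h_def by (rule someI2[of _ x]) (use that assms in auto)
  have "bij_betw h (F ` A) (G ` A)"
    unfolding bij_betw_def inj_on_def using h assms by (auto simp: image_image)
  then show ?thesis by blast
qed

text \<open>Any function whose fibres are the congruence classes counts cosets; this transfers
  counts to genuine finite sets such as systems of representatives or products.\<close>

lemma ncosets_eq_card:
  assumes "subgrp K" "\<And>x y. x \<in> A \<Longrightarrow> y \<in> A \<Longrightarrow> F x = F y \<longleftrightarrow> x - y \<in> K"
  shows "ncosets A K = card (F ` A)" and "finite (cosets A K) \<longleftrightarrow> finite (F ` A)"
proof -
  have "\<exists>h. bij_betw h (cosets A K) (F ` A)"
    unfolding cosets_def by (rule bij_betw_images) (use assms in \<open>simp add: coset_eq_iff\<close>)
  then show "ncosets A K = card (F ` A)" "finite (cosets A K) \<longleftrightarrow> finite (F ` A)"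
    unfolding ncosets_def using bij_betw_same_card bij_betw_finite by blast+
qed

text \<open>The map must reflect the two congruences and hit every class of \<open>A'\<close>.
  Additivity plays no part, so affine maps between solution sets of congruences qualify.\<close>

lemma ncosets_iso:
  assumes "subgrp K" "subgrp K'"
    and "\<And>x. x \<in> A \<Longrightarrow> f x \<in> A'"
    and "\<And>x y. x \<in> A \<Longrightarrow> y \<in> A \<Longrightarrow> f x - f y \<in> K' \<longleftrightarrow> x - y \<in> K"
    and "\<And>b. b \<in> A' \<Longrightarrow> \<exists>x\<in>A. f x - b \<in> K'"
  shows "ncosets A K = ncosets A' K'" and "finite (cosets A K) \<longleftrightarrow> finite (cosets A' K')"
proof -
  have "(\<lambda>x. (+) (f x) ` K') ` A = cosets A' K'"
    unfolding cosets_def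
  proof (intro equalityI subsetI)
    fix C assume "C \<in> (\<lambda>x. (+) x ` K') ` A'"
    then obtain b where b: "b \<in> A'" "C = (+) b ` K'" by auto
    then obtain x where "x \<in> A" "f x - b \<in> K'" using assms(5) by blast
    then have "C = (+) (f x) ` K'" "x \<in> A" 
      using b coset_eq_iff[OF assms(2)] by metis+
    then show "C \<in> (\<lambda>x. (+) (f x) ` K') ` A" by blast
  qed (use assms(3) in auto)
  then show "ncosets A K = ncosets A' K'" and "finite (cosets A K) \<longleftrightarrow> finite (cosets A' K')"
    using ncosets_eq_card[OF assms(1), of A "\<lambda>x. (+) (f x) ` K'"] assms(4)
    by (simp_all add: coset_eq_iff[OF assms(2)] ncosets_def)
qed

lemma ncosets_translate:
  assumes "subgrp K"
  shows "ncosets ((+) t ` A) K = ncosets A K"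
  by (rule ncosets_iso(1)[symmetric, of _ _ _ "(+) t"]) (use assms in \<open>auto intro!: bexI simp: subgrp_zero\<close>)

text \<open>Sorting \<open>A\<close> by the class of \<open>f x\<close> modulo \<open>K'\<close>
  gives pieces that are disjoint even up to \<open>K\<close>, because \<open>f\<close> respects the
  congruences. If \<open>k = 0\<close>, all fibres and hence \<open>A\<close> are empty; if
  \<open>k \<noteq> 0\<close>, every class of \<open>A'\<close> is hit.\<close>

lemma ncosets_fibration:
  assumes K: "subgrp K" and K': "subgrp K'"
    and f: "\<And>x. x \<in> A \<Longrightarrow> f x \<in> A'"
    and compat: "\<And>x y. x \<in> A \<Longrightarrow> y \<in> A \<Longrightarrow> x - y \<in> K \<Longrightarrow> f x - f y \<in> K'"
    and fin: "finite (cosets A K)"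
    and fiber: "\<And>b. b \<in> A' \<Longrightarrow> ncosets {x\<in>A. f x - b \<in> K'} K = k"
  shows "ncosets A K = k * ncosets A' K'"
proof -
  have finS: "finite (cosets S K)" if "S \<subseteq> A" for S
    using fin cosets_mono[OF that] finite_subset by blast
  have ne: "{x\<in>A. f x - b \<in> K'} \<noteq> {} \<longleftrightarrow> k \<noteq> 0" if "b \<in> A'" for b
  proof -
    have "k = 0 \<longleftrightarrow> cosets {x\<in>A. f x - b \<in> K'} K = {}"
      using fiber[OF that] finS[of "{x\<in>A. f x - b \<in> K'}"] card_0_eq[of "cosets {x\<in>A. f x - b \<in> K'} K"]
      unfolding ncosets_def by auto
    then show ?thesis by (auto simp: cosets_def)
  qed
  show ?thesis
  proof (cases "k = 0")
    case True
    have "False" if "x \<in> A" for x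
    proof -
      have "x \<in> {y\<in>A. f y - f x \<in> K'}" using that subgrp_zero[OF K'] by simp
      then show False using ne[OF f[OF that]] True by blast
    qed
    then have "A = {}" by blast
    then show ?thesis using True by (auto simp: ncosets_def cosets_def)
  next
    case False
    define c where "c x = (+) x ` K'" for x
    have c_eq: "c x = c y \<longleftrightarrow> x - y \<in> K'" for x y
      by (simp add: c_def coset_eq_iff[OF K'])
    have cA: "cosets A' K' = c ` A'" by (simp add: cosets_def c_def)
    define S where "S B = {x\<in>A. c (f x) = B}" for B
    have S: "S (c b) = {x\<in>A. f x - b \<in> K'}" for b
      by (simp add: S_def c_eq)
    have ex: "\<exists>x\<in>A. c (f x) = B" if "B \<in> c ` A'" for B
      using that ne False c_eq by blast
    \<comment> \<open>Finiteness downstairs is inherited: each class of \<open>A'\<close> is the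
      image of a class of \<open>A\<close>.\<close>
    have "c ` A' \<subseteq> (\<lambda>C. c (f (SOME x. x \<in> A \<and> (+) x ` K = C))) ` cosets A K"
    proof
      fix B assume "B \<in> c ` A'"
      then obtain x where x: "x \<in> A" "c (f x) = B" using ex by blast
      define y where "y = (SOME y. y \<in> A \<and> (+) y ` K = (+) x ` K)"
      have y: "y \<in> A \<and> (+) y ` K = (+) x ` K" unfolding y_def by (rule someI[of _ x]) (use x in auto)
      then have "c (f y) = c (f x)" using x(1) compat unfolding c_eq coset_eq_iff[OF K] by blast
      then show "B \<in> (\<lambda>C. c (f (SOME x. x \<in> A \<and> (+) x ` K = C))) ` cosets A K"
        using x unfolding cosets_def y_def by blast
    qed
    then have fin': "finite (c ` A')" using fin finite_surj by blast
    have "cosets A K = (\<Union>B\<in>c ` A'. cosets (S B) K)"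
      using f by (auto simp: cosets_def S_def)
    moreover have "card (\<Union>B\<in>c ` A'. cosets (S B) K) = (\<Sum>B\<in>c ` A'. card (cosets (S B) K))"
    proof (rule card_UN_disjoint[OF fin'])
      show "\<forall>B\<in>c ` A'. finite (cosets (S B) K)" using finS by (auto simp: S_def)
      have "B = C" if "x \<in> S B" "y \<in> S C" "(+) x ` K = (+) y ` K" for B C x y
        using that compat c_eq unfolding S_def coset_eq_iff[OF K] by blast
      then show "\<forall>B\<in>c ` A'. \<forall>C\<in>c ` A'. B \<noteq> C \<longrightarrow> cosets (S B) K \<inter> cosets (S C) K = {}"
        unfolding cosets_def by blast
    qed
    moreover have "card (cosets (S B) K) = k" if "B \<in> c ` A'" for B
      using that fiber by (auto simp: S ncosets_def)
    ultimately show ?thesis by (simp add: ncosets_def cA)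
  qed
qed

text \<open>For constants such as quotients of powers of \<open>q\<close>, whose integrality is not
  visible. Over a nonempty base some fibre shows that the constant is a natural number; over an
  empty base both sides vanish.\<close>

lemma ncosets_fibration_real:
  assumes "subgrp K" "subgrp K'"
    and "\<And>x. x \<in> A \<Longrightarrow> f x \<in> A'"
    and "\<And>x y. x \<in> A \<Longrightarrow> y \<in> A \<Longrightarrow> x - y \<in> K \<Longrightarrow> f x - f y \<in> K'"
    and "finite (cosets A K)"
    and fiber: "\<And>b. b \<in> A' \<Longrightarrow> real (ncosets {x\<in>A. f x - b \<in> K'} K) = k"
  shows "real (ncosets A K) = k * real (ncosets A' K')"
proof -
  have n: "ncosets {x\<in>A. f x - b \<in> K'} K = nat \<lfloor>k\<rfloor>" if "b \<in> A'" for b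
    unfolding fiber[OF that, symmetric] by simp
  have e: "ncosets A K = nat \<lfloor>k\<rfloor> * ncosets A' K'"
    by (rule ncosets_fibration[OF assms(1-5) n])
  show ?thesis
  proof (cases "A' = {}")
    case True
    then have "A = {}" using assms(3) by blast
    then show ?thesis using True by (simp add: ncosets_def cosets_def)
  next
    case False
    then obtain b where "b \<in> A'" by blast
    from fiber[OF this] n[OF this] have "real (nat \<lfloor>k\<rfloor>) = k" by simp
    then show ?thesis using e by (simp only: of_nat_mult)
  qed
qed

text \<open>Disjointness is demanded up to \<open>K\<close>: points of different pieces must lie in
  different cosets.\<close>

lemma ncosets_partition:
  assumes K: "subgrp K" and J: "finite J"
    and fin: "finite (cosets A K)"
    and A: "A = (\<Union>j\<in>J. S j)"
    and disj: "\<And>i j x y. i \<in> J \<Longrightarrow> j \<in> J \<Longrightarrow> x \<in> S i \<Longrightarrow> y \<in> S j \<Longrightarrow> x - y \<in> K \<Longrightarrow> i = j"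
  shows "ncosets A K = (\<Sum>j\<in>J. ncosets (S j) K)"
proof -
  have "cosets A K = (\<Union>j\<in>J. cosets (S j) K)" by (auto simp: cosets_def A)
  moreover have "card (\<Union>j\<in>J. cosets (S j) K) = (\<Sum>j\<in>J. card (cosets (S j) K))"
  proof (rule card_UN_disjoint[OF J])
    show "\<forall>j\<in>J. finite (cosets (S j) K)"
      using fin A cosets_mono finite_subset by (metis UN_upper)
    show "\<forall>i\<in>J. \<forall>j\<in>J. i \<noteq> j \<longrightarrow> cosets (S i) K \<inter> cosets (S j) K = {}"
      using disj by (fastforce simp: cosets_def coset_eq_iff[OF K])
  qed
  ultimately show ?thesis by (simp add: ncosets_def)
qed

text \<open>Each coset of \<open>K\<close> that meets the \<open>K\<close>-stable set
  \<open>A\<close> lies in it and splits like \<open>K\<close> itself into cosets of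
  \<open>K'\<close>.\<close>

lemma ncosets_index:
  assumes K: "subgrp K" and K': "subgrp K'" and sub: "K' \<subseteq> K" and fin: "finite (cosets A K')"
    and inv: "\<And>x k. x \<in> A \<Longrightarrow> k \<in> K \<Longrightarrow> x + k \<in> A"
  shows "ncosets A K' = ncosets K K' * ncosets A K"
proof (rule ncosets_fibration[where f = "\<lambda>x. x", OF K' K])
  fix b assume b: "b \<in> A"
  have "{x \<in> A. x - b \<in> K} = (+) b ` K"
  proof (intro equalityI subsetI)
    fix x assume "x \<in> {x \<in> A. x - b \<in> K}"
    then have "x = b + (x - b)" "x - b \<in> K" by auto
    then show "x \<in> (+) b ` K" by blast
  qed (use inv b in auto)
  then show "ncosets {x \<in> A. x - b \<in> K} K' = ncosets K K'"
    using ncosets_translate[OF K'] by simp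
qed (use sub fin in auto)

lemma finite_cosets_trans:
  assumes K: "subgrp K" and fin: "finite (cosets A K)" "finite (cosets K K')"
  shows "finite (cosets A K')"
proof -
  define s where "s C = (SOME a. a \<in> A \<and> (+) a ` K = C)" for C
  have "cosets A K' \<subseteq> (\<lambda>(C, D). (+) (s C) ` D) ` (cosets A K \<times> cosets K K')"
  proof
    fix E assume "E \<in> cosets A K'"
    then obtain x where x: "x \<in> A" "E = (+) x ` K'" by (auto simp: cosets_def)
    have s: "s ((+) x ` K) \<in> A \<and> (+) (s ((+) x ` K)) ` K = (+) x ` K"
      unfolding s_def by (rule someI[of _ x]) (use x in auto)
    define k where "k = x - s ((+) x ` K)"
    have "s ((+) x ` K) - x \<in> K" using s coset_eq_iff[OF K] by blast
    then have "k \<in> K" using subgrp_diff_commute[OF K, of x "s ((+) x ` K)"] by (simp add: k_def)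
    moreover have "E = (+) (s ((+) x ` K)) ` ((+) k ` K')" by (simp add: x k_def image_image)
    ultimately show "E \<in> (\<lambda>(C, D). (+) (s C) ` D) ` (cosets A K \<times> cosets K K')"
      using x unfolding cosets_def by blast
  qed
  then show ?thesis by (rule finite_subset) (use fin in auto)
qed

text \<open>Tuples are functions that vanish off the index set. With 0 as the default value they are
  closed under pointwise subtraction, so the coset calculus applies to them directly.\<close>

definition funs :: "'i set \<Rightarrow> ('i \<Rightarrow> 'g::ab_group_add set) \<Rightarrow> ('i \<Rightarrow> 'g) set" where
  "funs I A = {y. (\<forall>i\<in>I. y i \<in> A i) \<and> (\<forall>i. i \<notin> I \<longrightarrow> y i = 0)}"

lemma funsI: "(\<And>i. i \<in> I \<Longrightarrow> y i \<in> A i) \<Longrightarrow> (\<And>i. i \<notin> I \<Longrightarrow> y i = 0) \<Longrightarrow> y \<in> funs I A"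
  by (auto simp: funs_def)

lemma funsD: "y \<in> funs I A \<Longrightarrow> i \<in> I \<Longrightarrow> y i \<in> A i"
  and funs_outside: "y \<in> funs I A \<Longrightarrow> i \<notin> I \<Longrightarrow> y i = 0"
  by (auto simp: funs_def)

lemma subgrp_funs: "(\<And>i. i \<in> I \<Longrightarrow> subgrp (K i)) \<Longrightarrow> subgrp (funs I K)"
  by (auto simp: subgrp_def funs_def)

lemma ncosets_funs:
  assumes I: "finite I" and K: "\<And>i. i \<in> I \<Longrightarrow> subgrp (K i)"
  shows "ncosets (funs I A) (funs I K) = (\<Prod>i\<in>I. ncosets (A i) (K i))"
    and "(\<And>i. i \<in> I \<Longrightarrow> finite (cosets (A i) (K i))) \<Longrightarrow> finite (cosets (funs I A) (funs I K))"
proof -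
  define F where "F y = (\<lambda>i\<in>I. (+) (y i) ` K i)" for y
  have F: "F x = F y \<longleftrightarrow> x - y \<in> funs I K" if "x \<in> funs I A" "y \<in> funs I A" for x y
  proof -
    have "F x = F y \<longleftrightarrow> (\<forall>i\<in>I. (+) (x i) ` K i = (+) (y i) ` K i)"
      by (auto simp: F_def fun_eq_iff restrict_def)
    also have "\<dots> \<longleftrightarrow> x - y \<in> funs I K"
      using that K by (auto simp: funs_def coset_eq_iff)
    finally show ?thesis .
  qed
  have im: "F ` funs I A = PiE I (\<lambda>i. cosets (A i) (K i))"
  proof (intro equalityI subsetI)
    fix g assume g: "g \<in> PiE I (\<lambda>i. cosets (A i) (K i))"
    define y where "y i = (if i \<in> I then SOME x. x \<in> A i \<and> (+) x ` K i = g i else 0)" for i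
    have y: "y i \<in> A i \<and> (+) (y i) ` K i = g i" if "i \<in> I" for i
    proof -
      have "\<exists>x. x \<in> A i \<and> (+) x ` K i = g i" using PiE_mem[OF g that] by (auto simp: cosets_def)
      from someI_ex[OF this] show ?thesis using that by (simp add: y_def)
    qed
    then have "y \<in> funs I A" by (auto simp: funs_def y_def)
    moreover have "F y = g" using y g by (auto simp: F_def fun_eq_iff restrict_def PiE_def extensional_def)
    ultimately show "g \<in> F ` funs I A" by blast
  qed (auto simp: F_def funs_def cosets_def)
  show "ncosets (funs I A) (funs I K) = (\<Prod>i\<in>I. ncosets (A i) (K i))"
    using ncosets_eq_card(1)[OF subgrp_funs[OF K] F] I by (simp add: im card_PiE ncosets_def)
  show "finite (cosets (funs I A) (funs I K))" if "\<And>i. i \<in> I \<Longrightarrow> finite (cosets (A i) (K i))"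
    using ncosets_eq_card(2)[OF subgrp_funs[OF K] F] I that by (simp add: im finite_PiE)
qed

section \<open>The residue field and its quadratic character\<close>

locale odd_local_field = nonarch_local_field v for v :: "'a::field \<Rightarrow> int" +
  assumes odd_char: "odd (residue_char v)"
begin

abbreviation "\<O> \<equiv> integers v"
abbreviation "\<P> \<equiv> max_ideal v"
abbreviation "\<I> \<equiv> power_ideal v"
abbreviation "q \<equiv> real (residue_size v)"

section \<open>Valuation, ideals and units\<close>

definition pi_def: "\<pi> = (SOME x. x \<noteq> 0 \<and> v x = 1)"

lemma pi_nz [simp]: "\<pi> \<noteq> 0" and v_pi: "v \<pi> = 1"
  using someI_ex[OF uniformizer] by (auto simp: pi_def)

lemma v_one: "v 1 = 0" using val_mult[of 1 1] by simp

lemma v_minus: assumes "x \<noteq> 0" shows "v (- x) = v x"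
proof -
  have "v (-1) = 0" using val_mult[of "-1" "-1"] v_one by simp
  then show ?thesis using val_mult[of "-1" x] assms by simp
qed

lemma v_inverse: "x \<noteq> 0 \<Longrightarrow> v (inverse x) = - v x"
  using val_mult[of x "inverse x"] v_one by simp

lemma v_power: "x \<noteq> 0 \<Longrightarrow> v (x ^ n) = int n * v x"
  by (induction n) (auto simp: v_one val_mult algebra_simps)

lemma v_divide: "x \<noteq> 0 \<Longrightarrow> y \<noteq> 0 \<Longrightarrow> v (x / y) = v x - v y"
  by (simp add: divide_inverse val_mult v_inverse)

lemma I_0: "\<I> 0 = \<O>" by (auto simp: power_ideal_def integers_def)
lemma I_1: "\<I> (Suc 0) = \<P>" by (auto simp: power_ideal_def max_ideal_def)

lemma I_zero [simp]: "0 \<in> \<I> N" by (simp add: power_ideal_def)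
lemma I_add: "x \<in> \<I> N \<Longrightarrow> y \<in> \<I> N \<Longrightarrow> x + y \<in> \<I> N"
  using val_add[of x y] by (cases "x = 0"; cases "y = 0"; cases "x + y = 0") (auto simp: power_ideal_def)
lemma I_uminus [simp]: "- x \<in> \<I> N \<longleftrightarrow> x \<in> \<I> N"
  by (cases "x = 0") (auto simp: power_ideal_def v_minus)
lemma I_diff: "x \<in> \<I> N \<Longrightarrow> y \<in> \<I> N \<Longrightarrow> x - y \<in> \<I> N"
  using I_add[of x N "- y"] by simp
lemma subgrp_I [simp]: "subgrp (\<I> N)" by (simp add: subgrp_def I_diff)
lemma I_sum: "(\<And>i. i \<in> S \<Longrightarrow> f i \<in> \<I> N) \<Longrightarrow> sum f S \<in> \<I> N"
  by (rule subgrp_sum) auto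
lemma I_mult: "x \<in> \<I> m \<Longrightarrow> y \<in> \<I> n \<Longrightarrow> x * y \<in> \<I> (m + n)"
  by (cases "x = 0"; cases "y = 0") (auto simp: power_ideal_def val_mult)
lemma I_antimono: "m \<le> n \<Longrightarrow> x \<in> \<I> n \<Longrightarrow> x \<in> \<I> m"
  by (auto simp: power_ideal_def)
lemma I_iff: "x \<in> \<I> N \<longleftrightarrow> x / \<pi> ^ N \<in> \<O>"
  by (cases "x = 0") (auto simp: power_ideal_def integers_def v_divide v_power v_pi)
lemma I_pow_mult [simp]: "\<pi> ^ k * x \<in> \<I> (k + N) \<longleftrightarrow> x \<in> \<I> N"
  by (cases "x = 0") (auto simp: power_ideal_def val_mult v_power v_pi)

lemma O_zero [simp]: "0 \<in> \<O>" and O_one [simp]: "1 \<in> \<O>"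
  by (auto simp: integers_def v_one)
lemma O_add [intro]: "x \<in> \<O> \<Longrightarrow> y \<in> \<O> \<Longrightarrow> x + y \<in> \<O>"
  and O_diff [intro]: "x \<in> \<O> \<Longrightarrow> y \<in> \<O> \<Longrightarrow> x - y \<in> \<O>"
  and O_mult [intro]: "x \<in> \<O> \<Longrightarrow> y \<in> \<O> \<Longrightarrow> x * y \<in> \<O>"
  using I_add[of x 0 y] I_diff[of x 0 y] I_mult[of x 0 y 0] by (simp_all add: I_0)
lemma O_uminus [simp]: "- x \<in> \<O> \<longleftrightarrow> x \<in> \<O>" using I_uminus[of x 0] by (simp add: I_0)
lemma O_power [intro]: "x \<in> \<O> \<Longrightarrow> x ^ n \<in> \<O>" by (induction n) auto
lemma O_sum [intro]: "(\<And>i. i \<in> S \<Longrightarrow> f i \<in> \<O>) \<Longrightarrow> sum f S \<in> \<O>"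
  using I_sum[of S f 0] by (simp add: I_0)
lemma O_of_nat [simp]: "of_nat n \<in> \<O>" by (induction n) auto
lemma O_numeral [simp]: "numeral n \<in> \<O>" using O_of_nat[of "numeral n"] by simp
lemma subgrp_O [simp]: "subgrp \<O>" and subgrp_P [simp]: "subgrp \<P>"
  using subgrp_I[of 0] subgrp_I[of "Suc 0"] by (simp_all add: I_0 I_1)
lemma P_zero [simp]: "0 \<in> \<P>" by (simp add: max_ideal_def)
lemma P_one [simp]: "1 \<notin> \<P>" by (simp add: max_ideal_def v_one)
lemma P_add [intro]: "x \<in> \<P> \<Longrightarrow> y \<in> \<P> \<Longrightarrow> x + y \<in> \<P>"
  and P_diff [intro]: "x \<in> \<P> \<Longrightarrow> y \<in> \<P> \<Longrightarrow> x - y \<in> \<P>"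
  by (auto intro: subgrp_add subgrp_diff)
lemma P_uminus [simp]: "- x \<in> \<P> \<longleftrightarrow> x \<in> \<P>" using I_uminus[of x "Suc 0"] by (simp add: I_1)
lemma P_diff_commute: "x - y \<in> \<P> \<longleftrightarrow> y - x \<in> \<P>"
  using subgrp_diff_commute[OF subgrp_P] .
lemma P_diff_cong_left: "x - y \<in> \<P> \<Longrightarrow> x - z \<in> \<P> \<longleftrightarrow> y - z \<in> \<P>"
  using P_add[of "x - y" "y - z"] P_diff[of "x - z" "x - y"] by auto
lemma P_diff_cong_right: "x - y \<in> \<P> \<Longrightarrow> z - x \<in> \<P> \<longleftrightarrow> z - y \<in> \<P>"
  using P_diff_cong_left[of x y z] P_diff_commute by auto
lemma P_sum [intro]: "(\<And>i. i \<in> S \<Longrightarrow> f i \<in> \<P>) \<Longrightarrow> sum f S \<in> \<P>"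
  by (rule subgrp_sum) auto
lemma P_imp_O: "x \<in> \<P> \<Longrightarrow> x \<in> \<O>" by (auto simp: max_ideal_def integers_def)
lemma I_imp_O: "x \<in> \<I> N \<Longrightarrow> x \<in> \<O>" using I_antimono[of 0 N x] by (simp add: I_0)
lemma I_imp_P: "x \<in> \<I> N \<Longrightarrow> 0 < N \<Longrightarrow> x \<in> \<P>" using I_antimono[of "Suc 0" N x] by (simp add: I_1)
lemma I_mult_left: "c \<in> \<O> \<Longrightarrow> x \<in> \<I> N \<Longrightarrow> c * x \<in> \<I> N"
  and I_mult_right: "c \<in> \<O> \<Longrightarrow> x \<in> \<I> N \<Longrightarrow> x * c \<in> \<I> N"
  using I_mult[of c 0 x N] I_mult[of x N c 0] by (simp_all add: I_0)
lemma P_mult_left [intro]: "c \<in> \<O> \<Longrightarrow> x \<in> \<P> \<Longrightarrow> c * x \<in> \<P>"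
  and P_mult_right [intro]: "c \<in> \<O> \<Longrightarrow> x \<in> \<P> \<Longrightarrow> x * c \<in> \<P>"
  using I_mult_left[of c x "Suc 0"] I_mult_right[of c x "Suc 0"] by (simp_all add: I_1)
lemma P_iff: "x \<in> \<P> \<longleftrightarrow> x / \<pi> \<in> \<O>" using I_iff[of x "Suc 0"] by (simp add: I_1)
lemma pi_P [simp]: "\<pi> \<in> \<P>" by (simp add: P_iff)
lemma pi_O [simp]: "\<pi> \<in> \<O>" by (simp add: P_imp_O)
lemma pi_pow_I [simp]: "\<pi> ^ N \<in> \<I> N" by (simp add: I_iff)

lemma unit_nz: "x \<notin> \<P> \<Longrightarrow> x \<noteq> 0" by auto
lemma unit_inverse: "x \<in> \<O> \<Longrightarrow> x \<notin> \<P> \<Longrightarrow> inverse x \<in> \<O>" "x \<in> \<O> \<Longrightarrow> x \<notin> \<P> \<Longrightarrow> inverse x \<notin> \<P>"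
  by (auto simp: integers_def max_ideal_def v_inverse)
lemma unit_divide [intro]: "y \<in> \<O> \<Longrightarrow> x \<in> \<O> \<Longrightarrow> x \<notin> \<P> \<Longrightarrow> y / x \<in> \<O>"
  using unit_inverse(1) by (auto simp: divide_inverse)
lemma P_mult_iff: "x \<in> \<O> \<Longrightarrow> y \<in> \<O> \<Longrightarrow> x * y \<in> \<P> \<longleftrightarrow> x \<in> \<P> \<or> y \<in> \<P>"
  by (cases "x = 0"; cases "y = 0") (auto simp: integers_def max_ideal_def val_mult)
lemma P_power_iff: "x \<in> \<O> \<Longrightarrow> x ^ 2 \<in> \<P> \<longleftrightarrow> x \<in> \<P>"
  by (simp add: power2_eq_square P_mult_iff)
text \<open>If 2 were in \<open>\<P>\<close>, the residue characteristic, being the least positive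
  integer there, would be at most 2; as it is odd it would be 1, but 1 is a unit. Odd residue
  characteristic enters the later arguments through this fact.\<close>

lemma two_notin_P: "2 \<notin> \<P>"
proof
  assume "2 \<in> \<P>"
  then have *: "(0::nat) < 2 \<and> of_nat 2 \<in> \<P>" by simp
  have "residue_char v \<le> 2" unfolding residue_char_def by (rule Least_le) (fact *)
  moreover have "0 < residue_char v \<and> of_nat (residue_char v) \<in> \<P>"
    unfolding residue_char_def by (rule LeastI[where P = "\<lambda>p. 0 < p \<and> of_nat p \<in> \<P>"]) (fact *)
  moreover have "residue_char v \<noteq> 2" using odd_char by auto
  ultimately have "residue_char v = 1" "of_nat (residue_char v) \<in> \<P>" by auto
  then show False by simp
qed

section \<open>Representatives of the residue classes\<close>

lemma residue_field_cosets: "residue_field v = cosets \<O> \<P>"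
proof -
  have "{(x, y). x \<in> \<O> \<and> y \<in> \<O> \<and> x - y \<in> \<P>} `` {x} = (+) x ` \<P>" if "x \<in> \<O>" for x
  proof (intro equalityI subsetI)
    fix y assume "y \<in> {(x, y). x \<in> \<O> \<and> y \<in> \<O> \<and> x - y \<in> \<P>} `` {x}"
    then have "y = x + (y - x)" "y - x \<in> \<P>" using P_diff_commute by auto
    then show "y \<in> (+) x ` \<P>" by blast
  qed (use that P_imp_O in auto)
  then show ?thesis by (auto simp: residue_field_def quotient_def cosets_def)
qed

lemma finite_cosets_P: "finite (cosets \<O> \<P>)" and ncosets_P: "real (ncosets \<O> \<P>) = q"
  using finite_residue_field by (auto simp: residue_field_cosets ncosets_def residue_size_def)

text \<open>The choice is made from the coset and not from \<open>x\<close>, so congruent elements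
  receive the same representative. Sums over the residue field become sums over the finite set
  \<open>\<R>\<close> of representatives.\<close>

definition "rep x = (SOME y. y \<in> (+) x ` \<P>)"
definition R_def: "\<R> = rep ` \<O>"

lemma rep_diff: "x - rep x \<in> \<P>"
proof -
  have "rep x \<in> (+) x ` \<P>" unfolding rep_def by (rule someI[of _ x]) force
  then show ?thesis by (auto simp: P_diff_commute)
qed
lemma rep_O: "x \<in> \<O> \<Longrightarrow> rep x \<in> \<O>"
  using O_diff[of x "x - rep x"] rep_diff[of x] P_imp_O by auto
lemma R_O: "r \<in> \<R> \<Longrightarrow> r \<in> \<O>" by (auto simp: R_def rep_O)
lemma rep_R: "x \<in> \<O> \<Longrightarrow> rep x \<in> \<R>" by (auto simp: R_def)
lemma rep_eq: "rep x = rep y \<longleftrightarrow> x - y \<in> \<P>"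
proof
  assume *: "rep x = rep y"
  show "x - y \<in> \<P>" unfolding P_diff_cong_left[OF rep_diff[of x]] * using rep_diff[of y] P_diff_commute by simp
next
  assume "x - y \<in> \<P>"
  then have "(+) x ` \<P> = (+) y ` \<P>" by (simp add: coset_eq_iff)
  then show "rep x = rep y" by (simp add: rep_def)
qed
lemma R_eq: "r \<in> \<R> \<Longrightarrow> s \<in> \<R> \<Longrightarrow> r - s \<in> \<P> \<Longrightarrow> r = s"
proof -
  assume *: "r \<in> \<R>" "s \<in> \<R>" "r - s \<in> \<P>"
  then obtain x y where "r = rep x" "s = rep y" by (auto simp: R_def)
  moreover have "x - y \<in> \<P>"
    using *(3) unfolding calculation P_diff_cong_left[OF rep_diff[of x]] P_diff_cong_right[OF rep_diff[of y], symmetric]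
    using P_diff_cong_left[OF rep_diff[of x]] P_diff_cong_right[OF rep_diff[of y]] by simp
  ultimately show "r = s" by (simp add: rep_eq)
qed
lemma rep_id: "r \<in> \<R> \<Longrightarrow> rep r = r" using R_eq[of "rep r" r] rep_R R_O rep_diff P_diff_commute by blast
lemma finite_R [simp]: "finite \<R>" and card_R: "real (card \<R>) = q"
  using ncosets_eq_card[of \<P> \<O> rep] finite_cosets_P ncosets_P by (auto simp: rep_eq R_def)

lemma q_gt_1: "q > 1"
proof -
  have "{rep 0, rep 1} \<subseteq> \<R>" by (auto simp: rep_R)
  then have "card {rep 0, rep 1} \<le> card \<R>" by (intro card_mono) auto
  moreover have "rep 0 \<noteq> rep 1" by (simp add: rep_eq)
  ultimately show ?thesis using card_R by (simp flip: card_R)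
qed
lemma q_pos [simp]: "q > 0" "q \<noteq> 0" using q_gt_1 by auto

text \<open>Functions on the residue field, seen as functions on the ring of integers.\<close>

definition class_fun_def: "class_fun f \<longleftrightarrow> (\<forall>x\<in>\<O>. \<forall>y\<in>\<O>. x - y \<in> \<P> \<longrightarrow> f x = f y)"
lemma class_funD: "class_fun f \<Longrightarrow> x \<in> \<O> \<Longrightarrow> y \<in> \<O> \<Longrightarrow> x - y \<in> \<P> \<Longrightarrow> f x = f y"
  unfolding class_fun_def by blast
lemma class_fun_rep: "class_fun f \<Longrightarrow> x \<in> \<O> \<Longrightarrow> f (rep x) = f x"
  using rep_diff[of x] by (intro class_funD[of f]) (auto simp: rep_O P_diff_commute)

text \<open>Composed with \<open>rep\<close>, the map \<open>h\<close> is an injective self-map of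
  the finite set \<open>\<R>\<close>, hence a permutation. This is the change of variables for the
  character sums below.\<close>

lemma sum_R_reindex:
  assumes h: "\<And>x. x \<in> \<O> \<Longrightarrow> h x \<in> \<O>" and inj: "\<And>x y. x \<in> \<O> \<Longrightarrow> y \<in> \<O> \<Longrightarrow> h x - h y \<in> \<P> \<Longrightarrow> x - y \<in> \<P>"
    and g: "class_fun (g :: 'a \<Rightarrow> real)"
  shows "(\<Sum>r\<in>\<R>. g (h r)) = (\<Sum>r\<in>\<R>. g r)"
proof -
  have i: "inj_on (\<lambda>r. rep (h r)) \<R>"
    using inj R_O R_eq by (auto simp: inj_on_def rep_eq)
  have "(\<lambda>r. rep (h r)) ` \<R> = \<R>"
    by (rule endo_inj_surj[OF _ _ i]) (auto intro: rep_R h R_O)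
  then have "(\<Sum>r\<in>\<R>. g r) = (\<Sum>r\<in>\<R>. g (rep (h r)))"
    using sum.reindex[OF i, of g] by simp
  also have "\<dots> = (\<Sum>r\<in>\<R>. g (h r))"
    using class_fun_rep[OF g] h R_O by (intro sum.cong) auto
  finally show ?thesis by simp
qed

lemma sum_R_delta:
  assumes "x \<in> \<O>"
  shows "(\<Sum>b\<in>\<R>. if x - b \<in> \<P> then f b else 0) = (f (rep x) :: real)"
proof -
  have "x - b \<in> \<P> \<longleftrightarrow> b = rep x" if "b \<in> \<R>" for b
    using that rep_eq[of x b] rep_id[of b] by auto
  then have "(\<Sum>b\<in>\<R>. if x - b \<in> \<P> then f b else 0) = (\<Sum>b\<in>\<R>. if b = rep x then f b else 0)"
    by (intro sum.cong) auto
  then show ?thesis using rep_R[OF assms] by simp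
qed

section \<open>The quadratic character and its multiplicativity\<close>

definition \<chi> :: "'a \<Rightarrow> real" where chi_def: "\<chi> x = of_int (residue_symbol v x)"

lemma chi_P: "x \<in> \<P> \<Longrightarrow> \<chi> x = 0" by (simp add: chi_def residue_symbol_def)
lemma chi_square: "y \<in> \<O> \<Longrightarrow> x - y ^ 2 \<in> \<P> \<Longrightarrow> x \<notin> \<P> \<Longrightarrow> \<chi> x = 1"
  by (auto simp: chi_def residue_symbol_def)
lemma chi_cases: "x \<notin> \<P> \<Longrightarrow> \<chi> x = 1 \<and> (\<exists>y\<in>\<O>. x - y ^ 2 \<in> \<P>) \<or> \<chi> x = - 1 \<and> \<not> (\<exists>y\<in>\<O>. x - y ^ 2 \<in> \<P>)"
  by (auto simp: chi_def residue_symbol_def)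
lemma chi_sq: "x \<notin> \<P> \<Longrightarrow> \<chi> x * \<chi> x = 1" using chi_cases[of x] by auto
lemma chi_1 [simp]: "\<chi> 1 = 1" by (rule chi_square[of 1]) auto

lemma class_fun_chi: "class_fun \<chi>"
  unfolding class_fun_def
proof (intro ballI impI)
  fix x y assume *: "x - y \<in> \<P>"
  have "x - z \<in> \<P> \<longleftrightarrow> y - z \<in> \<P>" for z
    using P_diff_cong_left[OF *] .
  then have "x \<in> \<P> \<longleftrightarrow> y \<in> \<P>" and "\<And>z. x - z \<in> \<P> \<longleftrightarrow> y - z \<in> \<P>" by (metis diff_zero, blast)
  then show "\<chi> x = \<chi> y" by (simp add: chi_def residue_symbol_def)
qed
lemmas chi_cong = class_funD[OF class_fun_chi]

text \<open>A unit square has two roots \<open>y\<close> and \<open>- y\<close>, distinct because 2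
  is a unit; the class of 0 has one root and a nonsquare none.\<close>

lemma square_count:
  assumes b: "b \<in> \<O>" shows "real (card {c\<in>\<R>. c ^ 2 - b \<in> \<P>}) = 1 + \<chi> b"
proof (cases "b \<in> \<P>")
  case True
  have "{c\<in>\<R>. c ^ 2 - b \<in> \<P>} = {rep 0}"
  proof (intro equalityI subsetI)
    fix c assume c: "c \<in> {c\<in>\<R>. c ^ 2 - b \<in> \<P>}"
    then have "c ^ 2 \<in> \<P>" using P_add[of "c ^ 2 - b" b] True by auto
    then have "c - 0 \<in> \<P>" using c P_power_iff R_O by auto
    then show "c \<in> {rep 0}" using c rep_eq[of c 0] rep_id[of c] by auto
  next
    fix c assume c: "c \<in> {rep 0}"
    then have "c \<in> \<P>" using rep_diff[of 0] by auto
    then show "c \<in> {c\<in>\<R>. c ^ 2 - b \<in> \<P>}" using c True rep_R[of 0] by (auto simp: power2_eq_square P_imp_O intro!: P_diff)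
  qed
  then show ?thesis using True by (simp add: chi_P)
next
  case False
  show ?thesis
  proof (cases "\<exists>y\<in>\<O>. b - y ^ 2 \<in> \<P>")
    case True
    then obtain y where y: "y \<in> \<O>" "b - y ^ 2 \<in> \<P>" by auto
    have yP: "y \<notin> \<P>" using False P_add[OF y(2), of "y^2"] y(1) by (auto simp: P_power_iff)
    have iff: "c ^ 2 - b \<in> \<P> \<longleftrightarrow> c - y \<in> \<P> \<or> c - (- y) \<in> \<P>" if "c \<in> \<O>" for c
    proof -
      have "c ^ 2 - b \<in> \<P> \<longleftrightarrow> c ^ 2 - y ^ 2 \<in> \<P>"
        using P_diff_cong_right[OF y(2)] .
      also have "c ^ 2 - y ^ 2 = (c - y) * (c - (- y))" by (simp add: power2_eq_square algebra_simps)
      finally show ?thesis using that y(1) by (simp add: P_mult_iff O_diff O_add)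
    qed
    have "{c\<in>\<R>. c ^ 2 - b \<in> \<P>} = {rep y, rep (- y)}"
    proof (intro equalityI subsetI)
      fix c assume c: "c \<in> {c\<in>\<R>. c ^ 2 - b \<in> \<P>}"
      then have "rep c = rep y \<or> rep c = rep (- y)" using iff R_O unfolding rep_eq by auto
      then show "c \<in> {rep y, rep (- y)}" using rep_id c by auto
    next
      have "rep (- y) - (- y) \<in> \<P>" "rep y - y \<in> \<P>" using rep_diff P_diff_commute by blast+
      moreover fix c assume "c \<in> {rep y, rep (- y)}"
      moreover have "y \<in> \<O>" "- y \<in> \<O>" using y(1) by auto
      ultimately show "c \<in> {c\<in>\<R>. c ^ 2 - b \<in> \<P>}"
        using rep_R[of y] rep_R[of "- y"] iff[of c] rep_O[of y] rep_O[of "- y"] by blast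
    qed
    moreover have "rep y \<noteq> rep (- y)"
    proof
      assume "rep y = rep (- y)"
      then have "2 * y \<in> \<P>" by (simp add: rep_eq)
      then show False using yP y(1) two_notin_P by (simp add: P_mult_iff)
    qed
    moreover have "\<chi> b = 1" using chi_square[OF y False] .
    ultimately show ?thesis by simp
  next
    case nsq: False
    then have "{c\<in>\<R>. c ^ 2 - b \<in> \<P>} = {}" using R_O P_diff_commute by blast
    moreover have "\<chi> b = - 1" using chi_cases[OF False] nsq by auto
    ultimately show ?thesis by simp
  qed
qed

lemma square_count': "b \<in> \<O> \<Longrightarrow> (\<Sum>c\<in>\<R>. if c ^ 2 - b \<in> \<P> then 1 else 0) = 1 + \<chi> b"
  using square_count[of b] by (simp add: sum.If_cases Int_def)

text \<open>Adding up the numbers of square roots of all classes counts each class once, so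
  \<open>1 + \<chi> b\<close> has total \<open>q\<close>.\<close>

lemma sum_chi: "(\<Sum>b\<in>\<R>. \<chi> b) = 0"
proof -
  have "(\<Sum>b\<in>\<R>. 1 + \<chi> b) = (\<Sum>b\<in>\<R>. \<Sum>c\<in>\<R>. if c ^ 2 - b \<in> \<P> then 1 else 0)"
    using R_O by (intro sum.cong) (simp_all add: square_count')
  also have "\<dots> = (\<Sum>c\<in>\<R>. \<Sum>b\<in>\<R>. if c ^ 2 - b \<in> \<P> then 1 else 0)" by (rule sum.swap)
  also have "\<dots> = (\<Sum>c\<in>\<R>. 1)"
    using R_O by (intro sum.cong refl sum_R_delta[where f = "\<lambda>_. 1"]) auto
  finally show ?thesis by (simp add: sum.distrib)
qed

lemma class_fun_comp:
  assumes "class_fun f" "\<And>x. x \<in> \<O> \<Longrightarrow> h x \<in> \<O>" "\<And>x y. x \<in> \<O> \<Longrightarrow> y \<in> \<O> \<Longrightarrow> x - y \<in> \<P> \<Longrightarrow> h x - h y \<in> \<P>"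
  shows "class_fun (\<lambda>x. f (h x))"
  unfolding class_fun_def by (intro ballI impI class_funD[OF assms(1)] assms(2,3))

lemma class_fun_mult: "class_fun f \<Longrightarrow> class_fun g \<Longrightarrow> class_fun (\<lambda>x. f x * g x)"
  unfolding class_fun_def by (intro ballI impI arg_cong2[where f = "(*)"]) blast+

lemma sum_chi_mult: assumes "a \<in> \<O>" "a \<notin> \<P>" shows "(\<Sum>b\<in>\<R>. \<chi> (a * b)) = 0"
proof -
  have "(\<Sum>b\<in>\<R>. \<chi> (a * b)) = (\<Sum>b\<in>\<R>. \<chi> b)"
    by (rule sum_R_reindex) (use assms in \<open>auto simp: class_fun_chi P_mult_iff O_diff right_diff_distrib[symmetric]\<close>)
  then show ?thesis by (simp add: sum_chi)
qed

lemma chi_square_mult: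
  assumes "a \<in> \<O>" "b \<in> \<O>" "\<chi> b = 1" shows "\<chi> (a * b) = \<chi> a"
proof -
  have bP: "b \<notin> \<P>" using assms(3) chi_P by force
  obtain y where y: "y \<in> \<O>" "b - y ^ 2 \<in> \<P>" using chi_cases[OF bP] assms(3) by auto
  have yP: "y \<notin> \<P>" using bP P_add[OF y(2), of "y^2"] y(1) by (auto simp: P_power_iff)
  have e: "\<chi> (a * b) = \<chi> (a * y ^ 2)"
    using assms y by (intro chi_cong) (auto simp: right_diff_distrib[symmetric])
  have iff: "(\<exists>z\<in>\<O>. a * y ^ 2 - z ^ 2 \<in> \<P>) \<longleftrightarrow> (\<exists>z\<in>\<O>. a - z ^ 2 \<in> \<P>)"
  proof
    assume "\<exists>z\<in>\<O>. a - z ^ 2 \<in> \<P>"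
    then obtain z where z: "z \<in> \<O>" "a - z ^ 2 \<in> \<P>" by auto
    have "a * y ^ 2 - (z * y) ^ 2 = y ^ 2 * (a - z ^ 2)" by (simp add: algebra_simps power_mult_distrib)
    then show "\<exists>z\<in>\<O>. a * y ^ 2 - z ^ 2 \<in> \<P>" using z y by (intro bexI[of _ "z * y"]) auto
  next
    assume "\<exists>z\<in>\<O>. a * y ^ 2 - z ^ 2 \<in> \<P>"
    then obtain z where z: "z \<in> \<O>" "a * y ^ 2 - z ^ 2 \<in> \<P>" by auto
    have "a - (z / y) ^ 2 = (inverse y) ^ 2 * (a * y ^ 2 - z ^ 2)"
      using unit_nz[OF yP] by (simp add: field_simps)
    then show "\<exists>z\<in>\<O>. a - z ^ 2 \<in> \<P>" using z y yP unit_inverse[of y] by (intro bexI[of _ "z / y"]) auto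
  qed
  have "a * y ^ 2 \<in> \<P> \<longleftrightarrow> a \<in> \<P>" using assms y yP by (simp add: P_mult_iff P_power_iff O_power)
  then show ?thesis unfolding e unfolding chi_def residue_symbol_def using iff by simp
qed

text \<open>Only a product of two nonsquares needs an argument. If \<open>a\<close> is a nonsquare,
  then \<open>\<chi> (a * x) = - 1\<close> whenever \<open>\<chi> x = 1\<close>, so
  \<open>\<chi> (a * x) + \<chi> x\<close> is never positive. Its sum over the residue field is 0,
  hence every term vanishes. The cyclic structure of the unit group is not involved.\<close>

lemma chi_mult:
  assumes a: "a \<in> \<O>" and b: "b \<in> \<O>" shows "\<chi> (a * b) = \<chi> a * \<chi> b"
proof (cases "a \<in> \<P> \<or> b \<in> \<P>")
  case True
  then have "a * b \<in> \<P>" using a b by auto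
  then show ?thesis using True chi_P by auto
next
  case False
  show ?thesis
  proof (cases "\<chi> a = 1 \<or> \<chi> b = 1")
    case True
    then show ?thesis using chi_square_mult[OF a b] chi_square_mult[OF b a] by (auto simp: mult.commute)
  next
    case nsq: False
    have a1: "\<chi> a = - 1" and b1: "\<chi> b = - 1" using False nsq chi_cases by auto
    have "(\<Sum>x\<in>\<R>. \<chi> (a * x) + \<chi> x) = 0"
      using False a by (simp add: sum.distrib sum_chi sum_chi_mult)
    moreover have nn: "\<chi> (a * x) + \<chi> x \<le> 0" if "x \<in> \<R>" for x
    proof -
      have "\<chi> (a * x) = - 1" if "\<chi> x = 1"
        using chi_square_mult[OF a _ that] a1 R_O[OF \<open>x \<in> \<R>\<close>] by simp
      moreover have "\<chi> x = 0 \<or> \<chi> x = 1 \<or> \<chi> x = - 1" using chi_P chi_cases by blast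
      moreover have "\<chi> (a * x) \<le> 1" using chi_P[of "a * x"] chi_cases[of "a * x"] by force
      moreover have "\<chi> (a * x) = 0" if "\<chi> x = 0"
      proof -
        have "x \<in> \<P>" using that chi_cases[of x] by force
        then show ?thesis using a chi_P by blast
      qed
      ultimately show ?thesis by auto
    qed
    ultimately have z: "\<chi> (a * x) + \<chi> x = 0" if "x \<in> \<R>" for x
      using that sum_nonneg_eq_0_iff[of \<R> "\<lambda>x. - (\<chi> (a * x) + \<chi> x)"]
      by (simp add: sum_negf del: minus_add_distrib)
    have "class_fun (\<lambda>x. \<chi> (a * x))"
      by (rule class_fun_comp[OF class_fun_chi]) (use a in \<open>auto simp: right_diff_distrib[symmetric]\<close>)
    from class_fun_rep[OF this b] have "\<chi> (a * b) + \<chi> b = 0"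
      using z[of "rep b"] class_fun_rep[OF class_fun_chi b] b rep_R by simp
    then show ?thesis using a1 b1 by simp
  qed
qed

lemma residue_size_pos [simp]: "0 < residue_size v" using q_pos(1) by linarith

section \<open>Convolution with the quadratic character\<close>

definition conv :: "'a \<Rightarrow> ('a \<Rightarrow> real) \<Rightarrow> 'a \<Rightarrow> real" where
  "conv u f x = (\<Sum>b\<in>\<R>. \<chi> (u * b) * f (x - b))"

lemma class_fun_scaled_chi: "u \<in> \<O> \<Longrightarrow> class_fun (\<lambda>b. \<chi> (u * b))"
  by (rule class_fun_comp[OF class_fun_chi]) (auto simp: right_diff_distrib[symmetric])

lemma class_fun_reflect: "class_fun f \<Longrightarrow> x \<in> \<O> \<Longrightarrow> class_fun (\<lambda>b. f (x - b))"
  by (rule class_fun_comp[of f]) (auto simp: P_diff_commute)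

lemma sum_R_reflect:
  assumes "class_fun (f :: 'a \<Rightarrow> real)" "x \<in> \<O>" shows "(\<Sum>b\<in>\<R>. f (x - b)) = (\<Sum>b\<in>\<R>. f b)"
  by (rule sum_R_reindex) (use assms in \<open>auto simp: P_diff_commute\<close>)

lemma sum_chi_shift: "x \<in> \<O> \<Longrightarrow> (\<Sum>b\<in>\<R>. \<chi> (b - x)) = 0"
  using sum_R_reindex[of "\<lambda>b. b - x" \<chi>] by (auto simp: class_fun_chi sum_chi)

text \<open>The two factors \<open>\<chi> u\<close> cancel. For \<open>d \<in> \<P>\<close> every
  unit \<open>b\<close> contributes \<open>\<chi> (- 1)\<close>. For a unit \<open>d\<close>,
  \<open>\<chi> b * \<chi> (d - b) = \<chi> (d / b - 1)\<close> and \<open>d / b\<close> runs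
  through all units, so just the term \<open>\<chi> (0 - 1)\<close> is missing from a complete sum
  of \<open>\<chi>\<close>.\<close>

lemma jacobi_sum:
  assumes u: "u \<in> \<O>" "u \<notin> \<P>" and d: "d \<in> \<O>"
  shows "(\<Sum>b\<in>\<R>. \<chi> (u * b) * \<chi> (u * (d - b))) = \<chi> (- 1) * (q * (if d \<in> \<P> then 1 else 0) - 1)"
proof -
  have t: "\<chi> (u * b) * \<chi> (u * (d - b)) = \<chi> b * \<chi> (d - b)" if "b \<in> \<R>" for b
  proof -
    have "\<chi> (u * b) * \<chi> (u * (d - b)) = (\<chi> u * \<chi> u) * (\<chi> b * \<chi> (d - b))"
      using that u d R_O by (simp add: chi_mult O_diff)
    then show ?thesis using u chi_sq by simp
  qed
  have "(\<Sum>b\<in>\<R>. \<chi> b * \<chi> (d - b)) = \<chi> (- 1) * (q * (if d \<in> \<P> then 1 else 0) - 1)"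
  proof (cases "d \<in> \<P>")
    case True
    have "\<chi> b * \<chi> (d - b) = \<chi> (- 1) * (1 - (if 0 - b \<in> \<P> then 1 else 0))" if "b \<in> \<R>" for b
    proof -
      have b: "b \<in> \<O>" using that R_O by auto
      have "\<chi> (d - b) = \<chi> (- 1 * b)" using True b d by (intro chi_cong) auto
      also have "\<dots> = \<chi> (- 1) * \<chi> b" using b by (subst chi_mult) auto
      finally show ?thesis using chi_sq[of b] chi_P[of b] by (auto simp: algebra_simps)
    qed
    then have "(\<Sum>b\<in>\<R>. \<chi> b * \<chi> (d - b)) = (\<Sum>b\<in>\<R>. \<chi> (- 1) * (1 - (if 0 - b \<in> \<P> then 1 else 0)))"
      by (rule sum.cong[OF refl])
    also have "\<dots> = \<chi> (- 1) * (q - 1)"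
      using sum_R_delta[of 0 "\<lambda>_. 1"] by (simp add: sum_distrib_left[symmetric] sum_subtractf card_R)
    finally show ?thesis using True by simp
  next
    case False
    \<comment> \<open>The value 0 on \<open>\<P>\<close> completes \<open>b \<mapsto> d / b\<close>
      to a permutation of the residue field; the spurious term \<open>\<chi> (- 1)\<close> at the
      class of 0 is subtracted in the next formula.\<close>
    define h where "h b = (if b \<in> \<P> then 0 else d / b)" for b
    have hO: "h b \<in> \<O>" if "b \<in> \<O>" for b using that d by (auto simp: h_def)
    have "\<chi> b * \<chi> (d - b) = \<chi> (h b - 1) - (if 0 - b \<in> \<P> then \<chi> (- 1) else 0)" if "b \<in> \<R>" for b
    proof (cases "b \<in> \<P>")
      case True then show ?thesis by (simp add: chi_P h_def)
    next
      case bP: False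
      have b: "b \<in> \<O>" using that R_O by auto
      have "d - b = b * (h b - 1)" using unit_nz[OF bP] bP by (simp add: h_def algebra_simps)
      then have "\<chi> b * \<chi> (d - b) = (\<chi> b * \<chi> b) * \<chi> (h b - 1)"
        using b hO[OF b] by (simp add: chi_mult O_diff)
      then show ?thesis using bP chi_sq[OF bP] by simp
    qed
    then have "(\<Sum>b\<in>\<R>. \<chi> b * \<chi> (d - b)) = (\<Sum>b\<in>\<R>. \<chi> (h b - 1)) - (\<Sum>b\<in>\<R>. if 0 - b \<in> \<P> then \<chi> (- 1) else 0)"
      unfolding sum_subtractf[symmetric] by (rule sum.cong[OF refl])
    moreover have "(\<Sum>b\<in>\<R>. \<chi> (h b - 1)) = (\<Sum>b\<in>\<R>. \<chi> (b - 1))"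
    proof (rule sum_R_reindex)
      show "class_fun (\<lambda>b. \<chi> (b - 1))" by (rule class_fun_comp[OF class_fun_chi]) auto
      fix x y assume xy: "x \<in> \<O>" "y \<in> \<O>" "h x - h y \<in> \<P>"
      have unit: "d / z \<notin> \<P>" if "z \<in> \<O>" "z \<notin> \<P>" for z
        using P_mult_iff[of "d / z" z] unit_nz[OF that(2)] that d False by auto
      show "x - y \<in> \<P>"
      proof (cases "x \<in> \<P> \<or> y \<in> \<P>")
        case True
        then have "x \<in> \<P> \<and> y \<in> \<P>" using xy unit by (auto simp: h_def split: if_splits)
        then show ?thesis by auto
      next
        case F: False
        have "x * y * (h x - h y) = d * (y - x)" using F unit_nz by (simp add: h_def field_simps)
        moreover have "x * y * (h x - h y) \<in> \<P>" using xy by auto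
        ultimately show ?thesis using False d xy P_diff_commute by (auto simp: P_mult_iff O_diff)
      qed
    qed (rule hO)
    ultimately show ?thesis using sum_chi_shift[of 1] sum_R_delta[of 0 "\<lambda>_. \<chi> (- 1)"] False by simp
  qed
  then show ?thesis using t by simp
qed

text \<open>By the Jacobi sum, convolving twice is \<open>\<chi> (- 1) * q\<close> times the
  identity, up to a multiple of the total of \<open>f\<close>. So \<open>f\<close> is determined by
  its convolution and its total.\<close>

lemma conv_conv:
  assumes u: "u \<in> \<O>" "u \<notin> \<P>" and f: "class_fun f" and x: "x \<in> \<O>"
  shows "conv u (conv u f) x = \<chi> (- 1) * (q * f x - (\<Sum>b\<in>\<R>. f b))"
proof -
  have inner: "conv u f (x - b) = (\<Sum>d\<in>\<R>. \<chi> (u * (d - b)) * f (x - d))" if "b \<in> \<R>" for b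
  proof -
    have b: "b \<in> \<O>" using that R_O by auto
    have "(\<Sum>d\<in>\<R>. (\<lambda>c. \<chi> (u * c) * f (x - b - c)) (d - b)) = (\<Sum>c\<in>\<R>. (\<lambda>c. \<chi> (u * c) * f (x - b - c)) c)"
      by (rule sum_R_reindex)
        (use b x u in \<open>auto intro!: class_fun_mult class_fun_scaled_chi class_fun_reflect[OF f]\<close>)
    then show ?thesis by (simp add: conv_def)
  qed
  have "conv u (conv u f) x = (\<Sum>b\<in>\<R>. \<chi> (u * b) * (\<Sum>d\<in>\<R>. \<chi> (u * (d - b)) * f (x - d)))"
    unfolding conv_def[of u "conv u f"] using inner by simp
  also have "\<dots> = (\<Sum>b\<in>\<R>. \<Sum>d\<in>\<R>. f (x - d) * (\<chi> (u * b) * \<chi> (u * (d - b))))"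
    by (simp add: sum_distrib_left mult_ac)
  also have "\<dots> = (\<Sum>d\<in>\<R>. f (x - d) * (\<Sum>b\<in>\<R>. \<chi> (u * b) * \<chi> (u * (d - b))))"
    unfolding sum_distrib_left by (rule sum.swap)
  also have "\<dots> = (\<Sum>d\<in>\<R>. \<chi> (- 1) * (q * (if 0 - d \<in> \<P> then f (x - d) else 0) - f (x - d)))"
    using R_O by (intro sum.cong refl, subst jacobi_sum[OF u]) (simp_all add: right_diff_distrib mult_ac)
  also have "\<dots> = \<chi> (- 1) * (q * (\<Sum>d\<in>\<R>. if 0 - d \<in> \<P> then f (x - d) else 0) - (\<Sum>d\<in>\<R>. f (x - d)))"
    by (simp only: sum_distrib_left[symmetric] sum_subtractf)
  also have "(\<Sum>d\<in>\<R>. if 0 - d \<in> \<P> then f (x - d) else 0) = f (x - rep 0)"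
    by (rule sum_R_delta) simp
  also have "f (x - rep 0) = f x"
    using x rep_O[of 0] rep_diff[of 0] by (intro class_funD[OF f]) auto
  finally show ?thesis using sum_R_reflect[OF f x] by simp
qed

text \<open>The number of solutions of \<open>Q = a\<close> on a nondegenerate quadratic space of dimension \<open>r\<close>
  over the residue field whose discriminant has residue symbol \<open>th\<close>.\<close>

definition F :: "nat \<Rightarrow> real \<Rightarrow> 'a \<Rightarrow> real" where
  "F r th a = q ^ r / q + th * q ^ (r div 2) * (if even r then (if a \<in> \<P> then 1 else 0) - 1 / q else \<chi> a)"

lemma class_fun_F: "class_fun (F r th)"
proof -
  have "F r th x = F r th y" if "x \<in> \<O>" "y \<in> \<O>" "x - y \<in> \<P>" for x y
  proof -
    have "x \<in> \<P> \<longleftrightarrow> y \<in> \<P>" using P_diff_cong_left[OF that(3), of 0] by simp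
    then show ?thesis using chi_cong[OF that] by (simp add: F_def)
  qed
  then show ?thesis unfolding class_fun_def by blast
qed

text \<open>Adjoining an orthogonal vector of length \<open>u\<close>: the equation
  \<open>u * c ^ 2 = b\<close> has \<open>1 + \<chi> (u * b)\<close> solutions \<open>c\<close>. The
  discriminant carries the sign \<open>(-1)^(r(r-1)/2)\<close>, whose exponent grows by
  \<open>r\<close> when the dimension passes from \<open>r\<close> to \<open>r + 1\<close>; this is
  the origin of \<open>- u\<close> for odd \<open>r\<close>.\<close>

lemma F_up:
  assumes u: "u \<in> \<O>" "u \<notin> \<P>" and a: "a \<in> \<O>"
  shows "(\<Sum>b\<in>\<R>. (1 + \<chi> (u * b)) * F r th (a - b)) = F (Suc r) (th * \<chi> (if even r then u else - u)) a"
proof -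
  \<comment> \<open>\<open>C\<close> is the mean value of \<open>F r th\<close>, and
    \<open>t * G\<close> the deviation from it, which has total 0.\<close>
  define C where "C = q ^ r / q"
  define t where "t = th * q ^ (r div 2)"
  define G where "G x = (if even r then (if x \<in> \<P> then 1 else 0) - 1 / q else \<chi> x)" for x
  have "F r th x = C + t * G x" for x by (simp add: F_def C_def t_def G_def)
  then have "(\<Sum>b\<in>\<R>. (1 + \<chi> (u * b)) * F r th (a - b)) =
      (\<Sum>b\<in>\<R>. C + t * G (a - b) + C * \<chi> (u * b) + t * (\<chi> (u * b) * G (a - b)))"
    by (intro sum.cong) (simp_all add: algebra_simps)
  also have "\<dots> = q * C + t * (\<Sum>b\<in>\<R>. G (a - b)) + t * (\<Sum>b\<in>\<R>. \<chi> (u * b) * G (a - b))"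
    using sum_chi_mult[OF u] by (simp add: sum.distrib sum_distrib_left[symmetric] card_R)
  also have "(\<Sum>b\<in>\<R>. G (a - b)) = 0"
    using sum_R_delta[OF a, of "\<lambda>_. 1"] sum_R_reflect[OF class_fun_chi a] sum_chi
    by (cases "even r") (simp_all add: G_def sum_subtractf card_R residue_size_pos)
  also have "t * (\<Sum>b\<in>\<R>. \<chi> (u * b) * G (a - b)) =
    th * \<chi> (if even r then u else - u) * q ^ (Suc r div 2) * (if even (Suc r) then (if a \<in> \<P> then 1 else 0) - 1 / q else \<chi> a)"
  \<comment> \<open>For even \<open>r\<close> the deviation is a delta function minus its mean, and
    convolution returns the character; for odd \<open>r\<close> it is a multiple of the character,
    and convolution is a Jacobi sum.\<close>
  proof (cases "even r")
    case True
    have "(\<Sum>b\<in>\<R>. \<chi> (u * b) * G (a - b)) =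
        (\<Sum>b\<in>\<R>. (if a - b \<in> \<P> then \<chi> (u * b) else 0) - \<chi> (u * b) / q)"
      using True by (intro sum.cong) (auto simp: G_def algebra_simps)
    also have "\<dots> = \<chi> (u * rep a)"
      using sum_R_delta[OF a, of "\<lambda>b. \<chi> (u * b)"] sum_chi_mult[OF u]
      by (simp add: sum_subtractf sum_divide_distrib[symmetric])
    also have "\<dots> = \<chi> u * \<chi> a"
      using class_fun_rep[OF class_fun_scaled_chi[OF u(1)] a] u a by (simp add: chi_mult)
    finally show ?thesis using True by (simp add: t_def)
  next
    case False
    have uu: "\<chi> u * \<chi> u = 1" using chi_sq u by simp
    have "\<chi> (u * b) * G (a - b) = \<chi> u * (\<chi> (u * b) * \<chi> (u * (a - b)))" if "b \<in> \<R>" for b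
    proof -
      have "\<chi> u * (\<chi> (u * b) * \<chi> (u * (a - b))) = (\<chi> u * \<chi> u) * (\<chi> (u * b) * \<chi> (a - b))"
        using that u a R_O by (subst (2) chi_mult) auto
      then have e: "\<chi> u * (\<chi> (u * b) * \<chi> (u * (a - b))) = \<chi> (u * b) * \<chi> (a - b)" by (simp only: uu mult_1_left)
      have G: "G (a - b) = \<chi> (a - b)" using False by (simp add: G_def)
      show ?thesis unfolding G by (rule e[symmetric])
    qed
    then have "(\<Sum>b\<in>\<R>. \<chi> (u * b) * G (a - b)) = \<chi> u * (\<Sum>b\<in>\<R>. \<chi> (u * b) * \<chi> (u * (a - b)))"
      unfolding sum_distrib_left by (rule sum.cong[OF refl])
    also have "\<dots> = \<chi> u * \<chi> (- 1) * q * ((if a \<in> \<P> then 1 else 0) - 1 / q)"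
      unfolding jacobi_sum[OF u a] using residue_size_pos by (simp add: algebra_simps)
    also have "\<chi> u * \<chi> (- 1) = \<chi> (- u)" using chi_mult[of u "- 1"] u by simp
    finally show ?thesis using False by (simp add: t_def)
  qed
  finally show ?thesis by (simp add: F_def C_def)
qed

text \<open>The difference \<open>g\<close> of the two sides solves the homogeneous equation, that
  is, its convolution is the constant \<open>- S\<close> with \<open>S\<close> the total of
  \<open>g\<close>. A constant convolves to 0, so by \<open>conv_conv\<close> the function
  \<open>g\<close> is itself constant. Then its own convolution is 0, which gives
  \<open>S = 0\<close> and finally \<open>g = 0\<close>.\<close>

lemma F_down:
  assumes u: "u \<in> \<O>" "u \<notin> \<P>" and f: "class_fun f"
    and eq: "\<And>a. a \<in> \<O> \<Longrightarrow> (\<Sum>b\<in>\<R>. (1 + \<chi> (u * b)) * f (a - b)) = K * F (Suc r) th a"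
    and a: "a \<in> \<O>"
  shows "f a = K * F r (th * \<chi> (if even r then u else - u)) a"
proof -
  define u' where "u' = (if even r then u else - u)"
  have "\<chi> u' * \<chi> u' = 1" using u by (intro chi_sq) (auto simp: u'_def)
  then have th: "th * \<chi> u' * \<chi> u' = th" by simp
  define g where "g x = f x - K * F r (th * \<chi> u') x" for x
  have g: "class_fun g"
    unfolding class_fun_def g_def
    by (intro ballI impI arg_cong2[where f = "(-)"] arg_cong[where f = "(*) K"] class_funD[OF f] class_funD[OF class_fun_F])
  define S where "S = (\<Sum>b\<in>\<R>. g b)"
  have conv0: "conv u g x = - S" if x: "x \<in> \<O>" for x
  proof -
    have "(\<Sum>b\<in>\<R>. (1 + \<chi> (u * b)) * g (x - b)) =
       (\<Sum>b\<in>\<R>. (1 + \<chi> (u * b)) * f (x - b)) - K * (\<Sum>b\<in>\<R>. (1 + \<chi> (u * b)) * F r (th * \<chi> u') (x - b))"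
      by (simp add: g_def sum_distrib_left sum_subtractf[symmetric] algebra_simps)
    also have "\<dots> = K * F (Suc r) th x - K * F (Suc r) (th * \<chi> u' * \<chi> u') x"
      unfolding eq[OF x] F_up[OF u x, of r "th * \<chi> u'"] by (simp add: u'_def)
    also have "\<dots> = 0" unfolding th by simp
    finally show ?thesis
      using sum_R_reflect[OF g x] by (simp add: distrib_right sum.distrib conv_def S_def)
  qed
  have gx: "q * g x = S" if x: "x \<in> \<O>" for x
  proof -
    have "conv u (conv u g) x = (\<Sum>b\<in>\<R>. \<chi> (u * b) * (- S))"
      unfolding conv_def[of u "conv u g"] using x R_O by (intro sum.cong) (auto simp: conv0 O_diff)
    also have "\<dots> = 0" unfolding sum_distrib_right[symmetric] sum_chi_mult[OF u] by simp
    finally have "\<chi> (- 1) * (q * g x - S) = 0" using conv_conv[OF u g x] by (simp add: S_def)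
    moreover have "\<chi> (- 1) \<noteq> 0" using chi_cases[of "- 1"] by auto
    ultimately show ?thesis by simp
  qed
  have "conv u g 0 = (\<Sum>b\<in>\<R>. \<chi> (u * b) * (S / q))"
  proof -
    have "g (0 - b) = S / q" if "b \<in> \<R>" for b using gx[of "0 - b"] R_O[OF that] residue_size_pos by (simp add: field_simps)
    then show ?thesis unfolding conv_def by simp
  qed
  also have "\<dots> = 0" unfolding sum_distrib_right[symmetric] sum_chi_mult[OF u] by simp
  finally have "S = 0" using conv0[of 0] by simp
  then have "g a = 0" using gx[OF a] residue_size_pos by auto
  then show ?thesis by (simp add: g_def u'_def)
qed

lemma F_0: "F 0 1 a = (if a \<in> \<P> then 1 else 0)"
  by (simp add: F_def)

lemma sum_F: "(\<Sum>a\<in>\<R>. F r th a) = q ^ r"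
proof (cases "even r")
  case True
  have "(\<Sum>a\<in>\<R>. if a \<in> \<P> then 1 else 0 :: real) = 1"
    using sum_R_delta[of 0 "\<lambda>_. 1"] by simp
  then have "(\<Sum>a\<in>\<R>. (if a \<in> \<P> then 1 else 0 :: real) - 1 / q) = 0"
    by (simp add: sum_subtractf card_R residue_size_pos)
  then show ?thesis using True residue_size_pos by (simp add: F_def sum.distrib card_R sum_distrib_left[symmetric])
next
  case False
  then show ?thesis using residue_size_pos by (simp add: F_def sum.distrib card_R sum_distrib_left[symmetric] sum_chi)
qed

section \<open>Indices of the powers of the maximal ideal\<close>

lemma cosets_I_step: "real (ncosets (\<I> N) (\<I> (Suc N))) = q" "finite (cosets (\<I> N) (\<I> (Suc N)))"
proof -
  have 1: "\<pi> ^ N * x - \<pi> ^ N * y \<in> \<I> (Suc N) \<longleftrightarrow> x - y \<in> \<P>" for x y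
    using I_pow_mult[of N "x - y" "Suc 0"] by (simp add: right_diff_distrib I_1)
  have 2: "\<exists>x\<in>\<O>. \<pi> ^ N * x - b \<in> \<I> (Suc N)" if "b \<in> \<I> N" for b
    using that by (intro bexI[of _ "b / \<pi> ^ N"]) (auto simp: I_iff)
  have 3: "\<pi> ^ N * x \<in> \<I> N" if "x \<in> \<O>" for x
    using I_mult_right[OF that, of "\<pi> ^ N" N] by simp
  have "ncosets \<O> \<P> = ncosets (\<I> N) (\<I> (Suc N))" "finite (cosets \<O> \<P>) = finite (cosets (\<I> N) (\<I> (Suc N)))"
    using ncosets_iso[of \<P> "\<I> (Suc N)" \<O> "\<lambda>x. \<pi> ^ N * x" "\<I> N"] 1 2 3 by auto
  then show "real (ncosets (\<I> N) (\<I> (Suc N))) = q" "finite (cosets (\<I> N) (\<I> (Suc N)))"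
    using ncosets_P finite_cosets_P by simp_all
qed

lemma cosets_I: "finite (cosets (\<I> N) (\<I> (N + k)))" "real (ncosets (\<I> N) (\<I> (N + k))) = q ^ k"
proof (induction k)
  case 0
  have "cosets (\<I> N) (\<I> N) = {\<I> N}"
  proof -
    have "(+) x ` \<I> N = \<I> N" if "x \<in> \<I> N" for x using coset_eq_iff[of "\<I> N" x 0] that by simp
    moreover have "0 \<in> \<I> N" by simp
    ultimately show ?thesis unfolding cosets_def by blast
  qed
  then show "finite (cosets (\<I> N) (\<I> (N + 0)))" "real (ncosets (\<I> N) (\<I> (N + 0))) = q ^ 0" by (simp_all add: ncosets_def)
next
  case (Suc k)
  show fin: "finite (cosets (\<I> N) (\<I> (N + Suc k)))"
    by (rule finite_cosets_trans[OF _ Suc(1)]) (simp_all add: cosets_I_step)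
  have "ncosets (\<I> N) (\<I> (N + Suc k)) = ncosets (\<I> (N + k)) (\<I> (N + Suc k)) * ncosets (\<I> N) (\<I> (N + k))"
  proof (rule ncosets_index)
    fix x y assume "x \<in> \<I> N" "y \<in> \<I> (N + k)"
    then show "x + y \<in> \<I> N" using I_add I_antimono[of N "N + k" y] by auto
  qed (use fin I_antimono[of "N + k" "N + Suc k"] in auto)
  then show "real (ncosets (\<I> N) (\<I> (N + Suc k))) = q ^ Suc k" using Suc by (simp add: cosets_I_step)
qed

end

section \<open>Lifting primitive representations\<close>

locale quad_space = odd_local_field v + vs: vector_space s
  for v :: "'a::field \<Rightarrow> int" and s :: "'a \<Rightarrow> 'c::ab_group_add \<Rightarrow> 'c" +
  fixes B :: "'c \<Rightarrow> 'c \<Rightarrow> 'a"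
  assumes B_add: "B (x + y) z = B x z + B y z"
    and B_scale: "B (s c x) z = c * B x z"
    and B_sym: "B x y = B y x"
begin

lemma B_add_right: "B z (x + y) = B z x + B z y" using B_add B_sym by metis
lemma B_scale_right: "B z (s c x) = c * B z x" using B_scale B_sym by metis
lemma B_zero [simp]: "B 0 z = 0" "B z 0 = 0"
  using B_scale[of 0 0 z] B_scale_right[of z 0 0] by simp_all
lemma B_minus [simp]: "B (- x) z = - B x z" "B z (- x) = - B z x"
  using B_add[of x "- x" z] B_add_right[of z x "- x"] by (simp_all add: eq_neg_iff_add_eq_0 add.commute)
lemma B_diff: "B (x - y) z = B x z - B y z" "B z (x - y) = B z x - B z y"
  using B_add[of x "- y" z] B_add_right[of z x "- y"] by simp_all
lemma B_sum: "B (sum f S) z = (\<Sum>i\<in>S. B (f i) z)" "B z (sum f S) = (\<Sum>i\<in>S. B z (f i))"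
  by (induction S rule: infinite_finite_induct) (simp_all add: B_add B_add_right)

end

lemma sum_delta_mult: "j < n \<Longrightarrow> (\<Sum>i<n. c i * (if i = j then 1 else 0)) = (c j :: 'r::semiring_1)"
  for n :: nat
  by (simp add: if_distrib[of "\<lambda>x. _ * x"] cong: if_cong)

text \<open>The entries of a symmetric matrix on and above the diagonal: one condition for each when
  a Gram matrix is prescribed. Their number \<open>n(n+1)/2\<close> is what is subtracted from
  \<open>m n\<close> in the normalizing exponent of the density.\<close>

definition idx_pairs :: "nat \<Rightarrow> (nat \<times> nat) set" where
  "idx_pairs n = {(i, j). i \<le> j \<and> j < n}"

lemma finite_idx_pairs [simp]: "finite (idx_pairs n)"
  by (rule finite_subset[of _ "{..<n} \<times> {..<n}"]) (auto simp: idx_pairs_def)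

lemma idx_pairs_Suc: "idx_pairs (Suc n) = idx_pairs n \<union> (\<lambda>i. (i, n)) ` {..n}" "idx_pairs n \<inter> (\<lambda>i. (i, n)) ` {..n} = {}"
  by (auto simp: idx_pairs_def less_Suc_eq)

lemma card_idx_pairs: "2 * card (idx_pairs n) = n * (n + 1)"
proof (induction n)
  case (Suc n)
  have "card ((\<lambda>i. (i, n)) ` {..n}) = Suc n" by (subst card_image) (auto simp: inj_on_def)
  then show ?case using Suc idx_pairs_Suc(2)[of n] by (simp add: idx_pairs_Suc(1) card_Un_disjoint)
qed (auto simp: idx_pairs_def)

text \<open>Self-duality is stated residually: a vector of \<open>M\<close> that pairs with
  \<open>M\<close> into \<open>\<P>\<close> is divisible by \<open>\<pi>\<close>. The rank
  \<open>m\<close> is recorded through the index of \<open>\<pi> M\<close>. In this form the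
  counting arguments run without a basis of \<open>M\<close>.\<close>

locale unimodular = quad_space v s B
  for v :: "'a::field \<Rightarrow> int" and s :: "'a \<Rightarrow> 'c::ab_group_add \<Rightarrow> 'c" and B +
  fixes M :: "'c set" and m :: nat
  assumes M_zero [simp]: "0 \<in> M"
    and M_add: "x \<in> M \<Longrightarrow> y \<in> M \<Longrightarrow> x + y \<in> M"
    and M_smult: "c \<in> integers v \<Longrightarrow> x \<in> M \<Longrightarrow> s c x \<in> M"
    and B_integral: "x \<in> M \<Longrightarrow> y \<in> M \<Longrightarrow> B x y \<in> integers v"
    and selfdual: "z \<in> M \<Longrightarrow> (\<And>w. w \<in> M \<Longrightarrow> B w z \<in> max_ideal v) \<Longrightarrow> s (inverse \<pi>) z \<in> M"
    and M_card: "real (ncosets M {z. s (inverse \<pi>) z \<in> M}) = q ^ m"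
    and M_fin: "finite (cosets M {z. s (inverse \<pi>) z \<in> M})"
begin

text \<open>The multiple \<open>\<pi>^N M\<close>, described by division so that membership needs no
  witness.\<close>

definition pM :: "nat \<Rightarrow> 'c set" where "pM N = {z. s (inverse (\<pi> ^ N)) z \<in> M}"

lemma pM_0: "pM 0 = M" by (simp add: pM_def)
lemma pM_1: "pM (Suc 0) = {z. s (inverse \<pi>) z \<in> M}" by (simp add: pM_def)

lemma M_minus: "x \<in> M \<Longrightarrow> - x \<in> M" using M_smult[of "- 1" x] by simp
lemma M_diff: "x \<in> M \<Longrightarrow> y \<in> M \<Longrightarrow> x - y \<in> M" using M_add[of x "- y"] M_minus by simp
lemma subgrp_M [simp]: "subgrp M" by (simp add: subgrp_def M_diff)
lemma M_sum: "(\<And>i. i \<in> S \<Longrightarrow> f i \<in> M) \<Longrightarrow> sum f S \<in> M" by (rule subgrp_sum) auto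

lemma subgrp_pM [simp]: "subgrp (pM N)"
  by (auto simp: subgrp_def pM_def vs.scale_right_diff_distrib M_diff)
lemma pM_zero [simp]: "0 \<in> pM N" using subgrp_zero[OF subgrp_pM] .
lemma pM_scale_pi [simp]: "s (\<pi> ^ k) z \<in> pM (k + N) \<longleftrightarrow> z \<in> pM N"
proof -
  have "inverse (\<pi> ^ (k + N)) * \<pi> ^ k = inverse (\<pi> ^ N)" by (simp add: power_add)
  then show ?thesis by (simp add: pM_def)
qed
lemma pM_smult: assumes "c \<in> \<I> k" "z \<in> pM N" shows "s c z \<in> pM (N + k)"
proof -
  have "s (c / \<pi> ^ k) (s (inverse (\<pi> ^ N)) z) \<in> M"
    by (rule M_smult) (use assms I_iff[of c k] in \<open>auto simp: pM_def\<close>)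
  moreover have "c / \<pi> ^ k * inverse (\<pi> ^ N) = inverse (\<pi> ^ (N + k)) * c"
    by (simp add: power_add divide_inverse mult_ac)
  ultimately show ?thesis by (simp add: pM_def)
qed
lemma pM_smult_O: "c \<in> \<O> \<Longrightarrow> z \<in> pM N \<Longrightarrow> s c z \<in> pM N"
  using pM_smult[of c 0 z N] by (simp add: I_0)
lemma pM_smult_P: "c \<in> \<P> \<Longrightarrow> z \<in> M \<Longrightarrow> s c z \<in> pM (Suc 0)"
  using pM_smult[of c "Suc 0" z 0] by (simp add: I_1 pM_0)
lemma pM_antimono: assumes "N \<le> N'" "z \<in> pM N'" shows "z \<in> pM N"
proof -
  have "s (\<pi> ^ (N' - N)) (s (inverse (\<pi> ^ N')) z) \<in> M"
    by (rule M_smult) (use assms in \<open>auto simp: pM_def\<close>)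
  moreover have "\<pi> ^ (N' - N) * inverse (\<pi> ^ N') = inverse (\<pi> ^ N)"
    using assms(1) by (simp add: power_diff divide_inverse)
  ultimately show ?thesis by (simp add: pM_def)
qed
lemma pM_M: "z \<in> pM N \<Longrightarrow> z \<in> M" using pM_antimono[of 0 N z] by (simp add: pM_0)
lemma B_pM: assumes "x \<in> pM N" "y \<in> M" shows "B x y \<in> \<I> N"
proof -
  have "B x y = \<pi> ^ N * B (s (inverse (\<pi> ^ N)) x) y" by (simp add: B_scale)
  also have "\<dots> \<in> \<I> N" using assms B_integral by (intro I_mult_right[of _ _ N]) (auto simp: pM_def)
  finally show ?thesis .
qed

lemma cosets_pM_step: "real (ncosets (pM N) (pM (Suc N))) = q ^ m" "finite (cosets (pM N) (pM (Suc N)))"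
proof -
  have 1: "s (\<pi> ^ N) x - s (\<pi> ^ N) y \<in> pM (Suc N) \<longleftrightarrow> x - y \<in> pM (Suc 0)" for x y
    using pM_scale_pi[of N "x - y" "Suc 0"] by (simp add: vs.scale_right_diff_distrib)
  have 2: "\<exists>x\<in>M. s (\<pi> ^ N) x - b \<in> pM (Suc N)" if "b \<in> pM N" for b
    using that by (intro bexI[of _ "s (inverse (\<pi> ^ N)) b"]) (auto simp: pM_def)
  have 3: "s (\<pi> ^ N) x \<in> pM N" if "x \<in> M" for x
    using that pM_scale_pi[of N x 0] by (simp add: pM_0)
  have "ncosets M (pM (Suc 0)) = ncosets (pM N) (pM (Suc N))" "finite (cosets M (pM (Suc 0))) = finite (cosets (pM N) (pM (Suc N)))"
    using ncosets_iso[of "pM (Suc 0)" "pM (Suc N)" M "\<lambda>x. s (\<pi> ^ N) x" "pM N"] 1 2 3 by auto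
  then show "real (ncosets (pM N) (pM (Suc N))) = q ^ m" "finite (cosets (pM N) (pM (Suc N)))"
    using M_card M_fin unfolding pM_1 by simp_all
qed

lemma cosets_pM: "finite (cosets (pM N) (pM (N + k)))" "real (ncosets (pM N) (pM (N + k))) = q ^ (m * k)"
proof (induction k)
  case 0
  have "cosets (pM N) (pM N) = {pM N}"
  proof -
    have "(+) x ` pM N = pM N" if "x \<in> pM N" for x using coset_eq_iff[of "pM N" x 0] that by simp
    moreover have "0 \<in> pM N" by simp
    ultimately show ?thesis unfolding cosets_def by blast
  qed
  then show "finite (cosets (pM N) (pM (N + 0)))" "real (ncosets (pM N) (pM (N + 0))) = q ^ (m * 0)"
    by (simp_all add: ncosets_def)
next
  case (Suc k)
  show fin: "finite (cosets (pM N) (pM (N + Suc k)))"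
    by (rule finite_cosets_trans[OF _ Suc(1)]) (simp_all add: cosets_pM_step)
  have "ncosets (pM N) (pM (N + Suc k)) = ncosets (pM (N + k)) (pM (N + Suc k)) * ncosets (pM N) (pM (N + k))"
  proof (rule ncosets_index)
    fix x y assume "x \<in> pM N" "y \<in> pM (N + k)"
    then show "x + y \<in> pM N" using subgrp_add[OF subgrp_pM] pM_antimono[of N "N + k" y] by auto
  qed (use fin pM_antimono[of "N + k" "N + Suc k"] in auto)
  then show "real (ncosets (pM N) (pM (N + Suc k))) = q ^ (m * Suc k)" using Suc by (simp add: cosets_pM_step power_add)
qed

text \<open>Linear independence of the classes of the \<open>y i\<close> in
  \<open>M / \<pi> M\<close>.\<close>

definition prim :: "nat \<Rightarrow> (nat \<Rightarrow> 'c) \<Rightarrow> bool" where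
  "prim n y \<longleftrightarrow> (\<forall>c. (\<forall>i<n. c i \<in> \<O>) \<longrightarrow> (\<Sum>i<n. s (c i) (y i)) \<in> pM (Suc 0) \<longrightarrow> (\<forall>i<n. c i \<in> \<P>))"

lemma prim_cong:
  assumes "\<And>i. i < n \<Longrightarrow> y i - z i \<in> pM (Suc 0)" shows "prim n y \<longleftrightarrow> prim n z"
proof -
  have "(\<Sum>i<n. s (c i) (y i)) \<in> pM (Suc 0) \<longleftrightarrow> (\<Sum>i<n. s (c i) (z i)) \<in> pM (Suc 0)" if "\<forall>i<n. c i \<in> \<O>" for c
  proof -
    have d: "(\<Sum>i<n. s (c i) (y i)) - (\<Sum>i<n. s (c i) (z i)) \<in> pM (Suc 0)"
      unfolding sum_subtractf[symmetric] vs.scale_right_diff_distrib[symmetric]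
      by (rule subgrp_sum[OF subgrp_pM], rule pM_smult_O) (use that assms in auto)
    show ?thesis
      using subgrp_add[OF subgrp_pM d, of "\<Sum>i<n. s (c i) (z i)"]
        subgrp_diff[OF subgrp_pM _ d, of "\<Sum>i<n. s (c i) (y i)"] by auto
  qed
  then show ?thesis unfolding prim_def by blast
qed

lemma prim_SucD: assumes "prim (Suc n) y" shows "prim n y"
  unfolding prim_def
proof (intro allI impI)
  fix c i assume *: "\<forall>i<n. c i \<in> \<O>" "(\<Sum>i<n. s (c i) (y i)) \<in> pM (Suc 0)" "i < n"
  have "\<forall>i<Suc n. (c(n := 0)) i \<in> \<O>" "(\<Sum>i<Suc n. s ((c(n := 0)) i) (y i)) \<in> pM (Suc 0)"
    using * by (auto simp: less_Suc_eq)
  then have "\<forall>i<Suc n. (c(n := 0)) i \<in> \<P>" using assms unfolding prim_def by blast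
  then show "c i \<in> \<P>" using *(3) by (auto dest: spec[of _ i])
qed

text \<open>Self-duality provides, step by step, a system dual to a primitive tuple modulo the maximal
  ideal.\<close>

lemma dual_system:
  assumes "prim n y" "\<And>i. i < n \<Longrightarrow> y i \<in> M"
  shows "\<exists>w. \<forall>i<n. w i \<in> M \<and> (\<forall>j<n. B (w i) (y j) - (if i = j then 1 else 0) \<in> \<P>)"
  using assms
proof (induction n)
  case (Suc n)
  then obtain w where w: "\<And>i. i < n \<Longrightarrow> w i \<in> M"
    "\<And>i j. i < n \<Longrightarrow> j < n \<Longrightarrow> B (w i) (y j) - (if i = j then 1 else 0) \<in> \<P>"
    using prim_SucD by (metis less_Suc_eq)
  have yM: "y i \<in> M" if "i \<le> n" for i using Suc.prems(2) that by auto
  \<comment> \<open>Modulo \<open>\<P>\<close> this removes from \<open>y n\<close> its components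
    along the earlier vectors. The coefficient 1 of \<open>y n\<close> keeps \<open>z\<close> out of
    \<open>\<pi> M\<close>, so self-duality finds a vector with unit product.\<close>
  define z where "z = y n - (\<Sum>i<n. s (B (w i) (y n)) (y i))"
  have zM: "z \<in> M" unfolding z_def
    by (intro M_diff M_sum M_smult B_integral yM w) auto
  have "z \<notin> pM (Suc 0)"
  proof
    assume "z \<in> pM (Suc 0)"
    define c where "c i = (if i = n then 1 else - B (w i) (y n))" for i
    have "(\<Sum>i<Suc n. s (c i) (y i)) = z" by (simp add: c_def z_def sum_negf)
    moreover have "\<forall>i<Suc n. c i \<in> \<O>" using w yM B_integral by (auto simp: c_def less_Suc_eq)
    ultimately have "c n \<in> \<P>" using Suc.prems(1) \<open>z \<in> pM (Suc 0)\<close> unfolding prim_def by (metis lessI)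
    then show False by (simp add: c_def)
  qed
  then obtain u where u: "u \<in> M" "B u z \<notin> \<P>" using selfdual[OF zM] unfolding pM_1 by blast
  \<comment> \<open>The correction makes \<open>u'\<close> orthogonal to the earlier
    \<open>y j\<close> modulo \<open>\<P>\<close>, and its product with \<open>y n\<close> is
    exactly the unit \<open>B u z\<close>.\<close>
  define u' where "u' = u - (\<Sum>i<n. s (B u (y i)) (w i))"
  have u'M: "u' \<in> M" unfolding u'_def
    by (intro M_diff M_sum M_smult B_integral yM w u) auto
  have u'y: "B u' (y j) \<in> \<P>" if j: "j < n" for j
  proof -
    have "B u' (y j) = B u (y j) - (\<Sum>i<n. B u (y i) * B (w i) (y j))"
      by (simp add: u'_def B_diff B_sum B_scale)
    also have "B u (y j) = (\<Sum>i<n. B u (y i) * (if i = j then 1 else 0))" using j by (simp only: sum_delta_mult)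
    finally have "B u' (y j) = - (\<Sum>i<n. B u (y i) * (B (w i) (y j) - (if i = j then 1 else 0)))"
      by (simp add: right_diff_distrib sum_subtractf)
    moreover have "(\<Sum>i<n. B u (y i) * (B (w i) (y j) - (if i = j then 1 else 0))) \<in> \<P>"
      using w j yM u B_integral by (intro P_sum P_mult_left) auto
    ultimately show ?thesis by simp
  qed
  have u'n: "B u' (y n) = B u z"
    by (simp add: u'_def z_def B_diff B_sum B_scale B_scale_right mult.commute)
  define e where "e = s (inverse (B u z)) u'"
  have uO: "B u z \<in> \<O>" using B_integral u zM by auto
  have eM: "e \<in> M" unfolding e_def using unit_inverse[OF uO u(2)] u'M by (intro M_smult) auto
  have en: "B e (y n) = 1" using u'n unit_nz[OF u(2)] by (simp add: e_def B_scale)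
  have ey: "B e (y j) \<in> \<P>" if "j < n" for j
    using u'y[OF that] unit_inverse[OF uO u(2)] by (auto simp: e_def B_scale)
  define w' where "w' i = (if i = n then e else w i - s (B (w i) (y n)) e)" for i
  have "w' i \<in> M" if "i < Suc n" for i
    using that eM w yM B_integral by (auto simp: w'_def less_Suc_eq intro!: M_diff M_smult)
  moreover have "B (w' i) (y j) - (if i = j then 1 else 0) \<in> \<P>" if ij: "i < Suc n" "j < Suc n" for i j
  proof (cases "i = n")
    case True
    then show ?thesis using ij en ey by (auto simp: w'_def less_Suc_eq)
  next
    case False
    then have i: "i < n" using ij by auto
    show ?thesis
    proof (cases "j = n")
      case True
      then show ?thesis using i en by (simp add: w'_def B_diff B_scale)
    next
      case jn: False
      then have "B (w' i) (y j) - (if i = j then 1 else 0) =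
          (B (w i) (y j) - (if i = j then 1 else 0)) - B (w i) (y n) * B e (y j)"
        using False by (simp add: w'_def B_diff B_scale)
      also have "\<dots> \<in> \<P>" 
        by (rule P_diff[OF _ P_mult_left]) (use i jn ij w yM ey B_integral in auto)
      finally show ?thesis .
    qed
  qed
  ultimately show ?case by blast
qed auto

lemma prescribed_products:
  assumes "prim n y" "\<And>i. i < n \<Longrightarrow> y i \<in> M" "\<And>i. i < n \<Longrightarrow> c i \<in> \<O>"
  shows "\<exists>w\<in>M. \<forall>i<n. B w (y i) - c i \<in> \<P>"
proof -
  obtain w where w: "\<And>i. i < n \<Longrightarrow> w i \<in> M"
    "\<And>i j. i < n \<Longrightarrow> j < n \<Longrightarrow> B (w i) (y j) - (if i = j then 1 else 0) \<in> \<P>"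
    using dual_system[OF assms(1,2)] by blast
  have "B (\<Sum>i<n. s (c i) (w i)) (y j) - c j \<in> \<P>" if j: "j < n" for j
  proof -
    have "B (\<Sum>i<n. s (c i) (w i)) (y j) - c j = (\<Sum>i<n. c i * B (w i) (y j)) - (\<Sum>i<n. c i * (if i = j then 1 else 0))"
      using j by (simp add: B_sum B_scale sum_delta_mult)
    also have "\<dots> = (\<Sum>i<n. c i * (B (w i) (y j) - (if i = j then 1 else 0)))"
      by (simp add: right_diff_distrib sum_subtractf)
    also have "\<dots> \<in> \<P>" using w j assms(3) by (intro P_sum P_mult_left) auto
    finally show ?thesis .
  qed
  moreover have "(\<Sum>i<n. s (c i) (w i)) \<in> M" using w assms(3) by (intro M_sum M_smult) auto
  ultimately show ?thesis by blast
qed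

section \<open>Hensel lifting of primitive tuples\<close>

abbreviation tuples :: "nat \<Rightarrow> 'c set \<Rightarrow> (nat \<Rightarrow> 'c) set" where
  "tuples n K \<equiv> funs {..<n} (\<lambda>_. K)"

lemma tuples_pM_count: "real (ncosets (tuples n (pM N)) (tuples n (pM (N + k)))) = q ^ (m * n * k)"
    "finite (cosets (tuples n (pM N)) (tuples n (pM (N + k))))"
  using cosets_pM[of N k] ncosets_funs(1)[of "{..<n}" "\<lambda>_. pM (N + k)" "\<lambda>_. pM N"]
    ncosets_funs(2)[of "{..<n}" "\<lambda>_. pM (N + k)" "\<lambda>_. pM N"]
  by (simp_all add: power_mult[symmetric] mult_ac)

lemma finite_cosets_tuples: "A \<subseteq> tuples n M \<Longrightarrow> finite (cosets A (tuples n (pM N)))"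
  using tuples_pM_count(2)[of n 0 N] cosets_mono finite_subset by (metis add_0 pM_0)

text \<open>The derivative at \<open>b\<close> of the Gram matrix map is onto the symmetric matrices
  over the residue field, because a primitive tuple admits vectors with prescribed products. All
  fibres are translates of the kernel, which therefore has the quotient of the two cardinalities as
  its size.\<close>

lemma linear_count:
  assumes b: "prim n b" "b \<in> tuples n M" and D: "D \<in> funs (idx_pairs n) (\<lambda>_. \<O>)"
  shows "real (ncosets {w\<in>tuples n M. \<forall>(i,j)\<in>idx_pairs n. B (w i) (b j) + B (b i) (w j) - D (i, j) \<in> \<P>} (tuples n (pM (Suc 0))))
     = q ^ (m * n) / q ^ card (idx_pairs n)"
proof -
  define G where "G w = (\<lambda>(i, j). if (i, j) \<in> idx_pairs n then B (w i) (b j) + B (b i) (w j) else 0)" for w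
  let ?K' = "funs (idx_pairs n) (\<lambda>_. \<P>)"
  let ?K = "tuples n (pM (Suc 0))"
  define S where "S D = {w\<in>tuples n M. G w - D \<in> ?K'}" for D
  have sK: "subgrp ?K" "subgrp ?K'" by (auto intro: subgrp_funs)
  have bM: "b i \<in> M" if "i < n" for i using b(2) that by (auto simp: funs_def)
  have G_diff: "G (x - y) = G x - G y" for x y
    by (auto simp: G_def fun_eq_iff B_diff)
  have S_eq: "S D = {w\<in>tuples n M. \<forall>(i,j)\<in>idx_pairs n. B (w i) (b j) + B (b i) (w j) - D (i, j) \<in> \<P>}"
    if "D \<in> funs (idx_pairs n) (\<lambda>_. \<O>)" for D
    using that by (auto simp: S_def G_def funs_def)
  have GO: "G w \<in> funs (idx_pairs n) (\<lambda>_. \<O>)" if "w \<in> tuples n M" for w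
    using that bM by (auto simp: G_def funs_def idx_pairs_def intro!: O_add B_integral)
  have ex: "\<exists>w. w \<in> S D" if D: "D \<in> funs (idx_pairs n) (\<lambda>_. \<O>)" for D
  proof -
    \<comment> \<open>Half of the prescribed entry, read symmetrically: the summands
      \<open>B (w i) (b j)\<close> and \<open>B (b i) (w j)\<close> contribute one half each, on the
      diagonal as well.\<close>
    define c where "c j i = D (min i j, max i j) / 2" for i j
    have "c j i \<in> \<O>" if "i < n" "j < n" for i j
      unfolding c_def using two_notin_P by (intro unit_divide funsD[OF D]) (use that in \<open>auto simp: idx_pairs_def\<close>)
    then have "\<forall>j. \<exists>w. j < n \<longrightarrow> w \<in> M \<and> (\<forall>i<n. B w (b i) - c j i \<in> \<P>)"
      using prescribed_products[OF b(1) bM] by metis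
    then obtain w where w: "\<And>j. j < n \<Longrightarrow> w j \<in> M" "\<And>i j. j < n \<Longrightarrow> i < n \<Longrightarrow> B (w j) (b i) - c j i \<in> \<P>"
      by metis
    define w' where "w' j = (if j < n then w j else 0)" for j
    have "B (w' i) (b j) + B (b i) (w' j) - D (i, j) \<in> \<P>" if "(i, j) \<in> idx_pairs n" for i j
    proof -
      have ij: "i \<le> j" "j < n" "i < n" using that by (auto simp: idx_pairs_def)
      have "(2 :: 'a) \<noteq> 0" using two_notin_P by auto
      then have "c i j + c j i = D (i, j)" using ij by (simp add: c_def min_def max_def)
      then have "B (w' i) (b j) + B (b i) (w' j) - D (i, j) = (B (w i) (b j) - c i j) + (B (w j) (b i) - c j i)"
        using ij B_sym[of "b i" "w j"] by (simp add: w'_def algebra_simps)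
      also have "\<dots> \<in> \<P>" using w ij by (intro P_add) auto
      finally show ?thesis .
    qed
    moreover have "w' \<in> tuples n M" using w by (auto simp: funs_def w'_def)
    ultimately show ?thesis unfolding S_eq[OF D] by blast
  qed
  have G_compat: "G x - G y \<in> ?K'" if "x - y \<in> ?K" for x y
  proof -
    have "B (x i - y i) (b j) \<in> \<P>" "B (b i) (x j - y j) \<in> \<P>" if "(i, j) \<in> idx_pairs n" for i j
    proof -
      have ij: "j < n" "i < n" using that by (auto simp: idx_pairs_def)
      have "x i - y i \<in> pM (Suc 0)" "x j - y j \<in> pM (Suc 0)" using funsD[OF \<open>x - y \<in> ?K\<close>, of i] funsD[OF \<open>x - y \<in> ?K\<close>, of j] ij by auto
      then show "B (x i - y i) (b j) \<in> \<P>" "B (b i) (x j - y j) \<in> \<P>"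
        using B_pM[of "x i - y i" "Suc 0" "b j"] B_pM[of "x j - y j" "Suc 0" "b i"] bM ij B_sym by (simp_all add: I_1)
    qed
    then have "B (x i - y i) (b j) + B (b i) (x j - y j) \<in> \<P>" if "(i, j) \<in> idx_pairs n" for i j using that by (intro P_add) auto
    then show ?thesis unfolding G_diff[symmetric] by (auto simp: G_def funs_def)
  qed
  have SD: "ncosets (S D) ?K = ncosets (S 0) ?K" if D: "D \<in> funs (idx_pairs n) (\<lambda>_. \<O>)" for D
  proof -
    obtain w where w: "w \<in> S D" using ex[OF D] by blast
    have "S D = (+) w ` S 0"
    proof (intro equalityI subsetI)
      fix x assume x: "x \<in> S D"
      have "(G x - D) - (G w - D) \<in> ?K'" by (rule subgrp_diff[OF sK(2)]) (use x w in \<open>auto simp: S_def\<close>)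
      moreover have "x - w \<in> tuples n M"
        by (rule subgrp_diff[OF subgrp_funs]) (use x w in \<open>auto simp: S_def\<close>)
      ultimately have "x - w \<in> S 0" by (simp add: S_def G_diff)
      moreover have "x = w + (x - w)" by simp
      ultimately show "x \<in> (+) w ` S 0" by blast
    next
      fix x assume "x \<in> (+) w ` S 0"
      then obtain z where z: "x = w + z" "z \<in> S 0" by auto
      have "G x = G w + G z" using G_diff[of x z] z by simp
      then have "G x - D = (G w - D) + (G z - 0)" by simp
      also have "\<dots> \<in> ?K'" by (rule subgrp_add[OF sK(2)]) (use w z in \<open>auto simp: S_def\<close>)
      finally have "G x - D \<in> ?K'" .
      moreover have "x \<in> tuples n M" unfolding z(1)
        by (rule subgrp_add[OF subgrp_funs]) (use z w in \<open>auto simp: S_def\<close>)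
      ultimately show "x \<in> S D" by (simp add: S_def)
    qed
    then show ?thesis using ncosets_translate[OF sK(1)] by simp
  qed
  have "ncosets (tuples n M) ?K = ncosets (S 0) ?K * ncosets (funs (idx_pairs n) (\<lambda>_. \<O>)) ?K'"
  proof (rule ncosets_fibration[where f = G, OF sK])
    show "ncosets {x \<in> tuples n M. G x - D \<in> ?K'} ?K = ncosets (S 0) ?K" if "D \<in> funs (idx_pairs n) (\<lambda>_. \<O>)" for D
      using SD[OF that] by (simp add: S_def)
  qed (auto intro: GO G_compat finite_cosets_tuples)
  moreover have "real (ncosets (funs (idx_pairs n) (\<lambda>_. \<O>)) ?K') = q ^ card (idx_pairs n)"
    by (subst ncosets_funs) (simp_all add: ncosets_P)
  moreover have "real (ncosets (tuples n M) ?K) = q ^ (m * n)"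
    using tuples_pM_count(1)[of n 0 1] by (simp add: pM_0)
  ultimately have "q ^ (m * n) = real (ncosets (S 0) ?K) * q ^ card (idx_pairs n)" by (metis of_nat_mult)
  then show ?thesis using SD[OF D] residue_size_pos unfolding S_eq[OF D] by (simp add: field_simps)
qed

definition prim_reps :: "nat \<Rightarrow> nat \<Rightarrow> (nat \<times> nat \<Rightarrow> 'a) \<Rightarrow> (nat \<Rightarrow> 'c) set" where
  "prim_reps n N t = {y\<in>tuples n M. prim n y \<and> (\<forall>(i,j)\<in>idx_pairs n. B (y i) (y j) - t (i, j) \<in> \<I> N)}"

text \<open>A solution modulo \<open>\<I> (Suc N)\<close> near \<open>b\<close> has the form
  \<open>b + \<pi>^N w\<close>. Its Gram matrix differs from that of \<open>b\<close> by
  \<open>\<pi>^N\<close> times the derivative, plus a term with \<open>\<pi>^(2 N)\<close>,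
  negligible because \<open>N > 0\<close>. So the fibre over each \<open>b\<close> is the solution
  set of a linear system, of constant size.\<close>

lemma hensel_step:
  assumes N: "N > 0" and t: "t \<in> funs (idx_pairs n) (\<lambda>_. \<O>)"
  shows "real (ncosets (prim_reps n (Suc N) t) (tuples n (pM (Suc N)))) =
    q ^ (m * n) / q ^ card (idx_pairs n) * real (ncosets (prim_reps n N t) (tuples n (pM N)))"
proof -
  let ?K = "tuples n (pM (Suc N))" and ?K' = "tuples n (pM N)"
  have fib: "real (ncosets {x \<in> prim_reps n (Suc N) t. x - b \<in> ?K'} ?K) = q ^ (m * n) / q ^ card (idx_pairs n)"
    if b: "b \<in> prim_reps n N t" for b
  proof -
    have bT: "b \<in> tuples n M" "prim n b" using b by (auto simp: prim_reps_def)
    have bM: "b i \<in> M" if "i < n" for i using bT(1) that by (auto simp: funs_def)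
    \<comment> \<open>The error of \<open>b\<close> divided by \<open>\<pi>^N\<close>: the
      right-hand side of the linear system for \<open>w\<close>.\<close>
    define D where "D = (\<lambda>(i, j). if (i, j) \<in> idx_pairs n then (t (i, j) - B (b i) (b j)) / \<pi> ^ N else 0)"
    have D: "D \<in> funs (idx_pairs n) (\<lambda>_. \<O>)"
    proof (rule funsI)
      fix p assume p: "p \<in> idx_pairs n"
      obtain i j where ij: "p = (i, j)" by (cases p)
      have "B (b i) (b j) - t (i, j) \<in> \<I> N" using b p ij by (auto simp: prim_reps_def)
      then have "t (i, j) - B (b i) (b j) \<in> \<I> N" using subgrp_diff_commute[OF subgrp_I] by blast
      then show "D p \<in> \<O>" using p ij by (simp add: D_def I_iff)
    qed (auto simp: D_def)
    let ?A = "{w\<in>tuples n M. \<forall>(i,j)\<in>idx_pairs n. B (w i) (b j) + B (b i) (w j) - D (i, j) \<in> \<P>}"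
    define f where "f w = (\<lambda>i. b i + s (\<pi> ^ N) (w i))" for w
    have key: "B (f w i) (f w j) - t (i, j) \<in> \<I> (Suc N) \<longleftrightarrow> B (w i) (b j) + B (b i) (w j) - D (i, j) \<in> \<P>"
      if w: "w \<in> tuples n M" and ij: "(i, j) \<in> idx_pairs n" for w i j
    proof -
      have wM: "w i \<in> M" "w j \<in> M" using w ij by (auto simp: funs_def idx_pairs_def)
      have e: "\<pi> ^ N * D (i, j) = t (i, j) - B (b i) (b j)" using ij by (simp add: D_def)
      have "B (f w i) (f w j) - t (i, j) =
          \<pi> ^ N * (B (w i) (b j) + B (b i) (w j) - D (i, j) + \<pi> ^ N * B (w i) (w j))"
        unfolding right_diff_distrib distrib_left e
        by (simp add: f_def B_add B_add_right B_scale B_scale_right algebra_simps)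
      then have "B (f w i) (f w j) - t (i, j) \<in> \<I> (Suc N) \<longleftrightarrow>
          B (w i) (b j) + B (b i) (w j) - D (i, j) + \<pi> ^ N * B (w i) (w j) \<in> \<P>"
        using I_pow_mult[of N _ "Suc 0"] by (simp add: I_1)
      also have "\<dots> \<longleftrightarrow> B (w i) (b j) + B (b i) (w j) - D (i, j) \<in> \<P>"
      proof -
        have "\<pi> ^ N * B (w i) (w j) \<in> \<P>"
          using N wM B_integral by (intro P_mult_right I_imp_P[of _ N]) auto
        from P_add[OF _ this] P_diff[OF _ this] show ?thesis by (metis add_diff_cancel_right')
      qed
      finally show ?thesis .
    qed
    have diff: "f x - f y \<in> ?K \<longleftrightarrow> x - y \<in> tuples n (pM (Suc 0))" if "x \<in> ?A" "y \<in> ?A" for x y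
    proof -
      have "f x i - f y i \<in> pM (Suc N) \<longleftrightarrow> x i - y i \<in> pM (Suc 0)" for i
        using pM_scale_pi[of N "x i - y i" "Suc 0"] by (simp add: f_def vs.scale_right_diff_distrib)
      then show ?thesis using that by (auto simp: funs_def f_def)
    qed
    have fK: "f w - b \<in> ?K'" if w: "w \<in> tuples n M" for w
      using w pM_scale_pi[of N _ 0] by (auto simp: funs_def f_def pM_0)
    have fA: "f w \<in> {x \<in> prim_reps n (Suc N) t. x - b \<in> ?K'}" if w: "w \<in> ?A" for w
    proof -
      have wT: "w \<in> tuples n M" using w by simp
      have "f w i - b i \<in> pM (Suc 0)" if "i < n" for i
        using funsD[OF fK[OF wT], of i] that N pM_antimono[of "Suc 0" N "f w i - b i"] by auto
      then have "prim n (f w)" using prim_cong[of n "f w" b] bT by auto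
      moreover have "f w \<in> tuples n M"
        using wT bT(1) by (auto simp: funs_def f_def intro!: M_add M_smult O_power)
      ultimately show ?thesis using w key[OF wT] fK[OF wT] by (auto simp: prim_reps_def)
    qed
    have "ncosets ?A (tuples n (pM (Suc 0))) = ncosets {x \<in> prim_reps n (Suc N) t. x - b \<in> ?K'} ?K"
    proof (rule ncosets_iso(1)[where f = f])
      fix x assume x: "x \<in> {x \<in> prim_reps n (Suc N) t. x - b \<in> ?K'}"
      define w where "w i = s (inverse (\<pi> ^ N)) (x i - b i)" for i
      have w: "w \<in> tuples n M"
        using x by (auto simp: funs_def w_def pM_def)
      have fw: "f w = x" by (auto simp: f_def w_def fun_eq_iff)
      have "w \<in> ?A" using x w key[OF w] unfolding fw by (auto simp: prim_reps_def)
      then show "\<exists>w\<in>?A. f w - x \<in> ?K" using fw by (intro bexI[of _ w]) (auto simp: funs_def)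
    qed (use fA diff in \<open>auto intro: subgrp_funs\<close>)
    then show ?thesis using linear_count[OF bT(2,1) D] by simp
  qed
  define k where "k = nat \<lfloor>q ^ (m * n) / q ^ card (idx_pairs n)\<rfloor>"
  have k: "ncosets {x \<in> prim_reps n (Suc N) t. x - b \<in> ?K'} ?K = k" if "b \<in> prim_reps n N t" for b
    unfolding k_def fib[OF that, symmetric] by simp
  have "ncosets (prim_reps n (Suc N) t) ?K = k * ncosets (prim_reps n N t) ?K'"
  proof (rule ncosets_fibration[where f = "\<lambda>x. x"])
    show "x \<in> prim_reps n N t" if "x \<in> prim_reps n (Suc N) t" for x
      using that I_antimono[of N "Suc N"] by (auto simp: prim_reps_def)
    show "x - y \<in> ?K'" if "x - y \<in> ?K" for x y
      using that pM_antimono[of N "Suc N"] by (auto simp: funs_def)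
    show "finite (cosets (prim_reps n (Suc N) t) ?K)"
      by (rule finite_cosets_tuples) (auto simp: prim_reps_def)
  qed (use k in \<open>auto intro: subgrp_funs\<close>)
  moreover have "real k = q ^ (m * n) / q ^ card (idx_pairs n)" if "b \<in> prim_reps n N t" for b
    using fib[OF that] k[OF that] by simp
  moreover have "ncosets (prim_reps n N t) ?K' = 0" if "prim_reps n N t = {}"
    using that by (simp add: ncosets_def cosets_def)
  ultimately show ?thesis by (cases "prim_reps n N t = {}") auto
qed

lemma hensel:
  assumes t: "t \<in> funs (idx_pairs n) (\<lambda>_. \<O>)"
  shows "real (ncosets (prim_reps n (Suc N) t) (tuples n (pM (Suc N)))) =
    (q ^ (m * n) / q ^ card (idx_pairs n)) ^ N * real (ncosets (prim_reps n (Suc 0) t) (tuples n (pM (Suc 0))))"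
  using hensel_step[OF _ t] by (induction N) simp_all

end

section \<open>Primitive representations over the residue field\<close>

context odd_local_field begin

lemma residue_size_nz [simp]: "residue_size v \<noteq> 0" using residue_size_pos by linarith

text \<open>Substitution of \<open>b\<close> for \<open>u * c ^ 2\<close>. After multiplication by
  the unit \<open>u\<close>, the condition \<open>u * c ^ 2 = b\<close> says that
  \<open>u * c\<close> is a square root of \<open>u * b\<close>, and there are
  \<open>1 + \<chi> (u * b)\<close> of these.\<close>

lemma sum_quadratic:
  assumes u: "u \<in> \<O>" "u \<notin> \<P>" and g: "class_fun (g :: 'a \<Rightarrow> real)"
  shows "(\<Sum>c\<in>\<R>. g (u * c ^ 2)) = (\<Sum>b\<in>\<R>. (1 + \<chi> (u * b)) * g b)"
proof -
  have "(\<Sum>c\<in>\<R>. g (u * c ^ 2)) = (\<Sum>c\<in>\<R>. \<Sum>b\<in>\<R>. if u * c ^ 2 - b \<in> \<P> then g b else 0)"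
  proof (rule sum.cong[OF refl])
    fix c assume "c \<in> \<R>"
    then have "u * c ^ 2 \<in> \<O>" using u R_O by auto
    from sum_R_delta[OF this, of g] class_fun_rep[OF g this]
    show "g (u * c ^ 2) = (\<Sum>b\<in>\<R>. if u * c ^ 2 - b \<in> \<P> then g b else 0)" by simp
  qed
  also have "\<dots> = (\<Sum>b\<in>\<R>. \<Sum>c\<in>\<R>. if u * c ^ 2 - b \<in> \<P> then g b else 0)" by (rule sum.swap)
  also have "\<dots> = (\<Sum>b\<in>\<R>. (1 + \<chi> (u * b)) * g b)"
  proof (rule sum.cong[OF refl])
    fix b assume b: "b \<in> \<R>"
    have e: "u * c ^ 2 - b \<in> \<P> \<longleftrightarrow> (u * c) ^ 2 - u * b \<in> \<P>" if "c \<in> \<R>" for c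
    proof -
      have "(u * c) ^ 2 - u * b = u * (u * c ^ 2 - b)" by (simp add: power2_eq_square algebra_simps)
      then show ?thesis using u R_O[OF that] R_O[OF b] by (simp add: P_mult_iff O_diff O_mult O_power)
    qed
    have "(\<Sum>c\<in>\<R>. if u * c ^ 2 - b \<in> \<P> then g b else 0) = g b * (\<Sum>c\<in>\<R>. if (u * c) ^ 2 - u * b \<in> \<P> then 1 else 0)"
      unfolding sum_distrib_left using e by (intro sum.cong) auto
    also have "(\<Sum>c\<in>\<R>. if (u * c) ^ 2 - u * b \<in> \<P> then 1 else 0 :: real) = (\<Sum>c\<in>\<R>. if c ^ 2 - u * b \<in> \<P> then 1 else 0)"
    proof (rule sum_R_reindex)
      show "class_fun (\<lambda>c. if c ^ 2 - u * b \<in> \<P> then 1 else 0 :: real)"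
        unfolding class_fun_def
      proof (intro ballI impI)
        fix x y assume xy: "x \<in> \<O>" "y \<in> \<O>" "x - y \<in> \<P>"
        have "x ^ 2 - y ^ 2 = (x - y) * (x + y)" by (simp add: power2_eq_square algebra_simps)
        then have "x ^ 2 - y ^ 2 \<in> \<P>" using xy by auto
        from P_diff_cong_left[OF this]
        show "(if x ^ 2 - u * b \<in> \<P> then 1 else 0 :: real) = (if y ^ 2 - u * b \<in> \<P> then 1 else 0)" by simp
      qed
    next
      fix x y assume "x \<in> \<O>" "y \<in> \<O>" "u * x - u * y \<in> \<P>"
      then show "x - y \<in> \<P>" using u by (simp add: right_diff_distrib[symmetric] P_mult_iff O_diff)
    qed (use u in auto)
    also have "\<dots> = 1 + \<chi> (u * b)" using u R_O[OF b] by (intro square_count') auto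
    finally show "(\<Sum>c\<in>\<R>. if u * c ^ 2 - b \<in> \<P> then g b else 0) = (1 + \<chi> (u * b)) * g b" by simp
  qed
  finally show ?thesis .
qed

text \<open>The numerical side of splitting off a hyperbolic plane. The subtracted term is
  \<open>(q - 1) q^r\<close>, the number of solutions whose product with a fixed nonzero isotropic
  vector does not vanish.\<close>

lemma F_Suc_Suc: "F (Suc (Suc r)) th a - (q - 1) / q ^ 2 * q ^ Suc (Suc r) = q * F r th a"
proof -
  have "q ^ Suc (Suc r) / q - (q - 1) / q ^ 2 * q ^ Suc (Suc r) = q * (q ^ r / q)"
    using residue_size_pos by (simp add: power2_eq_square field_simps)
  moreover have "F (Suc (Suc r)) th a = q ^ Suc (Suc r) / q + q * (F r th a - q ^ r / q)"
    by (simp add: F_def)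
  ultimately show ?thesis by (simp add: algebra_simps)
qed

end

context unimodular begin

abbreviation "K1 \<equiv> pM (Suc 0)"

section \<open>Solution counts in submodules of the reduced lattice\<close>

definition fcount :: "'c set \<Rightarrow> 'a \<Rightarrow> real" where
  "fcount A a = real (ncosets {w\<in>A. B w w - a \<in> \<P>} K1)"

lemma class_fun_fcount: "class_fun (fcount A)"
  unfolding class_fun_def
proof (intro ballI impI)
  fix x y assume "x - y \<in> \<P>"
  from P_diff_cong_right[OF this] show "fcount A x = fcount A y" by (simp add: fcount_def)
qed

text \<open>The preimages in \<open>M\<close> of the subspaces of
  \<open>M / \<pi> M\<close>.\<close>

definition submod :: "'c set \<Rightarrow> bool" where
  "submod A \<longleftrightarrow> A \<subseteq> M \<and> K1 \<subseteq> A \<and> (\<forall>x\<in>A. \<forall>y\<in>A. x + y \<in> A) \<and> (\<forall>c\<in>\<O>. \<forall>x\<in>A. s c x \<in> A)"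

lemma submodD: assumes "submod A"
  shows "x \<in> A \<Longrightarrow> x \<in> M" "x \<in> K1 \<Longrightarrow> x \<in> A" "x \<in> A \<Longrightarrow> y \<in> A \<Longrightarrow> x + y \<in> A" "c \<in> \<O> \<Longrightarrow> x \<in> A \<Longrightarrow> s c x \<in> A"
  using assms by (auto simp: submod_def)

lemma submod_diff: "submod A \<Longrightarrow> x \<in> A \<Longrightarrow> y \<in> A \<Longrightarrow> x - y \<in> A"
  using submodD(3)[of A x "s (- 1) y"] submodD(4)[of A "- 1" y] by simp

lemma finite_cosets_M: "A \<subseteq> M \<Longrightarrow> finite (cosets A K1)"
  using cosets_pM(1)[of 0 1] cosets_mono[of A M K1] finite_subset by (auto simp: pM_0)

lemma B_cong: "x - y \<in> K1 \<Longrightarrow> z \<in> M \<Longrightarrow> B x z - B y z \<in> \<P>"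
  using B_pM[of "x - y" "Suc 0" z] by (simp add: B_diff I_1)

lemma B_self_cong: assumes "x - y \<in> K1" "x \<in> M" "y \<in> M" shows "B x x - B y y \<in> \<P>"
proof -
  have "B x x - B y y = (B x x - B y x) + (B x y - B y y)" using B_sym[of x y] by simp
  then show ?thesis using P_add[OF B_cong[OF assms(1,2)] B_cong[OF assms(1,3)]] B_sym[of y x] by simp
qed

lemma sum_fcount: assumes A: "submod A" shows "(\<Sum>a\<in>\<R>. fcount A a) = real (ncosets A K1)"
proof -
  have "ncosets A K1 = (\<Sum>a\<in>\<R>. ncosets {w\<in>A. B w w - a \<in> \<P>} K1)"
  proof (rule ncosets_partition)
    show "A = (\<Union>a\<in>\<R>. {w \<in> A. B w w - a \<in> \<P>})"
    proof (intro equalityI subsetI)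
      fix w assume "w \<in> A"
      then have "B w w \<in> \<O>" using B_integral submodD(1)[OF A] by auto
      then show "w \<in> (\<Union>a\<in>\<R>. {w \<in> A. B w w - a \<in> \<P>})"
        using \<open>w \<in> A\<close> rep_R[of "B w w"] rep_diff[of "B w w"] by blast
    qed auto
    fix i j x y assume *: "i \<in> \<R>" "j \<in> \<R>" "x \<in> {w \<in> A. B w w - i \<in> \<P>}" "y \<in> {w \<in> A. B w w - j \<in> \<P>}" "x - y \<in> K1"
    have "B x x - B y y \<in> \<P>" using * submodD(1)[OF A] by (intro B_self_cong) auto
    then have "B y y - i \<in> \<P>" using * P_diff_cong_left by blast
    then have "i - j \<in> \<P>" using * P_diff_commute P_diff_cong_left by blast
    then show "i = j" using * R_eq by blast
  qed (use A in \<open>auto intro!: finite_cosets_M simp: submod_def\<close>)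
  then show ?thesis by (simp add: fcount_def)
qed

text \<open>Since \<open>y\<close> has unit length \<open>u\<close>, the reduction of
  \<open>A\<close> is the orthogonal sum of the line of \<open>y\<close> and its complement. Sorting
  by the coordinate \<open>c = B w y / u\<close> and subtracting \<open>c y\<close> leaves a vector
  of the complement of length \<open>a - u * c ^ 2\<close>.\<close>

lemma unit_step:
  assumes A: "submod A" and y: "y \<in> A" "B y y \<notin> \<P>" and a: "a \<in> \<O>"
  shows "fcount A a = (\<Sum>b\<in>\<R>. (1 + \<chi> (B y y * b)) * fcount {w\<in>A. B w y \<in> \<P>} (a - b))"
proof -
  define u where "u = B y y"
  have yM: "y \<in> M" using submodD(1)[OF A] y by blast
  have u: "u \<in> \<O>" "u \<notin> \<P>" using B_integral yM y by (auto simp: u_def)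
  define A1 where "A1 = {w\<in>A. B w y \<in> \<P>}"
  define S where "S c = {w\<in>A. B w w - a \<in> \<P> \<and> B w y - c * u \<in> \<P>}" for c
  have S: "S c = (+) (s c y) ` {w\<in>A1. B w w - (a - u * c ^ 2) \<in> \<P>}" if c: "c \<in> \<O>" for c
  proof -
    have cy: "s c y \<in> A" using submodD(4)[OF A c] y by blast
    have eq: "w + s c y \<in> S c \<longleftrightarrow> w \<in> {w\<in>A1. B w w - (a - u * c ^ 2) \<in> \<P>}" if w: "w \<in> A" for w
    proof -
      have e1: "B (w + s c y) y - c * u = B w y" by (simp add: B_add B_scale u_def)
      have e2: "B (w + s c y) (w + s c y) - a = (B w w - (a - u * c ^ 2)) + 2 * c * B w y"
        using B_sym[of y w] by (simp add: B_add B_add_right B_scale B_scale_right u_def power2_eq_square algebra_simps)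
      have 1: "w + s c y \<in> S c \<longleftrightarrow> B w y \<in> \<P> \<and> (B w w - (a - u * c ^ 2)) + 2 * c * B w y \<in> \<P>"
        unfolding S_def mem_Collect_eq e1 e2 using w cy submodD(3)[OF A] by blast
      have "2 * c * B w y \<in> \<P>" if "B w y \<in> \<P>"
        by (rule P_mult_left[OF _ that]) (use c in auto)
      moreover have "X + Y \<in> \<P> \<longleftrightarrow> X \<in> \<P>" if "Y \<in> \<P>" for X Y
        using that P_add[of X Y] P_diff[of "X + Y" Y] by auto
      ultimately show ?thesis using w unfolding 1 A1_def by blast
    qed
    show ?thesis
    proof (intro equalityI subsetI)
      fix x assume x: "x \<in> S c"
      then have "x - s c y \<in> A" using submod_diff[OF A _ cy] by (auto simp: S_def)
      from eq[OF this] x have "x - s c y \<in> {w\<in>A1. B w w - (a - u * c ^ 2) \<in> \<P>}" by simp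
      moreover have "x = s c y + (x - s c y)" by simp
      ultimately show "x \<in> (+) (s c y) ` {w\<in>A1. B w w - (a - u * c ^ 2) \<in> \<P>}" by blast
    next
      fix x assume "x \<in> (+) (s c y) ` {w\<in>A1. B w w - (a - u * c ^ 2) \<in> \<P>}"
      then obtain w where w: "x = w + s c y" "w \<in> {w\<in>A1. B w w - (a - u * c ^ 2) \<in> \<P>}" by (auto simp: add.commute)
      then show "x \<in> S c" using eq[of w] by (auto simp: A1_def)
    qed
  qed
  have "ncosets {w\<in>A. B w w - a \<in> \<P>} K1 = (\<Sum>c\<in>\<R>. ncosets (S c) K1)"
  proof (rule ncosets_partition)
    show "{w\<in>A. B w w - a \<in> \<P>} = (\<Union>c\<in>\<R>. S c)"
    proof (intro equalityI subsetI)
      fix w assume w: "w \<in> {w\<in>A. B w w - a \<in> \<P>}"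
      then have "B w y \<in> \<O>" using B_integral submodD(1)[OF A] yM by auto
      then have wO: "B w y / u \<in> \<O>" using u by auto
      have "u * (B w y / u - rep (B w y / u)) \<in> \<P>" using u rep_diff by auto
      moreover have "u * (B w y / u - rep (B w y / u)) = B w y - rep (B w y / u) * u"
        using unit_nz[OF u(2)] by (simp add: algebra_simps)
      ultimately have "w \<in> S (rep (B w y / u))" using w by (simp add: S_def)
      then show "w \<in> (\<Union>c\<in>\<R>. S c)" using rep_R[OF wO] by blast
    qed (auto simp: S_def)
    fix i j x y' assume *: "i \<in> \<R>" "j \<in> \<R>" "x \<in> S i" "y' \<in> S j" "x - y' \<in> K1"
    have "B x y - B y' y \<in> \<P>" using B_cong[OF *(5) yM] .
    then have "B y' y - i * u \<in> \<P>" using * P_diff_cong_left by (auto simp: S_def)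
    moreover have "B y' y - j * u \<in> \<P>" using *(4) by (simp add: S_def)
    ultimately have "i * u - j * u \<in> \<P>" using P_diff[of "B y' y - j * u" "B y' y - i * u"] by simp
    then have "i - j \<in> \<P>" using u R_O * by (simp add: left_diff_distrib[symmetric] P_mult_iff O_diff)
    then show "i = j" using * R_eq by blast
  qed (use submodD(1)[OF A] in \<open>auto intro!: finite_cosets_M\<close>)
  then have "fcount A a = (\<Sum>c\<in>\<R>. fcount A1 (a - u * c ^ 2))"
    unfolding fcount_def using R_O by (simp add: S ncosets_translate)
  also have "\<dots> = (\<Sum>b\<in>\<R>. (1 + \<chi> (u * b)) * fcount A1 (a - b))"
    by (rule sum_quadratic[OF u, of "\<lambda>b. fcount A1 (a - b)"]) (rule class_fun_reflect[OF class_fun_fcount a])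
  finally show ?thesis by (simp add: u_def A1_def)
qed

text \<open>The solutions are sorted by \<open>c = B w y\<close>. For a unit \<open>c\<close>,
  translation by multiples of \<open>y\<close> moves the length through all classes, so each of
  these \<open>q - 1\<close> values of \<open>c\<close> accounts for exactly the fraction
  \<open>1 / q ^ 2\<close> of all vectors. What remains are the solutions orthogonal to
  \<open>y\<close>. The vector \<open>z\<close> makes all values of \<open>c\<close> equally
  frequent.\<close>

lemma isotropic_step:
  assumes A: "submod A" and y: "y \<in> A" "B y y \<in> \<P>" and z: "z \<in> A" "B z y - 1 \<in> \<P>" and a: "a \<in> \<O>"
  shows "fcount {w\<in>A. B w y \<in> \<P>} a = fcount A a - (q - 1) / q ^ 2 * real (ncosets A K1)"
proof -
  have AM: "x \<in> A \<Longrightarrow> x \<in> M" for x using submodD(1)[OF A] .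
  define D where "D c = {w\<in>A. B w y - c \<in> \<P>}" for c
  define S where "S c a = {w\<in>D c. B w w - a \<in> \<P>}" for c a
  have trans: "(+) t ` X = Y" if "\<And>x. x \<in> X \<Longrightarrow> t + x \<in> Y" "\<And>x. x \<in> Y \<Longrightarrow> x - t \<in> X" for t :: 'c and X Y
  proof (intro equalityI subsetI)
    fix x assume "x \<in> Y"
    then have "x = t + (x - t)" "x - t \<in> X" using that by auto
    then show "x \<in> (+) t ` X" by blast
  qed (use that in auto)
  have D: "real (ncosets (D c) K1) * q = real (ncosets A K1)" if c: "c \<in> \<O>" for c
  proof -
    have Dc: "ncosets (D e) K1 = ncosets (D 0) K1" if e: "e \<in> \<O>" for e
    proof -
      have ez: "s e z \<in> A" using submodD(4)[OF A e] z by blast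
      have "B (s e z) y - e = e * (B z y - 1)" by (simp add: B_scale algebra_simps)
      then have ez': "B (s e z) y - e \<in> \<P>" using z e by auto
      have "(+) (s e z) ` D 0 = D e"
      proof (rule trans)
        fix x assume "x \<in> D 0"
        then show "s e z + x \<in> D e" using ez ez' P_add[of "B (s e z) y - e" "B x y"] submodD(3)[OF A]
          by (auto simp: D_def B_add algebra_simps)
      next
        fix x assume "x \<in> D e"
        then show "x - s e z \<in> D 0" using ez ez' P_diff[of "B x y - e" "B (s e z) y - e"] submod_diff[OF A]
          by (auto simp: D_def B_diff algebra_simps)
      qed
      then show ?thesis using ncosets_translate[OF subgrp_pM, of "s e z" "D 0"] by simp
    qed
    have "ncosets A K1 = ncosets (D 0) K1 * ncosets \<O> \<P>"
    proof (rule ncosets_fibration[where f = "\<lambda>w. B w y"])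
      show "ncosets {x \<in> A. B x y - b \<in> \<P>} K1 = ncosets (D 0) K1" if "b \<in> \<O>" for b
        using Dc[OF that] by (simp add: D_def)
    qed (use y AM in \<open>auto intro!: B_cong B_integral finite_cosets_M\<close>)
    then show ?thesis using ncosets_P Dc[OF c] by simp
  qed
  have S: "real (ncosets (S c a) K1) * q = real (ncosets (D c) K1)" if c: "c \<in> \<O>" "c \<notin> \<P>" for c
  proof -
    have Sc: "ncosets (S c e) K1 = ncosets (S c 0) K1" if e: "e \<in> \<O>" for e
    proof -
      \<comment> \<open>Adding \<open>t y\<close> changes the length by \<open>2 * t * c\<close>
        modulo \<open>\<P>\<close>, as \<open>y\<close> is isotropic there; this choice makes the
        change equal to \<open>e\<close>.\<close>
      define t where "t = e / (2 * c)"
      have c2: "2 * c \<notin> \<P>" "2 * c \<in> \<O>" using c two_notin_P by (auto simp: P_mult_iff)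
      then have t: "t \<in> \<O>" using e by (auto simp: t_def)
      have ty: "s t y \<in> A" using submodD(4)[OF A t] y by blast
      have tc: "2 * t * c = e" using unit_nz[OF c2(1)] by (simp add: t_def)
      have d: "2 * t * (B w y - c) + t ^ 2 * B y y \<in> \<P>" if "w \<in> D c" for w
        by (rule P_add[OF P_mult_left P_mult_left]) (use that t y in \<open>auto simp: D_def\<close>)
      have sq: "B (w + s t y) (w + s t y) = B w w + e + (2 * t * (B w y - c) + t ^ 2 * B y y)" for w
        using B_sym[of y w] tc by (simp add: B_add B_add_right B_scale B_scale_right power2_eq_square algebra_simps)
      have sq': "B (w - s t y) (w - s t y) = B w w - e - (2 * t * (B w y - c) - t ^ 2 * B y y)" for w
        using B_sym[of y w] tc by (simp add: B_diff B_scale B_scale_right power2_eq_square algebra_simps)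
      have d': "2 * t * (B w y - c) - t ^ 2 * B y y \<in> \<P>" if "w \<in> D c" for w
        by (rule P_diff[OF P_mult_left P_mult_left]) (use that t y in \<open>auto simp: D_def\<close>)
      have tyP: "B (s t y) y \<in> \<P>" using t y by (auto simp: B_scale)
      have "(+) (s t y) ` S c 0 = S c e"
      proof (rule trans)
        fix x assume x: "x \<in> S c 0"
        then have xD: "x \<in> D c" by (auto simp: S_def)
        have "x + s t y \<in> D c" using xD ty tyP P_add[of "B x y - c" "B (s t y) y"] submodD(3)[OF A]
          by (auto simp: D_def B_add algebra_simps)
        moreover have "B (x + s t y) (x + s t y) - e \<in> \<P>"
          using P_add[OF _ d[OF xD], of "B x x"] x unfolding sq by (auto simp: S_def algebra_simps)
        ultimately show "s t y + x \<in> S c e" by (simp add: S_def add.commute)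
      next
        fix x assume x: "x \<in> S c e"
        then have xD: "x \<in> D c" by (auto simp: S_def)
        have "x - s t y \<in> D c" using xD ty tyP P_diff[of "B x y - c" "B (s t y) y"] submod_diff[OF A]
          by (auto simp: D_def B_diff algebra_simps)
        moreover have "B (x - s t y) (x - s t y) - 0 \<in> \<P>"
          using P_diff[OF _ d'[OF xD], of "B x x - e"] x unfolding sq' by (auto simp: S_def)
        ultimately show "x - s t y \<in> S c 0" by (simp add: S_def)
      qed
      then show ?thesis using ncosets_translate[OF subgrp_pM, of "s t y" "S c 0"] by simp
    qed
    have "ncosets (D c) K1 = ncosets (S c 0) K1 * ncosets \<O> \<P>"
    proof (rule ncosets_fibration[where f = "\<lambda>w. B w w"])
      show "ncosets {x \<in> D c. B x x - b \<in> \<P>} K1 = ncosets (S c 0) K1" if "b \<in> \<O>" for b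
        using Sc[OF that] by (simp add: S_def)
    qed (use AM in \<open>auto intro!: B_self_cong B_integral finite_cosets_M simp: D_def\<close>)
    then show ?thesis using ncosets_P Sc[OF a] by simp
  qed
  have "ncosets {w\<in>A. B w w - a \<in> \<P>} K1 = (\<Sum>c\<in>\<R>. ncosets (S c a) K1)"
  proof (rule ncosets_partition)
    show "{w\<in>A. B w w - a \<in> \<P>} = (\<Union>c\<in>\<R>. S c a)"
    proof (intro equalityI subsetI)
      fix w assume w: "w \<in> {w\<in>A. B w w - a \<in> \<P>}"
      then have wO: "B w y \<in> \<O>" using B_integral AM y by auto
      have "w \<in> S (rep (B w y)) a" using w rep_diff by (simp add: S_def D_def)
      then show "w \<in> (\<Union>c\<in>\<R>. S c a)" using rep_R[OF wO] by blast
    qed (auto simp: S_def D_def)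
    fix i j x y' assume *: "i \<in> \<R>" "j \<in> \<R>" "x \<in> S i a" "y' \<in> S j a" "x - y' \<in> K1"
    have "B x y - B y' y \<in> \<P>" using B_cong[OF *(5)] y AM by blast
    then have "B y' y - i \<in> \<P>" using * P_diff_cong_left by (auto simp: S_def D_def)
    moreover have "B y' y - j \<in> \<P>" using *(4) by (simp add: S_def D_def)
    ultimately have "i - j \<in> \<P>" using P_diff[of "B y' y - j" "B y' y - i"] by simp
    then show "i = j" using * R_eq by blast
  qed (use AM in \<open>auto intro!: finite_cosets_M\<close>)
  then have "fcount A a = (\<Sum>c\<in>\<R>. real (ncosets (S c a) K1))" by (simp add: fcount_def)
  also have "\<dots> = (\<Sum>c\<in>\<R>. real (ncosets A K1) / q ^ 2 + (if 0 - c \<in> \<P> then fcount {w\<in>A. B w y \<in> \<P>} a - real (ncosets A K1) / q ^ 2 else 0))"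
  proof (rule sum.cong[OF refl])
    fix c assume "c \<in> \<R>"
    then have c: "c \<in> \<O>" using R_O by auto
    show "real (ncosets (S c a) K1) = real (ncosets A K1) / q ^ 2 + (if 0 - c \<in> \<P> then fcount {w\<in>A. B w y \<in> \<P>} a - real (ncosets A K1) / q ^ 2 else 0)"
    proof (cases "c \<in> \<P>")
      case True
      then have "S c a = {w \<in> {w\<in>A. B w y \<in> \<P>}. B w w - a \<in> \<P>}"
        using P_diff_cong_right[of c 0] by (auto simp: S_def D_def)
      then show ?thesis using True by (simp add: fcount_def)
    next
      case False
      have "real (ncosets (S c a) K1) = real (ncosets A K1) / q ^ 2"
        using S[OF c False] D[OF c] by (simp add: power2_eq_square field_simps)
      then show ?thesis using False by simp
    qed
  qed
  also have "\<dots> = q * (real (ncosets A K1) / q ^ 2) + (fcount {w\<in>A. B w y \<in> \<P>} a - real (ncosets A K1) / q ^ 2)"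
    unfolding sum.distrib using sum_R_delta[of 0 "\<lambda>_. fcount {w\<in>A. B w y \<in> \<P>} a - real (ncosets A K1) / q ^ 2"]
    by (simp add: card_R)
  finally show ?thesis by (simp add: field_simps)
qed

definition perp :: "nat \<Rightarrow> (nat \<Rightarrow> 'c) \<Rightarrow> 'c set" where
  "perp j b = {w\<in>M. \<forall>i<j. B w (b i) \<in> \<P>}"

lemma perp_0: "perp 0 b = M" by (simp add: perp_def)
lemma perp_Suc: "perp (Suc j) b = {w\<in>perp j b. B w (b j) \<in> \<P>}"
  by (auto simp: perp_def less_Suc_eq)

lemma submod_perp: assumes "\<And>i. i < j \<Longrightarrow> b i \<in> M" shows "submod (perp j b)"
  unfolding submod_def
proof (intro conjI ballI subsetI)
  fix x assume "x \<in> K1"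
  then have "B x (b i) \<in> \<P>" if "i < j" for i using B_pM[of x "Suc 0" "b i"] assms[OF that] by (simp add: I_1)
  then show "x \<in> perp j b" using pM_M[OF \<open>x \<in> K1\<close>] by (simp add: perp_def)
qed (auto simp: perp_def B_add B_scale M_add M_smult)

text \<open>An orthogonal basis determines the number of solutions of \<open>Q = a\<close>: going down from the
  whole space to its zero subspace removes one basis vector at a time.\<close>

primrec basis_sign :: "(nat \<Rightarrow> 'a) \<Rightarrow> nat \<Rightarrow> nat \<Rightarrow> real" where
  "basis_sign u n 0 = 1"
| "basis_sign u n (Suc r) = basis_sign u n r * \<chi> (if even r then u (n - Suc r) else - u (n - Suc r))"

lemma fcount_orthogonal_basis:
  assumes y: "\<And>i. i < m \<Longrightarrow> y i \<in> M" "\<And>i j. i < m \<Longrightarrow> j < m \<Longrightarrow> i \<noteq> j \<Longrightarrow> B (y i) (y j) \<in> \<P>"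
    and u: "\<And>i. i < m \<Longrightarrow> B (y i) (y i) \<notin> \<P>"
    and span: "\<And>w. w \<in> M \<Longrightarrow> \<exists>c. (\<forall>i<m. c i \<in> \<O>) \<and> w = (\<Sum>i<m. s (c i) (y i))"
    and r: "r \<le> m" and a: "a \<in> \<O>"
  shows "fcount (perp (m - r) y) a = F r (basis_sign (\<lambda>i. B (y i) (y i)) m r) a"
  using r a
proof (induction r arbitrary: a)
  case 0
  \<comment> \<open>A vector orthogonal modulo \<open>\<P>\<close> to a whole basis pairs with all
    of \<open>M\<close> into \<open>\<P>\<close>, and self-duality puts it into
    \<open>\<pi> M\<close>.\<close>
  have pm: "perp m y = K1"
  proof (intro equalityI subsetI)
    fix w assume w: "w \<in> perp m y"
    have "B x w \<in> \<P>" if xM: "x \<in> M" for x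
    proof -
      obtain c where c: "\<forall>i<m. c i \<in> \<O>" "x = (\<Sum>i<m. s (c i) (y i))" using span[OF xM] by blast
      have "B x w = (\<Sum>i<m. c i * B w (y i))" using B_sym[of "y _" w] by (simp add: c(2) B_sum B_scale)
      also have "\<dots> \<in> \<P>" using c w by (intro P_sum P_mult_left) (auto simp: perp_def)
      finally show ?thesis .
    qed
    then show "w \<in> K1" using selfdual[of w] w by (auto simp: pM_1 perp_def)
  next
    fix w assume "w \<in> K1"
    then show "w \<in> perp m y" using submod_perp[of m y] y submodD(2) by blast
  qed
  have "B w w \<in> \<P>" if "w \<in> K1" for w using B_pM[OF that pM_M[OF that]] by (simp add: I_1)
  then have "{w\<in>K1. B w w - a \<in> \<P>} = (if a \<in> \<P> then K1 else {})"
    using P_diff_cong_left[of _ 0 a] by auto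
  moreover have "cosets K1 K1 = {K1}"
  proof -
    have "(+) x ` K1 = K1" if "x \<in> K1" for x using coset_eq_iff[of K1 x 0] that by simp
    moreover have "0 \<in> K1" by simp
    ultimately show ?thesis unfolding cosets_def by blast
  qed
  ultimately show ?case unfolding fcount_def by (simp add: F_0 pm ncosets_def cosets_def[of "{}"])
next
  case (Suc r)
  \<comment> \<open>Up to \<open>\<pi> M\<close>, \<open>perp (m - r) y\<close> is spanned by the
    last \<open>r\<close> basis vectors; enlarging \<open>r\<close> adjoins \<open>y j\<close>,
    which is what \<open>F_up\<close> describes.\<close>
  define j where "j = m - Suc r"
  have j: "m - r = Suc j" "j < m" using Suc.prems by (auto simp: j_def)
  have A: "submod (perp j y)" using y j by (intro submod_perp) auto
  have yj: "y j \<in> perp j y" using y j B_sym by (auto simp: perp_def)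
  have uO: "B (y j) (y j) \<in> \<O>" "B (y j) (y j) \<notin> \<P>" using B_integral y u j by auto
  have "fcount (perp j y) a = (\<Sum>b\<in>\<R>. (1 + \<chi> (B (y j) (y j) * b)) * fcount (perp (Suc j) y) (a - b))"
    using unit_step[OF A yj uO(2) Suc.prems(2)] by (simp add: perp_Suc)
  also have "\<dots> = (\<Sum>b\<in>\<R>. (1 + \<chi> (B (y j) (y j) * b)) * F r (basis_sign (\<lambda>i. B (y i) (y i)) m r) (a - b))"
    using Suc.IH R_O Suc.prems j by (intro sum.cong) (auto simp: O_diff)
  also have "\<dots> = F (Suc r) (basis_sign (\<lambda>i. B (y i) (y i)) m r * \<chi> (if even r then B (y j) (y j) else - B (y j) (y j))) a"
    by (rule F_up[OF uO Suc.prems(2)])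
  finally show ?case by (simp add: j_def)
qed

section \<open>Counting diagonal representations vector by vector\<close>

definition diag_reps :: "nat \<Rightarrow> (nat \<Rightarrow> 'a) \<Rightarrow> (nat \<Rightarrow> 'c) set" where
  "diag_reps n t = prim_reps n (Suc 0) (\<lambda>(i, j). if i = j then t i else 0)"

lemma diag_reps_iff: "y \<in> diag_reps n t \<longleftrightarrow> y \<in> tuples n M \<and> prim n y \<and> (\<forall>i<n. B (y i) (y i) - t i \<in> \<P>) \<and>
    (\<forall>i<n. \<forall>j<n. i \<noteq> j \<longrightarrow> B (y i) (y j) \<in> \<P>)"
proof -
  have "(\<forall>(i,j)\<in>idx_pairs n. B (y i) (y j) - (case (i, j) of (i, j) \<Rightarrow> if i = j then t i else 0) \<in> \<I> (Suc 0)) \<longleftrightarrow>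
     (\<forall>i<n. B (y i) (y i) - t i \<in> \<P>) \<and> (\<forall>i<n. \<forall>j<n. i \<noteq> j \<longrightarrow> B (y i) (y j) \<in> \<P>)" (is "?L \<longleftrightarrow> ?Q")
  proof
    assume L: ?L
    have d: "B (y i) (y i) - t i \<in> \<P>" if "i < n" for i
      using bspec[OF L, of "(i, i)"] that by (auto simp: idx_pairs_def I_1)
    have o: "B (y i) (y j) \<in> \<P>" if "i < j" "j < n" for i j
      using bspec[OF L, of "(i, j)"] that by (auto simp: idx_pairs_def I_1)
    have "B (y i) (y j) \<in> \<P>" if "i < n" "j < n" "i \<noteq> j" for i j
      using o[of i j] o[of j i] that B_sym[of "y i" "y j"] by (cases "i < j") auto
    then show ?Q using d by blast
  next
    assume ?Q
    then show ?L by (auto simp: idx_pairs_def I_1)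
  qed
  then show ?thesis unfolding diag_reps_def prim_reps_def by blast
qed

text \<open>The sign of the orthogonal complement of vectors with unit lengths
  \<open>t 0, ..., t (j - 1)\<close> in a space of dimension \<open>m\<close> and sign
  \<open>th\<close>. The twist depends on the parity of the dimension that remains, as in
  \<open>F_down\<close>.\<close>

primrec col_sign :: "real \<Rightarrow> (nat \<Rightarrow> 'a) \<Rightarrow> nat \<Rightarrow> real" where
  "col_sign th t 0 = th"
| "col_sign th t (Suc j) = col_sign th t j * \<chi> (if even (m - Suc j) then t j else - t j)"

lemma col_sign_cases:
  assumes "th \<in> {1, -1}" "\<And>i. i < j \<Longrightarrow> t i \<notin> \<P>" shows "col_sign th t j \<in> {1, -1}"
  using assms(2)
proof (induction j)
  case (Suc j)
  have "(if even (m - Suc j) then t j else - t j) \<notin> \<P>" using Suc.prems by auto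
  from chi_cases[OF this] have "\<chi> (if even (m - Suc j) then t j else - t j) \<in> {1, -1}" by blast
  moreover have "col_sign th t j \<in> {1, -1}" using Suc by auto
  ultimately show ?case by auto
qed (use assms in auto)

text \<open>\<open>unit_step\<close> expresses the known count for \<open>perp j b\<close> by the
  unknown one for \<open>perp (Suc j) b\<close>, and \<open>F_down\<close> inverts the relation. The
  embedded vectors are arbitrary, so this replaces the statement that all complements are
  isometric.\<close>

lemma fcount_perp_unit:
  assumes b: "b \<in> diag_reps n t" and t: "\<And>i. i < n \<Longrightarrow> t i \<in> \<O>" "\<And>i. i < d \<Longrightarrow> t i \<notin> \<P>"
    and Q0: "\<And>a. a \<in> \<O> \<Longrightarrow> fcount M a = F m th a"
    and j: "j \<le> d" "j \<le> n" "j \<le> m" and a: "a \<in> \<O>"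
  shows "fcount (perp j b) a = F (m - j) (col_sign th t j) a"
  using j a
proof (induction j arbitrary: a)
  case 0
  then show ?case using Q0 by (simp add: perp_0)
next
  case (Suc j)
  have bM: "b i \<in> M" if "i < n" for i using b that by (auto simp: diag_reps_iff funs_def)
  have A: "submod (perp j b)" using bM Suc.prems by (intro submod_perp) auto
  have yA: "b j \<in> perp j b" using b bM Suc.prems by (auto simp: perp_def diag_reps_iff)
  let ?u = "B (b j) (b j)"
  have uO: "?u \<in> \<O>" using bM Suc.prems by (auto intro: B_integral)
  have ut: "?u - t j \<in> \<P>" using b Suc.prems by (auto simp: diag_reps_iff)
  have uP: "?u \<notin> \<P>" using P_diff_cong_left[OF ut, of 0] t(2)[of j] Suc.prems by auto
  have \<chi>: "\<chi> ?u = \<chi> (t j)" "\<chi> (- ?u) = \<chi> (- t j)"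
    using uO t(1)[of j] Suc.prems ut by (auto intro!: chi_cong simp: P_diff_commute)
  have m: "m - j = Suc (m - Suc j)" using Suc.prems by simp
  have "fcount (perp (Suc j) b) a = 1 * F (m - Suc j) (col_sign th t j * \<chi> (if even (m - Suc j) then ?u else - ?u)) a"
  proof (rule F_down[OF uO uP class_fun_fcount _ Suc.prems(4)])
    fix x assume x: "x \<in> \<O>"
    show "(\<Sum>c\<in>\<R>. (1 + \<chi> (?u * c)) * fcount (perp (Suc j) b) (x - c)) = 1 * F (Suc (m - Suc j)) (col_sign th t j) x"
      using unit_step[OF A yA uP x] Suc.IH[OF _ _ _ x] Suc.prems m by (simp add: perp_Suc)
  qed
  then show ?case using \<chi> by (simp split: if_splits)
qed

text \<open>Passing to the complement of one more radical vector lowers the dimension of the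
  non-degenerate part by 2. The complement still contains the isotropic vectors chosen so far; they
  account for the factor \<open>q ^ r\<close>.\<close>

lemma fcount_perp_isotropic:
  assumes b: "b \<in> diag_reps n t" and t: "\<And>i. i < n \<Longrightarrow> t i \<in> \<O>" "\<And>i. i < d \<Longrightarrow> t i \<notin> \<P>"
      "\<And>i. d \<le> i \<Longrightarrow> i < n \<Longrightarrow> t i \<in> \<P>"
    and Q0: "\<And>a. a \<in> \<O> \<Longrightarrow> fcount M a = F m th a"
    and r: "d + r \<le> n" "d + 2 * r \<le> m" and a: "a \<in> \<O>"
  shows "fcount (perp (d + r) b) a = q ^ r * F (m - d - 2 * r) (col_sign th t d) a"
  using r a
proof (induction r arbitrary: a)
  case 0
  then show ?case using fcount_perp_unit[OF b t(1,2) Q0] by simp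
next
  case (Suc r)
  let ?j = "d + r"
  have bM: "b i \<in> M" if "i < n" for i using b that by (auto simp: diag_reps_iff funs_def)
  have A: "submod (perp ?j b)" using bM Suc.prems by (intro submod_perp) auto
  have yA: "b ?j \<in> perp ?j b" using b bM Suc.prems by (auto simp: perp_def diag_reps_iff)
  have "B (b ?j) (b ?j) - t ?j \<in> \<P>" using b Suc.prems by (auto simp: diag_reps_iff)
  then have yP: "B (b ?j) (b ?j) \<in> \<P>" using P_add[OF _ t(3)[of ?j]] Suc.prems by fastforce
  have "prim n b" using b by (simp add: diag_reps_iff)
  \<comment> \<open>Primitivity yields a vector with product 1 with \<open>b ?j\<close> and 0 with
    all other \<open>b i\<close>, as \<open>isotropic_step\<close> requires inside the complement of
    the first \<open>?j\<close> vectors.\<close>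
  then have "\<exists>z\<in>M. \<forall>i<n. B z (b i) - (if i = ?j then 1 else 0) \<in> \<P>"
    using bM by (intro prescribed_products) auto
  then obtain z where z: "z \<in> M" "\<And>i. i < n \<Longrightarrow> B z (b i) - (if i = ?j then 1 else 0) \<in> \<P>" by blast
  have zA: "z \<in> perp ?j b"
    unfolding perp_def
  proof (intro CollectI conjI allI impI)
    fix i assume "i < ?j" then show "B z (b i) \<in> \<P>" using z(2)[of i] Suc.prems by auto
  qed (rule z(1))
  have z1: "B z (b ?j) - 1 \<in> \<P>" using z(2)[of ?j] Suc.prems by auto
  define R' where "R' = m - d - 2 * Suc r"
  have R': "m - d - 2 * r = Suc (Suc R')" using Suc.prems by (simp add: R'_def)
  have IH: "fcount (perp ?j b) x = q ^ r * F (Suc (Suc R')) (col_sign th t d) x" if "x \<in> \<O>" for x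
    using Suc.IH[OF _ _ that] Suc.prems R' by simp
  have "real (ncosets (perp ?j b) K1) = q ^ r * (\<Sum>x\<in>\<R>. F (Suc (Suc R')) (col_sign th t d) x)"
    unfolding sum_fcount[OF A, symmetric] sum_distrib_left using IH R_O by (intro sum.cong) auto
  then have card: "real (ncosets (perp ?j b) K1) = q ^ r * q ^ Suc (Suc R')" unfolding sum_F .
  have "fcount (perp (Suc ?j) b) a = fcount (perp ?j b) a - (q - 1) / q ^ 2 * real (ncosets (perp ?j b) K1)"
    using isotropic_step[OF A yA yP zA z1 Suc.prems(3)] by (simp add: perp_Suc)
  also have "\<dots> = q ^ r * (F (Suc (Suc R')) (col_sign th t d) a - (q - 1) / q ^ 2 * q ^ Suc (Suc R'))"
    unfolding IH[OF Suc.prems(3)] card by (simp add: right_diff_distrib mult_ac)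
  also have "\<dots> = q ^ Suc r * F R' (col_sign th t d) a" unfolding F_Suc_Suc by simp
  finally show ?case by (simp add: R'_def)
qed

definition extensions :: "nat \<Rightarrow> (nat \<Rightarrow> 'a) \<Rightarrow> (nat \<Rightarrow> 'c) \<Rightarrow> 'c set" where
  "extensions j t b = {w\<in>perp j b. B w w - t j \<in> \<P> \<and> prim (Suc j) (b(j := w))}"

text \<open>Independence is automatic. In a relation, pairing with the new vector \<open>w\<close>
  kills the terms of \<open>b\<close> and leaves the coefficient of \<open>w\<close> times a unit;
  then primitivity of \<open>b\<close> applies.\<close>

lemma extensions_unit:
  assumes b: "b \<in> diag_reps j t" and tj: "t j \<in> \<O>" "t j \<notin> \<P>"
  shows "real (ncosets (extensions j t b) K1) = fcount (perp j b) (t j)"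
proof -
  have bM: "b i \<in> M" if "i < j" for i using b that by (auto simp: diag_reps_iff funs_def)
  have "prim (Suc j) (b(j := w))" if w: "w \<in> perp j b" "B w w - t j \<in> \<P>" for w
    unfolding prim_def
  proof (intro allI impI)
    fix c i assume c: "\<forall>i<Suc j. c i \<in> \<O>" "(\<Sum>i<Suc j. s (c i) ((b(j := w)) i)) \<in> K1" and i: "i < Suc j"
    have wM: "w \<in> M" using w by (simp add: perp_def)
    have sum: "(\<Sum>i<Suc j. s (c i) ((b(j := w)) i)) = (\<Sum>i<j. s (c i) (b i)) + s (c j) w" by simp
    have "B ((\<Sum>i<j. s (c i) (b i)) + s (c j) w) w \<in> \<P>"
      using B_pM[of _ "Suc 0" w] c(2) wM unfolding sum by (simp add: I_1)
    then have "(\<Sum>i<j. c i * B w (b i)) + c j * B w w \<in> \<P>"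
      using B_sym[of "b _" w] by (simp add: B_add B_sum B_scale)
    moreover have "(\<Sum>i<j. c i * B w (b i)) \<in> \<P>"
      using c w by (intro P_sum P_mult_left) (auto simp: perp_def)
    ultimately have "c j * B w w \<in> \<P>" using P_diff by fastforce
    moreover have "B w w \<notin> \<P>" using P_diff_cong_left[OF w(2), of 0] tj by auto
    ultimately have cj: "c j \<in> \<P>" using c wM B_integral by (simp add: P_mult_iff)
    then have "s (c j) w \<in> K1" using pM_smult_P wM by blast
    then have "(\<Sum>i<j. s (c i) (b i)) \<in> K1" using subgrp_diff[OF subgrp_pM c(2)[unfolded sum]] by fastforce
    then have "\<forall>i<j. c i \<in> \<P>" using b c(1) unfolding diag_reps_iff prim_def by auto
    then show "c i \<in> \<P>" using cj i by (auto simp: less_Suc_eq)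
  qed
  then have "extensions j t b = {w\<in>perp j b. B w w - t j \<in> \<P>}" by (auto simp: extensions_def)
  then show ?thesis by (simp add: fcount_def)
qed

text \<open>To be discarded are the solutions \<open>w\<close> dependent on \<open>b\<close>. Such a
  \<open>w\<close> is a combination of the \<open>b i\<close>, and orthogonality to the
  \<open>d\<close> vectors of unit length removes their coefficients. Conversely every combination
  of the \<open>j - d\<close> radical vectors is orthogonal to \<open>b\<close> and isotropic modulo
  \<open>\<P>\<close>.\<close>

lemma extensions_isotropic:
  assumes b: "b \<in> diag_reps j t" and tj: "t j \<in> \<P>" and d: "d \<le> j"
    and t: "\<And>i. i < d \<Longrightarrow> t i \<notin> \<P>" "\<And>i. d \<le> i \<Longrightarrow> i < j \<Longrightarrow> t i \<in> \<P>"
  shows "real (ncosets (extensions j t b) K1) = fcount (perp j b) (t j) - q ^ (j - d)"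
proof -
  have bM: "b i \<in> M" if "i < j" for i using b that by (auto simp: diag_reps_iff funs_def)
  have bt: "B (b i) (b i) - t i \<in> \<P>" if "i < j" for i using b that by (auto simp: diag_reps_iff)
  have bo: "B (b i) (b k) \<in> \<P>" if "i < j" "k < j" "i \<noteq> k" for i k using b that by (auto simp: diag_reps_iff)
  have bprim: "prim j b" using b by (simp add: diag_reps_iff)
  define E where "E = {w\<in>perp j b. B w w - t j \<in> \<P> \<and> \<not> prim (Suc j) (b(j := w))}"
  define f where "f c = (\<Sum>i<j. s (c i) (b i))" for c
  have f_diff: "f x - f y = (\<Sum>i<j. s ((x - y) i) (b i))" for x y
    by (simp add: f_def vs.scale_left_diff_distrib sum_subtractf)
  have SO: "funs {d..<j} (\<lambda>_. \<P>) \<subseteq> funs {d..<j} (\<lambda>_. \<O>)" using P_imp_O by (auto simp: funs_def)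
  have lin: "f c \<in> M \<and> (\<forall>i<j. B (f c) (b i) \<in> \<P>)" if c: "c \<in> funs {d..<j} (\<lambda>_. \<O>)" for c
  proof
    have cO: "c i \<in> \<O>" for i using c by (cases "i \<in> {d..<j}") (auto simp: funs_def)
    show "f c \<in> M" unfolding f_def using cO bM by (intro M_sum M_smult) auto
    show "\<forall>i<j. B (f c) (b i) \<in> \<P>"
    proof (intro allI impI)
      fix i assume i: "i < j"
      have "c k * B (b k) (b i) \<in> \<P>" if k: "k < j" for k
      proof (cases "k = i")
        case True
        have "t i \<in> \<P> \<Longrightarrow> B (b i) (b i) \<in> \<P>" using P_add[OF bt[OF i], of "t i"] by simp
        then show ?thesis using True t(2)[of i] i c cO by (cases "d \<le> i") (auto simp: funs_def)
      next
        case False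
        then show ?thesis using bo[OF k i] cO by blast
      qed
      then show "B (f c) (b i) \<in> \<P>" unfolding f_def B_sum B_scale by (intro P_sum) auto
    qed
  qed
  have "ncosets (funs {d..<j} (\<lambda>_. \<O>)) (funs {d..<j} (\<lambda>_. \<P>)) = ncosets E K1"
  proof (rule ncosets_iso(1)[where f = f])
    fix c assume c: "c \<in> funs {d..<j} (\<lambda>_. \<O>)"
    have cO: "c i \<in> \<O>" for i using c by (cases "i \<in> {d..<j}") (auto simp: funs_def)
    have "B x (\<Sum>i<j. s (c i) (b i)) = (\<Sum>i<j. c i * B x (b i))" for x
      by (simp only: B_sum B_scale_right)
    from this[of "f c"] have "B (f c) (f c) = (\<Sum>i<j. c i * B (f c) (b i))" by (simp only: f_def[of c])
    also have "\<dots> \<in> \<P>" using lin[OF c] cO by (intro P_sum P_mult_left) auto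
    finally have "B (f c) (f c) - t j \<in> \<P>" using tj by auto
    moreover have "\<not> prim (Suc j) (b(j := f c))"
    proof
      assume p: "prim (Suc j) (b(j := f c))"
      define c' where "c' = c(j := - 1)"
      have "(\<Sum>i<Suc j. s (c' i) ((b(j := f c)) i)) = 0" by (simp add: c'_def f_def)
      moreover have "\<forall>i<Suc j. c' i \<in> \<O>" using cO by (simp add: c'_def)
      ultimately have "c' j \<in> \<P>" using p unfolding prim_def by (metis lessI pM_zero)
      then show False by (simp add: c'_def)
    qed
    ultimately show "f c \<in> E" using lin[OF c] by (simp add: E_def perp_def)
  next
    fix x y assume xy: "x \<in> funs {d..<j} (\<lambda>_. \<O>)" "y \<in> funs {d..<j} (\<lambda>_. \<O>)"
    have xyO: "(x - y) i \<in> \<O>" for i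
      using xy by (cases "i \<in> {d..<j}") (auto simp: funs_def)
    show "f x - f y \<in> K1 \<longleftrightarrow> x - y \<in> funs {d..<j} (\<lambda>_. \<P>)"
    proof
      assume "f x - f y \<in> K1"
      then have "\<forall>i<j. (x - y) i \<in> \<P>" using bprim xyO unfolding f_diff prim_def by blast
      then show "x - y \<in> funs {d..<j} (\<lambda>_. \<P>)" using xy by (auto simp: funs_def)
    next
      assume *: "x - y \<in> funs {d..<j} (\<lambda>_. \<P>)"
      have "(x - y) i \<in> \<P>" for i using * by (cases "i \<in> {d..<j}") (auto simp: funs_def)
      then show "f x - f y \<in> K1"
        unfolding f_diff using bM by (intro subgrp_sum[OF subgrp_pM] pM_smult_P) auto
    qed
  next
    fix w assume w: "w \<in> E"
    then have wM: "w \<in> M" and wb: "\<And>i. i < j \<Longrightarrow> B w (b i) \<in> \<P>" by (auto simp: E_def perp_def)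
    from w obtain c where c: "\<forall>i<Suc j. c i \<in> \<O>" "(\<Sum>i<Suc j. s (c i) ((b(j := w)) i)) \<in> K1"
      "\<not> (\<forall>i<Suc j. c i \<in> \<P>)" by (auto simp: E_def prim_def)
    have sum: "(\<Sum>i<Suc j. s (c i) ((b(j := w)) i)) = (\<Sum>i<j. s (c i) (b i)) + s (c j) w" by simp
    \<comment> \<open>Otherwise the relation would already be one among the \<open>b i\<close>,
      which are independent.\<close>
    have cj: "c j \<notin> \<P>"
    proof
      assume cj: "c j \<in> \<P>"
      then have "s (c j) w \<in> K1" using pM_smult_P wM by blast
      then have "(\<Sum>i<j. s (c i) (b i)) \<in> K1" using subgrp_diff[OF subgrp_pM c(2)[unfolded sum]] by fastforce
      then have "\<forall>i<j. c i \<in> \<P>" using bprim c(1) unfolding prim_def by auto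
      then show False using cj c(3) by (auto simp: less_Suc_eq)
    qed
    have cjO: "c j \<in> \<O>" "inverse (c j) \<in> \<O>" using c(1) cj unit_inverse by auto
    define e where "e i = - inverse (c j) * c i" for i
    have eO: "e i \<in> \<O>" if "i < j" for i using cjO c(1) that by (auto simp: e_def)
    have "s (inverse (c j)) ((\<Sum>i<j. s (c i) (b i)) + s (c j) w) \<in> K1"
      using pM_smult_O cjO c(2) unfolding sum by blast
    moreover have "s (inverse (c j)) ((\<Sum>i<j. s (c i) (b i)) + s (c j) w) = w - (\<Sum>i<j. s (e i) (b i))"
      using unit_nz[OF cj] by (simp add: vs.scale_right_distrib vs.scale_sum_right e_def sum_negf)
    ultimately have we: "w - (\<Sum>i<j. s (e i) (b i)) \<in> K1" by simp
    \<comment> \<open>Pairing with \<open>b i\<close> isolates \<open>e i\<close> times the unit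
      length of \<open>b i\<close>, and the product is in \<open>\<P>\<close> because
      \<open>w\<close> is orthogonal to \<open>b i\<close>.\<close>
    have eP: "e i \<in> \<P>" if i: "i < d" for i
    proof -
      have ij: "i < j" using i d by simp
      have "B w (b i) - B (\<Sum>i<j. s (e i) (b i)) (b i) \<in> \<P>" using B_cong[OF we bM[OF ij]] .
      then have 1: "B (\<Sum>i<j. s (e i) (b i)) (b i) \<in> \<P>" using P_diff[OF wb[OF ij]] by fastforce
      have "B (\<Sum>i<j. s (e i) (b i)) (b i) = e i * B (b i) (b i) + (\<Sum>k\<in>{..<j} - {i}. e k * B (b k) (b i))"
        unfolding B_sum B_scale by (rule sum.remove) (use ij in auto)
      moreover have "(\<Sum>k\<in>{..<j} - {i}. e k * B (b k) (b i)) \<in> \<P>"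
        using eO bo ij by (intro P_sum P_mult_left) auto
      ultimately have "e i * B (b i) (b i) \<in> \<P>" using 1 P_diff by fastforce
      moreover have "B (b i) (b i) \<notin> \<P>" using P_diff_cong_left[OF bt[OF ij], of 0] t(1)[OF i] by auto
      ultimately show ?thesis using eO[OF ij] B_integral[OF bM[OF ij] bM[OF ij]] by (simp add: P_mult_iff)
    qed
    define c' where "c' i = (if i \<in> {d..<j} then e i else 0)" for i
    have "f c' - (\<Sum>i<j. s (e i) (b i)) = (\<Sum>i<j. s (c' i - e i) (b i))"
      by (simp add: f_def vs.scale_left_diff_distrib sum_subtractf)
    also have "\<dots> \<in> K1"
      using bM eP by (intro subgrp_sum[OF subgrp_pM] pM_smult_P) (auto simp: c'_def)
    finally have "f c' - w \<in> K1" using subgrp_diff[OF subgrp_pM _ we, of "f c' - (\<Sum>i<j. s (e i) (b i))"]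
      by simp
    moreover have "c' \<in> funs {d..<j} (\<lambda>_. \<O>)" using eO by (auto simp: funs_def c'_def)
    ultimately show "\<exists>x\<in>funs {d..<j} (\<lambda>_. \<O>). f x - w \<in> K1" by blast
  qed (auto intro: subgrp_funs)
  moreover have "real (ncosets (funs {d..<j} (\<lambda>_. \<O>)) (funs {d..<j} (\<lambda>_. \<P>))) = q ^ (j - d)"
    by (subst ncosets_funs) (simp_all add: ncosets_P)
  ultimately have E: "real (ncosets E K1) = q ^ (j - d)" by simp
  have "ncosets {w\<in>perp j b. B w w - t j \<in> \<P>} K1 = (\<Sum>p\<in>UNIV. ncosets (if p then extensions j t b else E) K1)"
  proof (rule ncosets_partition)
    show "{w \<in> perp j b. B w w - t j \<in> \<P>} = (\<Union>p\<in>UNIV. if p then extensions j t b else E)"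
      by (auto simp: extensions_def E_def split: if_splits)
    fix p p' x y
    assume *: "x \<in> (if p then extensions j t b else E)" "y \<in> (if p' then extensions j t b else E)" "x - y \<in> K1"
    have "prim (Suc j) (b(j := x)) \<longleftrightarrow> prim (Suc j) (b(j := y))"
      using *(3) by (intro prim_cong) auto
    then show "p = p'" using * by (auto simp: extensions_def E_def split: if_splits)
  qed (auto intro!: finite_cosets_M simp: perp_def)
  then have "fcount (perp j b) (t j) = real (ncosets (extensions j t b) K1) + real (ncosets E K1)"
    by (simp add: fcount_def UNIV_bool)
  then show ?thesis using E by simp
qed

text \<open>Restriction to the first \<open>j\<close> vectors, the last entry being reset to the
  default 0. A tuple whose restriction is congruent to \<open>b\<close> is congruent to one that
  restricts to \<open>b\<close> exactly, so the fibre over \<open>b\<close> is counted by the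
  extensions of \<open>b\<close>.\<close>

lemma diag_reps_Suc_count:
  assumes k: "\<And>b. b \<in> diag_reps j t \<Longrightarrow> real (ncosets (extensions j t b) K1) = k"
  shows "real (ncosets (diag_reps (Suc j) t) (tuples (Suc j) K1)) = k * real (ncosets (diag_reps j t) (tuples j K1))"
proof (rule ncosets_fibration_real[where f = "\<lambda>y. y(j := 0)"])
  show res: "y(j := 0) \<in> diag_reps j t" if y: "y \<in> diag_reps (Suc j) t" for y
  proof -
    have "prim j y" using y prim_SucD by (simp add: diag_reps_iff)
    then have "prim j (y(j := 0))" using prim_cong[of j "y(j := 0)" y] by simp
    then show ?thesis using y by (auto simp: diag_reps_iff funs_def)
  qed
  show "x(j := 0) - y(j := 0) \<in> tuples j K1" if "x - y \<in> tuples (Suc j) K1" for x y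
    using that by (auto simp: funs_def)
  show "finite (cosets (diag_reps (Suc j) t) (tuples (Suc j) K1))"
    by (rule finite_cosets_tuples) (auto simp: diag_reps_iff)
  fix b assume b: "b \<in> diag_reps j t"
  have bM: "b i \<in> M" if "i < j" for i using b that by (auto simp: diag_reps_iff funs_def)
  have bj: "b i = 0" if "i \<ge> j" for i using b that by (auto simp: diag_reps_iff funs_def)
  let ?Fib = "{x \<in> diag_reps (Suc j) t. x(j := 0) - b \<in> tuples j K1}"
  have "ncosets (extensions j t b) K1 = ncosets ?Fib (tuples (Suc j) K1)"
  proof (rule ncosets_iso(1)[where f = "\<lambda>w. b(j := w)"])
    fix w assume w: "w \<in> extensions j t b"
    have "B w (b i) \<in> \<P> \<and> B (b i) w \<in> \<P>" if "i < j" for i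
      using w that B_sym[of "b i" w] by (simp add: extensions_def perp_def)
    then have "b(j := w) \<in> diag_reps (Suc j) t"
      using b w bM by (auto simp: diag_reps_iff funs_def extensions_def perp_def less_Suc_eq)
    moreover have "(b(j := w))(j := 0) - b = 0" using bj by (auto simp: fun_eq_iff)
    moreover have "(0 :: nat \<Rightarrow> 'c) \<in> tuples j K1" by (auto simp: funs_def)
    ultimately show "b(j := w) \<in> ?Fib" by (simp del: fun_upd_upd)
  next
    fix x y show "b(j := x) - b(j := y) \<in> tuples (Suc j) K1 \<longleftrightarrow> x - y \<in> K1"
      by (auto simp: funs_def)
  next
    fix y assume y: "y \<in> ?Fib"
    have yb: "y i - b i \<in> K1" if "i < j" for i
      using y that by (auto simp: funs_def dest!: spec[of _ i])
    have yM: "y i \<in> M" if "i < Suc j" for i using y that by (auto simp: diag_reps_iff funs_def)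
    have "B (y j) (b i) \<in> \<P>" if i: "i < j" for i
    proof -
      have "B (y i) (y j) - B (b i) (y j) \<in> \<P>" using B_cong[OF yb[OF i]] yM by auto
      moreover have "B (y i) (y j) \<in> \<P>" using y i by (auto simp: diag_reps_iff)
      ultimately have "B (b i) (y j) \<in> \<P>" using P_diff by fastforce
      then show ?thesis using B_sym by metis
    qed
    moreover have "prim (Suc j) (b(j := y j))"
    proof -
      have "prim (Suc j) (b(j := y j)) \<longleftrightarrow> prim (Suc j) y"
        using yb subgrp_diff_commute[OF subgrp_pM] by (intro prim_cong) (auto simp: less_Suc_eq)
      then show ?thesis using y by (simp add: diag_reps_iff)
    qed
    moreover have "B (y j) (y j) - t j \<in> \<P>" using y by (auto simp: diag_reps_iff)
    ultimately have "y j \<in> extensions j t b" using yM by (auto simp: extensions_def perp_def)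
    moreover have "b(j := y j) - y \<in> tuples (Suc j) K1"
    proof (rule funsI)
      fix i assume "i \<in> {..<Suc j}"
      then show "(b(j := y j) - y) i \<in> K1" using yb[of i] subgrp_diff_commute[OF subgrp_pM, of "y i"] by (cases "i = j") auto
    next
      fix i assume "i \<notin> {..<Suc j}"
      then show "(b(j := y j) - y) i = 0" using bj[of i] y by (auto simp: diag_reps_iff funs_def)
    qed
    ultimately show "\<exists>x\<in>extensions j t b. b(j := x) - y \<in> tuples (Suc j) K1" by blast
  qed (auto intro: subgrp_funs)
  then show "real (ncosets ?Fib (tuples (Suc j) K1)) = k" using k[OF b] by simp
qed (auto intro: subgrp_funs)

text \<open>As \<open>r'\<close> grows, the dimension \<open>m' - d - 2 * r'\<close> passes 1 if it
  is odd, and otherwise 2 and 0. There the remaining space is anisotropic at one point: a line, the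
  zero space for sign 1, or the plane of sign -1. At that point the only isotropic vector is 0 and
  the corresponding factor of the count vanishes.\<close>

lemma F_zero_factor:
  assumes "th \<in> {1, -1}" "d < m'" "m' < d + 2 * r"
  shows "\<exists>r'<r. F (m' - d - 2 * r') th 0 = 1"
proof (cases "even (m' - d)")
  case False
  define h where "h = (m' - d) div 2"
  have h: "m' - d = Suc (2 * h)" using False unfolding h_def by presburger
  then have "h < r" "m' - d - 2 * h = Suc 0" using assms by auto
  moreover have "F (Suc 0) th 0 = 1" by (simp add: F_def chi_P)
  ultimately show ?thesis by metis
next
  case True
  define h where "h = (m' - d) div 2"
  have h: "m' - d = 2 * h" using True by (simp add: h_def)
  then have h: "m' - d = 2 * h" "0 < h" "h < r" using assms by linarith+
  show ?thesis
  proof (cases "th = 1")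
    case True
    then show ?thesis using h F_0[of 0] by (intro exI[of _ h]) simp
  next
    case False
    have "2 * h - 2 * (h - 1) = 2" using h by simp
    moreover have "F 2 (- 1) 0 = 1" by (simp add: F_def power2_eq_square algebra_simps)
    ultimately show ?thesis using False assms(1) h by (intro exI[of _ "h - 1"]) auto
  qed
qed

text \<open>The number of extensions depends only on how many vectors of each kind have been placed,
  so the count is the product over all steps: first the unit lengths, then the radical, where the
  \<open>q ^ r\<close> dependent choices are subtracted.\<close>

theorem diag_reps_count:
  assumes t: "\<And>i. i < d + e \<Longrightarrow> t i \<in> \<O>" "\<And>i. i < d \<Longrightarrow> t i \<notin> \<P>" "\<And>i. d \<le> i \<Longrightarrow> i < d + e \<Longrightarrow> t i \<in> \<P>"
    and Q0: "\<And>a. a \<in> \<O> \<Longrightarrow> fcount M a = F m th a" and th: "th \<in> {1, -1}" and d: "d < m"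
  shows "real (ncosets (diag_reps (d + e) t) (tuples (d + e) K1)) =
    (\<Prod>j<d. F (m - j) (col_sign th t j) (t j)) * (\<Prod>r<e. q ^ r * F (m - d - 2 * r) (col_sign th t d) 0 - q ^ r)"
proof -
  let ?c = "\<lambda>j. real (ncosets (diag_reps j t) (tuples j K1))"
  have units: "?c j = (\<Prod>j<j. F (m - j) (col_sign th t j) (t j))" if "j \<le> d" for j
    using that
  proof (induction j)
    case 0
    have "diag_reps 0 t = {0}" "tuples 0 K1 = {0}" by (auto simp: diag_reps_iff funs_def prim_def)
    then show ?case by (simp add: ncosets_def cosets_def)
  next
    case (Suc j)
    have "?c (Suc j) = F (m - j) (col_sign th t j) (t j) * ?c j"
    proof (rule diag_reps_Suc_count)
      fix b assume b: "b \<in> diag_reps j t"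
      have tj: "t j \<in> \<O>" "t j \<notin> \<P>" using t Suc.prems by auto
      show "real (ncosets (extensions j t b) K1) = F (m - j) (col_sign th t j) (t j)"
        unfolding extensions_unit[OF b tj]
        by (rule fcount_perp_unit[OF b _ t(2) Q0]) (use Suc.prems d t(1) in auto)
    qed
    then show ?case using Suc by simp
  qed
  have "?c (d + r) = (\<Prod>j<d. F (m - j) (col_sign th t j) (t j)) * (\<Prod>r<r. q ^ r * F (m - d - 2 * r) (col_sign th t d) 0 - q ^ r)"
    if "r \<le> e" for r
    using that
  proof (induction r)
    case 0
    then show ?case using units by simp
  next
    case (Suc r)
    show ?case
    proof (cases "d + 2 * r \<le> m")
      case True
      have "?c (Suc (d + r)) = (q ^ r * F (m - d - 2 * r) (col_sign th t d) 0 - q ^ r) * ?c (d + r)"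
      proof (rule diag_reps_Suc_count)
        fix b assume b: "b \<in> diag_reps (d + r) t"
        have tr: "t (d + r) \<in> \<P>" using t(3) Suc.prems by simp
        have "fcount (perp (d + r) b) (t (d + r)) = q ^ r * F (m - d - 2 * r) (col_sign th t d) (t (d + r))"
          by (rule fcount_perp_isotropic[OF b _ t(2) _ Q0]) (use True Suc.prems t in auto)
        moreover have "F (m - d - 2 * r) (col_sign th t d) (t (d + r)) = F (m - d - 2 * r) (col_sign th t d) 0"
          using class_funD[OF class_fun_F, of "t (d + r)" 0] tr P_imp_O by simp
        ultimately show "real (ncosets (extensions (d + r) t b) K1) = q ^ r * F (m - d - 2 * r) (col_sign th t d) 0 - q ^ r"
          using extensions_isotropic[OF b tr _ t(2), of d] t(3) Suc.prems by simp
      qed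
      then show ?thesis using Suc by simp
    next
      \<comment> \<open>The subtraction \<open>m - d - 2 * r\<close> is truncated and no longer a
        dimension. An earlier factor has already vanished, so there is nothing left to extend and
        both sides are 0.\<close>
      case False
      then obtain r' where r': "r' < r" "F (m - d - 2 * r') (col_sign th t d) 0 = 1"
        using F_zero_factor[of "col_sign th t d" d m r] col_sign_cases[OF th t(2), of d] d by auto
      have z: "(\<Prod>r<r. q ^ r * F (m - d - 2 * r) (col_sign th t d) 0 - q ^ r) = 0"
        by (rule prod_zero) (use r' in auto)
      then have "?c (d + r) = 0" using Suc by simp
      moreover have "finite (cosets (diag_reps (d + r) t) (tuples (d + r) K1))"
        by (rule finite_cosets_tuples) (auto simp: diag_reps_iff)
      ultimately have "diag_reps (d + r) t = {}" by (auto simp: ncosets_def cosets_def)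
      then have "?c (Suc (d + r)) = 0 * ?c (d + r)" by (intro diag_reps_Suc_count) simp
      then show ?thesis using z by simp
    qed
  qed
  then show ?thesis by simp
qed

end

section \<open>Lattice bases\<close>

context quad_space begin

definition lin :: "nat \<Rightarrow> (nat \<Rightarrow> 'c) \<Rightarrow> (nat \<Rightarrow> 'a) \<Rightarrow> 'c" where
  "lin n f c = (\<Sum>i<n. s (c i) (f i))"

definition indep :: "nat \<Rightarrow> (nat \<Rightarrow> 'c) \<Rightarrow> bool" where
  "indep n f \<longleftrightarrow> (\<forall>c. lin n f c = 0 \<longrightarrow> (\<forall>i<n. c i = 0))"

definition olat :: "nat \<Rightarrow> (nat \<Rightarrow> 'c) \<Rightarrow> 'c set" where
  "olat n f = {lin n f c | c. \<forall>i<n. c i \<in> \<O>}"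

lemma lin_add: "lin n f c + lin n f d = lin n f (\<lambda>i. c i + d i)"
  and lin_diff: "lin n f c - lin n f d = lin n f (\<lambda>i. c i - d i)"
  and lin_scale: "s a (lin n f c) = lin n f (\<lambda>i. a * c i)"
  by (simp_all add: lin_def sum.distrib sum_subtractf vs.scale_left_distrib vs.scale_left_diff_distrib vs.scale_sum_right)

lemma lin_cong: "(\<And>i. i < n \<Longrightarrow> c i = d i) \<Longrightarrow> lin n f c = lin n f d"
  by (simp add: lin_def)

lemma lin_single: "i < n \<Longrightarrow> lin n f (\<lambda>j. if j = i then a else 0) = s a (f i)"
proof -
  assume i: "i < n"
  have "lin n f (\<lambda>j. if j = i then a else 0) = (\<Sum>j<n. if j = i then s a (f j) else 0)"
    unfolding lin_def by (rule sum.cong) auto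
  then show ?thesis using i by simp
qed

lemma lin_upd: assumes "p < n" shows "lin n (f(p := y)) c = lin n f (c(p := 0)) + s (c p) y"
proof -
  have "lin n (f(p := y)) c = s (c p) y + (\<Sum>i\<in>{..<n} - {p}. s (c i) ((f(p := y)) i))"
    unfolding lin_def using assms by (subst sum.remove[of _ p]) auto
  also have "(\<Sum>i\<in>{..<n} - {p}. s (c i) ((f(p := y)) i)) = (\<Sum>i\<in>{..<n} - {p}. s ((c(p := 0)) i) (f i))"
    by (rule sum.cong) auto
  also have "\<dots> = lin n f (c(p := 0))"
    unfolding lin_def using assms by (subst (2) sum.remove[of _ p]) auto
  finally show ?thesis by (simp add: add.commute fun_upd_def)
qed

lemma indep_eq: "indep n f \<Longrightarrow> lin n f c = lin n f d \<Longrightarrow> i < n \<Longrightarrow> c i = d i"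
  using lin_diff[of n f c d] by (auto simp: indep_def)

lemma olat_iff: "indep n f \<Longrightarrow> lin n f c \<in> olat n f \<longleftrightarrow> (\<forall>i<n. c i \<in> \<O>)"
  unfolding olat_def using indep_eq by fastforce

lemma olatI: "(\<And>i. i < n \<Longrightarrow> c i \<in> \<O>) \<Longrightarrow> lin n f c \<in> olat n f"
  by (auto simp: olat_def)

lemma basis_in_olat: "i < n \<Longrightarrow> f i \<in> olat n f"
  using lin_single[of i n f 1] olatI[of n "\<lambda>j. if j = i then 1 else 0" f] by simp

lemma osubmoduleD: assumes "osubmodule v s S"
  shows "0 \<in> S" "x \<in> S \<Longrightarrow> y \<in> S \<Longrightarrow> x + y \<in> S" "c \<in> \<O> \<Longrightarrow> x \<in> S \<Longrightarrow> s c x \<in> S"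
  using assms by (auto simp: osubmodule_def)

lemma osubmodule_diff: "osubmodule v s S \<Longrightarrow> x \<in> S \<Longrightarrow> y \<in> S \<Longrightarrow> x - y \<in> S"
  using osubmoduleD(2)[of S x "s (- 1) y"] osubmoduleD(3)[of S "- 1" y] by simp

lemma subgrp_osubmodule: "osubmodule v s S \<Longrightarrow> subgrp S"
  by (auto simp: subgrp_def osubmodule_diff osubmoduleD)

lemma osubmodule_olat: "osubmodule v s (olat n f)"
  unfolding osubmodule_def
proof (intro conjI ballI)
  have "lin n f (\<lambda>_. 0) \<in> olat n f" by (rule olatI) simp
  then show "0 \<in> olat n f" by (simp add: lin_def)
  fix x y assume "x \<in> olat n f" "y \<in> olat n f"
  then obtain c d where "x = lin n f c" "\<forall>i<n. c i \<in> \<O>" "y = lin n f d" "\<forall>i<n. d i \<in> \<O>" by (auto simp: olat_def)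
  then show "x + y \<in> olat n f" by (auto simp: lin_add intro!: olatI)
next
  fix a x assume "a \<in> \<O>" "x \<in> olat n f"
  then obtain c where "x = lin n f c" "\<forall>i<n. c i \<in> \<O>" by (auto simp: olat_def)
  then show "s a x \<in> olat n f" using \<open>a \<in> \<O>\<close> by (auto simp: lin_scale intro!: olatI)
qed

lemma lin_in_osubmodule:
  assumes "osubmodule v s S" "\<And>i. i < n \<Longrightarrow> f i \<in> S" "\<And>i. i < n \<Longrightarrow> c i \<in> \<O>" shows "lin n f c \<in> S"
  unfolding lin_def by (rule subgrp_sum[OF subgrp_osubmodule[OF assms(1)]]) (use assms osubmoduleD in auto)

text \<open>\<open>T\<close> converts coordinates for \<open>f'\<close> into coordinates for
  \<open>f\<close> and \<open>U\<close> converts back; since both preserve integrality, the two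
  lattices agree. This replaces the inversion of matrices.\<close>

lemma basis_change:
  assumes f: "indep n f"
    and T: "\<And>c. lin n f' c = lin n f (T c)" "\<And>c. \<forall>i<n. c i \<in> \<O> \<Longrightarrow> \<forall>i<n. T c i \<in> \<O>"
      "\<And>c. \<forall>i<n. T c i = 0 \<Longrightarrow> \<forall>i<n. c i = 0"
    and U: "\<And>c. lin n f c = lin n f' (U c)" "\<And>c. \<forall>i<n. c i \<in> \<O> \<Longrightarrow> \<forall>i<n. U c i \<in> \<O>"
  shows "indep n f'" "olat n f' = olat n f"
proof -
  show "indep n f'"
    unfolding indep_def
  proof (intro allI impI)
    fix c i assume "lin n f' c = 0" "i < n"
    then have "\<forall>i<n. T c i = 0" using f unfolding T(1) indep_def by blast
    then show "c i = 0" using T(3) \<open>i < n\<close> by blast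
  qed
  show "olat n f' = olat n f"
  proof (intro equalityI subsetI)
    fix x assume "x \<in> olat n f'"
    then obtain c where "x = lin n f' c" "\<forall>i<n. c i \<in> \<O>" by (auto simp: olat_def)
    then show "x \<in> olat n f" using T(2)[of c] unfolding T(1) olat_def by blast
  next
    fix x assume "x \<in> olat n f"
    then obtain c where "x = lin n f c" "\<forall>i<n. c i \<in> \<O>" by (auto simp: olat_def)
    then show "x \<in> olat n f'" using U(2)[of c] unfolding U(1) olat_def by blast
  qed
qed

lemma basis_replace:
  assumes f: "indep n f" and p: "p < n" and d: "\<And>i. i < n \<Longrightarrow> d i \<in> \<O>" "d p = 1"
  shows "lin n (f(p := lin n f d)) c = lin n f (\<lambda>i. (if i = p then 0 else c i) + c p * d i)"
    "indep n (f(p := lin n f d))" "olat n (f(p := lin n f d)) = olat n f"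
proof -
  let ?f' = "f(p := lin n f d)"
  define T where "T c i = (if i = p then 0 else c i) + c p * d i" for c i
  define U where "U c i = (if i = p then c p else c i - c p * d i)" for c i
  have T1: "lin n ?f' c = lin n f (T c)" for c
    unfolding lin_upd[OF p] lin_scale lin_add by (rule lin_cong) (simp add: T_def)
  then show "lin n ?f' c = lin n f (\<lambda>i. (if i = p then 0 else c i) + c p * d i)" by (simp add: T_def[abs_def])
  have TU: "T (U c) = c" for c using d(2) by (auto simp: T_def U_def fun_eq_iff)
  have T3: "\<forall>i<n. c i = 0" if "\<forall>i<n. T c i = 0" for c
  proof -
    have "T c p = c p" using d(2) by (simp add: T_def)
    then have "c p = 0" using that p by auto
    then show ?thesis using that by (auto simp: T_def split: if_splits)
  qed
  have T2: "\<forall>i<n. T c i \<in> \<O>" if "\<forall>i<n. c i \<in> \<O>" for c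
    using that p d(1) by (auto simp: T_def)
  have U1: "lin n f c = lin n ?f' (U c)" for c unfolding T1 TU ..
  have U2: "\<forall>i<n. U c i \<in> \<O>" if "\<forall>i<n. c i \<in> \<O>" for c
    using that p d(1) by (auto simp: U_def)
  show "indep n ?f'" "olat n ?f' = olat n f" using basis_change[OF f T1 T2 T3 U1 U2] by auto
qed

lemma basis_shear:
  assumes f: "indep n f" and p: "p < n" and a: "\<And>i. i < n \<Longrightarrow> a i \<in> \<O>" "a p = 0"
  shows "indep n (\<lambda>i. f i + s (a i) (f p))" "olat n (\<lambda>i. f i + s (a i) (f p)) = olat n f"
proof -
  let ?f' = "\<lambda>i. f i + s (a i) (f p)"
  define T where "T c i = c i + (if i = p then \<Sum>j<n. c j * a j else 0)" for c i
  define U where "U c i = c i - (if i = p then \<Sum>j<n. c j * a j else 0)" for c i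
  have T1: "lin n ?f' c = lin n f (T c)" for c
  proof -
    have "lin n ?f' c = lin n f c + s (\<Sum>j<n. c j * a j) (f p)"
      by (simp add: lin_def vs.scale_right_distrib sum.distrib vs.scale_sum_left)
    also have "\<dots> = lin n f (T c)"
      unfolding lin_single[OF p, symmetric] lin_add by (rule lin_cong) (simp add: T_def)
    finally show ?thesis .
  qed
  have sT: "(\<Sum>j<n. (c j + (if j = p then x else 0)) * a j) = (\<Sum>j<n. c j * a j)" for c x
    using a(2) by (intro sum.cong) auto
  have TU: "T (U c) = c" for c
  proof -
    have "(\<Sum>j<n. U c j * a j) = (\<Sum>j<n. c j * a j)"
      unfolding U_def using a(2) by (intro sum.cong) auto
    then show ?thesis by (auto simp: T_def U_def[of c] fun_eq_iff)
  qed
  have UT: "U (T c) = c" for c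
    using sT[of c "\<Sum>j<n. c j * a j"] by (auto simp: T_def U_def fun_eq_iff)
  have sO: "(\<Sum>j<n. c j * a j) \<in> \<O>" if "\<forall>i<n. c i \<in> \<O>" for c
    using that a(1) by (intro O_sum O_mult) auto
  have T2: "\<forall>i<n. T c i \<in> \<O>" if "\<forall>i<n. c i \<in> \<O>" for c
    using that sO[OF that] by (auto simp: T_def)
  have U2: "\<forall>i<n. U c i \<in> \<O>" if "\<forall>i<n. c i \<in> \<O>" for c
    using that sO[OF that] by (auto simp: U_def)
  have T3: "\<forall>i<n. c i = 0" if z: "\<forall>i<n. T c i = 0" for c
  proof -
    have "U (T c) i = 0" if "i < n" for i using z that by (simp add: U_def)
    then show ?thesis unfolding UT by blast
  qed
  have U1: "lin n f c = lin n ?f' (U c)" for c unfolding T1 TU ..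
  show "indep n ?f'" "olat n ?f' = olat n f" using basis_change[OF f T1 T2 T3 U1 U2] by auto
qed

lemma basis_permute:
  assumes f: "indep n f" and h: "bij_betw h {..<n} {..<n}"
  shows "indep n (\<lambda>i. f (h i))" "olat n (\<lambda>i. f (h i)) = olat n f"
proof -
  let ?f' = "\<lambda>i. f (h i)"
  define g where "g = inv_into {..<n} h"
  have hg: "h i < n" "g i < n" "h (g i) = i" "g (h i) = i" if "i < n" for i
    using h that bij_betw_inv_into_right[OF h, of i] bij_betw_inv_into_left[OF h, of i]
      bij_betwE[OF bij_betw_inv_into[OF h]] bij_betwE[OF h] by (auto simp: g_def)
  have T1: "lin n ?f' c = lin n f (\<lambda>i. c (g i))" for c
  proof -
    have "lin n f (\<lambda>i. c (g i)) = (\<Sum>i<n. s (c (g (h i))) (f (h i)))"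
      unfolding lin_def using sum.reindex_bij_betw[OF h, of "\<lambda>i. s (c (g i)) (f i)"] by simp
    also have "\<dots> = lin n ?f' c" unfolding lin_def using hg by (intro sum.cong) auto
    finally show ?thesis by simp
  qed
  have U1: "lin n f c = lin n ?f' (\<lambda>i. c (h i))" for c
    unfolding T1 using hg by (intro lin_cong) auto
  have T3: "\<forall>i<n. c i = 0" if "\<forall>i<n. c (g i) = 0" for c using that hg by metis
  show "indep n ?f'" "olat n ?f' = olat n f"
    using basis_change[OF f T1 _ T3 U1] hg by auto
qed

text \<open>A module between a free lattice and one of its multiples is adapted to some basis of the
  lattice: the next basis vector is read off a vector with a coordinate of least valuation.\<close>

lemma adapted_basis:
  assumes e: "indep n e" and S: "osubmodule v s S" "olat n e \<subseteq> S"
    and bound: "\<And>x. x \<in> S \<Longrightarrow> s (\<pi> ^ a) x \<in> olat n e" and span: "\<And>x. x \<in> S \<Longrightarrow> \<exists>c. x = lin n e c"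
  shows "\<exists>f k. indep n f \<and> olat n f = olat n e \<and> (\<forall>c. lin n f c \<in> S \<longleftrightarrow> (\<forall>i<n. c i * \<pi> ^ (k i) \<in> \<O>))"
proof -
  \<comment> \<open>The invariant \<open>good\<close> separates coordinates: those in
    \<open>J\<close> are subject to individual conditions, and the others, seen through
    \<open>mask J\<close>, still form an unknown module.\<close>
  define mask :: "nat set \<Rightarrow> (nat \<Rightarrow> 'a) \<Rightarrow> nat \<Rightarrow> 'a" where "mask J c = (\<lambda>i. if i \<in> J then 0 else c i)" for J c
  define good where "good J f k \<longleftrightarrow> indep n f \<and> olat n f = olat n e \<and>
    (\<forall>c. lin n f c \<in> S \<longleftrightarrow> (\<forall>i\<in>J. c i * \<pi> ^ (k i) \<in> \<O>) \<and> lin n f (mask J c) \<in> S)" for J f and k :: "nat \<Rightarrow> nat"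
  have "\<exists>J f k. J \<subseteq> {..<n} \<and> card J = r \<and> good J f k" if "r \<le> n" for r
    using that
  proof (induction r)
    case 0
    have "good {} e k" for k using e by (simp add: good_def mask_def)
    then show ?case by (intro exI[of _ "{}"]) auto
  next
    case (Suc r)
    then obtain J f k where J: "J \<subseteq> {..<n}" "card J = r" and Inv: "good J f k" by auto
    have f: "indep n f" and off: "olat n f = olat n e"
      and fS: "\<And>c. lin n f c \<in> S \<longleftrightarrow> (\<forall>i\<in>J. c i * \<pi> ^ (k i) \<in> \<O>) \<and> lin n f (mask J c) \<in> S"
      using Inv unfolding good_def by blast+
    have mm: "mask J (mask J c) = mask J c" for c by (auto simp: mask_def)
    define Q where "Q cp \<longleftrightarrow> (case cp of (c, p) \<Rightarrow> p < n \<and> p \<notin> J \<and> c p \<noteq> 0 \<and> lin n f (mask J c) \<in> S)" for cp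
    \<comment> \<open>By \<open>bound\<close> the shifted valuations are nonnegative, so a least one
      exists.\<close>
    define mu where "mu cp = (case cp of (c, p) \<Rightarrow> nat (v (c p) + int a))" for cp :: "(nat \<Rightarrow> 'a) \<times> nat"
    have Qv: "0 \<le> v (c p) + int a" if "Q (c, p)" for c p
    proof -
      have "lin n f (\<lambda>i. \<pi> ^ a * mask J c i) \<in> olat n f"
        using bound[of "lin n f (mask J c)"] that off by (simp add: Q_def lin_scale)
      then have "\<pi> ^ a * c p \<in> \<O>" using that unfolding olat_iff[OF f] by (auto simp: Q_def mask_def)
      then show ?thesis using that by (simp add: Q_def integers_def val_mult v_power v_pi)
    qed
    have "card J < card {..<n}" using J Suc.prems by simp
    then obtain p0 where p0: "p0 < n" "p0 \<notin> J" using J(1) by (metis lessThan_iff nat_neq_iff subsetI subset_antisym)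
    have Q1: "Q (\<lambda>j. if j = i then 1 else 0, i)" if "i < n" "i \<notin> J" for i
    proof -
      have "mask J (\<lambda>j. if j = i then 1 else 0) = (\<lambda>j. if j = i then 1 else 0)"
        using that by (auto simp: mask_def)
      then show ?thesis using that basis_in_olat[of i n f] S(2) off by (auto simp: Q_def lin_single)
    qed
    obtain cp where "Q cp" and cp: "\<And>y. Q y \<Longrightarrow> mu cp \<le> mu y"
      using ex_has_least_nat[of Q _ mu, OF Q1[OF p0]] by blast
    obtain c0 p where cp_def: "cp = (c0, p)" by (cases cp)
    have Qp: "Q (c0, p)" using \<open>Q cp\<close> cp_def by simp
    have p: "p < n" "p \<notin> J" "c0 p \<noteq> 0" "lin n f (mask J c0) \<in> S" using Qp by (auto simp: Q_def)
    have least: "c' p' / c0 p \<in> \<O>" if "Q (c', p')" for c' p'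
      using cp[OF that] Qv[OF that] Qv[OF Qp] p(3) that by (auto simp: cp_def mu_def integers_def v_divide Q_def)
    \<comment> \<open>The minimal vector divided by its coordinate of least valuation: integral by
      minimality and with coordinate 1 at \<open>p\<close>, so it can replace the basis vector
      \<open>f p\<close>.\<close>
    define d where "d i = mask J c0 i / c0 p" for i
    have dO: "d i \<in> \<O>" if "i < n" for i
    proof (cases "mask J c0 i = 0")
      case False
      then have "Q (mask J c0, i)" using that p mm by (auto simp: Q_def) (auto simp: mask_def)
      from least[OF this] show ?thesis by (simp add: d_def)
    qed (simp add: d_def)
    have dp: "d p = 1" using p by (simp add: d_def mask_def)
    have dJ: "d i = 0" if "i \<in> J" for i using that by (simp add: d_def mask_def)
    define y where "y = lin n f d"
    have xS: "s (c0 p) y \<in> S"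
      using p by (simp add: y_def lin_scale d_def)
    define kap where "kap = nat (- v (c0 p))"
    \<comment> \<open>The vector \<open>f p\<close> lies in \<open>S\<close> and competes with
      coordinate 1, so the least valuation is at most 0 and equals \<open>- kap\<close>.\<close>
    have "1 / c0 p \<in> \<O>" using least[OF Q1[OF p(1,2)]] by simp
    then have "v (c0 p) \<le> 0" using p(3) v_one by (simp add: integers_def v_divide)
    then have kap: "x * \<pi> ^ kap \<in> \<O> \<longleftrightarrow> x / c0 p \<in> \<O>" for x
      using p(3) by (cases "x = 0") (auto simp: integers_def val_mult v_power v_pi v_divide kap_def)
    define f' where "f' = f(p := y)"
    have f': "indep n f'" "olat n f' = olat n e" "\<And>c. lin n f' c = lin n f (\<lambda>i. (if i = p then 0 else c i) + c p * d i)"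
      unfolding f'_def y_def using basis_replace[of n f p d] f p(1) dO dp off by simp_all
    have "good (insert p J) f' (k(p := kap))"
      unfolding good_def
    proof (intro conjI allI f')
      fix c
      define Tc where "Tc = (\<lambda>i. (if i = p then 0 else c i) + c p * d i)"
      have TJ: "Tc i = c i" if "i \<in> J" for i using that p dJ by (auto simp: Tc_def)
      have mf: "lin n f' (mask (insert p J) c) = lin n f (mask (insert p J) c)"
        unfolding f' by (rule lin_cong) (auto simp: mask_def)
      have split: "lin n f (mask J Tc) = lin n f (mask (insert p J) c) + s (c p) y"
        unfolding y_def lin_scale lin_add by (rule lin_cong) (auto simp: mask_def Tc_def dJ)
      have "lin n f' c \<in> S \<longleftrightarrow> (\<forall>i\<in>J. c i * \<pi> ^ (k i) \<in> \<O>) \<and> lin n f (mask J Tc) \<in> S"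
        unfolding f'(3) Tc_def[symmetric] fS[of Tc] using TJ by simp
      also have "lin n f (mask J Tc) \<in> S \<longleftrightarrow> c p * \<pi> ^ kap \<in> \<O> \<and> lin n f' (mask (insert p J) c) \<in> S"
      proof
        assume *: "lin n f (mask J Tc) \<in> S"
        have cpO: "c p / c0 p \<in> \<O>"
        proof (cases "c p = 0")
          case False
          then have "Q (Tc, p)" using * p dp by (simp add: Q_def Tc_def)
          from least[OF this] show ?thesis using dp by (simp add: Tc_def)
        qed simp
        have "s (c p) y = s (c p / c0 p) (s (c0 p) y)" using p(3) by simp
        then have "s (c p) y \<in> S" using osubmoduleD(3)[OF S(1) cpO xS] by (simp only:)
        then have "lin n f (mask (insert p J) c) \<in> S"
          using osubmodule_diff[OF S(1) *, of "s (c p) y"] by (simp add: split)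
        then show "c p * \<pi> ^ kap \<in> \<O> \<and> lin n f' (mask (insert p J) c) \<in> S"
          using cpO by (simp add: mf kap)
      next
        assume *: "c p * \<pi> ^ kap \<in> \<O> \<and> lin n f' (mask (insert p J) c) \<in> S"
        then have cpO: "c p / c0 p \<in> \<O>" by (simp add: kap)
        have "s (c p) y = s (c p / c0 p) (s (c0 p) y)" using p(3) by simp
        then have "s (c p) y \<in> S" using osubmoduleD(3)[OF S(1) cpO xS] by (simp only:)
        then show "lin n f (mask J Tc) \<in> S" using * osubmoduleD(2)[OF S(1)] by (simp add: mf split)
      qed
      finally show "lin n f' c \<in> S \<longleftrightarrow> (\<forall>i\<in>insert p J. c i * \<pi> ^ ((k(p := kap)) i) \<in> \<O>) \<and> lin n f' (mask (insert p J) c) \<in> S"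
        using p(2) by auto
    qed
    moreover have "insert p J \<subseteq> {..<n}" "card (insert p J) = Suc r"
      using J p finite_subset[OF J(1)] by auto
    ultimately show ?case by blast
  qed
  from this[of n] obtain J f k where J: "J \<subseteq> {..<n}" "card J = n" and Inv: "good J f k" by auto
  have Jn: "J = {..<n}" using J by (intro card_subset_eq) auto
  have z: "lin n f (mask J c) = 0" for c unfolding lin_def mask_def Jn by (rule sum.neutral) auto
  then have "lin n f c \<in> S \<longleftrightarrow> (\<forall>i<n. c i * \<pi> ^ (k i) \<in> \<O>)" for c
  proof -
    have "lin n f c \<in> S \<longleftrightarrow> (\<forall>i\<in>J. c i * \<pi> ^ (k i) \<in> \<O>) \<and> lin n f (mask J c) \<in> S"
      using Inv unfolding good_def by blast
    then show ?thesis using z osubmoduleD(1)[OF S(1)] Jn by auto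
  qed
  moreover have "indep n f" "olat n f = olat n e" using Inv unfolding good_def by blast+
  ultimately show ?thesis by blast
qed

text \<open>The Jordan splitting, which reaches blocks of rank one because 2 is a unit.
  \<open>J\<close> collects the indices whose vectors are already orthogonal to all the
  others.\<close>

lemma orthogonal_basis:
  assumes e: "indep n e" and nondeg: "\<And>c. (\<And>i. i < n \<Longrightarrow> B (lin n e c) (e i) = 0) \<Longrightarrow> lin n e c = 0"
  shows "\<exists>f. indep n f \<and> olat n f = olat n e \<and> (\<forall>i<n. \<forall>j<n. i \<noteq> j \<longrightarrow> B (f i) (f j) = 0)"
proof -
  define good where "good J f \<longleftrightarrow> indep n f \<and> olat n f = olat n e \<and> (\<forall>i\<in>J. \<forall>j<n. i \<noteq> j \<longrightarrow> B (f i) (f j) = 0)" for J f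
  have "\<exists>J f. J \<subseteq> {..<n} \<and> card J = r \<and> good J f" if "r \<le> n" for r
    using that
  proof (induction r)
    case 0
    show ?case using e by (intro exI[of _ "{}"] exI[of _ e]) (auto simp: good_def)
  next
    case (Suc r)
    then obtain J f where J: "J \<subseteq> {..<n}" "card J = r" and Inv: "good J f" by auto
    have f: "indep n f" and off: "olat n f = olat n e" and fJ: "\<And>i j. i \<in> J \<Longrightarrow> j < n \<Longrightarrow> i \<noteq> j \<Longrightarrow> B (f i) (f j) = 0"
      using Inv by (auto simp: good_def)
    have "card J < card {..<n}" using J Suc.prems by simp
    then obtain p0 where p0: "p0 < n" "p0 \<notin> J" using J(1) by (metis lessThan_iff nat_neq_iff subsetI subset_antisym)
    \<comment> \<open>The candidates for a pivot: nonzero entries of the Gram matrix outside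
      \<open>J\<close>. There are some, since otherwise \<open>f p0\<close> would be orthogonal to
      the whole space.\<close>
    define C where "C = {(i, k). i \<in> {..<n} - J \<and> k \<in> {..<n} - J \<and> B (f i) (f k) \<noteq> 0}"
    have "C \<noteq> {}"
    proof
      assume "C = {}"
      then have z: "B (f p0) (f k) = 0" if "k < n" for k
        using p0 that fJ[of k p0] B_sym[of "f p0" "f k"] by (cases "k \<in> J") (auto simp: C_def)
      have "B (f p0) x = 0" if "x \<in> olat n f" for x
        using that z by (auto simp: olat_def lin_def B_sum B_scale_right)
      then have "B (f p0) (e i) = 0" if "i < n" for i using basis_in_olat[OF that, of e] off by auto
      moreover have "f p0 \<in> olat n e" using basis_in_olat[OF p0(1), of f] off by simp
      ultimately have "f p0 = 0" using nondeg by (auto simp: olat_def)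
      then have "lin n f (\<lambda>j. if j = p0 then 1 else 0) = 0" using lin_single[OF p0(1), of f 1] by simp
      then have "(if p0 = p0 then 1 else 0 :: 'a) = 0" using f p0(1) unfolding indep_def by blast
      then show False by simp
    qed
    moreover have "finite C" by (rule finite_subset[of _ "{..<n} \<times> {..<n}"]) (auto simp: C_def)
    ultimately obtain ik where "is_arg_min (\<lambda>(i, k). v (B (f i) (f k))) (\<lambda>x. x \<in> C) ik"
      using ex_is_arg_min_if_finite by blast
    then have ik: "ik \<in> C" "\<And>jl. jl \<in> C \<Longrightarrow> (case ik of (i, k) \<Rightarrow> v (B (f i) (f k))) \<le> (case jl of (i, k) \<Rightarrow> v (B (f i) (f k)))"
      unfolding is_arg_min_linorder by blast+
    obtain i k where ikd: "ik = (i, k)" by (cases ik)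
    define b where "b = B (f i) (f k)"
    have i: "i < n" "i \<notin> J" and k: "k < n" "k \<notin> J" and b: "b \<noteq> 0" using ik(1) by (auto simp: ikd C_def b_def)
    have bO: "B (f j) (f l) / b \<in> \<O>" if "j < n" "j \<notin> J" "l < n" "l \<notin> J" for j l
    proof (cases "B (f j) (f l) = 0")
      case False
      then show ?thesis using ik(2)[of "(j, l)"] that b by (auto simp: ikd C_def b_def[symmetric] integers_def v_divide)
    qed simp
    have "\<exists>f' p. good J f' \<and> p < n \<and> p \<notin> J \<and> B (f' p) (f' p) \<noteq> 0 \<and> (\<forall>j<n. j \<notin> J \<longrightarrow> B (f' j) (f' p) / B (f' p) (f' p) \<in> \<O>)"
    proof (cases "B (f i) (f i) / b \<notin> \<P> \<or> B (f k) (f k) / b \<notin> \<P>")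
      case True
      then obtain p where p: "p < n" "p \<notin> J" "B (f p) (f p) / b \<notin> \<P>" using i k by blast
      have "B (f j) (f p) / B (f p) (f p) \<in> \<O>" if "j < n" "j \<notin> J" for j
      proof -
        have "(B (f j) (f p) / b) / (B (f p) (f p) / b) \<in> \<O>"
          by (rule unit_divide) (use that p bO in auto)
        then show ?thesis using b by simp
      qed
      moreover have "B (f p) (f p) \<noteq> 0" using p(3) by auto
      ultimately show ?thesis using Inv p by blast
    next
      \<comment> \<open>Only the off-diagonal entry \<open>b\<close> has least valuation here. Then
        \<open>f i + f k\<close> has length \<open>b\<close> times a unit congruent to 2, and serves
        as the pivot.\<close>
      case False
      then have ii: "B (f i) (f i) / b \<in> \<P>" and kk: "B (f k) (f k) / b \<in> \<P>" by auto
      have ne: "i \<noteq> k" using ii b by (auto simp: b_def)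
      define d where "d = (\<lambda>j. if j = i \<or> j = k then 1 else (0::'a))"
      have ld: "lin n f d = f i + f k"
      proof -
        have "lin n f d = lin n f (\<lambda>j. (if j = i then 1 else 0) + (if j = k then 1 else 0))"
          by (rule lin_cong) (use ne in \<open>auto simp: d_def\<close>)
        then show ?thesis unfolding lin_add[symmetric] using i k by (simp add: lin_single)
      qed
      define f' where "f' = f(i := lin n f d)"
      have f'b: "indep n f'" "olat n f' = olat n f"
        using basis_replace(2,3)[OF f i(1), of d] by (auto simp: f'_def d_def)
      have f'j: "f' j = f j" if "j \<noteq> i" for j using that by (simp add: f'_def)
      have f'i: "f' i = f i + f k" by (simp add: f'_def ld)
      have "good J f'"
        unfolding good_def
      proof (intro conjI ballI allI impI)
        fix j l assume jl: "j \<in> J" "l < n" "j \<noteq> l"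
        then have ji: "j \<noteq> i" "j \<noteq> k" using i k by auto
        show "B (f' j) (f' l) = 0"
          using jl ji fJ[of j l] fJ[of j i] fJ[of j k] i k by (cases "l = i") (auto simp: f'i f'j B_add_right)
      qed (use f'b off in auto)
      moreover have Bi: "B (f' i) (f' i) = b * (2 + (B (f i) (f i) / b + B (f k) (f k) / b))"
        using b B_sym[of "f k" "f i"] by (simp add: f'i B_add B_add_right b_def field_simps)
      have u: "2 + (B (f i) (f i) / b + B (f k) (f k) / b) \<in> \<O>" "2 + (B (f i) (f i) / b + B (f k) (f k) / b) \<notin> \<P>"
      proof -
        have s: "B (f i) (f i) / b + B (f k) (f k) / b \<in> \<P>" using ii kk by auto
        show "2 + (B (f i) (f i) / b + B (f k) (f k) / b) \<in> \<O>" using P_imp_O[OF s] by auto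
        show "2 + (B (f i) (f i) / b + B (f k) (f k) / b) \<notin> \<P>"
          using P_diff[OF _ s, of "2 + (B (f i) (f i) / b + B (f k) (f k) / b)"] two_notin_P by (auto simp del: add_divide_distrib)
      qed
      moreover have "B (f' j) (f' i) / B (f' i) (f' i) \<in> \<O>" if j: "j < n" "j \<notin> J" for j
      proof (cases "j = i")
        case True
        then show ?thesis by (cases "B (f' i) (f' i) = 0") auto
      next
        case False
        have "(B (f j) (f i) / b + B (f j) (f k) / b) / (2 + (B (f i) (f i) / b + B (f k) (f k) / b)) \<in> \<O>"
          by (rule unit_divide[OF O_add]) (use j i k bO u in auto)
        moreover have "B (f' j) (f' i) = b * (B (f j) (f i) / b + B (f j) (f k) / b)"
          using False b by (simp add: f'i f'j B_add_right distrib_left)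
        ultimately show ?thesis using b unfolding Bi by simp
      qed
      moreover have "B (f' i) (f' i) \<noteq> 0" unfolding Bi using b unit_nz[OF u(2)] by simp
      ultimately show ?thesis using i by blast
    qed
    then obtain f' p where Inv2: "good J f'" and p: "p < n" "p \<notin> J" "B (f' p) (f' p) \<noteq> 0"
      and pO: "\<And>j. j < n \<Longrightarrow> j \<notin> J \<Longrightarrow> B (f' j) (f' p) / B (f' p) (f' p) \<in> \<O>" by blast
    have f': "indep n f'" "olat n f' = olat n e" "\<And>i j. i \<in> J \<Longrightarrow> j < n \<Longrightarrow> i \<noteq> j \<Longrightarrow> B (f' i) (f' j) = 0"
      using Inv2 by (auto simp: good_def)
    \<comment> \<open>Projection away from the pivot \<open>f' p\<close>; the coefficients are
      integral by the choice of the pivot, so the lattice is unchanged.\<close>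
    define a where "a j = (if j \<in> J \<or> j = p then 0 else - (B (f' j) (f' p) / B (f' p) (f' p)))" for j
    define g where "g j = f' j + s (a j) (f' p)" for j
    have g: "indep n g" "olat n g = olat n e"
      using basis_shear[OF f'(1) p(1), of a] pO f'(2) by (auto simp: a_def g_def[abs_def])
    have gJ: "g j = f' j" if "j \<in> J \<or> j = p" for j using that by (simp add: g_def a_def)
    have "B (g i) (g j) = 0" if ij: "i \<in> insert p J" "j < n" "i \<noteq> j" for i j
    proof -
      have gp: "B (f' p) (g j) = 0" if "j < n" "j \<noteq> p" for j
      proof (cases "j \<in> J")
        case True
        then show ?thesis using f'(3)[of j p] p that B_sym[of "f' p" "f' j"] by (simp add: gJ)
      next
        case False
        then show ?thesis using that p B_sym[of "f' p" "f' j"] by (simp add: g_def a_def B_add_right B_diff B_scale_right)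
      qed
      show ?thesis
      proof (cases "i = p")
        case True
        then show ?thesis using gp[of j] ij by (simp add: gJ)
      next
        case False
        then have iJ: "i \<in> J" using ij by simp
        have "B (f' i) (f' p) = 0" using f'(3)[OF iJ p(1)] False by simp
        then show ?thesis using f'(3)[OF iJ ij(2,3)] iJ by (simp add: gJ g_def[of j] B_add_right B_scale_right)
      qed
    qed
    then have "good (insert p J) g" using g by (auto simp: good_def)
    moreover have "insert p J \<subseteq> {..<n}" "card (insert p J) = Suc r"
      using J p finite_subset[OF J(1)] by auto
    ultimately show ?case by blast
  qed
  from this[of n] obtain J f where J: "J \<subseteq> {..<n}" "card J = n" and Inv: "good J f" by auto
  have "J = {..<n}" using J by (intro card_subset_eq) auto
  then show ?thesis using Inv by (auto simp: good_def)
qed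

end

section \<open>Rank, length, type and sign\<close>

lemma det_mat_diag: "det (mat n n (\<lambda>(i, j). if i = j then d i else 0)) = (\<Prod>i<n. d i :: 'a::comm_ring_1)"
proof -
  let ?A = "mat n n (\<lambda>(i, j). if i = j then d i else 0)"
  have "det ?A = prod_list (diag_mat ?A)" by (rule det_upper_triangular[of _ n]) auto
  also have "diag_mat ?A = map d [0..<n]" by (auto simp: diag_mat_def)
  also have "prod_list (map d [0..<n]) = (\<Prod>i<n. d i)"
    by (metis atLeast_upt prod.distinct_set_conv_list distinct_upt)
  finally show ?thesis .
qed

context odd_local_field begin

lemma prod_O: "(\<And>i. i \<in> S \<Longrightarrow> f i \<in> \<O>) \<Longrightarrow> prod f S \<in> \<O>"
  by (induction S rule: infinite_finite_induct) auto

lemma prod_cong_P: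
  assumes "finite S" "\<And>i. i \<in> S \<Longrightarrow> x i \<in> \<O>" "\<And>i. i \<in> S \<Longrightarrow> y i \<in> \<O>" "\<And>i. i \<in> S \<Longrightarrow> x i - y i \<in> \<P>"
  shows "prod x S - prod y S \<in> \<P>"
  using assms
proof (induction S rule: finite_induct)
  case (insert a S)
  have "prod x (insert a S) - prod y (insert a S) = x a * (prod x S - prod y S) + (x a - y a) * prod y S"
    using insert by (simp add: algebra_simps)
  moreover have "x a * (prod x S - prod y S) \<in> \<P>" using insert by (intro P_mult_left) auto
  moreover have "prod y S \<in> \<O>" using insert by (intro prod_O) auto
  then have "(x a - y a) * prod y S \<in> \<P>" using insert by (intro P_mult_right) auto
  ultimately show ?case by auto
qed auto

lemma prod_notin_P: "(\<And>i. i \<in> S \<Longrightarrow> x i \<in> \<O> \<and> x i \<notin> \<P>) \<Longrightarrow> prod x S \<in> \<O> \<and> prod x S \<notin> \<P>"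
  by (induction S rule: infinite_finite_induct) (auto simp: P_mult_iff)

lemma det_O: assumes "A \<in> carrier_mat n n" "\<And>i j. i < n \<Longrightarrow> j < n \<Longrightarrow> A $$ (i, j) \<in> \<O>" shows "det A \<in> \<O>"
  unfolding det_def'[OF assms(1)]
proof (rule O_sum)
  fix p assume "p \<in> {p. p permutes {0..<n}}"
  then have p: "p permutes {0..<n}" by simp
  have "(\<Prod>i = 0..<n. A $$ (i, p i)) \<in> \<O>"
    using assms(2) permutes_in_image[OF p] by (intro prod_O) auto
  moreover have "(signof p :: 'a) \<in> \<O>" by (simp add: sign_def)
  ultimately show "signof p * (\<Prod>i = 0..<n. A $$ (i, p i)) \<in> \<O>" by auto
qed

lemma det_cong_P:
  assumes A: "A \<in> carrier_mat n n" "A' \<in> carrier_mat n n"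
    and AO: "\<And>i j. i < n \<Longrightarrow> j < n \<Longrightarrow> A $$ (i, j) \<in> \<O>" "\<And>i j. i < n \<Longrightarrow> j < n \<Longrightarrow> A' $$ (i, j) \<in> \<O>"
    and AP: "\<And>i j. i < n \<Longrightarrow> j < n \<Longrightarrow> A $$ (i, j) - A' $$ (i, j) \<in> \<P>"
  shows "det A - det A' \<in> \<P>"
  unfolding det_def'[OF A(1)] det_def'[OF A(2)] sum_subtractf[symmetric] right_diff_distrib[symmetric]
proof (rule P_sum, rule P_mult_left)
  fix p assume "p \<in> {p. p permutes {0..<n}}"
  then have p: "p permutes {0..<n}" by simp
  show "(signof p :: 'a) \<in> \<O>" by (simp add: sign_def)
  show "(\<Prod>i = 0..<n. A $$ (i, p i)) - (\<Prod>i = 0..<n. A' $$ (i, p i)) \<in> \<P>"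
    using AO AP permutes_in_image[OF p] by (intro prod_cong_P) auto
qed

lemma chi_pow: "x \<in> \<O> \<Longrightarrow> \<chi> (x ^ n) = \<chi> x ^ n"
  by (induction n) (simp_all add: chi_mult O_power)

lemma chi_prod: "finite S \<Longrightarrow> (\<And>i. i \<in> S \<Longrightarrow> f i \<in> \<O>) \<Longrightarrow> \<chi> (prod f S) = (\<Prod>i\<in>S. \<chi> (f i))"
  by (induction S rule: finite_induct) (auto simp: chi_mult prod_O)

lemma chi_eq_residue_symbol: "\<chi> x = \<chi> y \<longleftrightarrow> residue_symbol v x = residue_symbol v y"
  by (simp add: chi_def)

end

context quad_space begin

section \<open>Rank and length\<close>

lemma span_olat: "vs.span (olat n e) = range (lin n e)"
proof
  show "vs.span (olat n e) \<subseteq> range (lin n e)"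
  proof (rule vs.span_minimal)
    have "0 = lin n e (\<lambda>_. 0)" by (simp add: lin_def)
    then show "vs.subspace (range (lin n e))"
      unfolding vs.subspace_def by (auto simp: lin_add lin_scale)
  qed (auto simp: olat_def)
  have "lin n e c \<in> vs.span (olat n e)" for c
    unfolding lin_def by (intro vs.span_sum vs.span_scale vs.span_base basis_in_olat) auto
  then show "range (lin n e) \<subseteq> vs.span (olat n e)" by blast
qed

lemma dim_olat: assumes e: "indep n e" shows "vs.dim (olat n e) = n"
proof -
  have inj: "inj_on e {..<n}"
  proof (rule inj_onI)
    fix i j assume ij: "i \<in> {..<n}" "j \<in> {..<n}" "e i = e j"
    then have "lin n e (\<lambda>k. if k = i then 1 else 0) = lin n e (\<lambda>k. if k = j then 1 else 0)"
      by (simp add: lin_single)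
    from indep_eq[OF e this, of i] show "i = j" using ij by (auto split: if_splits)
  qed
  have "vs.independent (e ` {..<n})"
  proof (rule vs.independent_if_scalars_zero)
    fix u x assume *: "(\<Sum>x\<in>e ` {..<n}. s (u x) x) = 0" "x \<in> e ` {..<n}"
    then have "lin n e (\<lambda>i. u (e i)) = 0" by (simp add: sum.reindex[OF inj] lin_def)
    then show "u x = 0" using e *(2) unfolding indep_def by auto
  qed simp
  moreover have "e ` {..<n} \<subseteq> olat n e" using basis_in_olat by auto
  moreover have "olat n e \<subseteq> vs.span (e ` {..<n})"
    unfolding olat_def lin_def by (auto intro!: vs.span_sum vs.span_scale intro: vs.span_base)
  ultimately have "vs.dim (olat n e) = card (e ` {..<n})" by (metis vs.dim_unique)
  then show ?thesis using card_image[OF inj] by simp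
qed

lemma count_dilated_O: "real (ncosets {x. x * \<pi> ^ k \<in> \<O>} \<O>) = q ^ k" "finite (cosets {x. x * \<pi> ^ k \<in> \<O>} \<O>)"
proof -
  have "x * \<pi> ^ k - y * \<pi> ^ k \<in> \<I> k \<longleftrightarrow> x - y \<in> \<O>" for x y
    using I_pow_mult[of k "x - y" 0] by (simp add: I_0 algebra_simps)
  moreover have "\<exists>x\<in>{x. x * \<pi> ^ k \<in> \<O>}. x * \<pi> ^ k - b \<in> \<I> k" if "b \<in> \<O>" for b
    using that by (intro bexI[of _ "b / \<pi> ^ k"]) auto
  ultimately have "ncosets {x. x * \<pi> ^ k \<in> \<O>} \<O> = ncosets (\<I> 0) (\<I> (0 + k))"
     "finite (cosets {x. x * \<pi> ^ k \<in> \<O>} \<O>) = finite (cosets (\<I> 0) (\<I> (0 + k)))"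
    using ncosets_iso[of \<O> "\<I> k" "{x. x * \<pi> ^ k \<in> \<O>}" "\<lambda>x. x * \<pi> ^ k" \<O>] by (auto simp: I_0)
  then show "real (ncosets {x. x * \<pi> ^ k \<in> \<O>} \<O>) = q ^ k" "finite (cosets {x. x * \<pi> ^ k \<in> \<O>} \<O>)"
    using cosets_I[of 0 k] by auto
qed

text \<open>In coordinates with respect to a basis, a set given by separate conditions on the
  coordinates is a product, and its count factors.\<close>

lemma lin_coords_iso:
  assumes f: "indep n f" and A: "\<And>x. x \<in> A \<longleftrightarrow> (\<exists>c. x = lin n f c \<and> (\<forall>i<n. c i \<in> X i))"
     and K: "\<And>c. lin n f c \<in> K \<longleftrightarrow> (\<forall>i<n. c i \<in> Y i)" "subgrp K" and Y: "\<And>i. i < n \<Longrightarrow> subgrp (Y i)"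
  shows "ncosets A K = (\<Prod>i<n. ncosets (X i) (Y i))" "(\<And>i. i < n \<Longrightarrow> finite (cosets (X i) (Y i))) \<Longrightarrow> finite (cosets A K)"
proof -
  have sY: "subgrp (funs {..<n} Y)" using Y by (intro subgrp_funs) auto
  have 1: "lin n f c \<in> A" if "c \<in> funs {..<n} X" for c using that A by (auto simp: funs_def)
  have 2: "lin n f c - lin n f d \<in> K \<longleftrightarrow> c - d \<in> funs {..<n} Y" if "c \<in> funs {..<n} X" "d \<in> funs {..<n} X" for c d
    unfolding lin_diff K using that by (auto simp: funs_def)
  have 3: "\<exists>c\<in>funs {..<n} X. lin n f c - b \<in> K" if bA: "b \<in> A" for b
  proof -
    obtain c where c: "b = lin n f c" "\<forall>i<n. c i \<in> X i" using bA A by auto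
    have "lin n f (\<lambda>i. if i < n then c i else 0) = b" unfolding c(1) by (rule lin_cong) simp
    then show ?thesis using c subgrp_zero[OF K(2)]
      by (intro bexI[of _ "\<lambda>i. if i < n then c i else 0"]) (auto simp: funs_def)
  qed
  note iso = ncosets_iso[OF sY K(2) 1 2 3]
  show "ncosets A K = (\<Prod>i<n. ncosets (X i) (Y i))"
    using iso(1) ncosets_funs(1)[of "{..<n}" Y X] Y by simp
  show "finite (cosets A K)" if "\<And>i. i < n \<Longrightarrow> finite (cosets (X i) (Y i))"
    using iso(2) ncosets_funs(2)[of "{..<n}" Y X] Y that by simp
qed

text \<open>The lattice with basis \<open>\<pi>^(- k i) f i\<close>, given by conditions on the
  coordinates with respect to \<open>f\<close>.\<close>

definition dilate :: "nat \<Rightarrow> (nat \<Rightarrow> 'c) \<Rightarrow> (nat \<Rightarrow> nat) \<Rightarrow> 'c set" where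
  "dilate n f k = {lin n f c | c. \<forall>i<n. c i * \<pi> ^ (k i) \<in> \<O>}"

lemma osubmodule_dilate: "osubmodule v s (dilate n f k)"
  unfolding osubmodule_def
proof (intro conjI ballI)
  have "0 = lin n f (\<lambda>_. 0)" by (simp add: lin_def)
  then show "0 \<in> dilate n f k" unfolding dilate_def by force
  fix x y assume "x \<in> dilate n f k" "y \<in> dilate n f k"
  then obtain c d where "x = lin n f c" "\<forall>i<n. c i * \<pi> ^ (k i) \<in> \<O>" "y = lin n f d" "\<forall>i<n. d i * \<pi> ^ (k i) \<in> \<O>"
    by (auto simp: dilate_def)
  then show "x + y \<in> dilate n f k" unfolding dilate_def lin_add
    by (intro CollectI exI[of _ "\<lambda>i. c i + d i"]) (auto simp: distrib_right lin_add)
next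
  fix a x assume "a \<in> \<O>" "x \<in> dilate n f k"
  then obtain c where "x = lin n f c" "\<forall>i<n. c i * \<pi> ^ (k i) \<in> \<O>" by (auto simp: dilate_def)
  then show "s a x \<in> dilate n f k" using \<open>a \<in> \<O>\<close> unfolding dilate_def
    by (intro CollectI exI[of _ "\<lambda>i. a * c i"]) (auto simp: lin_scale mult.assoc)
qed

lemma dilate_iff:
  assumes f: "indep n f" shows "lin n f c \<in> dilate n f k \<longleftrightarrow> (\<forall>i<n. c i * \<pi> ^ (k i) \<in> \<O>)"
proof
  assume "lin n f c \<in> dilate n f k"
  then obtain d where d: "lin n f c = lin n f d" "\<forall>i<n. d i * \<pi> ^ (k i) \<in> \<O>" by (auto simp: dilate_def)
  then show "\<forall>i<n. c i * \<pi> ^ (k i) \<in> \<O>" using indep_eq[OF f d(1)] by simp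
qed (auto simp: dilate_def)

lemma count_dilate:
  assumes f: "indep n f"
  shows "real (ncosets (dilate n f k) (olat n f)) = q ^ (\<Sum>i<n. k i)" "finite (cosets (dilate n f k) (olat n f))"
proof -
  have A: "x \<in> dilate n f k \<longleftrightarrow> (\<exists>c. x = lin n f c \<and> (\<forall>i<n. c i \<in> {x. x * \<pi> ^ (k i) \<in> \<O>}))" for x
    by (auto simp: dilate_def)
  have K: "lin n f c \<in> olat n f \<longleftrightarrow> (\<forall>i<n. c i \<in> \<O>)" for c by (rule olat_iff[OF f])
  note iso = lin_coords_iso[OF f A K subgrp_osubmodule[OF osubmodule_olat]]
  show "real (ncosets (dilate n f k) (olat n f)) = q ^ (\<Sum>i<n. k i)"
    using iso(1) by (simp add: count_dilated_O power_sum)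
  show "finite (cosets (dilate n f k) (olat n f))" using iso(2) count_dilated_O by simp
qed

lemma ncosets_self: "subgrp K \<Longrightarrow> ncosets K K = 1"
proof -
  assume K: "subgrp K"
  have "(+) x ` K = K" if "x \<in> K" for x using coset_eq_iff[OF K, of x 0] that by simp
  then have "cosets K K = {K}" unfolding cosets_def using subgrp_zero[OF K] by auto
  then show ?thesis by (simp add: ncosets_def)
qed

text \<open>For \<open>x\<close> in \<open>A\<close> but not in \<open>C\<close>, the multiples
  \<open>r x\<close> with \<open>r \<in> \<R>\<close> are pairwise incongruent modulo
  \<open>C\<close>: a difference of two representatives is a unit and could be cancelled.\<close>

lemma index_ge_q:
  assumes A: "osubmodule v s A" and C: "osubmodule v s C" and L: "osubmodule v s L" "L \<subseteq> C"
    and strict: "C \<subset> A" and fin: "finite (cosets A L)"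
  shows "q * real (ncosets C L) \<le> real (ncosets A L)"
proof -
  note sC = subgrp_osubmodule[OF C]
  have idx: "ncosets A L = ncosets C L * ncosets A C"
    by (rule ncosets_index[OF sC subgrp_osubmodule[OF L(1)] L(2) fin]) (use osubmoduleD(2)[OF A] strict in blast)
  have "cosets A L \<noteq> {}" using osubmoduleD(1)[OF A] by (auto simp: cosets_def)
  then have "0 < ncosets A L" using fin by (simp add: ncosets_def card_gt_0_iff)
  then have "0 < ncosets A C" unfolding idx by simp
  then have finC: "finite (cosets A C)" by (simp add: ncosets_def card_ge_0_finite)
  obtain x where x: "x \<in> A" "x \<notin> C" using strict by blast
  have "inj_on (\<lambda>r. (+) (s r x) ` C) \<R>"
  proof (rule inj_onI)
    fix a b assume ab: "a \<in> \<R>" "b \<in> \<R>" "(+) (s a x) ` C = (+) (s b x) ` C"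
    then have d: "s (a - b) x \<in> C" unfolding coset_eq_iff[OF sC] by (simp add: vs.scale_left_diff_distrib)
    have "a - b \<in> \<P>"
    proof (rule ccontr)
      assume nP: "a - b \<notin> \<P>"
      then have "inverse (a - b) \<in> \<O>" using ab R_O by (intro unit_inverse) auto
      then have "s (inverse (a - b)) (s (a - b) x) \<in> C" using osubmoduleD(3)[OF C] d by blast
      then show False using x unit_nz[OF nP] by simp
    qed
    then show "a = b" using ab R_eq by blast
  qed
  then have "card \<R> = card ((\<lambda>r. (+) (s r x) ` C) ` \<R>)" by (simp add: card_image)
  also have "\<dots> \<le> card (cosets A C)"
    using finC x osubmoduleD(3)[OF A] R_O by (intro card_mono) (auto simp: cosets_def)
  finally have "q \<le> real (ncosets A C)" using card_R by (simp add: ncosets_def)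
  then show ?thesis unfolding idx using mult_right_mono[of q "real (ncosets A C)" "real (ncosets C L)"]
    by (simp add: mult.commute)
qed

text \<open>A chain of the asserted length arises by lowering one exponent by 1 at a time. No chain
  is longer, since each strict step multiplies the index by at least \<open>q\<close> and the total
  index is \<open>q\<close> to the sum of the exponents. Composition series are thus
  avoided.\<close>

lemma quot_length_dilate:
  assumes f: "indep n f"
  shows "quot_length v s (dilate n f k) (olat n f) = (\<Sum>i<n. k i)"
  unfolding quot_length_def
proof (rule Greatest_equality)
  show "\<exists>C. C 0 = olat n f \<and> C (\<Sum>i<n. k i) = dilate n f k \<and> (\<forall>i\<le>\<Sum>i<n. k i. osubmodule v s (C i)) \<and>
     (\<forall>i<\<Sum>i<n. k i. C i \<subset> C (Suc i))"
  proof (induction "\<Sum>i<n. k i" arbitrary: k)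
    case 0
    then have "dilate n f k = olat n f" by (auto simp: dilate_def olat_def)
    then show ?case using 0 osubmodule_olat by (intro exI[of _ "\<lambda>_. olat n f"]) auto
  next
    case (Suc l)
    then obtain p where p: "p < n" "k p \<noteq> 0" by (metis lessThan_iff nat.distinct(1) sum.neutral)
    define k' where "k' = k(p := k p - 1)"
    have "(\<Sum>i<n. k i) = k p + (\<Sum>i\<in>{..<n} - {p}. k i)" using p by (subst sum.remove[of _ p]) auto
    moreover have "(\<Sum>i<n. k' i) = k' p + (\<Sum>i\<in>{..<n} - {p}. k' i)" using p by (subst sum.remove[of _ p]) auto
    moreover have "(\<Sum>i\<in>{..<n} - {p}. k' i) = (\<Sum>i\<in>{..<n} - {p}. k i)" by (rule sum.cong) (auto simp: k'_def)
    ultimately have l: "l = (\<Sum>i<n. k' i)" using Suc.hyps(2) p by (simp add: k'_def)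
    obtain C where C: "C 0 = olat n f" "C l = dilate n f k'" "\<And>i. i \<le> l \<Longrightarrow> osubmodule v s (C i)"
      "\<And>i. i < l \<Longrightarrow> C i \<subset> C (Suc i)"
      using Suc.hyps(1)[OF l] unfolding l[symmetric] by blast
    have "dilate n f k' \<subset> dilate n f k"
    proof
      show "dilate n f k' \<subseteq> dilate n f k"
      proof
        fix x assume "x \<in> dilate n f k'"
        then obtain c where c: "x = lin n f c" "\<forall>i<n. c i * \<pi> ^ (k' i) \<in> \<O>" by (auto simp: dilate_def)
        have "c i * \<pi> ^ (k i) \<in> \<O>" if "i < n" for i
        proof -
          have "k i = k' i + (k i - k' i)" by (simp add: k'_def)
          then have e: "c i * \<pi> ^ (k i) = c i * \<pi> ^ (k' i) * \<pi> ^ (k i - k' i)" by (metis mult.assoc power_add)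
          show ?thesis unfolding e by (rule O_mult) (use c(2) that in auto)
        qed
        then show "x \<in> dilate n f k" using c(1) by (auto simp: dilate_def)
      qed
      let ?d = "\<lambda>j. if j = p then inverse (\<pi> ^ k p) else 0"
      have "lin n f ?d \<in> dilate n f k" unfolding dilate_iff[OF f] by auto
      moreover have "lin n f ?d \<notin> dilate n f k'"
      proof
        assume "lin n f ?d \<in> dilate n f k'"
        then have "inverse (\<pi> ^ k p) * \<pi> ^ (k p - 1) \<in> \<O>" using p unfolding dilate_iff[OF f] by (auto simp: k'_def)
        moreover have "\<pi> ^ k p = \<pi> * \<pi> ^ (k p - 1)" using p by (cases "k p") auto
        ultimately have "inverse \<pi> \<in> \<O>" by (simp add: mult.assoc)
        then have "inverse \<pi> * \<pi> \<in> \<P>" by (intro P_mult_left) auto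
        then show False by simp
      qed
      ultimately show "dilate n f k' \<noteq> dilate n f k" by blast
    qed
    then show ?case
      unfolding Suc.hyps(2)[symmetric]
      using C osubmodule_dilate
      by (intro exI[of _ "C(Suc l := dilate n f k)"]) (auto simp: le_Suc_eq less_Suc_eq)
  qed
next
  fix m assume "\<exists>C. C 0 = olat n f \<and> C m = dilate n f k \<and> (\<forall>i\<le>m. osubmodule v s (C i)) \<and> (\<forall>i<m. C i \<subset> C (Suc i))"
  then obtain C where C: "C 0 = olat n f" "C m = dilate n f k" "\<And>i. i \<le> m \<Longrightarrow> osubmodule v s (C i)"
    "\<And>i. i < m \<Longrightarrow> C i \<subset> C (Suc i)" by blast
  have up: "C i \<subseteq> dilate n f k" if "i \<le> m" for i
    using that
  proof (induction rule: inc_induct)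
    case (step l)
    then show ?case using C(4)[of l] by blast
  qed (use C in auto)
  have low: "olat n f \<subseteq> C i" if "i \<le> m" for i
    using that
  proof (induction i)
    case (Suc l)
    then show ?case using C(4)[of l] by auto
  qed (use C in auto)
  have "q ^ i \<le> real (ncosets (C i) (olat n f))" if "i \<le> m" for i
    using that
  proof (induction i)
    case 0
    then show ?case using ncosets_self[OF subgrp_osubmodule[OF osubmodule_olat]] C(1) by simp
  next
    case (Suc i)
    have "finite (cosets (C (Suc i)) (olat n f))"
      using count_dilate(2)[OF f] cosets_mono[OF up[OF Suc.prems]] finite_subset by blast
    then have "q * real (ncosets (C i) (olat n f)) \<le> real (ncosets (C (Suc i)) (olat n f))"
      using Suc.prems C(3,4) low osubmodule_olat by (intro index_ge_q) auto
    moreover have "q * q ^ i \<le> q * real (ncosets (C i) (olat n f))"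
      using Suc.IH Suc.prems by (intro mult_left_mono) simp_all
    ultimately show ?case unfolding power_Suc by (rule order_trans[rotated])
  qed
  from this[of m] have "q ^ m \<le> q ^ (\<Sum>i<n. k i)" using C(2) count_dilate(1)[OF f] by simp
  then show "m \<le> (\<Sum>i<n. k i)" using q_gt_1 power_le_imp_le_exp by blast
qed

section \<open>Dual lattice, type and sign from an orthogonal basis\<close>

definition orthogonal :: "nat \<Rightarrow> (nat \<Rightarrow> 'c) \<Rightarrow> bool" where
  "orthogonal n g \<longleftrightarrow> (\<forall>i<n. \<forall>j<n. i \<noteq> j \<longrightarrow> B (g i) (g j) = 0)"

lemma B_lin_basis:
  assumes "orthogonal n g" "j < n" shows "B (lin n g c) (g j) = c j * B (g j) (g j)"
proof -
  have "B (lin n g c) (g j) = (\<Sum>i<n. c i * B (g i) (g j))" by (simp add: lin_def B_sum B_scale)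
  also have "\<dots> = (\<Sum>i<n. if i = j then c j * B (g j) (g j) else 0)"
    using assms by (intro sum.cong) (auto simp: orthogonal_def)
  finally show ?thesis using assms by simp
qed

lemma B_lin_lin:
  assumes "orthogonal n g" shows "B (lin n g c) (lin n g d) = (\<Sum>j<n. d j * (c j * B (g j) (g j)))"
proof -
  have "B (lin n g c) (lin n g d) = (\<Sum>j<n. d j * B (lin n g c) (g j))"
    unfolding lin_def[of n g d] B_sum B_scale_right ..
  then show ?thesis using B_lin_basis[OF assms] by simp
qed

lemma lat_space_olat:
  assumes "scl L = s" "lat L = olat n g" shows "lat_space L = range (lin n g)"
  unfolding lat_space_def assms span_olat ..

lemma dual_orthogonal:
  assumes L: "scl L = s" "form L = B" "lat L = olat n g" and g: "orthogonal n g"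
  shows "dual v L = {lin n g c | c. \<forall>i<n. c i * B (g i) (g i) \<in> \<O>}"
proof -
  have "(\<forall>y\<in>olat n g. B (lin n g c) y \<in> \<O>) \<longleftrightarrow> (\<forall>i<n. c i * B (g i) (g i) \<in> \<O>)" for c
  proof
    assume *: "\<forall>y\<in>olat n g. B (lin n g c) y \<in> \<O>"
    show "\<forall>i<n. c i * B (g i) (g i) \<in> \<O>"
      using B_lin_basis[OF g] basis_in_olat * by metis
  next
    assume *: "\<forall>i<n. c i * B (g i) (g i) \<in> \<O>"
    show "\<forall>y\<in>olat n g. B (lin n g c) y \<in> \<O>"
    proof
      fix y assume "y \<in> olat n g"
      then obtain d where d: "y = lin n g d" "\<forall>i<n. d i \<in> \<O>" by (auto simp: olat_def)
      show "B (lin n g c) y \<in> \<O>" unfolding d B_lin_lin[OF g]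
        by (rule O_sum, rule O_mult) (use * d in auto)
    qed
  qed
  then show ?thesis unfolding dual_def lat_space_olat[OF L(1,3)] L by auto
qed

lemma osubmodule_dual: assumes L: "scl L = s" "form L = B" "lat L = olat n g" shows "osubmodule v s (dual v L)"
proof -
  have "vs.subspace (lat_space L)" unfolding lat_space_def L by simp
  then show ?thesis
    unfolding osubmodule_def dual_def L
    by (auto simp: vs.subspace_0 vs.subspace_add vs.subspace_scale B_add B_scale)
qed

text \<open>Reduction of the quotient \<open>dual v L / lat L\<close> modulo \<open>\<pi>\<close>:
  every cyclic summand with nonzero exponent contributes one dimension over the residue field. The
  right-hand side does not mention the presentation, so the number of nonzero exponents is an
  invariant.\<close>

lemma lat_presentation_count:
  fixes m :: nat and h :: "nat \<Rightarrow> 'c" and a :: "nat \<Rightarrow> nat"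
  assumes L: "scl L = s" "form L = B" "lat L = olat n g" "olat n g \<subseteq> dual v L"
    and h: "\<forall>i<m. h i \<in> dual v L"
      "\<forall>x\<in>dual v L. \<exists>c. (\<forall>i<m. c i \<in> \<O>) \<and> x - lin m h c \<in> lat L"
      "\<forall>c. (\<forall>i<m. c i \<in> \<O>) \<longrightarrow> (lin m h c \<in> lat L \<longleftrightarrow> (\<forall>i<m. c i \<in> \<I> (a i)))"
  shows "q ^ card {i. i < m \<and> a i \<noteq> 0} = real (ncosets (dual v L) {x + s \<pi> y | x y. x \<in> lat L \<and> y \<in> dual v L})"
proof -
  define D where "D = dual v L"
  define K where "K = {x + s \<pi> y | x y. x \<in> lat L \<and> y \<in> D}"
  have D: "osubmodule v s D" unfolding D_def by (rule osubmodule_dual[OF L(1-3)])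
  have La: "osubmodule v s (lat L)" unfolding L by (rule osubmodule_olat)
  have LD: "lat L \<subseteq> D" using L by (simp add: D_def)
  have K: "subgrp K"
    unfolding subgrp_def
  proof (intro conjI ballI)
    have "0 = 0 + s \<pi> 0" by simp
    then show "0 \<in> K" using osubmoduleD(1)[OF D] osubmoduleD(1)[OF La] unfolding K_def by blast
    fix u w assume "u \<in> K" "w \<in> K"
    then obtain x y x' y' where *: "u = x + s \<pi> y" "w = x' + s \<pi> y'" "x \<in> lat L" "x' \<in> lat L" "y \<in> D" "y' \<in> D"
      by (auto simp: K_def)
    then have "u - w = (x - x') + s \<pi> (y - y')" by (simp add: vs.scale_right_diff_distrib)
    moreover have "x - x' \<in> lat L" "y - y' \<in> D" using * osubmodule_diff[OF D] osubmodule_diff[OF La] by auto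
    ultimately show "u - w \<in> K" unfolding K_def by blast
  qed
  have LK: "x \<in> K" if "x \<in> lat L" for x
  proof -
    have "x = x + s \<pi> 0" by simp
    then show ?thesis using that osubmoduleD(1)[OF D] unfolding K_def by blast
  qed
  have DK: "s \<pi> y \<in> K" if "y \<in> D" for y
  proof -
    have "s \<pi> y = 0 + s \<pi> y" by simp
    then show ?thesis using that osubmoduleD(1)[OF La] unfolding K_def by blast
  qed
  let ?Y = "\<lambda>i. if a i \<noteq> 0 then \<P> else \<O>"
  have sY: "subgrp (funs {..<m} ?Y)" by (intro subgrp_funs) auto
  have hD: "h i \<in> D" if "i < m" for i using h(1) that by (simp add: D_def)
  have mem: "lin m h z \<in> K \<longleftrightarrow> (\<forall>i<m. z i \<in> ?Y i)" if z: "\<And>i. i < m \<Longrightarrow> z i \<in> \<O>" for z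
  proof
    assume "lin m h z \<in> K"
    then obtain l y where ly: "lin m h z = l + s \<pi> y" "l \<in> lat L" "y \<in> D" by (auto simp: K_def)
    then obtain d where d: "\<forall>i<m. d i \<in> \<O>" "y - lin m h d \<in> lat L" using h(2) by (auto simp: D_def)
    have "lin m h (\<lambda>i. z i - \<pi> * d i) = l + s \<pi> (y - lin m h d)"
      unfolding lin_diff[symmetric] lin_scale[symmetric] ly by (simp add: vs.scale_right_diff_distrib)
    also have "\<dots> \<in> lat L" using ly d osubmoduleD(2,3)[OF La] by simp
    finally have "\<forall>i<m. z i - \<pi> * d i \<in> \<I> (a i)"
      using h(3)[rule_format, of "\<lambda>i. z i - \<pi> * d i"] z d(1) by (simp add: O_diff O_mult)
    then have "z i - \<pi> * d i \<in> \<P>" if "i < m" "a i \<noteq> 0" for i using that I_imp_P by blast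
    moreover have "\<pi> * d i \<in> \<P>" if "i < m" for i using that d(1) by (intro P_mult_right) auto
    ultimately have "z i \<in> \<P>" if "i < m" "a i \<noteq> 0" for i
      using that P_add[of "z i - \<pi> * d i" "\<pi> * d i"] by fastforce
    then show "\<forall>i<m. z i \<in> ?Y i" using z by auto
  next
    assume *: "\<forall>i<m. z i \<in> ?Y i"
    have "s (z i) (h i) \<in> K" if i: "i < m" for i
    proof (cases "a i = 0")
      case True
      have "lin m h (\<lambda>j. if j = i then z i else 0) \<in> lat L"
        using h(3)[rule_format, of "\<lambda>j. if j = i then z i else 0"] z[OF i] True by (auto simp: I_0)
      then show ?thesis using LK lin_single[OF i, of h "z i"] by simp
    next
      case False
      then have "z i / \<pi> \<in> \<O>" using * i P_iff by auto
      then have "s \<pi> (s (z i / \<pi>) (h i)) \<in> K" using DK osubmoduleD(3)[OF D] hD[OF i] by blast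
      then show ?thesis by simp
    qed
    then show "lin m h z \<in> K" unfolding lin_def by (intro subgrp_sum[OF K]) auto
  qed
  have "ncosets (funs {..<m} (\<lambda>_. \<O>)) (funs {..<m} ?Y) = ncosets D K"
  proof (rule ncosets_iso(1)[where f = "lin m h", OF sY K])
    show "lin m h c \<in> D" if "c \<in> funs {..<m} (\<lambda>_. \<O>)" for c
      using that hD by (intro lin_in_osubmodule[OF D]) (auto simp: funs_def)
    show "lin m h c - lin m h d \<in> K \<longleftrightarrow> c - d \<in> funs {..<m} ?Y"
      if "c \<in> funs {..<m} (\<lambda>_. \<O>)" "d \<in> funs {..<m} (\<lambda>_. \<O>)" for c d
      unfolding lin_diff by (subst mem) (use that in \<open>auto simp: funs_def\<close>)
    show "\<exists>c\<in>funs {..<m} (\<lambda>_. \<O>). lin m h c - b \<in> K" if bD: "b \<in> D" for b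
    proof -
      obtain c where c: "\<forall>i<m. c i \<in> \<O>" "b - lin m h c \<in> lat L" using h(2) bD by (auto simp: D_def)
      have "lin m h c - b \<in> K" using LK[OF c(2)] subgrp_diff_commute[OF K] by blast
      moreover have "lin m h (\<lambda>i. if i < m then c i else 0) = lin m h c" by (rule lin_cong) simp
      ultimately show ?thesis using c(1)
        by (intro bexI[of _ "\<lambda>i. if i < m then c i else 0"]) (auto simp: funs_def)
    qed
  qed
  moreover have "real (ncosets (funs {..<m} (\<lambda>_. \<O>)) (funs {..<m} ?Y)) = (\<Prod>i<m. if a i \<noteq> 0 then q else 1)"
    by (subst ncosets_funs) (auto simp: ncosets_P ncosets_self intro!: prod.cong)
  moreover have "(\<Prod>i<m. if a i \<noteq> 0 then q else 1) = q ^ card {i. i < m \<and> a i \<noteq> 0}"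
    by (simp add: prod.If_cases Int_def)
  ultimately show ?thesis by (simp add: D_def K_def)
qed

text \<open>The vectors \<open>g i\<close> divided by their lengths generate the dual lattice, and
  the exponent of the \<open>i\<close>-th summand is the valuation of the length. The definite
  description is justified by \<open>lat_presentation_count\<close>.\<close>

lemma lat_type_eq:
  assumes L: "scl L = s" "form L = B" "lat L = olat n g" and g: "indep n g" "orthogonal n g"
    and T: "\<And>i. i < n \<Longrightarrow> B (g i) (g i) \<in> \<O>" "\<And>i. i < n \<Longrightarrow> B (g i) (g i) \<noteq> 0"
  shows "lat_type v L = card {i. i < n \<and> B (g i) (g i) \<in> \<P>}"
proof -
  let ?T = "\<lambda>i. B (g i) (g i)"
  define pres where "pres m h a \<longleftrightarrow> (\<forall>i<m. h i \<in> dual v L) \<and>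
     (\<forall>x\<in>dual v L. \<exists>c. (\<forall>i<m. c i \<in> \<O>) \<and> x - lin m h c \<in> lat L) \<and>
     (\<forall>c. (\<forall>i<m. c i \<in> \<O>) \<longrightarrow> (lin m h c \<in> lat L \<longleftrightarrow> (\<forall>i<m. c i \<in> \<I> (a i))))" for m :: nat and h and a :: "nat \<Rightarrow> nat"
  note dual = dual_orthogonal[OF L g(2)]
  have sub: "olat n g \<subseteq> dual v L"
  proof
    fix x assume "x \<in> olat n g"
    then obtain c where c: "x = lin n g c" "\<forall>i<n. c i \<in> \<O>" by (auto simp: olat_def)
    have "\<forall>i<n. c i * B (g i) (g i) \<in> \<O>" using c T(1) by auto
    then show "x \<in> dual v L" unfolding dual using c(1) by blast
  qed
  define h where "h i = s (1 / ?T i) (g i)" for i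
  define a where "a i = nat (v (?T i))" for i
  have lh: "lin n h c = lin n g (\<lambda>i. c i / ?T i)" for c
    by (simp add: lin_def h_def)
  have "pres n h a"
    unfolding pres_def
  proof (intro conjI allI impI ballI)
    fix i assume i: "i < n"
    have "h i = lin n g (\<lambda>j. if j = i then 1 / ?T i else 0)" using i by (simp add: lin_single h_def)
    then show "h i \<in> dual v L" unfolding dual using T i by fastforce
  next
    fix x assume "x \<in> dual v L"
    then obtain c where c: "x = lin n g c" "\<forall>i<n. c i * ?T i \<in> \<O>" by (auto simp: dual)
    have "lin n h (\<lambda>i. c i * ?T i) = x" unfolding lh c(1) using T(2) by (intro lin_cong) auto
    then have "x - lin n h (\<lambda>i. c i * ?T i) = 0" by simp
    also have "0 \<in> lat L" unfolding L using osubmoduleD(1)[OF osubmodule_olat] .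
    finally show "\<exists>c. (\<forall>i<n. c i \<in> \<O>) \<and> x - lin n h c \<in> lat L" using c by (intro exI[of _ "\<lambda>i. c i * ?T i"]) auto
  next
    fix c assume cO: "\<forall>i<n. c i \<in> \<O>"
    have "c i / ?T i \<in> \<O> \<longleftrightarrow> c i \<in> \<I> (a i)" if "i < n" for i
      using T[OF that] by (cases "c i = 0") (auto simp: integers_def power_ideal_def v_divide a_def)
    then show "lin n h c \<in> lat L \<longleftrightarrow> (\<forall>i<n. c i \<in> \<I> (a i))"
      unfolding lh L olat_iff[OF g(1)] by simp
  qed
  moreover have "{i. i < n \<and> a i \<noteq> 0} = {i. i < n \<and> ?T i \<in> \<P>}"
    using T by (auto simp: a_def max_ideal_def integers_def)
  ultimately have ex: "pres n h a \<and> card {i. i < n \<and> ?T i \<in> \<P>} = card {i. i < n \<and> a i \<noteq> 0}" by simp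
  have uniq: "card {i. i < m \<and> a' i \<noteq> 0} = card {i. i < n \<and> ?T i \<in> \<P>}" if "pres m h' a'" for m h' and a' :: "nat \<Rightarrow> nat"
  proof -
    have "q ^ card {i. i < k \<and> b i \<noteq> 0} = real (ncosets (dual v L) {x + s \<pi> y | x y. x \<in> lat L \<and> y \<in> dual v L})"
      if "pres k w b" for k w and b :: "nat \<Rightarrow> nat"
      using that unfolding pres_def by (intro lat_presentation_count[OF L sub, where h = w]) blast+
    from this[OF that] this[of n h a] ex
    have "q ^ card {i. i < m \<and> a' i \<noteq> 0} = q ^ card {i. i < n \<and> a i \<noteq> 0}" by (metis (no_types))
    then have "card {i. i < m \<and> a' i \<noteq> 0} = card {i. i < n \<and> a i \<noteq> 0}"
      by (simp only: power_inject_exp[OF q_gt_1])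
    then show ?thesis using ex by simp
  qed
  have "lat_type v L = (THE t. \<exists>m h a. pres m h a \<and> t = card {i. i < m \<and> a i \<noteq> 0})"
    unfolding lat_type_def pres_def lin_def L by (simp add: conj_assoc)
  also have "\<dots> = card {i. i < n \<and> ?T i \<in> \<P>}"
    by (rule the_equality) (use ex uniq in blast)+
  finally show ?thesis .
qed

text \<open>Both Gram determinants below are computed in the larger of the two sizes, padding the smaller
  system with zero vectors.\<close>

lemma residue_split_compare:
  assumes L: "scl L = s" "form L = B" and int: "\<And>x y. x \<in> lat L \<Longrightarrow> y \<in> lat L \<Longrightarrow> B x y \<in> \<O>"
    and Lo: "osubmodule v s (lat L)"
    and e: "residue_split v L d e" and e': "residue_split v L d' e'" and le: "d \<le> d'"
  shows "d = d' \<and> (\<exists>u\<in>\<O>. det (gram L d' e') - u ^ 2 * det (gram L d e) \<in> \<P>)"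
proof -
  have eL: "e i \<in> lat L" if "i < d" for i using e that by (simp add: residue_split_def)
  have e'L: "e' i \<in> lat L" if "i < d'" for i using e' that by (simp add: residue_split_def)
  have "\<forall>j. \<exists>c. j < d' \<longrightarrow> (\<forall>i<d. c i \<in> \<O>) \<and> e' j - (\<Sum>i<d. s (c i) (e i)) \<in> residue_radical v L"
    using e e'L by (auto simp: residue_split_def L)
  then obtain C where C: "\<And>i j. j < d' \<Longrightarrow> i < d \<Longrightarrow> C j i \<in> \<O>"
    "\<And>j. j < d' \<Longrightarrow> e' j - (\<Sum>i<d. s (C j i) (e i)) \<in> residue_radical v L" by metis
  define E where "E i = (if i < d then e i else 0)" for i
  define C' where "C' j i = (if i < d then C j i else 0)" for j i
  define w where "w j = lin d' E (C' j)" for j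
  have w: "w j = (\<Sum>i<d. s (C j i) (e i))" for j
  proof -
    have "w j = (\<Sum>i\<in>{..<d'}. if i < d then s (C j i) (e i) else 0)"
      unfolding w_def lin_def by (rule sum.cong) (auto simp: E_def C'_def)
    also have "\<dots> = (\<Sum>i<d. s (C j i) (e i))"
      using le by (subst sum.inter_filter[symmetric]) (auto intro!: sum.cong)
    finally show ?thesis .
  qed
  have wL: "w j \<in> lat L" if "j < d'" for j
    unfolding w by (rule subgrp_sum[OF subgrp_osubmodule[OF Lo]]) (use C(1)[OF that] eL osubmoduleD(3)[OF Lo] in auto)
  have rad: "B (e' j - w j) y \<in> \<P>" if "j < d'" "y \<in> lat L" for j y
    using C(2)[OF that(1)] that(2) by (simp add: residue_radical_def w L)
  define Cm where "Cm = mat d' d' (\<lambda>(j, i). C' j i)"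
  define Gm where "Gm = mat d' d' (\<lambda>(i, l). B (E i) (E l))"
  have carr: "Cm \<in> carrier_mat d' d'" "Gm \<in> carrier_mat d' d'" by (auto simp: Cm_def Gm_def)
  have entry: "(Cm * Gm * transpose_mat Cm) $$ (j, k) = B (w j) (w k)" if jk: "j < d'" "k < d'" for j k
  proof -
    have "(Cm * Gm * transpose_mat Cm) $$ (j, k) = (\<Sum>l = 0..<d'. (\<Sum>i = 0..<d'. C' j i * B (E i) (E l)) * C' k l)"
      using jk by (simp add: Cm_def Gm_def scalar_prod_def)
    also have "\<dots> = (\<Sum>l<d'. (\<Sum>i<d'. C' j i * B (E i) (E l)) * C' k l)" by (simp add: lessThan_atLeast0)
    also have "\<dots> = B (w j) (w k)"
      by (simp add: w_def lin_def B_sum B_scale B_scale_right sum_distrib_left mult_ac)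
    finally show ?thesis .
  qed
  have "det (gram L d' e') - det (Cm * Gm * transpose_mat Cm) \<in> \<P>"
  proof (rule det_cong_P[of _ d'])
    fix j k assume jk: "j < d'" "k < d'"
    show "gram L d' e' $$ (j, k) \<in> \<O>" using jk e'L int by (simp add: gram_def L)
    show "(Cm * Gm * transpose_mat Cm) $$ (j, k) \<in> \<O>" using jk wL int by (simp add: entry)
    have "B (e' j) (e' k) - B (w j) (w k) = B (e' j - w j) (e' k) + B (e' k - w k) (w j)"
      using B_sym[of "w j"] by (simp add: B_diff)
    also have "\<dots> \<in> \<P>" using rad jk e'L wL by (intro P_add) auto
    finally show "gram L d' e' $$ (j, k) - (Cm * Gm * transpose_mat Cm) $$ (j, k) \<in> \<P>"
      using jk entry by (simp add: gram_def L)
  qed (use carr in \<open>auto simp: gram_def\<close>)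
  moreover have "det (Cm * Gm * transpose_mat Cm) = det Cm ^ 2 * det Gm"
    using carr by (simp add: det_mult[of _ d'] det_transpose[of _ d'] power2_eq_square)
  ultimately have main: "det (gram L d' e') - det Cm ^ 2 * det Gm \<in> \<P>" by simp
  have "det Cm \<in> \<O>" by (rule det_O[OF carr(1)]) (auto simp: Cm_def C'_def C(1))
  moreover have "d = d'"
  proof (rule ccontr)
    \<comment> \<open>With padding by zero vectors the matrix \<open>Gm\<close> has a zero row, so
      the determinant of the larger system would be in \<open>\<P>\<close>.\<close>
    assume "d \<noteq> d'"
    then have "d < d'" using le by simp
    then have "(\<Prod>i = 0..<d'. Gm $$ (i, p i)) = 0" if "p permutes {0..<d'}" for p
      using permutes_in_image[OF that, of d] by (intro prod_zero) (auto intro!: bexI[of _ d] simp: Gm_def E_def)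
    then have "det Gm = 0" unfolding det_def'[OF carr(2)] by (intro sum.neutral) simp
    then show False using main e' by (simp add: residue_split_def)
  qed
  moreover have "Gm = gram L d e" using \<open>d = d'\<close> by (auto simp: Gm_def gram_def L E_def)
  ultimately show ?thesis using main by auto
qed

text \<open>The two Gram determinants differ by the square of \<open>u\<close> modulo
  \<open>\<P>\<close>. Both are units, hence so is \<open>u\<close>, and the character does not see
  its square.\<close>

lemma residue_split_unique:
  assumes L: "scl L = s" "form L = B" and int: "\<And>x y. x \<in> lat L \<Longrightarrow> y \<in> lat L \<Longrightarrow> B x y \<in> \<O>"
    and Lo: "osubmodule v s (lat L)"
    and e: "residue_split v L d e" and e': "residue_split v L d' e'"
  shows "d = d' \<and> residue_symbol v (disc L d e) = residue_symbol v (disc L d' e')"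
proof -
  have dd: "d = d'"
    using residue_split_compare[OF L int Lo e e'] residue_split_compare[OF L int Lo e' e] by (cases "d \<le> d'") auto
  obtain u where u: "u \<in> \<O>" "det (gram L d' e') - u ^ 2 * det (gram L d e) \<in> \<P>"
    using residue_split_compare[OF L int Lo e e'] dd by auto
  have G: "det (gram L d e) \<in> \<O>" "det (gram L d' e') \<in> \<O>" "det (gram L d' e') \<notin> \<P>"
    using e e' by (auto simp: residue_split_def gram_def L intro!: det_O int)
  have uP: "u \<notin> \<P>"
  proof
    assume "u \<in> \<P>"
    then have "u ^ 2 * det (gram L d e) \<in> \<P>" using G u(1) by (simp add: P_mult_iff P_power_iff O_power)
    then show False using P_add[OF u(2)] G by fastforce
  qed
  have "\<chi> (disc L d' e') = \<chi> ((-1) ^ (d' * (d' - 1) div 2)) * \<chi> (det (gram L d' e'))"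
    unfolding disc_def using G by (intro chi_mult) auto
  also have "\<chi> (det (gram L d' e')) = \<chi> (u ^ 2 * det (gram L d e))" using u G by (intro chi_cong) auto
  also have "\<dots> = \<chi> (u ^ 2) * \<chi> (det (gram L d e))" using u G by (intro chi_mult) auto
  also have "\<chi> (u ^ 2) = 1" using u uP by (intro chi_square[of u]) (auto simp: P_power_iff)
  also have "\<chi> ((-1) ^ (d' * (d' - 1) div 2)) * (1 * \<chi> (det (gram L d e))) = \<chi> (disc L d e)"
    unfolding disc_def dd using G dd by (subst chi_mult) auto
  finally show ?thesis using dd by (simp add: chi_eq_residue_symbol)
qed

lemma gram_orthogonal:
  assumes "form L = B" "orthogonal d g" shows "det (gram L d g) = (\<Prod>i<d. B (g i) (g i))"
proof -
  have "gram L d g = mat d d (\<lambda>(i, j). if i = j then B (g i) (g i) else 0)"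
    using assms by (auto simp: gram_def orthogonal_def)
  then show ?thesis by (simp add: det_mat_diag)
qed

text \<open>The basis vectors of unit length span a non-degenerate part; the others are orthogonal
  to all remaining basis vectors and have length in \<open>\<P>\<close>, so they lie in the
  radical.\<close>

lemma residue_split_orthogonal:
  assumes L: "scl L = s" "form L = B" "lat L = olat n g" and g: "orthogonal n g" and d: "d \<le> n"
    and T: "\<And>i. i < n \<Longrightarrow> B (g i) (g i) \<in> \<O>" "\<And>i. i < d \<Longrightarrow> B (g i) (g i) \<notin> \<P>" "\<And>i. d \<le> i \<Longrightarrow> i < n \<Longrightarrow> B (g i) (g i) \<in> \<P>"
  shows "residue_split v L d g"
  unfolding residue_split_def
proof (intro conjI ballI allI impI)
  show "g i \<in> lat L" if "i < d" for i using that d by (simp add: L basis_in_olat)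
  have "orthogonal d g" using g d by (auto simp: orthogonal_def)
  moreover have "(\<Prod>i<d. B (g i) (g i)) \<notin> \<P>" using T d by (intro conjunct2[OF prod_notin_P]) auto
  ultimately show "det (gram L d g) \<notin> \<P>" using gram_orthogonal[OF L(2)] by simp
  fix x assume "x \<in> lat L"
  then obtain c where c: "x = lin n g c" "\<forall>i<n. c i \<in> \<O>" by (auto simp: L olat_def)
  define c' where "c' i = (if i < d then 0 else c i)" for i
  have "x = (\<Sum>i<d. s (c i) (g i)) + (\<Sum>i\<in>{d..<n}. s (c i) (g i))"
    unfolding c(1) lin_def using d by (subst sum.union_disjoint[symmetric]) (auto intro: sum.cong)
  also have "(\<Sum>i\<in>{d..<n}. s (c i) (g i)) = lin n g c'"
    unfolding lin_def by (rule sum.mono_neutral_cong_left) (auto simp: c'_def)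
  finally have x: "x - (\<Sum>i<d. s (c i) (g i)) = lin n g c'" by simp
  have "B (lin n g c') y \<in> \<P>" if yL: "y \<in> lat L" for y
  proof -
    obtain b where b: "y = lin n g b" "\<forall>i<n. b i \<in> \<O>" using yL by (auto simp: L olat_def)
    show ?thesis unfolding b B_lin_lin[OF g]
    proof (rule P_sum)
      fix j assume j: "j \<in> {..<n}"
      then show "b j * (c' j * B (g j) (g j)) \<in> \<P>"
        using b(2) c(2) T(3)[of j] by (cases "j < d") (auto simp: c'_def)
    qed
  qed
  moreover have "lin n g c' \<in> lat L" unfolding L using c by (intro olatI) (auto simp: c'_def)
  ultimately have "x - (\<Sum>i<d. scl L (c i) (g i)) \<in> residue_radical v L"
    unfolding L(1) x by (simp add: residue_radical_def L(2))
  then show "\<exists>c. (\<forall>i<d. c i \<in> \<O>) \<and> x - (\<Sum>i<d. scl L (c i) (g i)) \<in> residue_radical v L"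
    using c d by (intro exI[of _ c]) auto
qed

lemma olat_integral:
  assumes "orthogonal n g" "\<And>i. i < n \<Longrightarrow> B (g i) (g i) \<in> \<O>" "x \<in> olat n g" "y \<in> olat n g" shows "B x y \<in> \<O>"
proof -
  obtain c d where "x = lin n g c" "\<forall>i<n. c i \<in> \<O>" "y = lin n g d" "\<forall>i<n. d i \<in> \<O>" using assms by (auto simp: olat_def)
  then show ?thesis using assms(2) by (auto simp: B_lin_lin[OF assms(1)] intro!: O_sum O_mult[OF _ O_mult])
qed

lemma lat_sgn_eq:
  assumes L: "scl L = s" "form L = B" "lat L = olat n g" and g: "orthogonal n g" and d: "d \<le> n"
    and T: "\<And>i. i < n \<Longrightarrow> B (g i) (g i) \<in> \<O>" "\<And>i. i < d \<Longrightarrow> B (g i) (g i) \<notin> \<P>" "\<And>i. d \<le> i \<Longrightarrow> i < n \<Longrightarrow> B (g i) (g i) \<in> \<P>"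
  shows "lat_sgn v r L = (if even d = even r then residue_symbol v ((-1) ^ (d * (d - 1) div 2) * (\<Prod>i<d. B (g i) (g i))) else 0)"
proof -
  have sp: "residue_split v L d g" by (rule residue_split_orthogonal[OF assms])
  have "orthogonal d g" using g d by (auto simp: orthogonal_def)
  then have disc: "disc L d g = (-1) ^ (d * (d - 1) div 2) * (\<Prod>i<d. B (g i) (g i))"
    by (simp add: disc_def gram_orthogonal[OF L(2)])
  have "osubmodule v s (lat L)" unfolding L by (rule osubmodule_olat)
  moreover have "B x y \<in> \<O>" if "x \<in> lat L" "y \<in> lat L" for x y using olat_integral[OF g T(1)] that L by auto
  ultimately have uniq: "d = d' \<and> residue_symbol v (disc L d g) = residue_symbol v (disc L d' e')"
    if "residue_split v L d' e'" for d' e'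
    using residue_split_unique[OF L(1,2) _ _ sp that] by blast
  show ?thesis unfolding lat_sgn_def disc[symmetric]
  proof (rule the_equality)
    show "\<exists>d' e. residue_split v L d' e \<and> (if even d = even r then residue_symbol v (disc L d g) else 0) =
        (if even d' = even r then residue_symbol v (disc L d' e) else 0)"
      using sp by blast
    fix x assume "\<exists>d' e. residue_split v L d' e \<and> x = (if even d' = even r then residue_symbol v (disc L d' e) else 0)"
    then obtain d' e where e: "residue_split v L d' e" "x = (if even d' = even r then residue_symbol v (disc L d' e) else 0)" by blast
    show "x = (if even d = even r then residue_symbol v (disc L d g) else 0)"
    proof -
      have 1: "d' = d" and 2: "residue_symbol v (disc L d' e) = residue_symbol v (disc L d g)"
        using uniq[OF e(1)] by auto
      show ?thesis unfolding e(2) 2 unfolding 1 ..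
    qed
  qed
qed

lemma sorted_orthogonal_basis:
  assumes e: "indep n e" and nondeg: "\<And>c. (\<And>i. i < n \<Longrightarrow> B (lin n e c) (e i) = 0) \<Longrightarrow> lin n e c = 0"
  shows "\<exists>g d. indep n g \<and> olat n g = olat n e \<and> orthogonal n g \<and> d \<le> n \<and> (\<forall>i<n. B (g i) (g i) \<noteq> 0) \<and>
    (\<forall>i<d. B (g i) (g i) \<notin> \<P>) \<and> (\<forall>i. d \<le> i \<longrightarrow> i < n \<longrightarrow> B (g i) (g i) \<in> \<P>)"
proof -
  obtain f where f: "indep n f" "olat n f = olat n e" "\<And>i j. i < n \<Longrightarrow> j < n \<Longrightarrow> i \<noteq> j \<Longrightarrow> B (f i) (f j) = 0"
    using orthogonal_basis[OF assms] by blast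
  have fo: "orthogonal n f" using f(3) by (simp add: orthogonal_def)
  define U where "U = {i. i < n \<and> B (f i) (f i) \<notin> \<P>}"
  define d where "d = card U"
  have U: "U \<subseteq> {..<n}" "finite U" by (auto simp: U_def)
  have dn: "d \<le> n" using card_mono[OF _ U(1)] by (simp add: d_def)
  have "\<exists>h. bij_betw h {..<d} U" by (rule finite_same_card_bij) (auto simp: U d_def)
  then obtain h1 where h1: "bij_betw h1 {..<d} U" by blast
  have "\<exists>h. bij_betw h {d..<n} ({..<n} - U)" by (rule finite_same_card_bij) (use U in \<open>auto simp: d_def card_Diff_subset\<close>)
  then obtain h2 where h2: "bij_betw h2 {d..<n} ({..<n} - U)" by blast
  define h where "h i = (if i < d then h1 i else h2 i)" for i
  have "bij_betw h {..<d} U" using h1 by (rule bij_betw_cong[THEN iffD1, rotated]) (auto simp: h_def)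
  moreover have "bij_betw h {d..<n} ({..<n} - U)" using h2 by (rule bij_betw_cong[THEN iffD1, rotated]) (auto simp: h_def)
  ultimately have "bij_betw h ({..<d} \<union> {d..<n}) (U \<union> ({..<n} - U))" by (rule bij_betw_combine) auto
  moreover have "{..<d} \<union> {d..<n} = {..<n}" "U \<union> ({..<n} - U) = {..<n}" using dn U by auto
  ultimately have h: "bij_betw h {..<n} {..<n}" by simp
  define g where "g i = f (h i)" for i
  have g: "indep n g" "olat n g = olat n e" using basis_permute[OF f(1) h] f(2) by (auto simp: g_def[abs_def])
  have hn: "h i < n" if "i < n" for i using bij_betwE[OF h] that by auto
  have "B (g i) (g j) = 0" if ij: "i < n" "j < n" "i \<noteq> j" for i j
  proof -
    have "h i \<noteq> h j" using inj_onD[OF bij_betw_imp_inj_on[OF h], of i j] ij by auto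
    then show ?thesis using f(3) hn ij by (simp add: g_def)
  qed
  then have "orthogonal n g" by (simp add: orthogonal_def)
  moreover have "B (f i) (f i) \<noteq> 0" if i: "i < n" for i
  proof
    assume z: "B (f i) (f i) = 0"
    have "B (f i) x = 0" if "x \<in> olat n f" for x
    proof -
      from that obtain c where "x = lin n f c" by (auto simp: olat_def)
      then show ?thesis using B_lin_basis[OF fo i, of c] z B_sym[of "f i" x] by simp
    qed
    then have "B (f i) (e j) = 0" if "j < n" for j using basis_in_olat[OF that, of e] f(2) by auto
    moreover have "f i \<in> olat n e" using basis_in_olat[OF i, of f] f(2) by simp
    ultimately have "f i = 0" using nondeg by (auto simp: olat_def)
    then have "lin n f (\<lambda>j. if j = i then 1 else 0) = 0" using lin_single[OF i, of f 1] by simp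
    then have "(if i = i then 1 else 0 :: 'a) = 0" using f(1) i unfolding indep_def by blast
    then show False by simp
  qed
  then have "B (g i) (g i) \<noteq> 0" if "i < n" for i using hn[OF that] by (simp add: g_def)
  moreover have "B (g i) (g i) \<notin> \<P>" if "i < d" for i
    using bij_betwE[OF h1] that by (auto simp: g_def h_def U_def)
  moreover have "B (g i) (g i) \<in> \<P>" if "d \<le> i" "i < n" for i
    using bij_betwE[OF h2] that by (auto simp: g_def h_def U_def)
  ultimately show ?thesis using g dn by blast
qed

text \<open>Pairing with \<open>g i\<close> returns the \<open>i\<close>-th coordinate times a unit,
  so a vector that pairs into \<open>\<P>\<close> has all coordinates in
  \<open>\<P>\<close>.\<close>

lemma unimodular_olat:
  assumes g: "indep m g" "orthogonal m g" and T: "\<And>i. i < m \<Longrightarrow> B (g i) (g i) \<in> \<O>" "\<And>i. i < m \<Longrightarrow> B (g i) (g i) \<notin> \<P>"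
  shows "unimodular v s B (olat m g) m"
proof
  note o = osubmoduleD[OF osubmodule_olat[of m g]]
  show "0 \<in> olat m g" by (rule o)
  show "x + y \<in> olat m g" if "x \<in> olat m g" "y \<in> olat m g" for x y using that by (rule o)
  show "s c x \<in> olat m g" if "c \<in> \<O>" "x \<in> olat m g" for c x using that by (rule o)
  show "B x y \<in> \<O>" if "x \<in> olat m g" "y \<in> olat m g" for x y using olat_integral[OF g(2) T(1)] that by auto
  have K: "lin m g c \<in> {z. s (inverse \<pi>) z \<in> olat m g} \<longleftrightarrow> (\<forall>i<m. c i \<in> \<P>)" for c
    by (auto simp: lin_scale olat_iff[OF g(1)] P_iff divide_inverse mult.commute)
  show "s (inverse \<pi>) z \<in> olat m g" if z: "z \<in> olat m g" and *: "\<And>w. w \<in> olat m g \<Longrightarrow> B w z \<in> \<P>" for z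
  proof -
    obtain c where c: "z = lin m g c" "\<forall>i<m. c i \<in> \<O>" using z by (auto simp: olat_def)
    have "c i \<in> \<P>" if i: "i < m" for i
    proof -
      have "c i * B (g i) (g i) \<in> \<P>" using *[OF basis_in_olat[OF i]] B_lin_basis[OF g(2) i, of c] B_sym[of "g i" z] by (simp add: c(1))
      then show ?thesis using c(2) T i by (simp add: P_mult_iff)
    qed
    then show ?thesis using K[of c] c(1) by simp
  qed
  have sK: "subgrp {z. s (inverse \<pi>) z \<in> olat m g}"
    by (auto simp: subgrp_def vs.scale_right_diff_distrib osubmodule_diff[OF osubmodule_olat] o(1))
  have A: "x \<in> olat m g \<longleftrightarrow> (\<exists>c. x = lin m g c \<and> (\<forall>i<m. c i \<in> \<O>))" for x by (auto simp: olat_def)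
  note iso = lin_coords_iso[OF g(1) A K sK subgrp_P]
  show "real (ncosets (olat m g) {z. s (inverse \<pi>) z \<in> olat m g}) = q ^ m"
    using iso(1) by (simp add: ncosets_P)
  show "finite (cosets (olat m g) {z. s (inverse \<pi>) z \<in> olat m g})" using iso(2) finite_cosets_P by simp
qed

end

context unimodular begin

text \<open>Passing from \<open>r\<close> to \<open>r + 1\<close> raises the exponent
  \<open>r(r-1)/2\<close> by \<open>r\<close>, which matches the alternation between
  \<open>u\<close> and \<open>- u\<close> in the recursion.\<close>

lemma basis_sign_eq:
  assumes u: "\<And>i. i < n \<Longrightarrow> u i \<in> \<O>" and r: "r \<le> n"
  shows "basis_sign u n r = \<chi> ((-1) ^ (r * (r - 1) div 2) * (\<Prod>i\<in>{n - r..<n}. u i))"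
  using r
proof (induction r)
  case (Suc r)
  let ?j = "n - Suc r"
  have "{?j..<n} = insert ?j {n - r..<n}" using Suc.prems by auto
  then have p: "(\<Prod>i\<in>{?j..<n}. u i) = u ?j * (\<Prod>i\<in>{n - r..<n}. u i)" using Suc.prems by simp
  have "2 * (Suc r * r div 2) = 2 * (r * (r - 1) div 2) + 2 * r"
    by (cases r) (auto simp: algebra_simps)
  then have ex: "Suc r * (Suc r - 1) div 2 = r * (r - 1) div 2 + r" by simp
  have pO: "(\<Prod>i\<in>{n - r..<n}. u i) \<in> \<O>" using u by (intro prod_O) auto
  have m1: "(- 1) ^ k \<in> \<O>" for k by (rule O_power) simp
  have "\<chi> (if even r then u ?j else - u ?j) = \<chi> ((-1) ^ r * u ?j)" by simp
  then have "basis_sign u n (Suc r) = \<chi> ((-1) ^ (r * (r - 1) div 2) * (\<Prod>i\<in>{n - r..<n}. u i)) * \<chi> ((-1) ^ r * u ?j)"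
    using Suc by simp
  also have "\<dots> = \<chi> (((-1) ^ (r * (r - 1) div 2) * (\<Prod>i\<in>{n - r..<n}. u i)) * ((-1) ^ r * u ?j))"
    by (rule chi_mult[symmetric]) (rule O_mult[OF m1], use pO u Suc.prems in auto)+
  also have "((-1) ^ (r * (r - 1) div 2) * (\<Prod>i\<in>{n - r..<n}. u i)) * ((-1) ^ r * u ?j) =
     (-1) ^ (Suc r * (Suc r - 1) div 2) * (\<Prod>i\<in>{?j..<n}. u i)"
    unfolding ex p power_add by (simp add: mult_ac)
  finally show ?case .
qed simp

text \<open>For even \<open>m - d\<close> the complement of the unit part has as sign the product of
  \<open>th\<close> with the discriminant symbol of that part. This identifies
  \<open>lat_sgn\<close>, defined from \<open>L'\<close> alone, with the sign met in the
  count.\<close>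

lemma col_sign_eq:
  assumes t: "\<And>i. i < d \<Longrightarrow> t i \<in> \<O>" and d: "d \<le> m" and ev: "even (m - d)"
  shows "col_sign th t d = th * \<chi> ((-1) ^ (d * (d - 1) div 2) * (\<Prod>i<d. t i))"
proof -
  \<comment> \<open>At intermediate stages the power of \<open>\<chi> (- 1)\<close> depends on the
    parity of the remaining dimension; only its exponent modulo 2 matters, and the two expressions
    are chosen so that one step turns each into the other.\<close>
  have "col_sign th t j = th * (\<Prod>i<j. \<chi> (t i)) * \<chi> (- 1) ^ (if even (m - j) then j * (j - 1) div 2 else j * (j + 1) div 2)"
    if "j \<le> d" for j
    using that
  proof (induction j)
    case (Suc j)
    have tj: "\<chi> (- t j) = \<chi> (- 1) * \<chi> (t j)" using chi_mult[of "- 1" "t j"] t Suc.prems by simp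
    have par: "even (m - Suc j) \<longleftrightarrow> odd (m - j)" using Suc.prems d by auto
    have c2: "\<chi> (- 1) * \<chi> (- 1) = 1" by (rule chi_sq) simp
    show ?case
    proof (cases "even (m - j)")
      case True
      have "2 * (Suc j * (Suc j + 1) div 2) = 2 * (j * (j - 1) div 2) + 2 * (2 * j + 1)"
        by (cases j) (auto simp: algebra_simps)
      moreover have "A = C + D" if "2 * A = 2 * C + 2 * D" for A C D :: nat using that by simp
      ultimately have ex: "Suc j * (Suc j + 1) div 2 = j * (j - 1) div 2 + (2 * j + 1)" by blast
      have "\<chi> (- 1) ^ (2 * j + 1) = \<chi> (- 1)" by (simp add: power_mult power2_eq_square c2)
      then have e3: "\<chi> (- 1) ^ (Suc j * (Suc j + 1) div 2) = \<chi> (- 1) ^ (j * (j - 1) div 2) * \<chi> (- 1)"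
        unfolding ex by (simp only: power_add)
      have o: "odd (m - Suc j)" using True par by simp
      have IH: "col_sign th t j = th * (\<Prod>i<j. \<chi> (t i)) * \<chi> (- 1) ^ (j * (j - 1) div 2)"
        using Suc True by simp
      have "col_sign th t (Suc j) = col_sign th t j * (\<chi> (- 1) * \<chi> (t j))" using o tj by simp
      then show ?thesis unfolding IH if_not_P[OF o] e3 by (simp only: prod.lessThan_Suc mult_ac)
    next
      case False
      then show ?thesis using Suc par by (simp add: mult.commute)
    qed
  qed simp
  from this[of d] have "col_sign th t d = th * ((\<Prod>i<d. \<chi> (t i)) * \<chi> (- 1) ^ (d * (d - 1) div 2))"
    using ev by simp
  also have "(\<Prod>i<d. \<chi> (t i)) * \<chi> (- 1) ^ (d * (d - 1) div 2) = \<chi> ((-1) ^ (d * (d - 1) div 2) * (\<Prod>i<d. t i))"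
  proof -
    have 1: "\<chi> (prod t {..<d}) = (\<Prod>i<d. \<chi> (t i))" using t by (intro chi_prod) auto
    have 2: "\<chi> ((-1) ^ (d * (d - 1) div 2)) = \<chi> (- 1) ^ (d * (d - 1) div 2)" by (rule chi_pow) simp
    have "\<chi> ((-1) ^ (d * (d - 1) div 2) * prod t {..<d}) = \<chi> ((-1) ^ (d * (d - 1) div 2)) * \<chi> (prod t {..<d})"
      by (rule chi_mult) (use t in \<open>auto intro!: prod_O O_power\<close>)
    then show ?thesis unfolding 1 2 by (simp only: mult.commute)
  qed
  finally show ?thesis .
qed

end

section \<open>Sorting representations by saturation\<close>

text \<open>Each index occurs \<open>n + 1\<close> times among the pairs, the diagonal counted
  twice. This is the exponent that the Gram matrix contributes to the change of precision.\<close>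

lemma sum_idx_pairs: "(\<Sum>(i, j)\<in>idx_pairs n. k i + k j) = (n + 1) * (\<Sum>i<n. k i :: nat)"
proof (induction n)
  case (Suc n)
  have "(\<Sum>(i, j)\<in>(\<lambda>i. (i, n)) ` {..n}. k i + k j) = (\<Sum>i\<le>n. k i + k n)"
    by (subst sum.reindex) (auto simp: inj_on_def)
  also have "\<dots> = (\<Sum>i\<le>n. k i) + (n + 1) * k n" by (simp add: sum.distrib)
  finally show ?case using Suc idx_pairs_Suc(2)[of n]
    by (simp add: idx_pairs_Suc(1) sum.union_disjoint lessThan_Suc_atMost[symmetric] algebra_simps)
qed (simp add: idx_pairs_def)

lemma (in quad_space) B_lin: "B (lin n f c) (lin n g d) = (\<Sum>i<n. \<Sum>j<n. c i * (d j * B (f i) (g j)))"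
proof -
  have "B (lin n f c) (lin n g d) = (\<Sum>i<n. c i * B (f i) (lin n g d))"
    by (simp only: lin_def[of n f c] B_sum(1) B_scale)
  then show ?thesis by (simp add: lin_def B_sum(2) B_scale_right sum_distrib_left)
qed

context unimodular begin

text \<open>Links independence modulo \<open>\<P>\<close> with saturation. If a combination with a
  non-integral coefficient were in \<open>M\<close>, scaling the least valuation to 0 would put it
  into \<open>\<pi> M\<close> while one coefficient is a unit.\<close>

lemma prim_iff_saturated:
  assumes y: "\<And>i. i < n \<Longrightarrow> y i \<in> M"
  shows "prim n y \<longleftrightarrow> (\<forall>c. lin n y c \<in> M \<longleftrightarrow> (\<forall>i<n. c i \<in> \<O>))"
proof
  assume p: "prim n y"
  show "\<forall>c. lin n y c \<in> M \<longleftrightarrow> (\<forall>i<n. c i \<in> \<O>)"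
  proof (rule allI, rule iffI)
    fix c assume "\<forall>i<n. c i \<in> \<O>"
    then show "lin n y c \<in> M" unfolding lin_def using y by (intro M_sum M_smult) auto
  next
    fix c assume cM: "lin n y c \<in> M"
    show "\<forall>i<n. c i \<in> \<O>"
    proof (rule ccontr)
      assume "\<not> (\<forall>i<n. c i \<in> \<O>)"
      then obtain i0 where i0: "i0 < n" "c i0 \<notin> \<O>" by auto
      define J where "J = {i. i < n \<and> c i \<noteq> 0}"
      have i0nz: "c i0 \<noteq> 0" using i0(2) by auto
      have "finite J" "J \<noteq> {}" using i0 i0nz by (auto simp: J_def)
      from ex_is_arg_min_if_finite[OF this, of "\<lambda>i. v (c i)"] obtain p0
        where p0: "p0 \<in> J" "\<And>i. i \<in> J \<Longrightarrow> v (c p0) \<le> v (c i)" unfolding is_arg_min_linorder by blast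
      have neg: "v (c p0) < 0" using p0(2)[of i0] i0 i0nz by (auto simp: J_def integers_def)
      define k where "k = nat (- v (c p0))"
      have dO: "\<pi> ^ k * c i \<in> \<O>" if "i < n" for i
        using p0(2)[of i] neg that by (cases "c i = 0") (auto simp: J_def integers_def val_mult v_power v_pi k_def)
      have "lin n y (\<lambda>i. \<pi> ^ k * c i) \<in> pM (k + 0)"
        unfolding lin_scale[symmetric] pM_scale_pi using cM by (simp add: pM_0)
      then have "(\<Sum>i<n. s (\<pi> ^ k * c i) (y i)) \<in> pM (Suc 0)"
        using pM_antimono[of "Suc 0" k] neg by (simp add: lin_def k_def)
      moreover have "(\<forall>i<n. \<pi> ^ k * c i \<in> \<O>) \<longrightarrow> (\<Sum>i<n. s (\<pi> ^ k * c i) (y i)) \<in> pM (Suc 0) \<longrightarrow> (\<forall>i<n. \<pi> ^ k * c i \<in> \<P>)"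
        using p unfolding prim_def by (rule spec)
      ultimately have "\<pi> ^ k * c p0 \<in> \<P>" using dO p0(1) by (simp add: J_def)
      then show False using p0(1) neg by (auto simp: J_def max_ideal_def val_mult v_power v_pi k_def)
    qed
  qed
next
  assume sat: "\<forall>c. lin n y c \<in> M \<longleftrightarrow> (\<forall>i<n. c i \<in> \<O>)"
  show "prim n y"
    unfolding prim_def
  proof (intro allI impI)
    fix c i assume c: "\<forall>i<n. c i \<in> \<O>" "(\<Sum>i<n. s (c i) (y i)) \<in> pM (Suc 0)" and i: "i < n"
    have "lin n y (\<lambda>i. inverse \<pi> * c i) \<in> M"
      using c(2) unfolding lin_scale[symmetric] by (simp add: lin_def pM_1)
    then have "inverse \<pi> * c i \<in> \<O>" using spec[OF sat, of "\<lambda>i. inverse \<pi> * c i"] i by simp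
    then show "c i \<in> \<P>" by (simp add: P_iff divide_inverse mult.commute)
  qed
qed

lemma prim_reps_sym:
  assumes t: "\<And>i j. t (i, j) = t (j, i)"
  shows "prim_reps n N t = {y\<in>tuples n M. prim n y \<and> (\<forall>i<n. \<forall>j<n. B (y i) (y j) - t (i, j) \<in> \<I> N)}"
proof -
  have "(\<forall>(i, j)\<in>idx_pairs n. B (y i) (y j) - t (i, j) \<in> \<I> N) \<longleftrightarrow> (\<forall>i<n. \<forall>j<n. B (y i) (y j) - t (i, j) \<in> \<I> N)" for y
  proof
    assume *: "\<forall>(i, j)\<in>idx_pairs n. B (y i) (y j) - t (i, j) \<in> \<I> N"
    show "\<forall>i<n. \<forall>j<n. B (y i) (y j) - t (i, j) \<in> \<I> N"
    proof (intro allI impI)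
      fix i j assume ij: "i < n" "j < n"
      show "B (y i) (y j) - t (i, j) \<in> \<I> N"
      proof (cases "i \<le> j")
        case True
        then show ?thesis using * ij by (auto simp: idx_pairs_def)
      next
        case False
        then have "B (y j) (y i) - t (j, i) \<in> \<I> N" using * ij by (auto simp: idx_pairs_def)
        then show ?thesis using B_sym[of "y i" "y j"] t[of i j] by simp
      qed
    qed
  qed (auto simp: idx_pairs_def)
  then show ?thesis unfolding prim_reps_def by blast
qed

text \<open>The representations of varying precision are sorted by their Gram matrix modulo
  \<open>power_ideal v N\<close>; by Hensel's lemma all these Gram matrices are equally frequent.\<close>

lemma varying_precision_count:
  assumes t: "\<And>i j. t (i, j) = t (j, i)" "\<And>i j. i < n \<Longrightarrow> j < n \<Longrightarrow> t (i, j) \<in> \<O>"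
    and k: "\<And>i j. i < n \<Longrightarrow> j < n \<Longrightarrow> k i + k j < N"
  defines "Y \<equiv> {y\<in>tuples n M. prim n y \<and> (\<forall>i<n. \<forall>j<n. B (y i) (y j) - t (i, j) \<in> \<I> (N - k i - k j))}"
  shows "real (ncosets Y (funs {..<n} (\<lambda>i. pM (N - k i)))) * q ^ (m * (\<Sum>i<n. k i)) =
    q ^ ((n + 1) * (\<Sum>i<n. k i)) * (q ^ (m * n) / q ^ card (idx_pairs n)) ^ (N - 1) *
    real (ncosets (prim_reps n (Suc 0) t) (tuples n K1))"
proof (cases "n = 0")
  \<comment> \<open>For \<open>n = 0\<close> the condition on \<open>k\<close> does not provide a
    positive \<open>N\<close>.\<close>
  case True
  have "prim_reps 0 (Suc 0) t = {0}" by (auto simp: prim_reps_def prim_def funs_def idx_pairs_def)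
  moreover have "Y = {0}" using True by (auto simp: Y_def prim_def funs_def)
  moreover have "idx_pairs 0 = {}" by (auto simp: idx_pairs_def)
  ultimately show ?thesis using True by (simp add: ncosets_def cosets_def)
next
  case False
  then have N: "N > 0" using k[of 0 0] by simp
  let ?La = "funs {..<n} (\<lambda>i. pM (N - k i))"
  let ?K = "tuples n (pM N)"
  have sub: "subgrp ?La" "subgrp ?K" by (auto intro: subgrp_funs)
  have KLa: "?K \<subseteq> ?La" using pM_antimono[of "N - k _" N] by (auto simp: funs_def)
  have finY: "finite (cosets Y ?K)" by (rule finite_cosets_tuples) (auto simp: Y_def)
  \<comment> \<open>The set \<open>Y\<close> is stable under the coarser group, where the
    \<open>i\<close>-th vector matters only modulo \<open>\<pi>^(N - k i) M\<close>; counting at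
    uniform precision \<open>N\<close> therefore introduces just the index of the two
    groups.\<close>
  have idx: "ncosets Y ?K = ncosets ?La ?K * ncosets Y ?La"
  proof (rule ncosets_index[OF sub KLa finY])
    fix y w assume y: "y \<in> Y" and w: "w \<in> ?La"
    have wi: "w i \<in> pM (N - k i)" if "i < n" for i using w that by (auto simp: funs_def)
    have wM: "w i \<in> M" if "i < n" for i using wi[OF that] pM_M by blast
    have yM: "y i \<in> M" if "i < n" for i using y that by (auto simp: Y_def funs_def)
    have "prim n (y + w) \<longleftrightarrow> prim n y"
    proof (rule prim_cong)
      fix i assume i: "i < n"
      then show "(y + w) i - y i \<in> K1" using pM_antimono[of "Suc 0" "N - k i" "w i"] wi[OF i] k[OF i i] by simp
    qed
    moreover have "B ((y + w) i) ((y + w) j) - t (i, j) \<in> \<I> (N - k i - k j)" if ij: "i < n" "j < n" for i j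
    proof -
      have "B (w i) (y j + w j) \<in> \<I> (N - k i - k j)"
        by (rule I_antimono[OF _ B_pM[OF wi[OF ij(1)]]]) (use yM wM ij M_add in auto)
      moreover have "B (w j) (y i) \<in> \<I> (N - k i - k j)"
        by (rule I_antimono[OF _ B_pM[OF wi[OF ij(2)]]]) (use yM ij in auto)
      moreover have "B (y i) (y j) - t (i, j) \<in> \<I> (N - k i - k j)" using y ij by (auto simp: Y_def)
      ultimately have "(B (y i) (y j) - t (i, j)) + (B (w i) (y j + w j) + B (w j) (y i)) \<in> \<I> (N - k i - k j)"
        by (intro I_add)
      then show ?thesis using B_sym[of "y i" "w j"] by (simp add: B_add B_add_right algebra_simps)
    qed
    moreover have "y + w \<in> tuples n M" using y yM wM w by (auto simp: Y_def funs_def intro: M_add)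
    ultimately show "y + w \<in> Y" using y by (simp add: Y_def)
  qed
  have "real (ncosets ?La ?K) = (\<Prod>i<n. q ^ (m * k i))"
  proof -
    have "real (ncosets (pM (N - k i)) (pM N)) = q ^ (m * k i)" if "i < n" for i
      using cosets_pM(2)[of "N - k i" "k i"] k[OF that that] by simp
    then show ?thesis by (subst ncosets_funs) simp_all
  qed
  then have La: "real (ncosets ?La ?K) = q ^ (m * (\<Sum>i<n. k i))"
    by (simp add: power_sum[symmetric] sum_distrib_left)
  define tt where "tt = (\<lambda>p. if p \<in> idx_pairs n then t p else 0)"
  \<comment> \<open>The Gram matrices at precision \<open>N\<close> that are compatible with
    \<open>t\<close> at the lower precision.\<close>
  define A' where "A' = {t'\<in>funs (idx_pairs n) (\<lambda>_. \<O>). \<forall>(i, j)\<in>idx_pairs n. t' (i, j) - t (i, j) \<in> \<I> (N - k i - k j)}"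
  let ?K' = "funs (idx_pairs n) (\<lambda>_. \<I> N)"
  define G where "G y = (\<lambda>(i, j). if (i, j) \<in> idx_pairs n then B (y i) (y j) else 0)" for y
  \<comment> \<open>As \<open>k i + k j < N\<close>, all these matrices agree modulo
    \<open>\<P>\<close>, so they have the same solutions over the residue field.\<close>
  have PR1: "prim_reps n (Suc 0) t' = prim_reps n (Suc 0) t" if t': "t' \<in> A'" for t'
  proof -
    have "B (y i) (y j) - t' (i, j) \<in> \<I> (Suc 0) \<longleftrightarrow> B (y i) (y j) - t (i, j) \<in> \<I> (Suc 0)" if ij: "(i, j) \<in> idx_pairs n" for y i j
    proof -
      have "i < n" "j < n" using ij by (auto simp: idx_pairs_def)
      then have "t' (i, j) - t (i, j) \<in> \<I> (Suc 0)"
        using t' ij k[of i j] I_antimono[of "Suc 0" "N - k i - k j"] by (fastforce simp: A'_def)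
      then show ?thesis using P_diff_cong_right unfolding I_1 by blast
    qed
    then show ?thesis unfolding prim_reps_def by blast
  qed
  have "real (ncosets Y ?K) = (q ^ (m * n) / q ^ card (idx_pairs n)) ^ (N - 1) * real (ncosets (prim_reps n (Suc 0) t) (tuples n K1)) * real (ncosets A' ?K')"
  proof (rule ncosets_fibration_real[where f = G])
    fix y assume y: "y \<in> Y"
    then have "B (y i) (y j) \<in> \<O>" if "(i, j) \<in> idx_pairs n" for i j
      using that by (intro B_integral) (auto simp: Y_def funs_def idx_pairs_def)
    then show "G y \<in> A'" using y by (auto simp: A'_def G_def funs_def Y_def idx_pairs_def)
  next
    fix x y assume xy: "x \<in> Y" "y \<in> Y" "x - y \<in> ?K"
    have "B (x i) (x j) - B (y i) (y j) \<in> \<I> N" if ij: "(i, j) \<in> idx_pairs n" for i j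
    proof -
      have l: "i < n" "j < n" using ij by (auto simp: idx_pairs_def)
      have d: "x i - y i \<in> pM N" "x j - y j \<in> pM N" using funsD[OF xy(3), of i] funsD[OF xy(3), of j] l by auto
      have M: "x j \<in> M" "y i \<in> M" using xy l by (auto simp: Y_def funs_def)
      have "B (x i) (x j) - B (y i) (y j) = B (x i - y i) (x j) + B (x j - y j) (y i)"
        using B_sym[of "y i"] by (simp add: B_diff)
      also have "\<dots> \<in> \<I> N" using B_pM[OF d(1) M(1)] B_pM[OF d(2) M(2)] by (rule I_add)
      finally show ?thesis .
    qed
    then show "G x - G y \<in> ?K'" by (auto simp: G_def funs_def)
  next
    fix t' assume t': "t' \<in> A'"
    have "{y \<in> Y. G y - t' \<in> ?K'} = prim_reps n N t'"
    proof (intro equalityI subsetI)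
      fix y assume "y \<in> {y \<in> Y. G y - t' \<in> ?K'}"
      then show "y \<in> prim_reps n N t'" by (fastforce simp: Y_def prim_reps_def G_def funs_def)
    next
      fix y assume y: "y \<in> prim_reps n N t'"
      have *: "B (y i) (y j) - t (i, j) \<in> \<I> (N - k i - k j)" if ij: "(i, j) \<in> idx_pairs n" for i j
      proof -
        have "B (y i) (y j) - t' (i, j) \<in> \<I> (N - k i - k j)"
          using y ij I_antimono[of "N - k i - k j" N] by (fastforce simp: prim_reps_def)
        moreover have "t' (i, j) - t (i, j) \<in> \<I> (N - k i - k j)" using t' ij by (auto simp: A'_def)
        ultimately show ?thesis using I_add by fastforce
      qed
      have "B (y i) (y j) - t (i, j) \<in> \<I> (N - k i - k j)" if ij: "i < n" "j < n" for i j
      proof (cases "i \<le> j")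
        case True
        then show ?thesis using * ij by (auto simp: idx_pairs_def)
      next
        case False
        then have "B (y j) (y i) - t (j, i) \<in> \<I> (N - k j - k i)" using * ij by (auto simp: idx_pairs_def)
        then show ?thesis using B_sym[of "y i" "y j"] t(1)[of i j] by (simp add: diff_right_commute add.commute)
      qed
      moreover have "G y - t' \<in> ?K'" using y t' by (auto simp: prim_reps_def G_def funs_def A'_def)
      ultimately show "y \<in> {y \<in> Y. G y - t' \<in> ?K'}" using y by (auto simp: Y_def prim_reps_def)
    qed
    then show "real (ncosets {y \<in> Y. G y - t' \<in> ?K'} ?K) =
      (q ^ (m * n) / q ^ card (idx_pairs n)) ^ (N - 1) * real (ncosets (prim_reps n (Suc 0) t) (tuples n K1))"
      using hensel[of t' n "N - 1"] t' N PR1[OF t'] by (simp add: A'_def)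
  qed (use finY in \<open>auto intro: subgrp_funs\<close>)
  moreover have "real (ncosets A' ?K') = q ^ ((n + 1) * (\<Sum>i<n. k i))"
  proof -
    let ?X = "funs (idx_pairs n) (\<lambda>(i, j). \<I> (N - k i - k j))"
    have ttO: "tt \<in> funs (idx_pairs n) (\<lambda>_. \<O>)" using t(2) by (auto simp: funs_def tt_def idx_pairs_def)
    have "A' = (+) tt ` ?X"
    proof (intro equalityI subsetI)
      fix t' assume t': "t' \<in> A'"
      have "t' - tt \<in> ?X" using t' by (auto simp: A'_def funs_def tt_def)
      moreover have "t' = tt + (t' - tt)" by simp
      ultimately show "t' \<in> (+) tt ` ?X" by blast
    next
      fix t' assume "t' \<in> (+) tt ` ?X"
      then obtain x where x: "t' = tt + x" "x \<in> ?X" by auto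
      have "x p \<in> \<O>" if "p \<in> idx_pairs n" for p using funsD[OF x(2) that] I_imp_O by (cases p) auto
      then show "t' \<in> A'" using x ttO by (auto simp: A'_def funs_def tt_def)
    qed
    then have "ncosets A' ?K' = ncosets ?X ?K'" using ncosets_translate[of ?K' tt ?X] by (simp add: subgrp_funs)
    also have "\<dots> = (\<Prod>p\<in>idx_pairs n. ncosets (case p of (i, j) \<Rightarrow> \<I> (N - k i - k j)) (\<I> N))"
      by (subst ncosets_funs) simp_all
    finally have "real (ncosets A' ?K') = (\<Prod>p\<in>idx_pairs n. real (ncosets (case p of (i, j) \<Rightarrow> \<I> (N - k i - k j)) (\<I> N)))"
      by simp
    also have "\<dots> = (\<Prod>p\<in>idx_pairs n. q ^ (case p of (i, j) \<Rightarrow> k i + k j))"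
    proof (rule prod.cong[OF refl])
      fix p assume p: "p \<in> idx_pairs n"
      obtain i j where ij: "p = (i, j)" by (cases p)
      have l: "i < n" "j < n" using p ij by (auto simp: idx_pairs_def)
      have "N - k i - k j + (k i + k j) = N" using k[OF l] by simp
      then show "real (ncosets (case p of (i, j) \<Rightarrow> \<I> (N - k i - k j)) (\<I> N)) = q ^ (case p of (i, j) \<Rightarrow> k i + k j)"
        using cosets_I(2)[of "N - k i - k j" "k i + k j"] by (simp add: ij)
    qed
    also have "\<dots> = q ^ ((n + 1) * (\<Sum>i<n. k i))"
      unfolding power_sum[symmetric] sum_idx_pairs[symmetric] by (simp add: case_prod_beta)
    finally show ?thesis .
  qed
  ultimately show ?thesis using idx La by (simp add: mult_ac)
qed

end

section \<open>Linear maps and their saturations\<close>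

locale rep_pair = odd_local_field v + L: quad_space v s B + H: unimodular v s' B' M m
  for v :: "'a::field \<Rightarrow> int" and s :: "'a \<Rightarrow> 'b::ab_group_add \<Rightarrow> 'b" and B
    and s' :: "'a \<Rightarrow> 'c::ab_group_add \<Rightarrow> 'c" and B' M m
begin

text \<open>Linear over the field on \<open>W\<close> and 0 elsewhere, so that maps are determined
  by their restriction to \<open>W\<close> and form a group under pointwise subtraction.\<close>

definition linmaps :: "'b set \<Rightarrow> ('b \<Rightarrow> 'c) set" where
  "linmaps W = {f. (\<forall>z\<in>W. \<forall>w\<in>W. f (z + w) = f z + f w) \<and> (\<forall>c. \<forall>z\<in>W. f (s c z) = s' c (f z)) \<and> (\<forall>z. z \<notin> W \<longrightarrow> f z = 0)}"

definition small_maps :: "'b set \<Rightarrow> 'b set \<Rightarrow> nat \<Rightarrow> ('b \<Rightarrow> 'c) set" where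
  "small_maps W L0 N = {f\<in>linmaps W. \<forall>z\<in>L0. f z \<in> H.pM N}"

text \<open>The maps with \<open>saturation W f = L'\<close> correspond to the primitive representations of \<open>L'\<close>.\<close>

definition approx_reps :: "'b set \<Rightarrow> 'b set \<Rightarrow> nat \<Rightarrow> ('b \<Rightarrow> 'c) set" where
  "approx_reps W L0 N = {f\<in>linmaps W. (\<forall>z\<in>L0. f z \<in> M) \<and> (\<forall>z\<in>L0. \<forall>w\<in>L0. B' (f z) (f w) - B z w \<in> \<I> N)}"

definition saturation :: "'b set \<Rightarrow> ('b \<Rightarrow> 'c) \<Rightarrow> 'b set" where
  "saturation W f = {z\<in>W. f z \<in> M}"

lemma linmaps_diff: "f \<in> linmaps W \<Longrightarrow> g \<in> linmaps W \<Longrightarrow> f - g \<in> linmaps W"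
  by (auto simp: linmaps_def H.vs.scale_right_diff_distrib)

lemma subgrp_small_maps: "subgrp (small_maps W L0 N)"
proof -
  have "0 \<in> linmaps W" by (simp add: linmaps_def)
  then show ?thesis using linmaps_diff subgrp_diff[OF H.subgrp_pM] by (auto simp: subgrp_def small_maps_def)
qed

lemma linmap_lin:
  assumes "f \<in> linmaps (range (L.lin n e))" shows "f (L.lin n e c) = H.lin n (\<lambda>i. f (e i)) c"
proof -
  let ?W = "range (L.lin n e)"
  have W0: "0 \<in> ?W" using L.lin_def[of n e "\<lambda>_. 0"] by (metis (no_types, lifting) L.vs.scale_zero_left rangeI sum.neutral)
  have f0: "f 0 = 0"
    using assms W0 unfolding linmaps_def by (metis (mono_tags, lifting) H.vs.scale_zero_left L.vs.scale_zero_left mem_Collect_eq)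
  have "f (\<Sum>i<j. s (c i) (e i)) = (\<Sum>i<j. s' (c i) (f (e i))) \<and> (\<Sum>i<j. s (c i) (e i)) \<in> ?W" if "j \<le> n" for j
    using that
  proof (induction j)
    case 0
    then show ?case using f0 W0 by simp
  next
    case (Suc j)
    have ej: "s a (e j) \<in> ?W" for a using L.lin_single[of j n e a] Suc.prems by (metis Suc_le_eq rangeI)
    have "e j \<in> ?W" using ej[of 1] by simp
    then have 1: "f (s (c j) (e j)) = s' (c j) (f (e j))" using assms by (auto simp: linmaps_def)
    have IH: "f (\<Sum>i<j. s (c i) (e i)) = (\<Sum>i<j. s' (c i) (f (e i)))" "(\<Sum>i<j. s (c i) (e i)) \<in> ?W" using Suc by auto
    have "f ((\<Sum>i<j. s (c i) (e i)) + s (c j) (e j)) = f (\<Sum>i<j. s (c i) (e i)) + f (s (c j) (e j))"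
      using assms IH(2) ej[of "c j"] unfolding linmaps_def by blast
    moreover have "(\<Sum>i<j. s (c i) (e i)) + s (c j) (e j) \<in> ?W"
    proof -
      obtain d d' where "(\<Sum>i<j. s (c i) (e i)) = L.lin n e d" "s (c j) (e j) = L.lin n e d'"
        using IH(2) ej[of "c j"] by blast
      then show ?thesis using L.lin_add by simp
    qed
    ultimately show ?case using IH(1) 1 by simp
  qed
  then show ?thesis by (simp add: L.lin_def H.lin_def)
qed

lemma linmap_exists:
  assumes e: "L.indep n e"
  shows "\<exists>f\<in>linmaps (range (L.lin n e)). \<forall>c. f (L.lin n e c) = H.lin n x c"
proof -
  define f where "f z = (if z \<in> range (L.lin n e) then H.lin n x (SOME c. L.lin n e c = z) else 0)" for z
  have f: "f (L.lin n e c) = H.lin n x c" for c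
  proof -
    have "\<exists>c'. L.lin n e c' = L.lin n e c" by blast
    from someI_ex[OF this] have "L.lin n e (SOME c'. L.lin n e c' = L.lin n e c) = L.lin n e c" .
    from L.indep_eq[OF e this] show ?thesis by (auto simp: f_def intro: H.lin_cong)
  qed
  have "f \<in> linmaps (range (L.lin n e))"
    by (auto simp: linmaps_def L.lin_add L.lin_scale f H.lin_add H.lin_scale) (simp add: f_def)
  then show ?thesis using f by blast
qed

text \<open>Evaluation on a basis of the smaller lattice turns linear maps into tuples, and
  congruence of maps on that lattice into congruence of tuples. The saturation becomes a condition
  on which combinations of the tuple lie in \<open>M\<close>.\<close>

lemma eval_count:
  assumes e: "L.indep n e" and L': "L' \<subseteq> range (L.lin n e)"
  shows "ncosets {f\<in>approx_reps (range (L.lin n e)) (L.olat n e) N. saturation (range (L.lin n e)) f = L'}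
      (small_maps (range (L.lin n e)) (L.olat n e) N) =
    ncosets {x\<in>H.tuples n M. (\<forall>i<n. \<forall>j<n. B' (x i) (x j) - B (e i) (e j) \<in> \<I> N) \<and>
      (\<forall>c. H.lin n x c \<in> M \<longleftrightarrow> L.lin n e c \<in> L')} (H.tuples n (H.pM N))"
proof (rule ncosets_iso(1)[where f = "\<lambda>f i. if i < n then f (e i) else 0"])
  let ?W = "range (L.lin n e)"
  have eL: "e i \<in> L.olat n e" if "i < n" for i using L.basis_in_olat that by auto
  show "subgrp (H.tuples n (H.pM N))" by (rule subgrp_funs) simp
  show "subgrp (small_maps ?W (L.olat n e) N)" by (rule subgrp_small_maps)
  fix f assume f: "f \<in> {f\<in>approx_reps ?W (L.olat n e) N. saturation ?W f = L'}"
  have fl: "f \<in> linmaps ?W" using f by (simp add: approx_reps_def)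
  have "H.lin n (\<lambda>i. if i < n then f (e i) else 0) c = f (L.lin n e c)" for c
    unfolding linmap_lin[OF fl] by (simp add: H.lin_def)
  moreover have "f (L.lin n e c) \<in> M \<longleftrightarrow> L.lin n e c \<in> L'" for c using f by (auto simp: saturation_def)
  ultimately show "(\<lambda>i. if i < n then f (e i) else 0) \<in> {x\<in>H.tuples n M. (\<forall>i<n. \<forall>j<n. B' (x i) (x j) - B (e i) (e j) \<in> \<I> N) \<and>
      (\<forall>c. H.lin n x c \<in> M \<longleftrightarrow> L.lin n e c \<in> L')}"
    using f eL by (auto simp: funs_def approx_reps_def)
  fix g assume g: "g \<in> {f\<in>approx_reps ?W (L.olat n e) N. saturation ?W f = L'}"
  have gl: "g \<in> linmaps ?W" using g by (simp add: approx_reps_def)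
  have fg: "f - g \<in> linmaps ?W" using linmaps_diff fl gl by auto
  have "f - g \<in> small_maps ?W (L.olat n e) N \<longleftrightarrow> (\<forall>i<n. f (e i) - g (e i) \<in> H.pM N)"
  proof
    assume "f - g \<in> small_maps ?W (L.olat n e) N"
    then show "\<forall>i<n. f (e i) - g (e i) \<in> H.pM N" using eL by (auto simp: small_maps_def)
  next
    assume *: "\<forall>i<n. f (e i) - g (e i) \<in> H.pM N"
    have "(f - g) z \<in> H.pM N" if zL: "z \<in> L.olat n e" for z
    proof -
      obtain c where c: "z = L.lin n e c" "\<forall>i<n. c i \<in> \<O>" using zL by (auto simp: L.olat_def)
      show ?thesis unfolding c(1) linmap_lin[OF fg] H.lin_def
        by (rule subgrp_sum[OF H.subgrp_pM], rule H.pM_smult_O) (use c(2) * in auto)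
    qed
    then show "f - g \<in> small_maps ?W (L.olat n e) N" using fg by (simp add: small_maps_def)
  qed
  then show "(\<lambda>i. if i < n then f (e i) else 0) - (\<lambda>i. if i < n then g (e i) else 0) \<in> H.tuples n (H.pM N) \<longleftrightarrow>
      f - g \<in> small_maps ?W (L.olat n e) N"
    by (auto simp: funs_def)
next
  let ?W = "range (L.lin n e)"
  fix x assume x: "x \<in> {x\<in>H.tuples n M. (\<forall>i<n. \<forall>j<n. B' (x i) (x j) - B (e i) (e j) \<in> \<I> N) \<and>
      (\<forall>c. H.lin n x c \<in> M \<longleftrightarrow> L.lin n e c \<in> L')}"
  obtain f where f: "f \<in> linmaps ?W" "\<And>c. f (L.lin n e c) = H.lin n x c" using linmap_exists[OF e, of x] by blast
  have fe: "f (e i) = x i" if "i < n" for i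
    using f(2)[of "\<lambda>j. if j = i then 1 else 0"] L.lin_single[OF that, of e 1] H.lin_single[OF that, of x 1] by simp
  have xM: "x i \<in> M" if "i < n" for i using x that by (auto simp: funs_def)
  have "B' (f z) (f w) - B z w \<in> \<I> N" if zw: "z \<in> L.olat n e" "w \<in> L.olat n e" for z w
  proof -
    obtain c d where c: "z = L.lin n e c" "\<forall>i<n. c i \<in> \<O>" "w = L.lin n e d" "\<forall>i<n. d i \<in> \<O>" using zw by (auto simp: L.olat_def)
    have "B' (f z) (f w) - B z w = (\<Sum>i<n. \<Sum>j<n. c i * d j * (B' (x i) (x j) - B (e i) (e j)))"
      unfolding c f(2) H.B_lin L.B_lin by (simp add: sum_subtractf right_diff_distrib mult.assoc)
    also have "\<dots> \<in> \<I> N" using c x by (intro I_sum I_mult_left) auto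
    finally show ?thesis .
  qed
  moreover have "f z \<in> M" if zL: "z \<in> L.olat n e" for z
  proof -
    obtain c where c: "z = L.lin n e c" "\<forall>i<n. c i \<in> \<O>" using zL by (auto simp: L.olat_def)
    show ?thesis unfolding c(1) f(2) H.lin_def by (intro H.M_sum H.M_smult) (use c(2) xM in auto)
  qed
  ultimately have "f \<in> approx_reps ?W (L.olat n e) N" using f by (simp add: approx_reps_def)
  moreover have "saturation ?W f = L'" using x L' f(2) by (auto simp: saturation_def)
  moreover have "(\<lambda>i. if i < n then f (e i) else 0) - x \<in> H.tuples n (H.pM N)"
    using fe x by (auto simp: funs_def)
  ultimately show "\<exists>f\<in>{f\<in>approx_reps ?W (L.olat n e) N. saturation ?W f = L'}.
      (\<lambda>i. if i < n then f (e i) else 0) - x \<in> H.tuples n (H.pM N)" by blast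
qed

end

section \<open>Integral overlattices\<close>

context quad_space begin

lemma lin_scaled: "lin n (\<lambda>i. s (d i) (f i)) c = lin n f (\<lambda>i. c i * d i)"
  by (simp add: lin_def)

lemma range_lin_eq: "olat n f = olat n e \<Longrightarrow> range (lin n f) = range (lin n e)"
  using span_olat by metis

lemma dilate_basis:
  assumes f: "indep n f"
  shows "indep n (\<lambda>i. s (inverse (\<pi> ^ k i)) (f i))" "olat n (\<lambda>i. s (inverse (\<pi> ^ k i)) (f i)) = dilate n f k"
    "range (lin n (\<lambda>i. s (inverse (\<pi> ^ k i)) (f i))) = range (lin n f)"
proof -
  let ?h = "\<lambda>i. s (inverse (\<pi> ^ k i)) (f i)"
  have lh: "lin n ?h c = lin n f (\<lambda>i. c i * inverse (\<pi> ^ k i))" for c by (rule lin_scaled)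
  have lf: "lin n f c = lin n ?h (\<lambda>i. c i * \<pi> ^ k i)" for c unfolding lh by (rule lin_cong) (simp add: mult.assoc)
  show "indep n ?h"
    unfolding indep_def
  proof (intro allI impI)
    fix c i assume "lin n ?h c = 0" "i < n"
    then have "c i * inverse (\<pi> ^ k i) = 0" using f unfolding lh indep_def by blast
    then show "c i = 0" by simp
  qed
  show "olat n ?h = dilate n f k"
  proof (intro equalityI subsetI)
    fix x assume "x \<in> olat n ?h"
    then obtain c where "x = lin n ?h c" "\<forall>i<n. c i \<in> \<O>" by (auto simp: olat_def)
    then show "x \<in> dilate n f k"
      unfolding lh dilate_def by (intro CollectI exI[of _ "\<lambda>i. c i * inverse (\<pi> ^ k i)"]) (auto simp: mult.assoc)
  next
    fix x assume "x \<in> dilate n f k"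
    then obtain c where "x = lin n f c" "\<forall>i<n. c i * \<pi> ^ k i \<in> \<O>" by (auto simp: dilate_def)
    then show "x \<in> olat n ?h"
      unfolding lf olat_def by (intro CollectI exI[of _ "\<lambda>i. c i * \<pi> ^ k i"]) auto
  qed
  show "range (lin n ?h) = range (lin n f)" 
  proof -
    have "lin n ?h c \<in> range (lin n f)" for c unfolding lh by blast
    moreover have "lin n f c \<in> range (lin n ?h)" for c unfolding lf by blast
    ultimately show ?thesis by blast
  qed
qed

lemma adapted_dilate:
  assumes e: "indep n e" and S: "osubmodule v s S" "olat n e \<subseteq> S"
    and bound: "\<And>x. x \<in> S \<Longrightarrow> s (\<pi> ^ a) x \<in> olat n e" and span: "S \<subseteq> range (lin n e)"
  shows "\<exists>f k. indep n f \<and> olat n f = olat n e \<and> S = dilate n f k \<and> (\<forall>i<n. k i \<le> a)"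
proof -
  obtain f k where f: "indep n f" "olat n f = olat n e" and fk: "\<And>c. lin n f c \<in> S \<longleftrightarrow> (\<forall>i<n. c i * \<pi> ^ (k i) \<in> \<O>)"
    using adapted_basis[OF e S bound] span by blast
  have "S = dilate n f k"
  proof (intro equalityI subsetI)
    fix x assume x: "x \<in> S"
    then obtain c where "x = lin n f c" using span range_lin_eq[OF f(2)] by blast
    then show "x \<in> dilate n f k" using x fk by (auto simp: dilate_def)
  qed (use fk in \<open>auto simp: dilate_def\<close>)
  moreover have "k i \<le> a" if i: "i < n" for i
  proof -
    let ?c = "\<lambda>j. if j = i then inverse (\<pi> ^ k i) else 0"
    have "lin n f ?c \<in> S" unfolding fk by auto
    then have "lin n f (\<lambda>j. \<pi> ^ a * ?c j) \<in> olat n f" using bound f(2) unfolding lin_scale[symmetric] by simp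
    then have "\<pi> ^ a * inverse (\<pi> ^ k i) \<in> \<O>" using i unfolding olat_iff[OF f(1)] by auto
    then show ?thesis by (simp add: integers_def val_mult v_inverse v_power v_pi)
  qed
  ultimately show ?thesis using f by blast
qed

text \<open>Described as modules with integral form; that they are free follows from an adapted
  basis, once their denominators are bounded.\<close>

definition overlattices :: "nat \<Rightarrow> (nat \<Rightarrow> 'c) \<Rightarrow> 'c set set" where
  "overlattices n e = {S. osubmodule v s S \<and> olat n e \<subseteq> S \<and> S \<subseteq> range (lin n e) \<and> (\<forall>x\<in>S. \<forall>y\<in>S. B x y \<in> \<O>)}"

text \<open>An integral overlattice lies in the dual of the small lattice, where the
  \<open>i\<close>-th coordinate has at most the denominator \<open>B (g i) (g i)\<close>, a divisor
  of \<open>\<pi>^a\<close>.\<close>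

lemma overlattice_bound:
  assumes g: "orthogonal n g" and a: "\<And>i. i < n \<Longrightarrow> B (g i) (g i) \<noteq> 0 \<and> \<pi> ^ a / B (g i) (g i) \<in> \<O>"
    and S: "S \<in> overlattices n g" "x \<in> S"
  shows "s (\<pi> ^ a) x \<in> olat n g"
proof -
  obtain c where c: "x = lin n g c" using S by (auto simp: overlattices_def)
  have "\<pi> ^ a * c i \<in> \<O>" if i: "i < n" for i
  proof -
    have "g i \<in> S" using S(1) basis_in_olat[OF i] by (auto simp: overlattices_def)
    then have "B x (g i) \<in> \<O>" using S by (auto simp: overlattices_def)
    then have "c i * B (g i) (g i) \<in> \<O>" unfolding c B_lin_basis[OF g i] .
    then have "c i * B (g i) (g i) * (\<pi> ^ a / B (g i) (g i)) \<in> \<O>" by (rule O_mult) (use a[OF i] in auto)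
    then show ?thesis using a[OF i] by (simp add: mult.commute)
  qed
  then show ?thesis unfolding c lin_scale by (intro olatI)
qed

text \<open>All overlattices lie between the lattice and its multiple by \<open>\<pi>^(- a)\<close>,
  which has finite index over it, and each is the union of its cosets.\<close>

lemma finite_overlattices:
  assumes gi: "indep n g" and g: "orthogonal n g" and a: "\<And>i. i < n \<Longrightarrow> B (g i) (g i) \<noteq> 0 \<and> \<pi> ^ a / B (g i) (g i) \<in> \<O>"
  shows "finite (overlattices n g)"
proof -
  have sub: "S \<subseteq> dilate n g (\<lambda>_. a)" if S: "S \<in> overlattices n g" for S
  proof
    fix x assume x: "x \<in> S"
    obtain c where c: "x = lin n g c" using S x by (auto simp: overlattices_def)
    have "lin n g (\<lambda>i. \<pi> ^ a * c i) \<in> olat n g" using overlattice_bound[OF g a S x] unfolding c lin_scale .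
    then show "x \<in> dilate n g (\<lambda>_. a)" unfolding c dilate_iff[OF gi] olat_iff[OF gi] by (simp add: mult.commute)
  qed
  have un: "S = \<Union> (cosets S (olat n g))" if S: "S \<in> overlattices n g" for S
  proof -
    have o: "osubmodule v s S" and l: "olat n g \<subseteq> S" using S by (auto simp: overlattices_def)
    have "0 \<in> olat n g" using osubmoduleD(1)[OF osubmodule_olat] .
    then have "x \<in> \<Union> (cosets S (olat n g))" if "x \<in> S" for x
      using that by (auto simp: cosets_def intro!: bexI[of _ x] image_eqI[of _ _ 0])
    moreover have "\<Union> (cosets S (olat n g)) \<subseteq> S" using osubmoduleD(2)[OF o] l by (auto simp: cosets_def)
    ultimately show ?thesis by blast
  qed
  have "inj_on (\<lambda>S. cosets S (olat n g)) (overlattices n g)" by (rule inj_onI) (metis un)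
  moreover have "(\<lambda>S. cosets S (olat n g)) ` overlattices n g \<subseteq> Pow (cosets (dilate n g (\<lambda>_. a)) (olat n g))"
    using cosets_mono[OF sub] by blast
  ultimately show ?thesis using count_dilate(2)[OF gi] by (metis finite_Pow_iff finite_imageD finite_subset)
qed

end

lemma (in unimodular) prim_reps_cong:
  assumes "\<And>p. p \<in> idx_pairs n \<Longrightarrow> t p = t' p" shows "prim_reps n N t = prim_reps n N t'"
proof -
  have "(\<forall>(i, j)\<in>idx_pairs n. B (y i) (y j) - t (i, j) \<in> \<I> N) \<longleftrightarrow> (\<forall>(i, j)\<in>idx_pairs n. B (y i) (y j) - t' (i, j) \<in> \<I> N)" for y
    by (rule ball_cong) (use assms in auto)
  then show ?thesis by (simp add: prim_reps_def)
qed

context rep_pair begin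

text \<open>Precision 1 suffices: \<open>hensel\<close> derives the primitive counts at higher
  precision from this one.\<close>

definition prim_count :: "'b set \<Rightarrow> 'b set \<Rightarrow> real" where
  "prim_count W L' = real (ncosets {f\<in>approx_reps W L' (Suc 0). saturation W f = L'} (small_maps W L' (Suc 0)))"

lemma prim_count_basis:
  assumes h: "L.indep n h"
  shows "prim_count (range (L.lin n h)) (L.olat n h) =
    real (ncosets (H.prim_reps n (Suc 0) (\<lambda>(i, j). B (h i) (h j))) (H.tuples n (H.pM (Suc 0))))"
proof -
  have "{x \<in> H.tuples n M. (\<forall>i<n. \<forall>j<n. B' (x i) (x j) - B (h i) (h j) \<in> \<I> (Suc 0)) \<and>
      (\<forall>c. H.lin n x c \<in> M \<longleftrightarrow> L.lin n h c \<in> L.olat n h)} =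
    {y\<in>H.tuples n M. H.prim n y \<and> (\<forall>i<n. \<forall>j<n. B' (y i) (y j) - (\<lambda>(i, j). B (h i) (h j)) (i, j) \<in> \<I> (Suc 0))}"
  proof (rule Collect_cong)
    fix x
    have "H.prim n x \<longleftrightarrow> (\<forall>c. H.lin n x c \<in> M \<longleftrightarrow> L.lin n h c \<in> L.olat n h)" if "x \<in> H.tuples n M"
      unfolding L.olat_iff[OF h] using that by (intro H.prim_iff_saturated) (auto simp: funs_def)
    then show "(x \<in> H.tuples n M \<and> (\<forall>i<n. \<forall>j<n. B' (x i) (x j) - B (h i) (h j) \<in> \<I> (Suc 0)) \<and>
      (\<forall>c. H.lin n x c \<in> M \<longleftrightarrow> L.lin n h c \<in> L.olat n h)) \<longleftrightarrow>
      (x\<in>H.tuples n M \<and> H.prim n x \<and> (\<forall>i<n. \<forall>j<n. B' (x i) (x j) - (\<lambda>(i, j). B (h i) (h j)) (i, j) \<in> \<I> (Suc 0)))"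
      by auto
  qed
  also have "\<dots> = H.prim_reps n (Suc 0) (\<lambda>(i, j). B (h i) (h j))"
    by (rule H.prim_reps_sym[symmetric]) (simp add: L.B_sym)
  finally show ?thesis
    unfolding prim_count_def using eval_count[OF h, of "L.olat n h" "Suc 0"] by (auto simp: L.olat_def)
qed

lemma prim_count_orthogonal:
  assumes g: "L.indep n g" "L.orthogonal n g"
  shows "prim_count (range (L.lin n g)) (L.olat n g) =
    real (ncosets (H.diag_reps n (\<lambda>i. B (g i) (g i))) (H.tuples n (H.pM (Suc 0))))"
proof -
  have "H.prim_reps n (Suc 0) (\<lambda>(i, j). B (g i) (g j)) = H.diag_reps n (\<lambda>i. B (g i) (g i))"
    unfolding H.diag_reps_def
    by (rule H.prim_reps_cong) (use g(2) in \<open>auto simp: idx_pairs_def L.orthogonal_def\<close>)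
  then show ?thesis using prim_count_basis[OF g(1)] by simp
qed

text \<open>For the basis \<open>\<pi>^(- k i) f i\<close> of \<open>L'\<close>, saturation
  \<open>L'\<close> means primitivity, while precision \<open>N\<close> on the \<open>f i\<close>
  becomes the uneven precision treated in \<open>varying_precision_count\<close>. The sum of the
  \<open>k i\<close> is the length of \<open>L'\<close> over the small lattice.\<close>

lemma count_overlattice:
  assumes f: "L.indep n f" and L': "L' = L.dilate n f k" and k: "\<And>i. i < n \<Longrightarrow> k i \<le> a"
    and int: "\<And>x y. x \<in> L' \<Longrightarrow> y \<in> L' \<Longrightarrow> B x y \<in> \<O>" and N: "2 * a < N"
  defines "W \<equiv> range (L.lin n f)" and "L0 \<equiv> L.olat n f"
  shows "real (ncosets {\<phi>\<in>approx_reps W L0 N. saturation W \<phi> = L'} (small_maps W L0 N)) * q ^ (m * (\<Sum>i<n. k i)) =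
    q ^ ((n + 1) * (\<Sum>i<n. k i)) * (q ^ (m * n) / q ^ card (idx_pairs n)) ^ (N - 1) * prim_count W L'"
proof -
  define h where "h i = s (inverse (\<pi> ^ k i)) (f i)" for i
  have h: "L.indep n h" "L.olat n h = L'" "range (L.lin n h) = W"
    using L.dilate_basis[OF f, of k] by (simp_all add: h_def[abs_def] L' W_def)
  have hL: "h i \<in> L'" if "i < n" for i using L.basis_in_olat[OF that, of h] h(2) by simp
  let ?t = "\<lambda>(i, j). B (h i) (h j)"
  define Y where "Y = {y\<in>H.tuples n M. H.prim n y \<and> (\<forall>i<n. \<forall>j<n. B' (y i) (y j) - ?t (i, j) \<in> \<I> (N - k i - k j))}"
  define X where "X = {x\<in>H.tuples n M. (\<forall>i<n. \<forall>j<n. B' (x i) (x j) - B (f i) (f j) \<in> \<I> N) \<and>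
      (\<forall>c. H.lin n x c \<in> M \<longleftrightarrow> L.lin n f c \<in> L')}"
  have kN: "k i + k j < N" if "i < n" "j < n" for i j using k[OF that(1)] k[OF that(2)] N by simp
  have fk: "L.lin n f c \<in> L' \<longleftrightarrow> (\<forall>i<n. c i * \<pi> ^ k i \<in> \<O>)" for c unfolding L' by (rule L.dilate_iff[OF f])
  let ?La = "funs {..<n} (\<lambda>i. H.pM (N - k i))"
  have fh: "f i = s (\<pi> ^ k i) (h i)" for i by (simp add: h_def)
  have scale: "B' (s' (\<pi> ^ k i) y) (s' (\<pi> ^ k j) y') - B (f i) (f j) \<in> \<I> N \<longleftrightarrow> B' y y' - B (h i) (h j) \<in> \<I> (N - k i - k j)"
    if "i < n" "j < n" for i j y y'
  proof -
    have e: "B' (s' (\<pi> ^ k i) y) (s' (\<pi> ^ k j) y') - B (f i) (f j) = \<pi> ^ (k i + k j) * (B' y y' - B (h i) (h j))"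
      unfolding fh[of i] fh[of j]
      by (simp add: L.B_scale L.B_scale_right H.B_scale H.B_scale_right power_add right_diff_distrib)
    have "N = (k i + k j) + (N - k i - k j)" using kN[OF that] by simp
    then show ?thesis using I_pow_mult[of "k i + k j" "B' y y' - B (h i) (h j)" "N - k i - k j"] unfolding e by simp
  qed
  have "ncosets Y ?La = ncosets X (H.tuples n (H.pM N))"
  proof (rule ncosets_iso(1)[where f = "\<lambda>y i. s' (\<pi> ^ k i) (y i)"])
    fix y assume y: "y \<in> Y"
    have yM: "y i \<in> M" if "i < n" for i using y that by (auto simp: Y_def funs_def)
    have sat: "H.lin n y c \<in> M \<longleftrightarrow> (\<forall>i<n. c i \<in> \<O>)" for c
      using y H.prim_iff_saturated[of n y] yM by (auto simp: Y_def)
    have "(\<lambda>i. s' (\<pi> ^ k i) (y i)) \<in> H.tuples n M" using y yM H.M_smult[OF O_power[OF pi_O]] by (auto simp: funs_def Y_def)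
    moreover have "H.lin n (\<lambda>i. s' (\<pi> ^ k i) (y i)) c \<in> M \<longleftrightarrow> L.lin n f c \<in> L'" for c
      unfolding H.lin_scaled sat fk ..
    ultimately show "(\<lambda>i. s' (\<pi> ^ k i) (y i)) \<in> X" using y scale by (auto simp: X_def Y_def)
  next
    fix y y' assume yy: "y \<in> Y" "y' \<in> Y"
    have "s' (\<pi> ^ k i) (y i) - s' (\<pi> ^ k i) (y' i) \<in> H.pM N \<longleftrightarrow> y i - y' i \<in> H.pM (N - k i)" if "i < n" for i
      using H.pM_scale_pi[of "k i" "y i - y' i" "N - k i"] kN[OF that that] by (simp add: H.vs.scale_right_diff_distrib)
    then show "(\<lambda>i. s' (\<pi> ^ k i) (y i)) - (\<lambda>i. s' (\<pi> ^ k i) (y' i)) \<in> H.tuples n (H.pM N) \<longleftrightarrow> y - y' \<in> ?La"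
      using yy by (auto simp: funs_def Y_def)
  next
    fix x assume x: "x \<in> X"
    have sat: "H.lin n x c \<in> M \<longleftrightarrow> (\<forall>i<n. c i * \<pi> ^ k i \<in> \<O>)" for c using x fk by (simp add: X_def)
    define y where "y i = s' (inverse (\<pi> ^ k i)) (x i)" for i
    have yx: "(\<lambda>i. s' (\<pi> ^ k i) (y i)) = x" by (simp add: y_def)
    have yM: "y i \<in> M" if i: "i < n" for i
    proof -
      have "H.lin n x (\<lambda>j. if j = i then inverse (\<pi> ^ k i) else 0) \<in> M" unfolding sat by auto
      then show ?thesis using H.lin_single[OF i] by (simp add: y_def)
    qed
    have "H.lin n y c \<in> M \<longleftrightarrow> (\<forall>i<n. c i \<in> \<O>)" for c
      unfolding y_def H.lin_scaled sat by (simp add: mult.assoc)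
    then have "H.prim n y" using H.prim_iff_saturated[of n y] yM by blast
    moreover have "y \<in> H.tuples n M" using yM x by (auto simp: funs_def X_def y_def)
    moreover have "B' (y i) (y j) - B (h i) (h j) \<in> \<I> (N - k i - k j)" if ij: "i < n" "j < n" for i j
      using scale[OF ij, of "y i" "y j"] x ij fun_cong[OF yx, of i] fun_cong[OF yx, of j] by (simp add: X_def)
    ultimately have "y \<in> Y" by (simp add: Y_def)
    moreover have "(\<lambda>i. s' (\<pi> ^ k i) (y i)) - x \<in> H.tuples n (H.pM N)" unfolding yx by (auto simp: funs_def)
    ultimately show "\<exists>y\<in>Y. (\<lambda>i. s' (\<pi> ^ k i) (y i)) - x \<in> H.tuples n (H.pM N)" by blast
  qed (auto intro: subgrp_funs)
  moreover have "L' \<subseteq> W" unfolding L' W_def by (auto simp: L.dilate_def)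
  then have "ncosets {\<phi>\<in>approx_reps W L0 N. saturation W \<phi> = L'} (small_maps W L0 N) = ncosets X (H.tuples n (H.pM N))"
    using eval_count[OF f, of L' N] by (simp add: W_def L0_def X_def)
  ultimately have *: "ncosets {\<phi>\<in>approx_reps W L0 N. saturation W \<phi> = L'} (small_maps W L0 N) = ncosets Y ?La" by simp
  have "real (ncosets Y ?La) * q ^ (m * (\<Sum>i<n. k i)) =
    q ^ ((n + 1) * (\<Sum>i<n. k i)) * (q ^ (m * n) / q ^ card (idx_pairs n)) ^ (N - 1) *
    real (ncosets (H.prim_reps n (Suc 0) ?t) (H.tuples n (H.pM (Suc 0))))"
    unfolding Y_def by (rule H.varying_precision_count) (use L.B_sym hL int kN in auto)
  then show ?thesis unfolding * using prim_count_basis[OF h(1)] by (simp add: h)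
qed

text \<open>Let \<open>c p\<close> be a coordinate of \<open>z\<close> of least valuation. The
  product of \<open>f z\<close> and \<open>f (g p)\<close> is \<open>c p * B (g p) (g p)\<close>
  times a unit, because the error of the approximate isometry is relatively small. If
  \<open>f z\<close> is in \<open>M\<close>, this product is integral, which bounds the denominators
  of \<open>z\<close> by \<open>\<pi>^a\<close>. With this bound the error stays integral on the
  saturation, and so does the form.\<close>

lemma saturation_overlattice:
  assumes g: "L.indep n g" "L.orthogonal n g"
    and a: "\<And>i. i < n \<Longrightarrow> B (g i) (g i) \<noteq> 0 \<and> \<pi> ^ a / B (g i) (g i) \<in> \<O>" and N: "2 * a < N"
  defines "W \<equiv> range (L.lin n g)" and "L0 \<equiv> L.olat n g"
  assumes f: "f \<in> approx_reps W L0 N"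
  shows "\<And>z. z \<in> saturation W f \<Longrightarrow> s (\<pi> ^ a) z \<in> L0" and "saturation W f \<in> L.overlattices n g"
proof -
  have fl: "f \<in> linmaps (range (L.lin n g))" using f by (simp add: approx_reps_def W_def)
  have gL: "g i \<in> L0" if "i < n" for i using L.basis_in_olat[OF that] by (simp add: L0_def)
  have fM: "f (g i) \<in> M" if "i < n" for i using f gL[OF that] by (simp add: approx_reps_def)
  define E where "E i j = B' (f (g i)) (f (g j)) - B (g i) (g j)" for i j
  have E: "E i j \<in> \<I> N" if "i < n" "j < n" for i j using f gL that by (simp add: approx_reps_def E_def)
  have flin: "f (L.lin n g c) = H.lin n (\<lambda>i. f (g i)) c" for c by (rule linmap_lin[OF fl])
  have bnd: "\<pi> ^ a * c i \<in> \<O>" if cM: "f (L.lin n g c) \<in> M" and i: "i < n" for c i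
  proof -
    define J where "J = {i. i < n \<and> c i \<noteq> 0}"
    show ?thesis
    proof (cases "c i = 0")
      case False
      then have "finite J" "J \<noteq> {}" using i by (auto simp: J_def)
      from ex_is_arg_min_if_finite[OF this, of "\<lambda>i. v (c i)"] obtain p
        where p: "p \<in> J" "\<And>i. i \<in> J \<Longrightarrow> v (c p) \<le> v (c i)" unfolding is_arg_min_linorder by blast
      have pn: "p < n" "c p \<noteq> 0" using p(1) by (auto simp: J_def)
      have rO: "c j / c p \<in> \<O>" if "j < n" for j
        using p(2)[of j] pn that by (cases "c j = 0") (auto simp: J_def integers_def v_divide)
      let ?T = "B (g p) (g p)"
      have T: "?T \<noteq> 0" "\<pi> ^ a / ?T \<in> \<O>" using a[OF pn(1)] by auto
      \<comment> \<open>Dividing by \<open>c p\<close> keeps the coefficients integral, so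
        \<open>E'\<close> has precision \<open>N\<close>. As \<open>N > a\<close>, it remains in
        \<open>\<P>\<close> after division by the length \<open>?T\<close>.\<close>
      define E' where "E' = (\<Sum>j<n. c j / c p * E j p)"
      have "E' \<in> \<I> N" unfolding E'_def using rO E pn by (intro I_sum I_mult_left) auto
      then have "E' / \<pi> ^ N \<in> \<O>" by (simp add: I_iff)
      then have "E' / \<pi> ^ N * (\<pi> ^ a / ?T) * \<pi> ^ (N - a) \<in> \<P>"
        using N T(2) by (intro P_mult_left O_mult I_imp_P[of _ "N - a"]) auto
      moreover have "E' / \<pi> ^ N * (\<pi> ^ a / ?T) * \<pi> ^ (N - a) = E' / ?T"
        using N T(1) by (simp add: field_simps power_add[symmetric])
      ultimately have EP: "E' / ?T \<in> \<P>" by simp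
      have u: "1 + E' / ?T \<in> \<O>" "1 + E' / ?T \<notin> \<P>"
        using P_imp_O[OF EP] P_diff[OF _ EP, of "1 + E' / ?T"] by auto
      have "B' (f (L.lin n g c)) (f (g p)) = (\<Sum>j<n. c j * (B (g j) (g p) + E j p))"
        unfolding flin by (simp add: H.lin_def H.B_sum H.B_scale E_def)
      also have "\<dots> = B (L.lin n g c) (g p) + (\<Sum>j<n. c j * E j p)"
        by (simp add: L.lin_def L.B_sum L.B_scale distrib_left sum.distrib)
      also have "B (L.lin n g c) (g p) = c p * ?T" by (rule L.B_lin_basis[OF g(2) pn(1)])
      also have "(\<Sum>j<n. c j * E j p) = c p * E'" using pn by (simp add: E'_def sum_distrib_left)
      finally have "B' (f (L.lin n g c)) (f (g p)) = c p * ?T * (1 + E' / ?T)" using T by (simp add: distrib_left)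
      moreover have "B' (f (L.lin n g c)) (f (g p)) \<in> \<O>" using cM fM pn by (intro H.B_integral) auto
      ultimately have "c p * ?T * (1 + E' / ?T) / (1 + E' / ?T) \<in> \<O>" using u by (intro unit_divide) auto
      then have "c p * ?T \<in> \<O>" using unit_nz[OF u(2)] by simp
      then have "c p * ?T * (\<pi> ^ a / ?T) * (c i / c p) \<in> \<O>" 
        by (rule O_mult[OF O_mult]) (rule T rO[OF i])+
      then show ?thesis using T pn by (simp add: mult.commute)
    qed simp
  qed
  show zL: "s (\<pi> ^ a) z \<in> L0" if z: "z \<in> saturation W f" for z
  proof -
    obtain c where c: "z = L.lin n g c" using z by (auto simp: saturation_def W_def)
    then show ?thesis using bnd[of c] z unfolding c L.lin_scale L0_def by (intro L.olatI) (auto simp: saturation_def)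
  qed
  have lin0: "L.lin n g (\<lambda>_. 0) = 0" by (simp add: L.lin_def)
  show "saturation W f \<in> L.overlattices n g"
    unfolding L.overlattices_def
  proof (intro CollectI conjI ballI)
    show "osubmodule v s (saturation W f)"
      unfolding osubmodule_def
    proof (intro conjI ballI)
      have "f 0 = 0" using flin[of "\<lambda>_. 0"] unfolding lin0 by (simp add: H.lin_def)
      then show "0 \<in> saturation W f" using rangeI[of "L.lin n g" "\<lambda>_. 0"] unfolding saturation_def W_def lin0 by simp
    next
      fix x y assume xy: "x \<in> saturation W f" "y \<in> saturation W f"
      then obtain c d where "x = L.lin n g c" "y = L.lin n g d" by (auto simp: saturation_def W_def)
      moreover have "f (x + y) = f x + f y" using xy fl by (auto simp: linmaps_def saturation_def W_def)
      ultimately show "x + y \<in> saturation W f" using xy H.M_add by (auto simp: saturation_def W_def L.lin_add)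
    next
      fix b x assume b: "b \<in> \<O>" and x: "x \<in> saturation W f"
      then obtain c where "x = L.lin n g c" by (auto simp: saturation_def W_def)
      moreover have "f (s b x) = s' b (f x)" using x fl by (auto simp: linmaps_def saturation_def W_def)
      ultimately show "s b x \<in> saturation W f" using x b H.M_smult by (auto simp: saturation_def W_def L.lin_scale)
    qed
    show "L.olat n g \<subseteq> saturation W f"
      using f by (auto simp: approx_reps_def saturation_def L0_def W_def L.olat_def)
    show "saturation W f \<subseteq> range (L.lin n g)" by (auto simp: saturation_def W_def)
    fix z w assume zw: "z \<in> saturation W f" "w \<in> saturation W f"
    obtain c d where c: "z = L.lin n g c" "w = L.lin n g d" using zw by (auto simp: saturation_def W_def)
    have b1: "\<pi> ^ a * c i \<in> \<O>" "\<pi> ^ a * d i \<in> \<O>" if "i < n" for i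
      using bnd[of c i] bnd[of d i] zw c that by (auto simp: saturation_def)
    have "B' (f z) (f w) - B z w = (\<Sum>i<n. \<Sum>j<n. c i * (d j * E i j))"
      unfolding c flin H.B_lin L.B_lin E_def by (simp add: sum_subtractf right_diff_distrib)
    \<comment> \<open>Each coordinate has denominator at most \<open>\<pi>^a\<close>; two of them
      are compensated by the error term, as \<open>2 * a < N\<close>.\<close>
    moreover have "(\<Sum>i<n. \<Sum>j<n. c i * (d j * E i j)) \<in> \<O>"
    proof (rule O_sum, rule O_sum)
      fix i j assume ij: "i \<in> {..<n}" "j \<in> {..<n}"
      have EN: "E i j / \<pi> ^ N \<in> \<O>" using E ij by (simp add: I_iff[symmetric])
      have "(\<pi> ^ a * c i) * (\<pi> ^ a * d j) * (E i j / \<pi> ^ N) * \<pi> ^ (N - 2 * a) \<in> \<O>"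
        by (rule O_mult[OF O_mult[OF O_mult]]) (use b1 ij EN in auto)
      moreover have "(\<pi> ^ a * c i) * (\<pi> ^ a * d j) * (E i j / \<pi> ^ N) * \<pi> ^ (N - 2 * a) = c i * (d j * E i j)"
      proof -
        have "\<pi> ^ N = \<pi> ^ a * \<pi> ^ a * \<pi> ^ (N - 2 * a)" using N by (simp add: power_add[symmetric])
        then show ?thesis by simp
      qed
      ultimately show "c i * (d j * E i j) \<in> \<O>" by simp
    qed
    ultimately have "B' (f z) (f w) - B z w \<in> \<O>" by simp
    moreover have "B' (f z) (f w) \<in> \<O>" using zw by (intro H.B_integral) (auto simp: saturation_def)
    ultimately show "B z w \<in> \<O>" using O_diff[of "B' (f z) (f w)" "B' (f z) (f w) - B z w"] by simp
  qed
qed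

lemma small_maps_basis:
  assumes f: "f \<in> linmaps (range (L.lin n e))"
  shows "f \<in> small_maps (range (L.lin n e)) (L.olat n e) N \<longleftrightarrow> (\<forall>i<n. f (e i) \<in> H.pM N)"
proof
  assume "f \<in> small_maps (range (L.lin n e)) (L.olat n e) N"
  then show "\<forall>i<n. f (e i) \<in> H.pM N" using L.basis_in_olat by (auto simp: small_maps_def)
next
  assume *: "\<forall>i<n. f (e i) \<in> H.pM N"
  have "f z \<in> H.pM N" if zL: "z \<in> L.olat n e" for z
  proof -
    obtain c where c: "z = L.lin n e c" "\<forall>i<n. c i \<in> \<O>" using zL by (auto simp: L.olat_def)
    show ?thesis unfolding c(1) linmap_lin[OF f] H.lin_def
      by (rule subgrp_sum[OF H.subgrp_pM], rule H.pM_smult_O) (use c(2) * in auto)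
  qed
  then show "f \<in> small_maps (range (L.lin n e)) (L.olat n e) N" using f by (simp add: small_maps_def)
qed

lemma finite_approx_reps:
  "finite (cosets (approx_reps (range (L.lin n e)) (L.olat n e) N) (small_maps (range (L.lin n e)) (L.olat n e) N))"
proof -
  let ?A = "approx_reps (range (L.lin n e)) (L.olat n e) N"
  let ?ev = "\<lambda>f i. if i < n then f (e i) else 0"
  have "finite (cosets ?A (small_maps (range (L.lin n e)) (L.olat n e) N)) \<longleftrightarrow> finite (cosets (?ev ` ?A) (H.tuples n (H.pM N)))"
  proof (rule ncosets_iso(2)[where f = ?ev])
    fix f g assume fg: "f \<in> ?A" "g \<in> ?A"
    then have d: "f - g \<in> linmaps (range (L.lin n e))" by (auto simp: approx_reps_def intro: linmaps_diff)
    show "?ev f - ?ev g \<in> H.tuples n (H.pM N) \<longleftrightarrow> f - g \<in> small_maps (range (L.lin n e)) (L.olat n e) N"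
      unfolding small_maps_basis[OF d] by (auto simp: funs_def)
  next
    fix b assume "b \<in> ?ev ` ?A"
    then obtain f where "f \<in> ?A" "b = ?ev f" by blast
    moreover from this have "?ev f - b \<in> H.tuples n (H.pM N)" by (simp add: funs_def)
    ultimately show "\<exists>x\<in>?A. ?ev x - b \<in> H.tuples n (H.pM N)" by blast
  qed (auto intro: subgrp_funs subgrp_small_maps)
  moreover have "?ev ` ?A \<subseteq> H.tuples n M" using L.basis_in_olat by (auto simp: approx_reps_def funs_def)
  ultimately show ?thesis using H.finite_cosets_tuples by blast
qed

text \<open>Saturation is constant on the cosets counted: if \<open>\<pi>^a z\<close> is in the
  lattice, two maps that agree there modulo \<open>\<pi>^N M\<close> differ at \<open>z\<close> by
  an element of \<open>\<pi>^(N - a) M\<close>, hence of \<open>M\<close>.\<close>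

lemma approx_reps_partition:
  assumes g: "L.indep n g" "L.orthogonal n g"
    and a: "\<And>i. i < n \<Longrightarrow> B (g i) (g i) \<noteq> 0 \<and> \<pi> ^ a / B (g i) (g i) \<in> \<O>" and N: "2 * a < N"
  defines "W \<equiv> range (L.lin n g)" and "L0 \<equiv> L.olat n g"
  shows "ncosets (approx_reps W L0 N) (small_maps W L0 N) =
    (\<Sum>L'\<in>L.overlattices n g. ncosets {f\<in>approx_reps W L0 N. saturation W f = L'} (small_maps W L0 N))"
proof (rule ncosets_partition)
  show "finite (cosets (approx_reps W L0 N) (small_maps W L0 N))" unfolding W_def L0_def by (rule finite_approx_reps)
  show "finite (L.overlattices n g)" by (rule L.finite_overlattices[OF g a])
  show "approx_reps W L0 N = (\<Union>L'\<in>L.overlattices n g. {f\<in>approx_reps W L0 N. saturation W f = L'})"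
    using saturation_overlattice(2)[OF g a N] unfolding W_def L0_def by blast
  fix L' L'' f h
  assume fh: "f \<in> {f\<in>approx_reps W L0 N. saturation W f = L'}" "h \<in> {f\<in>approx_reps W L0 N. saturation W f = L''}"
    and d: "f - h \<in> small_maps W L0 N"
  have fh': "f \<in> approx_reps W L0 N" "h \<in> approx_reps W L0 N" using fh by auto
  have close: "f z - h z \<in> M" if zW: "z \<in> W" and zL: "s (\<pi> ^ a) z \<in> L0" for z
  proof -
    have "f (s (\<pi> ^ a) z) - h (s (\<pi> ^ a) z) \<in> H.pM N" using d zL by (auto simp: small_maps_def)
    also have "f (s (\<pi> ^ a) z) - h (s (\<pi> ^ a) z) = s' (\<pi> ^ a) (f z - h z)"
      using fh' zW by (auto simp: approx_reps_def linmaps_def H.vs.scale_right_diff_distrib)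
    finally have "s' (\<pi> ^ a) (f z - h z) \<in> H.pM (a + (N - a))" using N by simp
    then show ?thesis unfolding H.pM_scale_pi using H.pM_M by blast
  qed
  have "saturation W f \<subseteq> saturation W h"
  proof
    fix z assume z: "z \<in> saturation W f"
    then have "f z - h z \<in> M" using close saturation_overlattice(1)[OF g a N, of f z] fh' by (auto simp: W_def L0_def saturation_def)
    then show "z \<in> saturation W h" using z H.M_diff[of "f z" "f z - h z"] by (auto simp: saturation_def)
  qed
  moreover have "saturation W h \<subseteq> saturation W f"
  proof
    fix z assume z: "z \<in> saturation W h"
    then have "f z - h z \<in> M" using close saturation_overlattice(1)[OF g a N, of h z] fh' by (auto simp: W_def L0_def saturation_def)
    then show "z \<in> saturation W f" using z H.M_add[of "f z - h z" "h z"] by (auto simp: saturation_def)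
  qed
  ultimately show "L' = L''" using fh by auto
qed (rule subgrp_small_maps)

end

lemma (in quad_space) lat_multiple_eq:
  assumes "scl L = s" "osubmodule v s (lat L)"
  shows "lat_multiple v N L = {z. s (inverse (\<pi> ^ N)) z \<in> lat L}"
proof (intro equalityI subsetI)
  fix x assume "x \<in> lat_multiple v N L"
  then obtain c z where c: "x = s c z" "c \<in> \<I> N" "z \<in> lat L" by (auto simp: lat_multiple_def assms(1))
  have "s (c / \<pi> ^ N) z \<in> lat L" using c I_iff osubmoduleD(3)[OF assms(2)] by blast
  then show "x \<in> {z. s (inverse (\<pi> ^ N)) z \<in> lat L}" by (simp add: c(1) divide_inverse mult.commute)
next
  fix x assume x: "x \<in> {z. s (inverse (\<pi> ^ N)) z \<in> lat L}"
  have "x = s (\<pi> ^ N) (s (inverse (\<pi> ^ N)) x)" by simp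
  then show "x \<in> lat_multiple v N L" using x pi_pow_I unfolding lat_multiple_def assms(1) by blast
qed

context rep_pair begin

text \<open>A representation is a map between sets of cosets. Linear lifts exist because the lattice
  is free; two of them induce the same map of cosets exactly when their difference is in
  \<open>small_maps\<close>.\<close>

lemma card_reps:
  assumes Lq: "scl Lq = s" "form Lq = B" "lat Lq = L.olat n e" and e: "L.indep n e"
    and Mq: "scl Mq = s'" "form Mq = B'" "lat Mq = M"
  shows "card (reps v Mq Lq N) =
    ncosets (approx_reps (range (L.lin n e)) (L.olat n e) N) (small_maps (range (L.lin n e)) (L.olat n e) N)"
proof -
  define W where "W = range (L.lin n e)"
  define L0 where "L0 = L.olat n e"
  define LN where "LN = {z. s (inverse (\<pi> ^ N)) z \<in> L0}"
  have oL: "osubmodule v s L0" unfolding L0_def by (rule L.osubmodule_olat)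
  note oLD = L.osubmoduleD[OF oL]
  have L0W: "L0 \<subseteq> W" by (auto simp: L0_def W_def L.olat_def)
  have oM: "osubmodule v s' M" by (simp add: osubmodule_def H.M_add H.M_smult)
  have multL: "lat_multiple v N Lq = LN"
    using L.lat_multiple_eq[OF Lq(1)] oL by (simp add: LN_def Lq(3) L0_def)
  have multM: "lat_multiple v N Mq = H.pM N"
    using H.lat_multiple_eq[OF Mq(1)] oM by (simp add: H.pM_def Mq(3))
  have sLN: "subgrp LN"
    unfolding subgrp_def LN_def using oLD(1) L.osubmodule_diff[OF oL] by (simp add: L.vs.scale_right_diff_distrib)
  define kL where "kL x = (+) x ` LN" for x
  define kM where "kM x = (+) x ` H.pM N" for x
  have cL: "lat_class v N Lq = kL" by (simp add: lat_class_def kL_def multL fun_eq_iff)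
  have cM: "lat_class v N Mq = kM" by (simp add: lat_class_def kM_def multM fun_eq_iff)
  have kL_eq: "kL x = kL y \<longleftrightarrow> x - y \<in> LN" for x y unfolding kL_def by (rule coset_eq_iff[OF sLN])
  have kM_eq: "kM x = kM y \<longleftrightarrow> x - y \<in> H.pM N" for x y unfolding kM_def by (rule coset_eq_iff) simp
  have kM_mem: "u \<in> kM x \<longleftrightarrow> u - x \<in> H.pM N" for u x
  proof
    assume "u - x \<in> H.pM N"
    moreover have "u = x + (u - x)" by simp
    ultimately show "u \<in> kM x" unfolding kM_def by blast
  qed (auto simp: kM_def)
  let ?A = "approx_reps W L0 N"
  let ?K = "small_maps W L0 N"
  have fl: "f \<in> linmaps W" and fM: "\<And>z. z \<in> L0 \<Longrightarrow> f z \<in> M"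
    and fB: "\<And>z w. z \<in> L0 \<Longrightarrow> w \<in> L0 \<Longrightarrow> B' (f z) (f w) - B z w \<in> \<I> N" if "f \<in> ?A" for f
    using that by (auto simp: approx_reps_def)
  have f_add: "f (z + w) = f z + f w" if "f \<in> ?A" "z \<in> L0" "w \<in> L0" for f z w
    using fl[OF that(1)] that(2-) L0W unfolding linmaps_def by blast
  have f_scale: "f (s c z) = s' c (f z)" if "f \<in> ?A" "z \<in> L0" for f z c
    using fl[OF that(1)] that(2-) L0W unfolding linmaps_def by blast
  have fLN: "f x - f y \<in> H.pM N" if f: "f \<in> ?A" and xy: "x \<in> L0" "y \<in> L0" "x - y \<in> LN" for f x y
  proof -
    define z where "z = s (inverse (\<pi> ^ N)) (x - y)"
    have z: "z \<in> L0" using xy by (simp add: z_def LN_def)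
    have "x = y + s (\<pi> ^ N) z" by (simp add: z_def)
    then have "f x = f y + s' (\<pi> ^ N) (f z)" using f_add[OF f xy(2)] f_scale[OF f z] oLD(3)[OF O_power[OF pi_O] z, of N] by auto
    moreover have "s' (\<pi> ^ N) (f z) \<in> H.pM N" using H.pM_smult[OF pi_pow_I, of "f z" 0 N] fM[OF f z] by (simp add: H.pM_0)
    ultimately show ?thesis by simp
  qed
  define F where "F f = (\<lambda>C\<in>kL ` L0. kM (f (SOME x. x \<in> L0 \<and> kL x = C)))" for f
  have Fv: "F f (kL x) = kM (f x)" if f: "f \<in> ?A" and x: "x \<in> L0" for f x
  proof -
    define y where "y = (SOME y. y \<in> L0 \<and> kL y = kL x)"
    have y: "y \<in> L0 \<and> kL y = kL x" unfolding y_def by (rule someI[of _ x]) (use x in auto)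
    then have "kM (f y) = kM (f x)" unfolding kM_eq using fLN[OF f _ x] kL_eq by blast
    then show ?thesis using x by (simp add: F_def y_def)
  qed
  have Feq: "F f = F g \<longleftrightarrow> f - g \<in> ?K" if f: "f \<in> ?A" and g: "g \<in> ?A" for f g
  proof
    assume "F f = F g"
    then have "kM (f x) = kM (g x)" if "x \<in> L0" for x using Fv[OF f that] Fv[OF g that] by simp
    then show "f - g \<in> ?K" using linmaps_diff[OF fl[OF f] fl[OF g]] by (auto simp: small_maps_def kM_eq)
  next
    assume *: "f - g \<in> ?K"
    have "F f C = F g C" if C: "C \<in> kL ` L0" for C
    proof -
      obtain x where x: "x \<in> L0" "C = kL x" using C by blast
      have "f x - g x \<in> H.pM N" using * x by (auto simp: small_maps_def)
      then show ?thesis unfolding x(2) Fv[OF f x(1)] Fv[OF g x(1)] kM_eq .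
    qed
    then show "F f = F g" by (auto simp: F_def fun_eq_iff restrict_def)
  qed
  have red: "lat_reduction v N Lq = kL ` L0" "lat_reduction v N Mq = kM ` M"
    by (simp_all add: lat_reduction_def cL cM Lq Mq L0_def)
  have reps: "reps v Mq Lq N = {f \<in> kL ` L0 \<rightarrow>\<^sub>E kM ` M.
     (\<forall>x\<in>L0. \<forall>y\<in>L0. \<forall>u\<in>f (kL x). \<forall>w\<in>f (kL y). u + w \<in> f (kL (x + y)) \<and> B' u w - B x y \<in> \<I> N) \<and>
     (\<forall>c\<in>\<O>. \<forall>x\<in>L0. \<forall>u\<in>f (kL x). s' c u \<in> f (kL (s c x)))}"
    by (simp add: reps_def red cL Lq Mq L0_def)
  have "F ` ?A = reps v Mq Lq N"
  proof (intro equalityI subsetI)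
    fix r assume "r \<in> F ` ?A"
    then obtain f where f: "f \<in> ?A" "r = F f" by blast
    note v = Fv[OF f(1)]
    have p1: "F f \<in> kL ` L0 \<rightarrow>\<^sub>E kM ` M"
    proof (rule PiE_I)
      fix C assume "C \<in> kL ` L0"
      then show "F f C \<in> kM ` M" using v fM[OF f(1)] by auto
    qed (simp add: F_def)
    have p2: "u + w \<in> F f (kL (x + y)) \<and> B' u w - B x y \<in> \<I> N"
      if xy: "x \<in> L0" "y \<in> L0" and u: "u \<in> F f (kL x)" and w: "w \<in> F f (kL y)" for x y u w
    proof -
      have uw: "u - f x \<in> H.pM N" "w - f y \<in> H.pM N" using u w v xy by (auto simp: kM_mem)
      have e: "(u + w) - f (x + y) = (u - f x) + (w - f y)" using f_add[OF f(1) xy] by simp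
      have 1: "u + w \<in> F f (kL (x + y))"
        unfolding v[OF oLD(2)[OF xy]] kM_mem e by (rule subgrp_add[OF H.subgrp_pM uw])
      have M: "f x \<in> M" "f y \<in> M" using fM[OF f(1)] xy by auto
      have uM: "w \<in> M" using H.M_add[OF M(2) H.pM_M[OF uw(2)]] by simp
      have "B' u w - B x y = B' (u - f x) w + (B' (w - f y) (f x) + (B' (f x) (f y) - B x y))"
        using H.B_sym[of "f x"] by (simp add: H.B_diff)
      also have "\<dots> \<in> \<I> N" using H.B_pM[OF uw(1) uM] H.B_pM[OF uw(2) M(1)] fB[OF f(1) xy] by (intro I_add)
      finally show ?thesis using 1 by blast
    qed
    have p3: "s' c u \<in> F f (kL (s c x))" if c: "c \<in> \<O>" and x: "x \<in> L0" and u: "u \<in> F f (kL x)" for c x u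
    proof -
      have "u - f x \<in> H.pM N" using u v x by (auto simp: kM_mem)
      then have "s' c (u - f x) \<in> H.pM N" using c by (rule H.pM_smult_O[rotated])
      then show ?thesis using v[OF oLD(3)[OF c x]] f_scale[OF f(1) x] by (simp add: kM_mem H.vs.scale_right_diff_distrib)
    qed
    show "r \<in> reps v Mq Lq N"
      unfolding reps f(2) by (intro CollectI conjI ballI p1 p2[THEN conjunct1] p2[THEN conjunct2] p3)
  next
    fix r assume r: "r \<in> reps v Mq Lq N"
    have rE: "r \<in> kL ` L0 \<rightarrow>\<^sub>E kM ` M"
      and radd: "\<And>x y u w. x \<in> L0 \<Longrightarrow> y \<in> L0 \<Longrightarrow> u \<in> r (kL x) \<Longrightarrow> w \<in> r (kL y) \<Longrightarrow> u + w \<in> r (kL (x + y)) \<and> B' u w - B x y \<in> \<I> N"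
      and rsc: "\<And>c x u. c \<in> \<O> \<Longrightarrow> x \<in> L0 \<Longrightarrow> u \<in> r (kL x) \<Longrightarrow> s' c u \<in> r (kL (s c x))"
      using r unfolding reps by blast+
    have coset: "\<exists>y\<in>M. r (kL x) = kM y" if "x \<in> L0" for x
      using PiE_mem[OF rE, of "kL x"] that by auto
    have ne: "\<exists>u. u \<in> r (kL x)" if "x \<in> L0" for x
      using coset[OF that] kM_mem by (metis diff_self H.pM_zero)
    have eL: "e i \<in> L0" if "i < n" for i using L.basis_in_olat[OF that] by (simp add: L0_def)
    \<comment> \<open>Only the images of the basis vectors are lifted. Additivity and compatibility
      with scalars then show that the linear extension takes values in the prescribed
      cosets.\<close>
    have "\<forall>i. \<exists>u. i < n \<longrightarrow> u \<in> r (kL (e i))" using ne eL by blast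
    then obtain x where x: "\<And>i. i < n \<Longrightarrow> x i \<in> r (kL (e i))" by metis
    obtain f where f: "f \<in> linmaps W" "\<And>c. f (L.lin n e c) = H.lin n x c"
      using linmap_exists[OF e, of x] by (auto simp: W_def)
    have mem: "f z \<in> r (kL z)" if zL: "z \<in> L0" for z
    proof -
      obtain c where c: "z = L.lin n e c" "\<forall>i<n. c i \<in> \<O>" using zL by (auto simp: L0_def L.olat_def)
      have "(\<Sum>i<j. s (c i) (e i)) \<in> L0 \<and> (\<Sum>i<j. s' (c i) (x i)) \<in> r (kL (\<Sum>i<j. s (c i) (e i)))" if "j \<le> n" for j
        using that
      proof (induction j)
        case 0
        obtain u where "u \<in> r (kL 0)" using ne[OF oLD(1)] by blast
        from rsc[OF _ oLD(1) this, of 0] show ?case using oLD(1) by simp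
      next
        case (Suc j)
        have j: "j < n" "c j \<in> \<O>" using Suc.prems c(2) by auto
        have "s' (c j) (x j) \<in> r (kL (s (c j) (e j)))" by (rule rsc[OF j(2) eL[OF j(1)] x[OF j(1)]])
        then show ?case using Suc radd[of "\<Sum>i<j. s (c i) (e i)" "s (c j) (e j)"] oLD(2) oLD(3)[OF j(2) eL[OF j(1)]] by auto
      qed
      from this[of n] show ?thesis unfolding c(1) f(2) by (simp add: L.lin_def H.lin_def)
    qed
    have fr: "r (kL z) = kM (f z)" and fMz: "f z \<in> M" if zL: "z \<in> L0" for z
    proof -
      obtain y where y: "y \<in> M" "r (kL z) = kM y" using coset[OF zL] by blast
      have d: "f z - y \<in> H.pM N" using mem[OF zL] unfolding y(2) kM_mem .
      then show "r (kL z) = kM (f z)" unfolding y(2) kM_eq using subgrp_diff_commute[OF H.subgrp_pM] by blast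
      show "f z \<in> M" using H.M_add[OF H.pM_M[OF d] y(1)] by simp
    qed
    have fA: "f \<in> ?A" using f(1) fMz radd mem by (auto simp: approx_reps_def)
    have "F f C = r C" for C
    proof (cases "C \<in> kL ` L0")
      case True
      then show ?thesis using Fv[OF fA] fr by auto
    next
      case False
      then show ?thesis using rE by (simp add: F_def PiE_def extensional_def)
    qed
    then show "r \<in> F ` ?A" using fA by blast
  qed
  moreover have "ncosets ?A ?K = card (F ` ?A)"
    by (rule ncosets_eq_card(1)[OF subgrp_small_maps Feq])
  ultimately show ?thesis by (simp add: W_def L0_def)
qed

end

section \<open>Evaluation of the product\<close>

context odd_local_field begin

abbreviation "u \<equiv> inverse q"

lemma u_pow: "q ^ n * u ^ n = 1" by (simp add: power_mult_distrib[symmetric])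

text \<open>The sign-dependent factor of the count in dimension \<open>r\<close>, visible in even
  dimension only. In dimension \<open>n + 1 + 2 * k\<close> it is the linear factor of the
  normalizing polynomial at \<open>q^(- k)\<close>.\<close>

definition E :: "nat \<Rightarrow> real \<Rightarrow> real" where
  "E r th = (if even r then 1 - th * u ^ (r div 2) else 1)"

text \<open>One column trades the factor \<open>E\<close> of its dimension for that of the next, so
  products of columns telescope. For even \<open>r\<close>, the two factors
  \<open>1 + th' u^h\<close> and \<open>1 - th' u^h\<close> combine to \<open>1 - u ^ r\<close>; for
  odd \<open>r\<close>, the column itself is \<open>q ^ r\<close> times \<open>E\<close>.\<close>

lemma F_unit_column:
  assumes a: "a \<in> \<O>" "a \<notin> \<P>" and th: "th \<in> {1, -1}"
  shows "F (Suc r) th a * E r (th * \<chi> (if even r then a else - a)) =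
    q ^ r * (E (Suc r) th * (if even r then 1 - u ^ r else 1))"
proof (cases "even r")
  case True
  define th' where "th' = th * \<chi> a"
  have t2: "th' * th' = 1" using chi_sq[OF a(2)] th by (auto simp: th'_def mult_ac)
  obtain h where h: "r = 2 * h" using True by blast
  have Fv: "F (Suc r) th a = q ^ r + th' * q ^ h" by (simp add: F_def h th'_def)
  have q2: "q ^ r * u ^ h = q ^ h"
    by (simp add: h mult_2 power_add mult.assoc u_pow)
  have "(q ^ r + th' * q ^ h) * (1 - th' * u ^ h) = q ^ r + th' * q ^ h - th' * (q ^ r * u ^ h) - (th' * th') * (q ^ h * u ^ h)"
    by (simp add: algebra_simps)
  also have "\<dots> = q ^ r - 1" unfolding t2 q2 u_pow by simp
  also have "\<dots> = q ^ r * (1 - u ^ r)" by (simp add: right_diff_distrib u_pow)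
  finally show ?thesis unfolding Fv using True by (simp add: E_def th'_def h)
next
  case False
  obtain h where h: "Suc r = 2 * Suc h" using False by (metis dvdE even_Suc gr0_conv_Suc mult_0_right nat.distinct(1) not_gr_zero)
  have r: "r = 2 * h + 1" using h by simp
  have Fv: "F (Suc r) th a = q ^ r - th * q ^ h"
    using a by (simp add: F_def r)
  have q2: "q ^ r * u ^ Suc h = q ^ h"
  proof -
    have "q ^ r = q ^ h * q ^ Suc h" by (simp add: r power_add[symmetric] mult_2)
    then show ?thesis by (simp only: mult.assoc u_pow mult_1_right)
  qed
  have eq: "q ^ r * (1 - th * u ^ Suc h) = q ^ r - th * (q ^ r * u ^ Suc h)" by (simp only: right_diff_distrib mult_1_right mult.left_commute)
  have E: "E (Suc r) th = 1 - th * u ^ Suc h" "E r x = 1" for x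
    unfolding h using False by (simp_all add: E_def h)
  show ?thesis using False unfolding Fv E by (simp only: if_False mult_1_right eq q2)
qed

text \<open>The number of nonzero isotropic vectors in factored form; in dimension
  \<open>2 h + 2\<close> it is \<open>(q^(h+1) - th) (q^h + th)\<close>.\<close>

lemma F_isotropic_column:
  assumes th: "th \<in> {1, -1}"
  shows "F (Suc r) th 0 - 1 = q ^ r * (if odd r then (1 - th * u ^ Suc (r div 2)) * (1 + th * u ^ (r div 2)) else 1 - u ^ r)"
proof (cases "even r")
  case True
  then show ?thesis by (simp add: F_def chi_P right_diff_distrib u_pow)
next
  case False
  define h where "h = r div 2"
  have r: "r = 2 * h + 1" using False by (simp add: h_def)
  have t2: "th * th = 1" using th by auto
  have 1: "q ^ r * u ^ Suc h = q ^ h"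
  proof -
    have "q ^ r = q ^ h * q ^ Suc h" by (simp add: r power_add[symmetric] mult_2)
    then show ?thesis by (simp only: mult.assoc u_pow mult_1_right)
  qed
  have 2: "q ^ r * u ^ h = q ^ Suc h"
  proof -
    have "q ^ r = q ^ Suc h * q ^ h" by (simp add: r power_add[symmetric] mult_2)
    then show ?thesis by (simp only: mult.assoc u_pow mult_1_right)
  qed
  have "q ^ r * ((1 - th * u ^ Suc h) * (1 + th * u ^ h)) =
    q ^ r + th * (q ^ r * u ^ h) - th * (q ^ r * u ^ Suc h) - (th * th) * ((q ^ r * u ^ Suc h) * u ^ h)"
    by (simp add: algebra_simps)
  also have "\<dots> = q ^ r + th * q ^ Suc h - th * q ^ h - 1" unfolding 1 2 t2 u_pow by simp
  also have "\<dots> = F (Suc r) th 0 - 1"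
    by (simp add: F_def r algebra_simps)
  finally show ?thesis using False by (simp add: h_def)
qed

text \<open>The second factor of one term and the first factor of the next combine to a difference
  of squares; the first and the last factor of the product remain alone.\<close>

lemma telescope:
  "S \<le> h \<Longrightarrow> th * th = 1 \<Longrightarrow> 0 < S \<Longrightarrow>
   (\<Prod>j<S. (1 - th * u ^ (h - j)) * (1 + th * u ^ (h - Suc j))) =
   (1 - th * u ^ h) * (\<Prod>j\<in>{1..<S}. 1 - u ^ (2 * (h - j))) * (1 + th * u ^ (h - S))"
proof (induction S)
  case (Suc S)
  show ?case
  proof (cases "S = 0")
    case False
    have IH: "(\<Prod>j<S. (1 - th * u ^ (h - j)) * (1 + th * u ^ (h - Suc j))) =
      (1 - th * u ^ h) * (\<Prod>j\<in>{1..<S}. 1 - u ^ (2 * (h - j))) * (1 + th * u ^ (h - S))"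
      using Suc False by simp
    have sq: "(1 + th * u ^ (h - S)) * (1 - th * u ^ (h - S)) = 1 - u ^ (2 * (h - S))"
    proof -
      have "(1 + th * x) * (1 - th * x) = 1 - (th * th) * (x * x)" for x :: real by (simp add: algebra_simps)
      then show ?thesis using Suc.prems(2) by (simp add: mult_2 power_add)
    qed
    have "{1..<Suc S} = insert S {1..<S}" using False by auto
    then have p: "(\<Prod>j\<in>{1..<Suc S}. 1 - u ^ (2 * (h - j))) = (1 - u ^ (2 * (h - S))) * (\<Prod>j\<in>{1..<S}. 1 - u ^ (2 * (h - j)))"
      by simp
    have "(\<Prod>j<Suc S. (1 - th * u ^ (h - j)) * (1 + th * u ^ (h - Suc j))) =
      (1 - th * u ^ h) * (\<Prod>j\<in>{1..<S}. 1 - u ^ (2 * (h - j))) * ((1 + th * u ^ (h - S)) * (1 - th * u ^ (h - S))) * (1 + th * u ^ (h - Suc S))"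
      unfolding prod.lessThan_Suc IH by (simp only: mult.assoc)
    then show ?thesis unfolding sq p by (simp only: mult_ac)
  qed simp
qed simp

text \<open>Since \<open>e + 1 + 2 * k\<close> is even exactly for odd \<open>e\<close>, the sign
  appears only then, and \<open>telescope\<close> applies. The factor left at its end is the linear
  factor of the weight polynomial, the one at its beginning cancels against the columns of unit
  length.\<close>

lemma isotropic_product:
  assumes th: "th \<in> {1, -1}" and e: "e \<le> 2 * k + 2"
  shows "(\<Prod>r<e. q ^ r * F (e + 1 + 2 * k - 2 * r) th 0 - q ^ r) =
    (\<Prod>r<e. q ^ (e + 2 * k - r)) * E (e + 1 + 2 * k) th *
    (\<Prod>i\<in>{k + 1 - e div 2..k + e div 2}. 1 - u ^ (2 * i)) * (if odd e then 1 + th * u ^ (k - e div 2) else 1)"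
proof -
  have col: "q ^ r * F (e + 1 + 2 * k - 2 * r) th 0 - q ^ r = q ^ (e + 2 * k - r) *
     (if odd e then (1 - th * u ^ (e div 2 + 1 + k - r)) * (1 + th * u ^ (e div 2 + 1 + k - Suc r)) else 1 - u ^ (2 * (e div 2 + k - r)))"
    if r: "r < e" for r
  proof -
    \<comment> \<open>One less than the dimension of the space in which the \<open>r\<close>-th
      radical vector is chosen; the bound on \<open>e\<close> makes the subtraction exact.\<close>
    define w where "w = e + 2 * k - 2 * r"
    have w1: "e + 1 + 2 * k - 2 * r = Suc w" using r e by (simp add: w_def)
    have w2: "e + 2 * k - r = r + w" using r e by (simp add: w_def)
    have w3: "odd w \<longleftrightarrow> odd e" using r e by (simp add: w_def)
    have w4: "w = 2 * (e div 2 + k - r)" if "even e" using r e that by (auto simp: w_def elim!: evenE)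
    have w5: "w div 2 = e div 2 + 1 + k - Suc r \<and> Suc (w div 2) = e div 2 + 1 + k - r" if oe: "odd e"
    proof -
      obtain g where g: "e = 2 * g + 1" using oe by (rule oddE)
      have "w = 2 * (g + k - r) + 1" using r e g by (simp add: w_def)
      then have "w div 2 = g + k - r" by simp
      then show ?thesis using r e g by simp
    qed
    have "q ^ r * F (Suc w) th 0 - q ^ r = q ^ r * (F (Suc w) th 0 - 1)" by (simp add: algebra_simps)
    also have "\<dots> = q ^ (r + w) * (if odd e then (1 - th * u ^ (e div 2 + 1 + k - r)) * (1 + th * u ^ (e div 2 + 1 + k - Suc r)) else 1 - u ^ (2 * (e div 2 + k - r)))"
    proof (cases "odd e")
      case True
      then have "odd w" using w3 by simp
      have 5: "w div 2 = e div 2 + 1 + k - Suc r" "Suc (w div 2) = e div 2 + 1 + k - r" using w5[OF True] by auto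
      show ?thesis unfolding F_isotropic_column[OF th] if_P[OF \<open>odd w\<close>] if_P[OF True] 5(2)[symmetric] 5(1)[symmetric] power_add by (simp only: mult.assoc)
    next
      case False
      then have ew: "\<not> odd w" and "w = 2 * (e div 2 + k - r)" using w3 w4 by auto
      then show ?thesis unfolding F_isotropic_column[OF th] if_not_P[OF ew] if_not_P[OF False] power_add by (simp add: mult.assoc)
    qed
    finally show ?thesis unfolding w1 w2 .
  qed
  have split: "(\<Prod>r<e. q ^ r * F (e + 1 + 2 * k - 2 * r) th 0 - q ^ r) = (\<Prod>r<e. q ^ (e + 2 * k - r)) *
    (\<Prod>r<e. if odd e then (1 - th * u ^ (e div 2 + 1 + k - r)) * (1 + th * u ^ (e div 2 + 1 + k - Suc r)) else 1 - u ^ (2 * (e div 2 + k - r)))"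
    unfolding prod.distrib[symmetric] by (rule prod.cong[OF refl], rule col) simp
  show ?thesis
  proof (cases "odd e")
    case False
    then obtain f where f: "e = 2 * f" by blast
    have "(\<Prod>r<e. 1 - u ^ (2 * (f + k - r))) = (\<Prod>i\<in>{k + 1 - f..k + f}. 1 - u ^ (2 * i))"
      by (rule prod.reindex_bij_witness[of _ "\<lambda>i. f + k - i" "\<lambda>r. f + k - r"]) (use f e in auto)
    then show ?thesis unfolding split using False f by (simp add: E_def)
  next
    case True
    then obtain f where f: "e = 2 * f + 1" by (rule oddE)
    have "(\<Prod>r<e. (1 - th * u ^ (f + 1 + k - r)) * (1 + th * u ^ (f + 1 + k - Suc r))) =
      (1 - th * u ^ (f + 1 + k)) * (\<Prod>j\<in>{1..<e}. 1 - u ^ (2 * (f + 1 + k - j))) * (1 + th * u ^ (f + 1 + k - e))"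
      by (rule telescope) (use f e th in auto)
    also have "(\<Prod>j\<in>{1..<e}. 1 - u ^ (2 * (f + 1 + k - j))) = (\<Prod>i\<in>{k + 1 - f..k + f}. 1 - u ^ (2 * i))"
      by (rule prod.reindex_bij_witness[of _ "\<lambda>i. f + 1 + k - i" "\<lambda>r. f + 1 + k - r"]) (use f e in auto)
    also have "f + 1 + k - e = k - f" using f by simp
    finally have *: "(\<Prod>r<e. (1 - th * u ^ (f + 1 + k - r)) * (1 + th * u ^ (f + 1 + k - Suc r))) =
      (1 - th * u ^ (f + 1 + k)) * (\<Prod>i\<in>{k + 1 - f..k + f}. 1 - u ^ (2 * i)) * (1 + th * u ^ (k - f))" .
    have ed: "e div 2 = f" using f by simp
    have E1: "E (e + 1 + 2 * k) th = 1 - th * u ^ (f + 1 + k)" using f by (simp add: E_def)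
    show ?thesis unfolding split ed E1 using True * by (simp add: mult.assoc)
  qed
qed

lemma E_pos: assumes "th \<in> {1, -1}" "0 < r" shows "E r th \<noteq> 0"
proof (cases "even r")
  case True
  then have h: "0 < r div 2" using assms(2) by auto
  define x where "x = u ^ (r div 2)"
  have x: "0 < x" "x < 1"
    unfolding x_def using q_gt_1 h by (auto simp: inverse_less_1_iff intro!: power_Suc_less_one power_less_one_iff[THEN iffD2])
  then have "th * x \<noteq> 1" using assms(1) by (cases "th = 1") auto
  then show ?thesis using True by (simp add: E_def x_def)
qed (simp add: E_def)

text \<open>At \<open>X = q^(- k)\<close> every exponent is shifted by \<open>k\<close>: the factor
  with index \<open>i\<close> becomes \<open>1 - u ^ (2 * (k + i))\<close>.\<close>

lemma nor_poly_value:
  "poly (nor_poly q eps n) (u ^ k) = E (n + 1 + 2 * k) (of_int eps) * (\<Prod>i\<in>{k + 1..k + n div 2}. 1 - u ^ (2 * i))"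
proof -
  have powr: "q powr (- 2 * real i) = u ^ (2 * i)" for i
  proof -
    have "q powr (- 2 * real i) = inverse (q powr (real (2 * i)))" by (simp add: powr_minus[symmetric])
    also have "q powr (real (2 * i)) = q ^ (2 * i)" by (rule powr_realpow) simp
    finally show ?thesis by (simp add: power_inverse)
  qed
  have set: "{i. 1 \<le> i \<and> real i < (real n + 1) / 2} = {1..n div 2}"
  proof -
    have *: "real i < (real n + 1) / 2 \<longleftrightarrow> i \<le> n div 2" for i
    proof -
      have "real i < (real n + 1) / 2 \<longleftrightarrow> real (2 * i) < real (n + 1)" by auto
      then have "real i < (real n + 1) / 2 \<longleftrightarrow> 2 * i < n + 1" unfolding of_nat_less_iff .
      then show ?thesis by linarith
    qed
    show ?thesis by (simp only: set_eq_iff mem_Collect_eq * atLeastAtMost_iff lessThan_iff simp_thms)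
  qed
  have "poly (\<Prod>i\<in>{1..n div 2}. [:1, 0, - (q powr (- 2 * real i)):]) (u ^ k) = (\<Prod>i\<in>{1..n div 2}. 1 - u ^ (2 * (k + i)))"
    unfolding poly_prod powr
    by (rule prod.cong) (simp_all add: power_add power_mult power2_eq_square mult_ac power_mult_distrib)
  also have "\<dots> = (\<Prod>i\<in>{k + 1..k + n div 2}. 1 - u ^ (2 * i))"
    by (rule prod.reindex_bij_witness[of _ "\<lambda>i. i - k" "\<lambda>i. k + i"]) auto
  finally have 1: "poly (\<Prod>i\<in>{1..n div 2}. [:1, 0, - (q powr (- 2 * real i)):]) (u ^ k) = (\<Prod>i\<in>{k + 1..k + n div 2}. 1 - u ^ (2 * i))" .
  have 2: "poly [:1, - of_int (sgn_H eps (n + 1)) * q powr (- (real n + 1) / 2):] (u ^ k) = E (n + 1 + 2 * k) (of_int eps)"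
  proof (cases "even (n + 1)")
    case True
    then obtain h where h: "n + 1 = 2 * h" by blast
    then have hr: "(real n + 1) / 2 = real h" by (metis (no_types, opaque_lifting) mult_2 nonzero_mult_div_cancel_left of_nat_1 of_nat_add of_nat_mult of_nat_numeral zero_neq_numeral)
    have "q powr (- (real n + 1) / 2) = inverse (q powr (real h))" using hr by (simp add: powr_minus[symmetric])
    also have "\<dots> = u ^ h" by (simp add: powr_realpow power_inverse)
    finally have p: "q powr (- (real n + 1) / 2) = u ^ h" .
    have "(n + 1 + 2 * k) div 2 = h + k" using h by simp
    moreover have "even (n + 1 + 2 * k)" using True by simp
    ultimately have "E (n + 1 + 2 * k) (of_int eps) = 1 - of_int eps * u ^ (h + k)" by (simp only: E_def if_True)
    moreover have "sgn_H eps (n + 1) = eps" using True by (simp only: sgn_H_def if_True)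
    ultimately show ?thesis unfolding p by (simp add: power_add)
  next
    case False
    then show ?thesis by (simp add: E_def sgn_H_def)
  qed
  show ?thesis unfolding nor_poly_def set poly_mult 1 2 ..
qed

text \<open>The quadratic factors do not see \<open>eps\<close>, whose square is 1. The bound on
  \<open>t\<close> keeps the subtractions in the exponents exact wherever they matter.\<close>

lemma weight_poly_value:
  assumes eps: "eps \<in> {1, -1 :: int}" and t: "even t \<Longrightarrow> sg = 0" "t \<le> 2 * k + 2"
  shows "poly (pcompose (weight_poly q t sg) [:0, of_int eps:]) (u ^ k) =
    (\<Prod>i\<in>{k + 1 - t div 2..k}. 1 - u ^ (2 * i)) * (if odd t then 1 + of_int (eps * sg) * u ^ (k - t div 2) else 1)"
proof (cases "t = 0")
  case True
  then show ?thesis by (simp add: weight_poly_def poly_pcompose)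
next
  case False
  have set: "{i. real i < (real t - 1) / 2} = {..<t div 2}"
  proof -
    have *: "real i < (real t - 1) / 2 \<longleftrightarrow> i < t div 2" for i
    proof -
      have "real i < (real t - 1) / 2 \<longleftrightarrow> real (2 * i + 1) < real t" by auto
      then have "real i < (real t - 1) / 2 \<longleftrightarrow> 2 * i + 1 < t" unfolding of_nat_less_iff .
      then show ?thesis by linarith
    qed
    show ?thesis by (simp only: set_eq_iff mem_Collect_eq * atLeastAtMost_iff lessThan_iff simp_thms)
  qed
  have e2: "(of_int eps :: real) * of_int eps = 1" using eps by auto
  have "poly (\<Prod>i\<in>{..<t div 2}. [:1, 0, - (q ^ (2 * i)):]) (of_int eps * u ^ k) = (\<Prod>i<t div 2. 1 - u ^ (2 * (k - i)))"
    unfolding poly_prod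
  proof (rule prod.cong[OF refl])
    fix i assume "i \<in> {..<t div 2}"
    then have ik: "i \<le> k" using t(2) by auto
    have "poly [:1, 0, - (q ^ (2 * i)):] (of_int eps * u ^ k) = 1 - (of_int eps * of_int eps) * (q ^ (2 * i) * (u ^ k * u ^ k))"
      by (simp add: algebra_simps)
    also have "u ^ k * u ^ k = u ^ (2 * i) * u ^ (2 * (k - i))" using ik by (simp add: power_add[symmetric] mult_2)
    also have "q ^ (2 * i) * (u ^ (2 * i) * u ^ (2 * (k - i))) = u ^ (2 * (k - i))"
      by (simp only: mult.assoc[symmetric] u_pow mult_1_left)
    finally show "poly [:1, 0, - (q ^ (2 * i)):] (of_int eps * u ^ k) = 1 - u ^ (2 * (k - i))" unfolding e2 by simp
  qed
  also have "\<dots> = (\<Prod>i\<in>{k + 1 - t div 2..k}. 1 - u ^ (2 * i))"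
    by (rule prod.reindex_bij_witness[of _ "\<lambda>i. k - i" "\<lambda>i. k - i"]) (use t(2) in auto)
  finally have 1: "poly (\<Prod>i\<in>{..<t div 2}. [:1, 0, - (q ^ (2 * i)):]) (of_int eps * u ^ k) = (\<Prod>i\<in>{k + 1 - t div 2..k}. 1 - u ^ (2 * i))" .
  have 2: "poly [:1, of_int sg * q powr ((real t - 1) / 2):] (of_int eps * u ^ k) =
     (if odd t then 1 + of_int (eps * sg) * u ^ (k - t div 2) else 1)"
  proof (cases "odd t")
    case True
    then obtain f where f: "t = 2 * f + 1" by (rule oddE)
    have fk: "f \<le> k" using f t(2) by simp
    have "(real t - 1) / 2 = real f" using f by simp
    then have p: "q powr ((real t - 1) / 2) = q ^ f" by (simp add: powr_realpow)
    have "u ^ k = u ^ f * u ^ (k - f)" using fk by (simp add: power_add[symmetric])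
    then have "q ^ f * u ^ k = u ^ (k - f)" by (simp only: mult.assoc[symmetric] u_pow mult_1_left)
    then show ?thesis unfolding p using True f by (simp add: mult_ac)
  next
    case False
    then show ?thesis using t(1) by simp
  qed
  have w: "weight_poly q t sg = [:1, of_int sg * q powr ((real t - 1) / 2):] * (\<Prod>i\<in>{..<t div 2}. [:1, 0, - (q ^ (2 * i)):])"
    using False unfolding weight_poly_def set by simp
  have arg: "poly [:0, of_int eps:] (u ^ k) = of_int eps * u ^ k" by simp
  show ?thesis unfolding w poly_pcompose arg poly_mult 1 2 by (rule mult.commute)
qed

text \<open>For such \<open>t\<close> the quadratic factor with index \<open>k\<close> occurs in the
  product, and \<open>q^(2 k) X^2 = 1\<close> at this point.\<close>

lemma weight_poly_zero:
  assumes eps: "eps \<in> {1, -1 :: int}" and t: "2 * k + 3 \<le> t"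
  shows "poly (pcompose (weight_poly q t sg) [:0, of_int eps:]) (u ^ k) = 0"
proof -
  have fin: "finite {i. real i < (real t - 1) / 2}"
    by (rule finite_subset[of _ "{..t}"]) auto
  have "k \<in> {i. real i < (real t - 1) / 2}" using t by auto
  moreover have "poly [:1, 0, - (q ^ (2 * k)):] (of_int eps * u ^ k) = 0"
  proof -
    have e2: "(of_int eps :: real) * of_int eps = 1" using eps by auto
    have "poly [:1, 0, - (q ^ (2 * k)):] (of_int eps * u ^ k) = 1 - (of_int eps * of_int eps) * (q ^ (2 * k) * u ^ (2 * k))"
      by (simp add: algebra_simps mult_2 mult_2_right power_add)
    then show ?thesis unfolding e2 u_pow by simp
  qed
  ultimately have "poly (\<Prod>i | real i < (real t - 1) / 2. [:1, 0, - (q ^ (2 * i)):]) (of_int eps * u ^ k) = 0"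
    unfolding poly_prod using fin by (intro prod_zero) auto
  then show ?thesis using t by (simp add: weight_poly_def poly_pcompose mult.commute)
qed

lemma column_powers: "n \<le> m \<Longrightarrow> (\<Prod>j<n. q ^ (m - 1 - j)) = q ^ (m * n) / q ^ card (idx_pairs n)"
proof (induction n)
  case (Suc n)
  have c: "card (idx_pairs (Suc n)) = card (idx_pairs n) + Suc n"
    using card_idx_pairs[of n] card_idx_pairs[of "Suc n"] by simp
  have "m = (m - 1 - n) + Suc n" using Suc.prems by simp
  then have "q ^ m = q ^ (m - 1 - n) * q ^ Suc n" by (metis power_add)
  then show ?case using Suc unfolding c by (simp add: power_add field_simps)
qed (simp add: idx_pairs_def)

end

context unimodular begin

text \<open>Repeated use of \<open>F_unit_column\<close>: all intermediate factors \<open>E\<close>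
  cancel, leaving that of the full dimension on one side and that of the complement on the
  other.\<close>

lemma unit_product:
  assumes t: "\<And>i. i < d \<Longrightarrow> t i \<in> \<O> \<and> t i \<notin> \<P>" and th: "th \<in> {1, -1}" and j: "j \<le> d" "d \<le> m"
  shows "(\<Prod>i<j. F (m - i) (col_sign th t i) (t i)) * E (m - j) (col_sign th t j) =
    (\<Prod>i<j. q ^ (m - 1 - i)) * E m th * (\<Prod>i<j. if even (m - Suc i) then 1 - u ^ (m - Suc i) else 1)"
  using j
proof (induction j)
  case (Suc j)
  have s: "m - j = Suc (m - Suc j)" using Suc.prems by simp
  have th': "col_sign th t j \<in> {1, -1}" by (rule col_sign_cases[OF th]) (use t Suc.prems in auto)
  have col: "F (m - j) (col_sign th t j) (t j) * E (m - Suc j) (col_sign th t (Suc j)) =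
    q ^ (m - Suc j) * (E (m - j) (col_sign th t j) * (if even (m - Suc j) then 1 - u ^ (m - Suc j) else 1))"
    unfolding s using F_unit_column[OF _ _ th', of "t j" "m - Suc j"] t[of j] Suc.prems by simp
  have "(\<Prod>i<Suc j. F (m - i) (col_sign th t i) (t i)) * E (m - Suc j) (col_sign th t (Suc j)) =
    (\<Prod>i<j. F (m - i) (col_sign th t i) (t i)) * (F (m - j) (col_sign th t j) (t j) * E (m - Suc j) (col_sign th t (Suc j)))"
    by (simp only: prod.lessThan_Suc mult.assoc)
  also have "\<dots> = ((\<Prod>i<j. F (m - i) (col_sign th t i) (t i)) * E (m - j) (col_sign th t j)) *
     (q ^ (m - Suc j) * (if even (m - Suc j) then 1 - u ^ (m - Suc j) else 1))"
    unfolding col by (simp only: mult_ac)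
  also have "(\<Prod>i<j. F (m - i) (col_sign th t i) (t i)) * E (m - j) (col_sign th t j) =
    (\<Prod>i<j. q ^ (m - 1 - i)) * E m th * (\<Prod>i<j. if even (m - Suc i) then 1 - u ^ (m - Suc i) else 1)"
    using Suc by simp
  finally show ?case by (simp add: mult_ac)
qed simp

text \<open>The factor \<open>E\<close> of the complement, contributed by the radical columns, is
  exactly what \<open>unit_product\<close> needs; it turns into the sign factor of dimension
  \<open>m\<close>. The quadratic factors are then regrouped.\<close>

theorem diag_reps_value:
  assumes t: "\<And>i. i < n \<Longrightarrow> t i \<in> \<O>" "\<And>i. i < d \<Longrightarrow> t i \<notin> \<P>" "\<And>i. d \<le> i \<Longrightarrow> i < n \<Longrightarrow> t i \<in> \<P>"
    and Q0: "\<And>a. a \<in> \<O> \<Longrightarrow> fcount M a = F m (of_int eps) a" and eps: "eps \<in> {1, -1}"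
    and d: "d \<le> n" and m: "m = n + 1 + 2 * k"
    and sg: "sg = (if even d = even (n + 1) then residue_symbol v ((-1) ^ (d * (d - 1) div 2) * (\<Prod>i<d. t i)) else 0)"
  shows "real (ncosets (diag_reps n t) (tuples n K1)) = q ^ (m * n) / q ^ card (idx_pairs n) *
    (poly (nor_poly q eps n) (u ^ k) * poly (pcompose (weight_poly q (n - d) sg) [:0, of_int eps:]) (u ^ k))"
proof -
  define e where "e = n - d"
  define th where "th = col_sign (of_int eps) t d"
  have n: "n = d + e" using d by (simp add: e_def)
  have md: "m - d = e + 1 + 2 * k" using m n by simp
  have eps': "of_int eps \<in> {1, -1 :: real}" using eps by auto
  have th': "th \<in> {1, -1}" unfolding th_def by (rule col_sign_cases[OF eps' t(2)])
  have "real (ncosets (diag_reps (d + e) t) (tuples (d + e) K1)) =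
      (\<Prod>j<d. F (m - j) (col_sign (of_int eps) t j) (t j)) * (\<Prod>r<e. q ^ r * F (m - d - 2 * r) th 0 - q ^ r)"
    unfolding th_def
  proof (rule diag_reps_count)
    show "t i \<in> \<O>" if "i < d + e" for i using that t(1) n by simp
    show "t i \<in> \<P>" if "d \<le> i" "i < d + e" for i using that t(3) n by simp
    show "d < m" using m n by simp
  qed (fact t(2) Q0 eps')+
  then have cnt: "real (ncosets (diag_reps n t) (tuples n K1)) =
      (\<Prod>j<d. F (m - j) (col_sign (of_int eps) t j) (t j)) * (\<Prod>r<e. q ^ r * F (e + 1 + 2 * k - 2 * r) th 0 - q ^ r)"
    unfolding md n[symmetric] .
  show ?thesis
  proof (cases "e \<le> 2 * k + 2")
    \<comment> \<open>Both sides are 0: a factor of the count vanishes by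
      \<open>F_zero_factor\<close>, and the weight polynomial by
      \<open>weight_poly_zero\<close>.\<close>
    case False
    have "\<exists>r'<e. F (m - d - 2 * r') th 0 = 1"
      by (rule F_zero_factor[OF th']) (use m n False in auto)
    then obtain r' where r': "r' < e" "F (e + 1 + 2 * k - 2 * r') th 0 = 1" unfolding md by blast
    have "(\<Prod>r<e. q ^ r * F (e + 1 + 2 * k - 2 * r) th 0 - q ^ r) = 0"
      by (rule prod_zero) (use r' in auto)
    then show ?thesis using cnt weight_poly_zero[OF eps, of k e sg] False by (simp add: e_def)
  next
    case True
    let ?A = "\<Prod>j<d. F (m - j) (col_sign (of_int eps) t j) (t j)"
    let ?U = "\<Prod>i<d. if even (m - Suc i) then 1 - u ^ (m - Suc i) else 1"
    let ?f = "e div 2"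
    have A: "?A * E (m - d) th = (\<Prod>i<d. q ^ (m - 1 - i)) * E m (of_int eps) * ?U"
      unfolding th_def by (rule unit_product[where d = d]) (use t eps' m n in auto)
    \<comment> \<open>Among the unit columns only those with even \<open>m - Suc i\<close>
      contribute; half of that number serves as the new index.\<close>
    have U: "?U = (\<Prod>i\<in>{k + ?f + 1..k + n div 2}. 1 - u ^ (2 * i))"
    proof -
      have "?U = (\<Prod>i\<in>{i\<in>{..<d}. even (m - Suc i)}. 1 - u ^ (m - Suc i))"
        by (rule prod.inter_filter[symmetric]) simp
      also have "\<dots> = (\<Prod>i\<in>{k + ?f + 1..k + n div 2}. 1 - u ^ (2 * i))"
      proof (rule prod.reindex_bij_witness[of _ "\<lambda>i. m - Suc (2 * i)" "\<lambda>i. (m - Suc i) div 2"])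
        fix i assume i: "i \<in> {i\<in>{..<d}. even (m - Suc i)}"
        then have "even (m - Suc i)" by simp
        then obtain h where h: "m - Suc i = 2 * h" by (rule evenE)
        have i': "i < d" using i by simp
        show "m - Suc (2 * ((m - Suc i) div 2)) = i" using h i' m n by simp
        have "m = 2 * h + Suc i" using h i' m n by simp
        then show "(m - Suc i) div 2 \<in> {k + ?f + 1..k + n div 2}" using h i' m n by auto
        show "1 - u ^ (2 * ((m - Suc i) div 2)) = 1 - u ^ (m - Suc i)" using h by simp
      next
        fix i assume i: "i \<in> {k + ?f + 1..k + n div 2}"
        then have i1: "k + e div 2 + 1 \<le> i" "i \<le> k + n div 2" by auto
        have i2: "2 * i \<le> 2 * k + n" using i1(2) by linarith
        have i3: "e + 1 + 2 * k \<le> 2 * i" using i1(1) by linarith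
        have ms: "m - Suc (m - Suc (2 * i)) = 2 * i" using i2 m by simp
        show "(m - Suc (m - Suc (2 * i))) div 2 = i" unfolding ms by simp
        show "m - Suc (2 * i) \<in> {i \<in> {..<d}. even (m - Suc i)}" unfolding mem_Collect_eq ms using i2 i3 m n by auto
      qed
      finally show ?thesis .
    qed
    have "of_int eps * of_int sg = th" if "odd e"
    proof -
      have "even (m - d)" unfolding md using that by simp
      then have "th = of_int eps * \<chi> ((-1) ^ (d * (d - 1) div 2) * (\<Prod>i<d. t i))"
        unfolding th_def by (intro col_sign_eq) (use t m n in auto)
      moreover have "even d = even (n + 1)" using that n by auto
      ultimately show ?thesis unfolding sg by (simp add: chi_def)
    qed
    moreover have sg0: "sg = 0" if "even e" using that n unfolding sg by auto
    ultimately have W: "poly (pcompose (weight_poly q e sg) [:0, of_int eps:]) (u ^ k) =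
      (\<Prod>i\<in>{k + 1 - ?f..k}. 1 - u ^ (2 * i)) * (if odd e then 1 + th * u ^ (k - ?f) else 1)"
      using weight_poly_value[OF eps, of e sg k] True by simp
    have ne: "E (m - d) th \<noteq> 0" by (rule E_pos[OF th']) (simp add: md)
    let ?g = "\<lambda>i. 1 - u ^ (2 * i)"
    have fn: "?f \<le> n div 2" using n by simp
    \<comment> \<open>One product over an interval, cut in two ways: after \<open>k + ?f\<close>,
      into radical and unit columns, and after \<open>k\<close>, into the weight polynomial and the
      normalizing polynomial.\<close>
    have P1: "(\<Prod>i\<in>{k + 1 - ?f..k + ?f}. ?g i) * (\<Prod>i\<in>{k + ?f + 1..k + n div 2}. ?g i) = (\<Prod>i\<in>{k + 1 - ?f..k + n div 2}. ?g i)"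
      using fn by (subst prod.union_disjoint[symmetric]) (auto intro!: prod.cong)
    have P2: "(\<Prod>i\<in>{k + 1 - ?f..k}. ?g i) * (\<Prod>i\<in>{k + 1..k + n div 2}. ?g i) = (\<Prod>i\<in>{k + 1 - ?f..k + n div 2}. ?g i)"
      by (subst prod.union_disjoint[symmetric]) (auto intro!: prod.cong)
    have pw: "(\<Prod>i<d. q ^ (m - 1 - i)) * (\<Prod>r<e. q ^ (e + 2 * k - r)) = q ^ (m * n) / q ^ card (idx_pairs n)"
    proof -
      have "(\<Prod>j<n. q ^ (m - 1 - j)) = (\<Prod>i<d. q ^ (m - 1 - i)) * (\<Prod>j\<in>{d..<n}. q ^ (m - 1 - j))"
        using d by (subst prod.union_disjoint[symmetric]) (auto intro!: prod.cong)
      also have "(\<Prod>j\<in>{d..<n}. q ^ (m - 1 - j)) = (\<Prod>r<e. q ^ (e + 2 * k - r))"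
        by (rule prod.reindex_bij_witness[of _ "\<lambda>r. d + r" "\<lambda>j. j - d"]) (use m n in \<open>auto simp: ac_simps\<close>)
      finally show ?thesis using column_powers[of n m] m by simp
    qed
    have "real (ncosets (diag_reps n t) (tuples n K1)) = (?A * E (m - d) th) * (\<Prod>r<e. q ^ (e + 2 * k - r)) *
       (\<Prod>i\<in>{k + 1 - ?f..k + ?f}. ?g i) * (if odd e then 1 + th * u ^ (k - ?f) else 1)"
      unfolding cnt isotropic_product[OF th' True] md by (simp only: mult_ac)
    also have "\<dots> = ((\<Prod>i<d. q ^ (m - 1 - i)) * (\<Prod>r<e. q ^ (e + 2 * k - r))) * E m (of_int eps) *
       ((\<Prod>i\<in>{k + 1 - ?f..k + ?f}. ?g i) * (\<Prod>i\<in>{k + ?f + 1..k + n div 2}. ?g i)) * (if odd e then 1 + th * u ^ (k - ?f) else 1)"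
      unfolding A U by (simp only: mult_ac)
    also have "\<dots> = q ^ (m * n) / q ^ card (idx_pairs n) * E m (of_int eps) *
       ((\<Prod>i\<in>{k + 1 - ?f..k}. ?g i) * (\<Prod>i\<in>{k + 1..k + n div 2}. ?g i)) * (if odd e then 1 + th * u ^ (k - ?f) else 1)"
      unfolding pw P1 P2 ..
    also have "\<dots> = q ^ (m * n) / q ^ card (idx_pairs n) *
      (poly (nor_poly q eps n) (u ^ k) * poly (pcompose (weight_poly q e sg) [:0, of_int eps:]) (u ^ k))"
      unfolding W nor_poly_value m[symmetric] by (simp only: mult_ac)
    finally show ?thesis by (simp add: e_def)
  qed
qed

end

section \<open>The Cho--Yamauchi formula\<close>

lemma (in odd_local_field) quad_space_quadratic_lattice:
  assumes "quadratic_lattice v L" shows "quad_space v (scl L) (form L)"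
proof -
  have vs: "vector_space (scl L)" and sym: "\<And>x y. form L x y = form L y x"
    and lin: "\<And>x. module_hom (scl L) (*) (form L x)"
    using assms Vector_Spaces.linear.axioms(3) unfolding quadratic_lattice_def by blast+
  show ?thesis
  proof (intro quad_space.intro quad_space_axioms.intro)
    show "odd_local_field v" by (rule odd_local_field_axioms)
    show "form L (x + y) z = form L x z + form L y z" for x y z
      using module_hom.add[OF lin[of z], of x y] sym by metis
    show "form L (scl L c x) z = c * form L x z" for c x z
      using module_hom.scale[OF lin[of z], of c x] sym by metis
  qed (fact vs sym)+
qed

section \<open>Passing from lattices as defined to orthogonal bases\<close>

context quad_space begin

lemma lat_basis_iff: "scl L = s \<Longrightarrow> lat_basis v L n e \<longleftrightarrow> lat L = olat n e \<and> indep n e"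
  unfolding lat_basis_def olat_def lin_def indep_def by simp

lemma B_lin_right: "B x (lin n e c) = (\<Sum>i<n. c i * B x (e i))"
  unfolding lin_def B_sum by (simp add: B_scale_right)

lemma lattice_nondegenerate:
  assumes L: "scl L = s" "form L = B" "lat L = olat n e" and Q: "quadratic_lattice v L"
    and z: "\<And>i. i < n \<Longrightarrow> B (lin n e c) (e i) = 0"
  shows "lin n e c = 0"
proof -
  have "\<forall>x\<in>range (lin n e). (\<forall>y\<in>range (lin n e). B x y = 0) \<longrightarrow> x = 0"
    using Q L(2) lat_space_olat[OF L(1,3)] unfolding quadratic_lattice_def by simp
  moreover have "B (lin n e c) (lin n e d) = 0" for d unfolding B_lin_right using z by simp
  ultimately show ?thesis by blast
qed

lemma orthogonal_nondegenerate:
  assumes g: "orthogonal n g" "\<And>i. i < n \<Longrightarrow> B (g i) (g i) \<noteq> 0" and h: "range (lin n h) = range (lin n g)"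
    and z: "\<And>i. i < n \<Longrightarrow> B (lin n h c) (h i) = 0"
  shows "lin n h c = 0"
proof -
  have z': "B (lin n h c) (lin n h d) = 0" for d unfolding B_lin_right using z by simp
  obtain b where b: "lin n h c = lin n g b" using h by blast
  have "b j = 0" if j: "j < n" for j
  proof -
    have "lin n g (\<lambda>i. if i = j then 1 else 0) \<in> range (lin n h)" using h by blast
    then have "s 1 (g j) \<in> range (lin n h)" unfolding lin_single[OF j] .
    then obtain d where d: "g j = lin n h d" by auto
    have "b j * B (g j) (g j) = B (lin n h c) (g j)" unfolding b B_lin_basis[OF g(1) j] ..
    also have "\<dots> = 0" unfolding d by (rule z')
    finally show ?thesis using g(2)[OF j] by simp
  qed
  then have "lin n g b = lin n g (\<lambda>_. 0)" by (intro lin_cong) auto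
  then show ?thesis unfolding b by (simp add: lin_def)
qed

text \<open>A single exponent that bounds the denominators in the dual lattice; the precision at
  which the counts stabilize is expressed by it.\<close>

lemma conductor_exists:
  fixes n :: nat assumes "\<And>i. i < n \<Longrightarrow> t i \<noteq> 0"
  shows "\<exists>a. \<forall>i<n. \<pi> ^ a / t i \<in> \<O>"
proof (intro exI allI impI)
  fix i assume i: "i < n"
  have "nat (v (t i)) \<le> (\<Sum>i<n. nat (v (t i)))" using i by (intro member_le_sum) auto
  then have "v (t i) \<le> int (\<Sum>i<n. nat (v (t i)))" by linarith
  then have "0 \<le> v (\<pi> ^ (\<Sum>i<n. nat (v (t i))) / t i)"
    using assms[OF i] by (simp only: v_divide v_power v_pi power_not_zero pi_nz simp_thms)
  then show "\<pi> ^ (\<Sum>i<n. nat (v (t i))) / t i \<in> \<O>" by (simp add: integers_def)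
qed

context
  fixes n a g
  assumes g: "indep n g" "orthogonal n g"
    and a: "\<And>i. i < n \<Longrightarrow> B (g i) (g i) \<noteq> 0 \<and> \<pi> ^ a / B (g i) (g i) \<in> \<O>"
begin

lemma overlattice_dilate:
  assumes S: "S \<in> overlattices n g"
  shows "\<exists>f k. indep n f \<and> olat n f = olat n g \<and> S = dilate n f k \<and> (\<forall>i<n. k i \<le> a)"
proof (rule adapted_dilate[OF g(1)])
  show "s (\<pi> ^ a) x \<in> olat n g" if "x \<in> S" for x by (rule overlattice_bound[OF g(2) a S that])
qed (use S in \<open>auto simp: overlattices_def\<close>)

lemma overlattice_basis:
  assumes S: "S \<in> overlattices n g"
  shows "\<exists>h. indep n h \<and> olat n h = S \<and> range (lin n h) = range (lin n g)"
proof -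
  obtain f k where f: "indep n f" "olat n f = olat n g" "S = dilate n f k"
    using overlattice_dilate[OF S] by blast
  show ?thesis using dilate_basis[OF f(1), of k] f(3) range_lin_eq[OF f(2)] by metis
qed

lemma overlattice_orthogonal_basis:
  assumes S: "S \<in> overlattices n g"
  shows "\<exists>h d. indep n h \<and> olat n h = S \<and> range (lin n h) = range (lin n g) \<and> orthogonal n h \<and> d \<le> n \<and>
    (\<forall>i<n. B (h i) (h i) \<in> \<O>) \<and> (\<forall>i<n. B (h i) (h i) \<noteq> 0) \<and>
    (\<forall>i<d. B (h i) (h i) \<notin> \<P>) \<and> (\<forall>i. d \<le> i \<longrightarrow> i < n \<longrightarrow> B (h i) (h i) \<in> \<P>)"
proof -
  obtain e where e: "indep n e" "olat n e = S" "range (lin n e) = range (lin n g)"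
    using overlattice_basis[OF S] by blast
  have nd: "lin n e c = 0" if "\<And>i. i < n \<Longrightarrow> B (lin n e c) (e i) = 0" for c
    by (rule orthogonal_nondegenerate[OF g(2) _ e(3) that]) (use a in auto)
  obtain h d where h: "indep n h" "olat n h = olat n e" "orthogonal n h" "d \<le> n" "\<forall>i<n. B (h i) (h i) \<noteq> 0"
    "\<forall>i<d. B (h i) (h i) \<notin> \<P>" "\<forall>i. d \<le> i \<longrightarrow> i < n \<longrightarrow> B (h i) (h i) \<in> \<P>"
    using sorted_orthogonal_basis[OF e(1) nd] by auto
  have "h i \<in> S" if "i < n" for i using basis_in_olat[OF that, of h] h(2) e(2) by simp
  then have "\<forall>i<n. B (h i) (h i) \<in> \<O>" using S by (auto simp: overlattices_def)
  then show ?thesis using h e range_lin_eq[OF h(2)] by metis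
qed

text \<open>The substance is that a module in \<open>overlattices\<close> is free and spans the same
  space: the first is \<open>overlattice_basis\<close>, and with the second non-degeneracy is
  inherited.\<close>

lemma integral_overlattices_eq:
  assumes L: "scl L = s" "form L = B" "lat L = olat n g" and Q: "quadratic_lattice v L"
  shows "integral_overlattices v L = overlattices n g"
proof (intro equalityI subsetI)
  fix S assume S: "S \<in> integral_overlattices v L"
  have Q': "quadratic_lattice v (L\<lparr>lat := S\<rparr>)" and 1: "S \<subseteq> range (lin n g)" "olat n g \<subseteq> S"
    and dual: "S \<subseteq> dual v (L\<lparr>lat := S\<rparr>)"
    using S unfolding integral_overlattices_def lat_space_olat[OF L(1,3)] L(3) by auto
  have "\<exists>n' e'. lat_basis v (L\<lparr>lat := S\<rparr>) n' e'" using Q' unfolding quadratic_lattice_def by blast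
  then obtain n' e' where e': "lat_basis v (L\<lparr>lat := S\<rparr>) n' e'" by blast
  then have "S = olat n' e'" using lat_basis_iff[of "L\<lparr>lat := S\<rparr>" n' e'] L by simp
  then have "osubmodule v s S" using osubmodule_olat by simp
  moreover have "B x y \<in> \<O>" if "x \<in> S" "y \<in> S" for x y
    using that dual L(2) unfolding dual_def by auto
  ultimately show "S \<in> overlattices n g" using 1 by (simp add: overlattices_def)
next
  fix S assume S: "S \<in> overlattices n g"
  obtain h where h: "indep n h" "olat n h = S" "range (lin n h) = range (lin n g)"
    using overlattice_basis[OF S] by blast
  have W: "lat_space L = range (lin n g)" by (rule lat_space_olat[OF L(1,3)])
  have W': "lat_space (L\<lparr>lat := S\<rparr>) = range (lin n g)"
    using lat_space_olat[of "L\<lparr>lat := S\<rparr>" n h] L h by simp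
  have b: "lat_basis v (L\<lparr>lat := S\<rparr>) n h" using lat_basis_iff[of "L\<lparr>lat := S\<rparr>" n h] L h by simp
  have "quadratic_lattice v (L\<lparr>lat := S\<rparr>)"
    unfolding quadratic_lattice_def W'
  proof (intro conjI)
    show "\<exists>n e. lat_basis v (L\<lparr>lat := S\<rparr>) n e" using b by blast
  qed (use Q in \<open>simp_all add: quadratic_lattice_def W\<close>)
  moreover have "S \<subseteq> range (lin n g)" "olat n g \<subseteq> S" "\<And>x y. x \<in> S \<Longrightarrow> y \<in> S \<Longrightarrow> B x y \<in> \<O>"
    using S by (auto simp: overlattices_def)
  moreover from this have "S \<subseteq> dual v (L\<lparr>lat := S\<rparr>)" unfolding dual_def W' using L(2) by auto
  ultimately show "S \<in> integral_overlattices v L" unfolding integral_overlattices_def W using L(3) by simp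
qed

end

text \<open>Self-duality makes the lengths units: otherwise \<open>g i\<close> divided by its length
  would lie in the dual but not in the lattice. The discriminant symbol is given for some basis
  \<open>e\<close> and carried over to \<open>g\<close> by \<open>residue_split_unique\<close>, as
  both bases are residue splittings with zero radical part.\<close>

lemma is_H_orthogonal_basis:
  assumes L: "scl L = s" "form L = B" and H: "is_H v \<epsilon> m L" and eps: "\<epsilon> \<in> {1, -1}"
  shows "\<exists>g. indep m g \<and> lat L = olat m g \<and> orthogonal m g \<and>
    (\<forall>i<m. B (g i) (g i) \<in> \<O> \<and> B (g i) (g i) \<notin> \<P>) \<and>
    residue_symbol v ((-1) ^ (m * (m - 1) div 2) * (\<Prod>i<m. B (g i) (g i))) = \<epsilon>"
proof -
  have Q: "quadratic_lattice v L" and self: "dual v L = lat L"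
    and ex: "\<exists>e. lat_basis v L m e \<and> residue_symbol v (disc L m e) = \<epsilon>"
    using H unfolding is_H_def by blast+
  obtain e where b: "lat_basis v L m e" and disc: "residue_symbol v (disc L m e) = \<epsilon>" using ex by blast
  have e: "lat L = olat m e" "indep m e" using b lat_basis_iff[OF L(1)] by auto
  obtain g d where g: "indep m g" "olat m g = olat m e" "orthogonal m g" and T0: "\<forall>i<m. B (g i) (g i) \<noteq> 0"
    using sorted_orthogonal_basis[OF e(2) lattice_nondegenerate[OF L e(1) Q]] by blast
  have Lg: "lat L = olat m g" using e g by simp
  have TO: "B (g i) (g i) \<in> \<O>" if "i < m" for i
  proof -
    have "g i \<in> lat L" unfolding Lg by (rule basis_in_olat[OF that])
    moreover from this have "g i \<in> dual v L" using self by simp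
    ultimately show ?thesis using L(2) unfolding dual_def by auto
  qed
  have TP: "B (g i) (g i) \<notin> \<P>" if i: "i < m" for i
  proof
    let ?T = "B (g i) (g i)"
    assume P: "?T \<in> \<P>"
    let ?c = "\<lambda>j. if j = i then inverse ?T else 0"
    have "\<forall>j<m. ?c j * B (g j) (g j) \<in> \<O>" using T0 i by auto
    then have "lin m g ?c \<in> lat L" unfolding self[symmetric] dual_orthogonal[OF L Lg g(3)] by blast
    then have "\<forall>j<m. ?c j \<in> \<O>" unfolding Lg olat_iff[OF g(1)] .
    then have "inverse ?T \<in> \<O>" using i by auto
    then have "inverse ?T * ?T \<in> \<P>" using P by (rule P_mult_left)
    then show False using T0 i by auto
  qed
  have int: "B x y \<in> \<O>" if "x \<in> lat L" "y \<in> lat L" for x y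
    using that unfolding Lg by (intro olat_integral[OF g(3) TO])
  have "disc L m e \<notin> \<P>" using disc eps by (auto simp: residue_symbol_def)
  then have det: "det (gram L m e) \<notin> \<P>" unfolding disc_def using P_mult_left[of "(-1) ^ (m * (m - 1) div 2)"] O_power by auto
  have se: "residue_split v L m e"
    unfolding residue_split_def
  proof (intro conjI ballI allI impI)
    show "e i \<in> lat L" if "i < m" for i unfolding e(1) by (rule basis_in_olat[OF that])
    fix x assume "x \<in> lat L"
    then obtain c where c: "x = lin m e c" "\<forall>i<m. c i \<in> \<O>" unfolding e(1) olat_def by blast
    have "0 \<in> lat L" using osubmoduleD(1)[OF osubmodule_olat] e(1) by simp
    then have "x - (\<Sum>i<m. scl L (c i) (e i)) \<in> residue_radical v L"
      unfolding c(1) lin_def residue_radical_def L by simp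
    then show "\<exists>c. (\<forall>i<m. c i \<in> \<O>) \<and> x - (\<Sum>i<m. scl L (c i) (e i)) \<in> residue_radical v L" using c(2) by blast
  qed (rule det)
  have sg: "residue_split v L m g"
    by (rule residue_split_orthogonal[OF L Lg g(3) order_refl]) (use TO TP in auto)
  have "osubmodule v s (lat L)" unfolding Lg by (rule osubmodule_olat)
  then have "residue_symbol v (disc L m g) = \<epsilon>" using residue_split_unique[OF L int _ se sg] disc by simp
  then show ?thesis using g Lg TO TP unfolding disc_def gram_orthogonal[OF L(2) g(3)] by blast
qed

lemma is_H_unimodular:
  assumes "scl L = s" "form L = B" "is_H v \<epsilon> m L" "\<epsilon> \<in> {1, -1}"
  shows "unimodular v s B (lat L) m"
proof -
  obtain g where g: "indep m g" "lat L = olat m g" "orthogonal m g" "\<forall>i<m. B (g i) (g i) \<in> \<O> \<and> B (g i) (g i) \<notin> \<P>"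
    using is_H_orthogonal_basis[OF assms] by blast
  show ?thesis unfolding g(2) by (rule unimodular_olat) (use g in auto)
qed

end

text \<open>The sign built up along the orthogonal basis is the residue symbol of the discriminant,
  hence \<open>\<epsilon>\<close>. This supplies the count for the whole lattice from which all
  counts in complements descend.\<close>

lemma (in unimodular) is_H_fcount:
  assumes L: "scl L = s" "form L = B" "lat L = M" and H: "is_H v \<epsilon> m L" "\<epsilon> \<in> {1, -1}" and a: "a \<in> \<O>"
  shows "fcount M a = F m (of_int \<epsilon>) a"
proof -
  obtain g where g: "indep m g" "lat L = olat m g" "orthogonal m g" "\<forall>i<m. B (g i) (g i) \<in> \<O> \<and> B (g i) (g i) \<notin> \<P>"
    and sym: "residue_symbol v ((-1) ^ (m * (m - 1) div 2) * (\<Prod>i<m. B (g i) (g i))) = \<epsilon>"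
    using is_H_orthogonal_basis[OF L(1,2) H] by blast
  have M: "M = olat m g" using g(2) L(3) by simp
  have "fcount (perp (m - m) g) a = F m (basis_sign (\<lambda>i. B (g i) (g i)) m m) a"
  proof (rule fcount_orthogonal_basis)
    show "g i \<in> M" if "i < m" for i unfolding M by (rule basis_in_olat[OF that])
    show "B (g i) (g j) \<in> \<P>" if "i < m" "j < m" "i \<noteq> j" for i j using that g(3) by (simp add: orthogonal_def)
    show "\<exists>c. (\<forall>i<m. c i \<in> \<O>) \<and> w = (\<Sum>i<m. s (c i) (g i))" if "w \<in> M" for w
      using that unfolding M olat_def lin_def by blast
  qed (use g a in auto)
  moreover have "basis_sign (\<lambda>i. B (g i) (g i)) m m = of_int \<epsilon>"
    using basis_sign_eq[of m "\<lambda>i. B (g i) (g i)" m] g(4) sym by (simp add: chi_def lessThan_atLeast0)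
  ultimately show ?thesis by (simp add: perp_0)
qed

section \<open>From counts to densities and the series\<close>

context odd_local_field begin

lemma powr_density:
  "n < m \<Longrightarrow> q powr (real N * real n * (2 * real m - real n - 1) / 2) = (q ^ (m * n) / q ^ card (idx_pairs n)) ^ N"
proof -
  have c: "2 * real (card (idx_pairs n)) = real n * (real n + 1)"
    using arg_cong[OF card_idx_pairs[of n], of real] by (simp add: algebra_simps)
  have "q ^ (m * n) / q ^ card (idx_pairs n) = q powr (real (m * n) - real (card (idx_pairs n)))"
    by (simp only: powr_realpow[OF q_pos(1), symmetric] powr_diff)
  also have "\<dots> ^ N = q powr (real N * (real (m * n) - real (card (idx_pairs n))))"
    by (subst powr_realpow[symmetric]) (simp_all add: powr_powr mult.commute)
  also have "real N * (real (m * n) - real (card (idx_pairs n))) = real N * real n * (2 * real m - real n - 1) / 2"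
    using c by (simp add: algebra_simps)
  finally show ?thesis ..
qed

lemma nor_poly_nonzero:
  assumes "eps \<in> {1, -1}" shows "poly (nor_poly q eps n) (u ^ k) \<noteq> 0"
proof -
  have "1 - u ^ (2 * i) \<noteq> 0" if "0 < i" for i
  proof -
    have "u ^ (2 * i) < 1" using q_gt_1 that by (simp add: power_less_one_iff inverse_less_1_iff)
    then show ?thesis by simp
  qed
  then show ?thesis unfolding nor_poly_value using E_pos[of "of_int eps" "n + 1 + 2 * k"] assms by auto
qed

text \<open>The powers of \<open>u\<close> are infinitely many because \<open>u < 1\<close>; this
  makes the Siegel series well defined.\<close>

lemma poly_eq_on_powers:
  fixes p p' :: "real poly"
  assumes "\<And>k. poly p (u ^ k) = poly p' (u ^ k)" shows "p = p'"
proof (rule ccontr)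
  assume "p \<noteq> p'"
  then have "finite {x. poly (p - p') x = 0}" by (intro poly_roots_finite) simp
  moreover have "range (\<lambda>k. u ^ k) \<subseteq> {x. poly (p - p') x = 0}" using assms by auto
  ultimately have "finite (range (\<lambda>k. u ^ k))" by (rule rev_finite_subset)
  moreover have "inj (\<lambda>k. u ^ k)"
  proof (rule linorder_injI)
    fix i j :: nat assume "i < j"
    then have "u ^ j < u ^ i" using q_gt_1 by (intro power_strict_decreasing) (auto simp: inverse_less_1_iff)
    then show "u ^ i \<noteq> u ^ j" by simp
  qed
  ultimately show False using finite_imageD by blast
qed

end

context rep_pair begin

context
  fixes n k a :: nat and eps :: int and g and Lq :: "('a, 'b) qlattice" and Mq :: "('a, 'c) qlattice"
  assumes Lq: "scl Lq = s" "form Lq = B" "lat Lq = L.olat n g"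
    and Mq: "scl Mq = s'" "form Mq = B'" "lat Mq = M"
    and g: "L.indep n g" "L.orthogonal n g"
    and a: "\<And>i. i < n \<Longrightarrow> B (g i) (g i) \<noteq> 0 \<and> \<pi> ^ a / B (g i) (g i) \<in> \<O>"
    and Q0: "\<And>b. b \<in> \<O> \<Longrightarrow> H.fcount M b = F m (of_int eps) b" and eps: "eps \<in> {1, -1}"
    and m: "m = n + 1 + 2 * k"
begin

lemma prim_count_value:
  assumes S: "S \<in> L.overlattices n g"
  shows "prim_count (range (L.lin n g)) S = q ^ (m * n) / q ^ card (idx_pairs n) *
    (poly (nor_poly q eps n) (u ^ k) *
     poly (pcompose (weight_poly q (lat_type v (Lq\<lparr>lat := S\<rparr>)) (lat_sgn v (n + 1) (Lq\<lparr>lat := S\<rparr>))) [:0, of_int eps:]) (u ^ k))"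
proof -
  obtain h d where h: "L.indep n h" "L.olat n h = S" "range (L.lin n h) = range (L.lin n g)" "L.orthogonal n h"
    and d: "d \<le> n" and T: "\<And>i. i < n \<Longrightarrow> B (h i) (h i) \<in> \<O>" "\<And>i. i < n \<Longrightarrow> B (h i) (h i) \<noteq> 0"
      "\<And>i. i < d \<Longrightarrow> B (h i) (h i) \<notin> \<P>" "\<And>i. d \<le> i \<Longrightarrow> i < n \<Longrightarrow> B (h i) (h i) \<in> \<P>"
    using L.overlattice_orthogonal_basis[OF g a S] by blast
  let ?L = "Lq\<lparr>lat := S\<rparr>"
  have L': "scl ?L = s" "form ?L = B" "lat ?L = L.olat n h" using Lq h(2) by simp_all
  have "lat_type v ?L = card {i. i < n \<and> B (h i) (h i) \<in> \<P>}" by (rule L.lat_type_eq[OF L' h(1,4) T(1,2)])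
  also have "{i. i < n \<and> B (h i) (h i) \<in> \<P>} = {d..<n}"
  proof -
    have "B (h i) (h i) \<in> \<P> \<longleftrightarrow> d \<le> i" if "i < n" for i using T(3)[of i] T(4)[of i] that by (cases "i < d") auto
    then show ?thesis by auto
  qed
  finally have type: "lat_type v ?L = n - d" by simp
  have "prim_count (range (L.lin n g)) S =
    real (ncosets (H.diag_reps n (\<lambda>i. B (h i) (h i))) (H.tuples n (H.pM (Suc 0))))"
    using prim_count_orthogonal[OF h(1,4)] h(2,3) by simp
  also have "\<dots> = q ^ (m * n) / q ^ card (idx_pairs n) *
    (poly (nor_poly q eps n) (u ^ k) *
     poly (pcompose (weight_poly q (n - d) (lat_sgn v (n + 1) ?L)) [:0, of_int eps:]) (u ^ k))"
    by (rule H.diag_reps_value[OF T(1,3,4) Q0 eps d m L.lat_sgn_eq[OF L' h(4) d T(1,3,4)]])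
  finally show ?thesis unfolding type .
qed

lemma card_reps_value:
  assumes N: "2 * a < N" and over: "integral_overlattices v Lq = L.overlattices n g" and rank: "lat_rank Lq = n"
  shows "real (card (reps v Mq Lq N)) = (q ^ (m * n) / q ^ card (idx_pairs n)) ^ N *
    (poly (nor_poly q eps n) (u ^ k) * poly (cho_yamauchi_poly v eps Lq) (u ^ k))"
proof -
  define C where "C = q ^ (m * n) / q ^ card (idx_pairs n)"
  define W where "W = range (L.lin n g)"
  define L0 where "L0 = L.olat n g"
  define w where "w S = poly (pcompose (weight_poly q (lat_type v (Lq\<lparr>lat := S\<rparr>)) (lat_sgn v (n + 1) (Lq\<lparr>lat := S\<rparr>))) [:0, of_int eps:]) (u ^ k)" for S
  define len where "len S = quot_length v s S L0" for S
  have summand: "real (ncosets {f\<in>approx_reps W L0 N. saturation W f = S} (small_maps W L0 N)) =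
     C ^ N * (poly (nor_poly q eps n) (u ^ k) * ((u ^ k) ^ (2 * len S) * w S))" (is "?c = _")
    if S: "S \<in> L.overlattices n g" for S
  proof -
    obtain f e where f: "L.indep n f" "L.olat n f = L.olat n g" "S = L.dilate n f e" "\<forall>i<n. e i \<le> a"
      using L.overlattice_dilate[OF g a S] by blast
    have int: "B x y \<in> \<O>" if "x \<in> S" "y \<in> S" for x y using S that by (auto simp: L.overlattices_def)
    have l: "(\<Sum>i<n. e i) = len S" unfolding len_def L0_def f(3) f(2)[symmetric] L.quot_length_dilate[OF f(1)] ..
    have "?c * q ^ (m * len S) = q ^ ((n + 1) * len S) * C ^ (N - 1) * prim_count W S"
      using count_overlattice[OF f(1,3) _ int N] f(4) unfolding l L.range_lin_eq[OF f(2)] f(2) W_def L0_def C_def by blast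
    also have "\<dots> = q ^ ((n + 1) * len S) * (C ^ (N - 1) * C) * (poly (nor_poly q eps n) (u ^ k) * w S)"
      unfolding W_def prim_count_value[OF S] w_def C_def by (simp only: mult_ac)
    also have "C ^ (N - 1) * C = C ^ N" using N by (metis gr_implies_not_zero power_minus_mult zero_less_iff_neq_zero)
    finally have f1: "?c * q ^ (m * len S) * u ^ (m * len S) = (q ^ ((n + 1) * len S) * u ^ (m * len S)) * C ^ N * (poly (nor_poly q eps n) (u ^ k) * w S)"
      by (simp only: mult_ac)
    have f2: "?c * q ^ (m * len S) * u ^ (m * len S) = ?c" by (simp only: mult.assoc u_pow mult_1_right)
    \<comment> \<open>Here \<open>m - (n + 1) = 2 * k\<close> turns the loss of precision into the
      power of \<open>X\<close> with exponent twice the length.\<close>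
    have f3: "q ^ ((n + 1) * len S) * u ^ (m * len S) = (u ^ k) ^ (2 * len S)"
    proof -
      have "m * len S = (n + 1) * len S + k * (2 * len S)" unfolding m by (simp add: algebra_simps)
      then have "u ^ (m * len S) = u ^ ((n + 1) * len S) * u ^ (k * (2 * len S))" by (simp only: power_add)
      then show ?thesis by (simp only: mult.assoc[symmetric] u_pow mult_1_left power_mult[symmetric])
    qed
    show ?thesis using f1 unfolding f2 f3 by (simp only: mult_ac)
  qed
  have "poly (cho_yamauchi_poly v eps Lq) (u ^ k) = (\<Sum>S\<in>L.overlattices n g. (u ^ k) ^ (2 * len S) * w S)"
    unfolding cho_yamauchi_poly_def over rank poly_sum poly_mult poly_monom w_def len_def L0_def Lq by simp
  moreover have "real (card (reps v Mq Lq N)) =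
     (\<Sum>S\<in>L.overlattices n g. real (ncosets {f\<in>approx_reps W L0 N. saturation W f = S} (small_maps W L0 N)))"
    using card_reps[OF Lq g(1) Mq, of N] approx_reps_partition[OF g a N] unfolding W_def L0_def by simp
  moreover have "\<dots> = (\<Sum>S\<in>L.overlattices n g. C ^ N * (poly (nor_poly q eps n) (u ^ k) * ((u ^ k) ^ (2 * len S) * w S)))"
    by (rule sum.cong[OF refl summand])
  ultimately show ?thesis unfolding C_def by (simp only: sum_distrib_left)
qed

text \<open>For \<open>N > 2 * a\<close> the normalized count equals the asserted value, so the
  limit is that of an eventually constant sequence.\<close>

lemma den_value:
  assumes over: "integral_overlattices v Lq = L.overlattices n g" and rank: "lat_rank Lq = n" "lat_rank Mq = m"
  shows "den v Mq Lq = poly (nor_poly q eps n) (u ^ k) * poly (cho_yamauchi_poly v eps Lq) (u ^ k)"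
proof -
  let ?r = "poly (nor_poly q eps n) (u ^ k) * poly (cho_yamauchi_poly v eps Lq) (u ^ k)"
  have "eventually (\<lambda>N. real (card (reps v Mq Lq N)) /
     q powr (real N * real (lat_rank Lq) * (2 * real (lat_rank Mq) - real (lat_rank Lq) - 1) / 2) = ?r) sequentially"
    using eventually_gt_at_top[of "2 * a"]
  proof eventually_elim
    case (elim N)
    have "n < m" using m by simp
    then show ?case unfolding rank card_reps_value[OF elim over rank(1)] powr_density[OF \<open>n < m\<close>] by simp
  qed
  then show ?thesis unfolding den_def by (intro limI tendsto_eventually)
qed

end

end

theorem theorem3p4p5:
  fixes v :: "'a::field \<Rightarrow> int"
    and L :: "('a, 'b::ab_group_add) qlattice"
    and H :: "nat \<Rightarrow> ('a, 'c::ab_group_add) qlattice"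
    and \<epsilon> :: int and n :: nat
  assumes "nonarch_local_field v"
    and "odd (residue_char v)"
    and "quadratic_lattice v L"
    and "lat_rank L = n"
    and "\<epsilon> \<in> {1, -1}"
    and "\<And>k. is_H v \<epsilon> (n + 1 + 2 * k) (H k)"
  shows "(\<forall>k. let X = inverse (real (residue_size v)) ^ k in
            den v (H k) L =
              poly (nor_poly (real (residue_size v)) \<epsilon> n) X * poly (cho_yamauchi_poly v \<epsilon> L) X)
         \<and> siegel_series v \<epsilon> H L = cho_yamauchi_poly v \<epsilon> L"
proof -
  interpret odd_local_field v using assms(1,2) by (intro odd_local_field.intro odd_local_field_axioms.intro)
  interpret QL: quad_space v "scl L" "form L" by (rule quad_space_quadratic_lattice[OF assms(3)])
  have "\<exists>n e. lat_basis v L n e" using assms(3) unfolding quadratic_lattice_def by blast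
  then obtain n' e where "lat_basis v L n' e" by blast
  then have e': "lat L = QL.olat n' e" "QL.indep n' e" using QL.lat_basis_iff[OF refl] by auto
  have "n' = n" using QL.dim_olat[OF e'(2)] assms(4) e'(1) unfolding lat_rank_def by simp
  then have e: "lat L = QL.olat n e" "QL.indep n e" using e' by auto
  obtain g where g: "QL.indep n g" "QL.olat n g = QL.olat n e" "QL.orthogonal n g"
    and T0: "\<forall>i<n. form L (g i) (g i) \<noteq> 0"
    using QL.sorted_orthogonal_basis[OF e(2) QL.lattice_nondegenerate[OF refl refl e(1) assms(3)]] by blast
  have Lg: "lat L = QL.olat n g" using e g by simp
  obtain a where a: "\<forall>i<n. \<pi> ^ a / form L (g i) (g i) \<in> \<O>"
    using QL.conductor_exists[of n "\<lambda>i. form L (g i) (g i)"] T0 by blast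
  have a': "form L (g i) (g i) \<noteq> 0 \<and> \<pi> ^ a / form L (g i) (g i) \<in> \<O>" if "i < n" for i using a T0 that by blast
  have over: "integral_overlattices v L = QL.overlattices n g"
    by (rule QL.integral_overlattices_eq[OF g(1,3) a' refl refl Lg assms(3)])
  have den: "den v (H k) L = poly (nor_poly q \<epsilon> n) (u ^ k) * poly (cho_yamauchi_poly v \<epsilon> L) (u ^ k)" for k
  proof -
    have Hk: "quadratic_lattice v (H k)" "lat_rank (H k) = n + 1 + 2 * k" using assms(6)[of k] unfolding is_H_def by blast+
    interpret QH: quad_space v "scl (H k)" "form (H k)" by (rule quad_space_quadratic_lattice[OF Hk(1)])
    interpret UH: unimodular v "scl (H k)" "form (H k)" "lat (H k)" "n + 1 + 2 * k"
      by (rule QH.is_H_unimodular[OF refl refl assms(6,5)])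
    interpret rep_pair v "scl L" "form L" "scl (H k)" "form (H k)" "lat (H k)" "n + 1 + 2 * k"
      by unfold_locales
    show ?thesis
      by (rule den_value[OF refl refl Lg refl refl refl g(1,3) a' _ assms(5) refl over assms(4) Hk(2)])
        (assumption | rule UH.is_H_fcount[OF refl refl refl assms(6,5)])+
  qed
  moreover have "siegel_series v \<epsilon> H L = cho_yamauchi_poly v \<epsilon> L"
    unfolding siegel_series_def Let_def assms(4)
  proof (rule the_equality)
    show *: "\<forall>k. poly (cho_yamauchi_poly v \<epsilon> L) (u ^ k) = den v (H k) L / poly (nor_poly q \<epsilon> n) (u ^ k)"
      unfolding den using nor_poly_nonzero[OF assms(5)] by simp
    fix D assume "\<forall>k. poly D (u ^ k) = den v (H k) L / poly (nor_poly q \<epsilon> n) (u ^ k)"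
    then show "D = cho_yamauchi_poly v \<epsilon> L" using * by (intro poly_eq_on_powers) simp
  qed
  ultimately show ?thesis by (simp add: Let_def)
qed

end
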